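(* Let $q$ be a prime power, $n\ge 2$, and let $\mathcal{L}$ be a non-empty set of lines of $\mathrm{PG}(n,q)$. Then $\mathcal{L}$ is the line set of a split Cayley hexagon $\mathbf{H}(q)$ naturally embedded in $\mathrm{PG}(6,q)$ if and only if $\mathcal{L}$ satisfies all of the following: (Pt) every point of $\mathrm{PG}(n,q)$ is incident with either $0$ or $q+1$ elements of $\mathcal{L}$; (Pl) every plane of $\mathrm{PG}(n,q)$ contains either $0$, $1$ or $q+1$ elements of $\mathcal{L}$; (Sd) every solid ($3$-dimensional subspace) of $\mathrm{PG}(n,q)$ contains either $0$, $1$, $q+1$ or $2q+1$ elements of $\mathcal{L}$; (4d) every $4$-dimensional subspace of $\mathrm{PG}(n,q)$ contains at most $q^3-q^2+4q$ elements of $\mathcal{L}$; (To) $|\mathcal{L}|\le q^5+q^4+q^3+q^2+q+1$.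
   Context: A line is said to be contained in (incident with) a subspace if it is a subset of it. The natural embedding of the split Cayley hexagon $\mathbf{H}(q)$ in $\mathrm{PG}(6,q)$ with homogeneous coordinates $(x_0,\dots,x_6)$: its points are the points of the parabolic quadric $\mathbf{Q}(6,q)$ given by $x_0x_4+x_1x_5+x_2x_6=x_3^2$, and its lines are those lines of $\mathbf{Q}(6,q)$ whose Grassmann coordinates $p_{ij}=x_iy_j-x_jy_i$ (for a line spanned by points $x,y$) satisfy $p_{12}=p_{34}$, $p_{54}=p_{32}$, $p_{20}=p_{35}$, $p_{65}=p_{30}$, $p_{01}=p_{36}$, $p_{46}=p_{31}$. "$\mathcal{L}$ is the line set of a split Cayley hexagon naturally embedded in $\mathrm{PG}(6,q)$" means that $\mathcal{L}$ spans a $6$-dimensional subspace of $\mathrm{PG}(n,q)$ and, up to a projectivity (choice of coordinates in that subspace), $\mathcal{L}$ is exactly the line set of this natural embedding of $\mathbf{H}(q)$. *)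

theory Defs
  imports Main
begin

text \<open>Vectors of F^(n+1) are modelled as functions nat => F vanishing above index n.
  A projective k-subspace of PG(n,q) is a vector subspace of dimension k+1,
  given by a linearly independent spanning list.\<close>

definition vecs :: "nat \<Rightarrow> (nat \<Rightarrow> 'a::field) set" where
  "vecs n = {v. \<forall>i>n. v i = 0}"

definition lcomb :: "(nat \<Rightarrow> 'a::field) list \<Rightarrow> (nat \<Rightarrow> 'a) \<Rightarrow> (nat \<Rightarrow> 'a)" where
  "lcomb vs c = (\<lambda>j. \<Sum>i<length vs. c i * (vs ! i) j)"

definition span_list :: "(nat \<Rightarrow> 'a::field) list \<Rightarrow> (nat \<Rightarrow> 'a) set" where
  "span_list vs = {lcomb vs c | c. True}"

definition span_set :: "(nat \<Rightarrow> 'a::field) set \<Rightarrow> (nat \<Rightarrow> 'a) set" where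
  "span_set S = {lcomb vs c | vs c. set vs \<subseteq> S}"

definition lin_indep :: "(nat \<Rightarrow> 'a::field) list \<Rightarrow> bool" where
  "lin_indep vs \<longleftrightarrow> (\<forall>c. lcomb vs c = (\<lambda>_. 0) \<longrightarrow> (\<forall>i<length vs. c i = 0))"

definition vsubspace :: "nat \<Rightarrow> nat \<Rightarrow> (nat \<Rightarrow> 'a::field) set \<Rightarrow> bool" where
  "vsubspace n d S \<longleftrightarrow> (\<exists>vs. length vs = d \<and> set vs \<subseteq> vecs n \<and> lin_indep vs \<and> S = span_list vs)"

definition proj_subspace :: "nat \<Rightarrow> nat \<Rightarrow> (nat \<Rightarrow> 'a::field) set \<Rightarrow> bool" where
  "proj_subspace n k S \<longleftrightarrow> vsubspace n (Suc k) S"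

definition pg_lines :: "nat \<Rightarrow> (nat \<Rightarrow> 'a::field) set set" where
  "pg_lines n = {S. proj_subspace n 1 S}"

definition quadQ6 :: "(nat \<Rightarrow> 'a::field) \<Rightarrow> 'a" where
  "quadQ6 x = x 0 * x 4 + x 1 * x 5 + x 2 * x 6 - x 3 ^ 2"

definition grass :: "(nat \<Rightarrow> 'a::field) \<Rightarrow> (nat \<Rightarrow> 'a) \<Rightarrow> nat \<Rightarrow> nat \<Rightarrow> 'a" where
  "grass x y i j = x i * y j - x j * y i"

definition hexagon_lines :: "(nat \<Rightarrow> 'a::field) set set" where
  "hexagon_lines = {l. \<exists>x y. x \<in> vecs 6 \<and> y \<in> vecs 6 \<and> lin_indep [x, y] \<and>
      l = span_list [x, y] \<and> (\<forall>v\<in>l. quadQ6 v = 0) \<and>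
      grass x y 1 2 = grass x y 3 4 \<and> grass x y 5 4 = grass x y 3 2 \<and>
      grass x y 2 0 = grass x y 3 5 \<and> grass x y 6 5 = grass x y 3 0 \<and>
      grass x y 0 1 = grass x y 3 6 \<and> grass x y 4 6 = grass x y 3 1}"

definition matmap :: "nat \<Rightarrow> (nat \<Rightarrow> nat \<Rightarrow> 'a::field) \<Rightarrow> (nat \<Rightarrow> 'a) \<Rightarrow> (nat \<Rightarrow> 'a)" where
  "matmap n A v = (\<lambda>i. if i \<le> n then (\<Sum>j\<le>6. A i j * v j) else 0)"

text \<open>L is the line set of a split Cayley hexagon naturally embedded in a 6-dimensional
  subspace of PG(n,q): there is an injective linear map (a projectivity onto its 7-dimensional
  image, which is then the span of L) carrying the standard line set onto L.\<close>
definition is_hexagon_line_set :: "nat \<Rightarrow> (nat \<Rightarrow> 'a::field) set set \<Rightarrow> bool" where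
  "is_hexagon_line_set n L \<longleftrightarrow>
     (\<exists>A. inj_on (matmap n A) (vecs 6) \<and>
          vsubspace n 7 (matmap n A ` vecs 6) \<and>
          span_set (\<Union>L) = matmap n A ` vecs 6 \<and>
          L = (\<lambda>l. matmap n A ` l) ` hexagon_lines)"

end

theory Submission
  imports Defs Complex_Main "HOL-Library.Function_Algebras" "HOL-Library.Cardinality" "HOL-Library.FuncSet"
begin

text \<open>For the sufficiency of the conditions, (Pt), (Pl) and (Sd) force the lines of \<open>L\<close> on a point to form a planar pencil, and
  exclude triangles and quadrangles. A pentagon would span a 4-space, and a standard double count over the solids of that 4-space
  contradicts (4d). The lines within distance three of a point then already number \<open>q\<^sup>5 + \<dots> + 1\<close>, so by (To) the geometry is
  a generalized hexagon. The points not opposite a given point span a hyperplane of a 7-dimensional vector space, hence an apartment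
  together with a vector in the intersection of its six hyperplanes is a basis. The incidences on the edges of the apartment
  are governed by a few structure constants, which can be normalised by rescaling the basis. The normal form is preserved by rotations,
  reflections and two families of root elations, which act transitively on flags and are automorphisms of the standard model in
  these coordinates. Thus every line of \<open>L\<close> is a line of the standard model, and the line counts agree.

  For the necessity, two points of the standard model are collinear if and only if their product as trace-zero split octonions
  vanishes. Transitivity on singular points reduces the needed facts (no triangles, quadrangles or pentagons, planar pencils) to a single point,
  and the line counts in subspaces follow from these facts and the polar form of the quadric.\<close>

section \<open>Subspaces of finite vector spaces\<close>

text \<open>(4d) is needed in three places: besides the pentagons it rules out two opposite points
  whose pencils lie in one 4-space (\<open>no_full_opp\<close>), and a set \<open>L\<close>
  contained in a 5-space (\<open>not_in_sd6\<close>). The main obstacle is to bound the dimension of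
  the span of the points not opposite \<open>x\<close>, since no quadric or polarity is given. The
  key object is the 4-space spanned by the pencils of three independent points x, z, z' of the plane
  \<open>Pi x\<close>. Counting shows that the points of \<open>Pi x\<close> whose pencil lies in
  this 4-space are x and exactly the points of the line zz'. One further pencil then captures the
  pencils of all points of \<open>Pi x\<close>, which gives vector dimension 6
  (\<open>H_sd\<close>). The same 4-spaces later make the incidences between edges and diagonals of
  an apartment linear in their parameters. Hence no field has to be recovered from the geometry:
  only finitely many constants remain, with one sign relation between them (\<open>VD_prod\<close>).
  Finally, no list of the lines of \<open>L\<close> is ever compared with the model. One frame is
  carried around by automorphisms until each line of \<open>L\<close> occurs as an edge of a
  frame.\<close>

definition scl :: "'a::field \<Rightarrow> (nat \<Rightarrow> 'a) \<Rightarrow> nat \<Rightarrow> 'a" (infixr "*s" 75)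
  where "c *s v = (\<lambda>i. c * v i)"

interpretation vs: vector_space scl
  by unfold_locales (auto simp: scl_def plus_fun_def algebra_simps)

lemma scl_apply: "(c *s v) i = c * v i"
  by (simp add: scl_def)

text \<open>Dimensions are measured by cardinality: \<open>sd d S\<close> says that \<open>S\<close> is a subspace of vector space dimension \<open>d\<close>,
  that is, a projective subspace of dimension \<open>d - 1\<close>. Projective points are represented by nonzero vectors.\<close>
definition sd :: "nat \<Rightarrow> (nat \<Rightarrow> 'a::{field,finite}) set \<Rightarrow> bool"
  where "sd d S \<longleftrightarrow> vs.subspace S \<and> card S = CARD('a) ^ d"

definition ssum :: "(nat \<Rightarrow> 'a::field) set \<Rightarrow> (nat \<Rightarrow> 'a) set \<Rightarrow> (nat \<Rightarrow> 'a) set"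
  where "ssum A B = {x + y |x y. x \<in> A \<and> y \<in> B}"

lemma CARD_field_ge2: "2 \<le> CARD('a::{field,finite})"
proof -
  have "card {0::'a, 1} \<le> CARD('a)" by (rule card_mono) auto
  then show ?thesis by simp
qed

lemma CARD_field_gt1: "1 < CARD('a::{field,finite})"
  using CARD_field_ge2[where 'a='a] by linarith

lemma sd_subspace: "sd d S \<Longrightarrow> vs.subspace S" by (simp add: sd_def)

lemma sd_finite: "sd d (S :: (nat \<Rightarrow> 'a::{field,finite}) set) \<Longrightarrow> finite S"
  by (rule ccontr) (simp add: sd_def)

lemma sd_zero: "sd d S \<Longrightarrow> 0 \<in> S" by (simp add: sd_def vs.subspace_0)

lemma sd_add: "sd d S \<Longrightarrow> x \<in> S \<Longrightarrow> y \<in> S \<Longrightarrow> x + y \<in> S"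
  by (simp add: sd_def vs.subspace_add)

lemma sd_scale: "sd d S \<Longrightarrow> x \<in> S \<Longrightarrow> c *s x \<in> S"
  by (simp add: sd_def vs.subspace_scale)

lemma sd_diff: "sd d S \<Longrightarrow> x \<in> S \<Longrightarrow> y \<in> S \<Longrightarrow> x - y \<in> S"
  by (simp add: sd_def vs.subspace_diff)

lemma sd_span_le: "sd d S \<Longrightarrow> B \<subseteq> S \<Longrightarrow> vs.span B \<subseteq> S"
  by (simp add: sd_def vs.span_minimal)

lemma sd_unique: "sd d (S :: (nat \<Rightarrow> 'a::{field,finite}) set) \<Longrightarrow> sd e S \<Longrightarrow> d = e"
  using CARD_field_gt1[where 'a='a] by (auto simp: sd_def)

lemma sd_mono:
  assumes "sd d (S :: (nat \<Rightarrow> 'a::{field,finite}) set)" "sd e T" "S \<subseteq> T" shows "d \<le> e"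
proof -
  have "CARD('a) ^ d \<le> CARD('a) ^ e"
    using assms card_mono[OF sd_finite[OF assms(2)] assms(3)] by (simp add: sd_def)
  then show ?thesis using CARD_field_gt1[where 'a='a] by simp
qed

lemma sd_eq:
  assumes "sd d (S :: (nat \<Rightarrow> 'a::{field,finite}) set)" "sd e T" "S \<subseteq> T" "e \<le> d" shows "S = T"
proof -
  have "d = e" using sd_mono[OF assms(1,2,3)] assms(4) by simp
  then show ?thesis using card_subset_eq[OF sd_finite[OF assms(2)] assms(3)] assms by (simp add: sd_def)
qed

lemma sd_0_iff: "sd 0 S \<longleftrightarrow> S = {0}"
proof
  assume s: "sd 0 S"
  then have "card S = 1" by (simp add: sd_def)
  then show "S = {0}" using sd_zero[OF s] by (auto simp: card_1_singleton_iff)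
qed (auto simp: sd_def vs.subspace_def)

lemma sd_nz: "sd d S \<Longrightarrow> d > 0 \<Longrightarrow> \<exists>x\<in>S. x \<noteq> 0"
  using sd_0_iff[of S] sd_unique[of d S 0] sd_zero[of d S] by (cases "\<forall>x\<in>S. x = 0") auto

lemma subspace_ssum: "vs.subspace A \<Longrightarrow> vs.subspace B \<Longrightarrow> vs.subspace (ssum A B)"
  unfolding ssum_def by (rule vs.subspace_sums)

lemma ssum_ge1: "vs.subspace B \<Longrightarrow> A \<subseteq> ssum A B"
  unfolding ssum_def using vs.subspace_0 by (metis (mono_tags, lifting) add.right_neutral mem_Collect_eq subsetI)

lemma ssum_ge2: "vs.subspace A \<Longrightarrow> B \<subseteq> ssum A B"
  unfolding ssum_def using vs.subspace_0 by (metis (mono_tags, lifting) add.left_neutral mem_Collect_eq subsetI)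

lemma ssum_le: "vs.subspace C \<Longrightarrow> A \<subseteq> C \<Longrightarrow> B \<subseteq> C \<Longrightarrow> ssum A B \<subseteq> C"
  unfolding ssum_def using vs.subspace_add by blast

lemma ssumI: "x \<in> A \<Longrightarrow> y \<in> B \<Longrightarrow> x + y \<in> ssum A B"
  unfolding ssum_def by blast

lemma ssum_image: "ssum A B = (\<lambda>(x,y). x + y) ` (A \<times> B)"
  unfolding ssum_def by (auto simp: image_iff)

lemma finite_ssum: "finite A \<Longrightarrow> finite B \<Longrightarrow> finite (ssum A B)"
  by (simp add: ssum_image)

lemma add_eq_imp_diff_eq: "(x::'b::ab_group_add) + y = a + b \<Longrightarrow> x - a = b - y"
  by (metis add.commute add_diff_cancel_left diff_add_cancel add_diff_eq diff_diff_eq2 add_diff_cancel)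

text \<open>The fibres of addition from A x B onto the sum are the translates of the pairs (z, -z)
  with z in both spaces. This yields the dimension formula without a choice of bases.\<close>

lemma card_ssum:
  assumes A: "vs.subspace A" "finite A" and B: "vs.subspace B" "finite B"
  shows "card (ssum A B) * card (A \<inter> B) = card A * card B"
proof -
  let ?f = "\<lambda>(x,y). x + y"
  have fin: "finite (ssum A B)" using A B by (simp add: finite_ssum)
  have AB: "A \<times> B = (\<Union>s\<in>ssum A B. {p \<in> A \<times> B. ?f p = s})"
  proof (intro set_eqI iffI)
    fix p assume "p \<in> A \<times> B"
    then show "p \<in> (\<Union>s\<in>ssum A B. {p \<in> A \<times> B. ?f p = s})" by (intro UN_I[of "?f p"]) (simp_all add: ssum_image)
  next
    fix p assume "p \<in> (\<Union>s\<in>ssum A B. {p \<in> A \<times> B. ?f p = s})"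
    then show "p \<in> A \<times> B" by blast
  qed
  have fib: "card {p \<in> A \<times> B. ?f p = s} = card (A \<inter> B)" if "s \<in> ssum A B" for s
  proof -
    obtain a b where ab: "a \<in> A" "b \<in> B" "s = a + b" using \<open>s \<in> ssum A B\<close> unfolding ssum_def by blast
    have "bij_betw (\<lambda>z. (a + z, b - z)) (A \<inter> B) {p \<in> A \<times> B. ?f p = s}"
    proof (rule bij_betwI[where g = "\<lambda>(x,y). x - a"])
      show "(\<lambda>z. (a + z, b - z)) \<in> A \<inter> B \<rightarrow> {p \<in> A \<times> B. ?f p = s}"
        using ab A B by (auto intro: vs.subspace_add vs.subspace_diff)
      show "(\<lambda>(x, y). x - a) \<in> {p \<in> A \<times> B. ?f p = s} \<rightarrow> A \<inter> B"
      proof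
        fix p assume "p \<in> {p \<in> A \<times> B. ?f p = s}"
        then obtain x y where xy: "p = (x,y)" "x \<in> A" "y \<in> B" "x + y = a + b" using ab by auto
        then have "x - a = b - y" by (blast intro: add_eq_imp_diff_eq)
        moreover have "x - a \<in> A" "b - y \<in> B" using xy ab A B by (auto intro: vs.subspace_diff)
        ultimately show "(case p of (x, y) \<Rightarrow> x - a) \<in> A \<inter> B" using xy by simp
      qed
    next
      fix p assume "p \<in> {p \<in> A \<times> B. ?f p = s}"
      then obtain x y where xy: "p = (x,y)" "x + y = a + b" using ab by auto
      then have "b - (x - a) = y" using add_eq_imp_diff_eq[of x y a b] by simp
      then show "(a + (case p of (x, y) \<Rightarrow> x - a), b - (case p of (x, y) \<Rightarrow> x - a)) = p" using xy by simp
    qed simp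
    then show ?thesis by (rule bij_betw_same_card[symmetric])
  qed
  have "card (A \<times> B) = (\<Sum>s\<in>ssum A B. card {p \<in> A \<times> B. ?f p = s})"
  proof -
    have "card (A \<times> B) = card (\<Union>s\<in>ssum A B. {p \<in> A \<times> B. ?f p = s})" by (rule arg_cong[OF AB])
    also have "\<dots> = (\<Sum>s\<in>ssum A B. card {p \<in> A \<times> B. ?f p = s})"
      by (rule card_UN_disjoint) (use fin A B in \<open>simp_all, blast\<close>)
    finally show ?thesis .
  qed
  also have "\<dots> = card (ssum A B) * card (A \<inter> B)" using fib by simp
  finally show ?thesis by (simp add: card_cartesian_product)
qed

lemma sd_span_insert:
  assumes S: "sd d (vs.span B)" and a: "a \<notin> vs.span B"
  shows "sd (Suc d) (vs.span (insert a (B :: (nat \<Rightarrow> 'a::{field,finite}) set)))"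
proof -
  let ?S = "vs.span B"
  have e: "vs.span (insert a B) = (\<lambda>(c,s). c *s a + s) ` (UNIV \<times> ?S)" (is "_ = ?f ` _")
  proof (intro set_eqI iffI)
    fix x assume "x \<in> vs.span (insert a B)"
    then obtain k where "x - k *s a \<in> ?S" by (auto simp: vs.span_insert)
    then show "x \<in> ?f ` (UNIV \<times> ?S)" by (intro image_eqI[of _ _ "(k, x - k *s a)"]) auto
  next
    fix x assume "x \<in> ?f ` (UNIV \<times> ?S)"
    then obtain c s where "x = c *s a + s" "s \<in> ?S" by auto
    then have "x - c *s a \<in> ?S" by simp
    then show "x \<in> vs.span (insert a B)" by (auto simp: vs.span_insert)
  qed
  have "inj_on ?f (UNIV \<times> ?S)"
  proof (rule inj_onI, clarsimp)
    fix c s c' s' assume h: "s \<in> ?S" "s' \<in> ?S" "c *s a + s = c' *s a + s'"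
    then have "(c - c') *s a = s' - s" by (simp add: vs.scale_left_diff_distrib algebra_simps)
    moreover have "s' - s \<in> ?S" using h by (simp add: vs.span_diff)
    ultimately have m: "(c - c') *s a \<in> ?S" by simp
    have "c = c'"
    proof (rule ccontr)
      assume "c \<noteq> c'"
      then have "a = inverse (c - c') *s ((c - c') *s a)" by simp
      then have "a \<in> ?S" using m by (metis vs.span_scale)
      then show False using a by simp
    qed
    then show "c = c' \<and> s = s'" using h by simp
  qed
  then have "card (vs.span (insert a B)) = card ((UNIV::'a set) \<times> ?S)"
    by (simp add: e card_image)
  then show ?thesis using S by (simp add: sd_def card_cartesian_product)
qed

lemma sd_span_indep:
  assumes "finite B" "vs.independent (B :: (nat \<Rightarrow> 'a::{field,finite}) set)"
  shows "sd (card B) (vs.span B)"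
  using assms
proof (induction B rule: finite_induct)
  case empty
  then show ?case by (simp add: sd_0_iff)
next
  case (insert a B)
  have "vs.independent B" using insert.prems vs.independent_mono by blast
  moreover have "a \<notin> vs.span B" using insert.prems insert.hyps by (simp add: vs.independent_insert)
  ultimately show ?case using sd_span_insert insert by simp
qed

lemma sd_basis:
  assumes "vs.subspace S" "finite (S :: (nat \<Rightarrow> 'a::{field,finite}) set)"
  shows "\<exists>B. B \<subseteq> S \<and> finite B \<and> vs.independent B \<and> vs.span B = S \<and> sd (card B) S"
proof -
  obtain B where B: "B \<subseteq> S" "vs.independent B" "S \<subseteq> vs.span B"
    using vs.maximal_independent_subset by blast
  then have "finite B" using assms(2) finite_subset by blast
  moreover have "vs.span B = S" using B assms by (simp add: subset_antisym vs.span_minimal)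
  ultimately show ?thesis using B sd_span_indep by metis
qed

lemma sd_exists: "vs.subspace S \<Longrightarrow> finite (S :: (nat \<Rightarrow> 'a::{field,finite}) set) \<Longrightarrow> \<exists>d. sd d S"
  using sd_basis by metis

lemma sd_int_sum:
  assumes A: "sd a (A :: (nat \<Rightarrow> 'a::{field,finite}) set)" and B: "sd b B"
  obtains k where "sd k (A \<inter> B)" "sd (a + b - k) (ssum A B)" "k \<le> a" "k \<le> b"
proof -
  have sA: "vs.subspace A" "finite A" and sB: "vs.subspace B" "finite B"
    using A B sd_finite by (auto simp: sd_def)
  obtain k where k: "sd k (A \<inter> B)" using sd_exists[OF vs.subspace_inter[OF sA(1) sB(1)]] sA by auto
  have ka: "k \<le> a" "k \<le> b" using sd_mono[OF k A] sd_mono[OF k B] by auto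
  have "finite (ssum A B)" using sA sB by (simp add: finite_ssum)
  then obtain s where s: "sd s (ssum A B)" using sd_exists[OF subspace_ssum[OF sA(1) sB(1)]] by auto
  have "CARD('a) ^ (s + k) = CARD('a) ^ (a + b)"
    using card_ssum[OF sA sB] A B k s by (simp add: sd_def power_add)
  then have "s + k = a + b" using CARD_field_gt1[where 'a='a] by simp
  then have "s = a + b - k" by simp
  then show thesis using that k s ka by simp
qed

lemma sd_int_ge:
  assumes A: "sd a (A :: (nat \<Rightarrow> 'a::{field,finite}) set)" and B: "sd b B" and C: "sd c C"
    and "A \<subseteq> C" "B \<subseteq> C"
  obtains k where "sd k (A \<inter> B)" "a + b \<le> c + k" "k \<le> a" "k \<le> b"
proof -
  obtain k where k: "sd k (A \<inter> B)" "sd (a + b - k) (ssum A B)" "k \<le> a" "k \<le> b"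
    using sd_int_sum[OF A B] by metis
  have "a + b - k \<le> c" using sd_mono[OF k(2) C] ssum_le[OF sd_subspace[OF C] assms(4,5)] by simp
  then show thesis using that k by simp
qed

lemma sd_int_nz:
  assumes "sd a (A :: (nat \<Rightarrow> 'a::{field,finite}) set)" "sd b B" "sd c C" "A \<subseteq> C" "B \<subseteq> C" "c < a + b"
  obtains x where "x \<in> A" "x \<in> B" "x \<noteq> 0"
proof -
  obtain k where k: "sd k (A \<inter> B)" "a + b \<le> c + k" using sd_int_ge[OF assms(1-5)] by metis
  then have "k > 0" using assms(6) by simp
  then show thesis using sd_nz[OF k(1)] that by auto
qed

lemma sd_span1: "x \<noteq> 0 \<Longrightarrow> sd 1 (vs.span {x :: nat \<Rightarrow> 'a::{field,finite}})"
  using sd_span_insert[of 0 "{}" x] by (simp add: sd_0_iff)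

lemma sd_span2: "x \<noteq> 0 \<Longrightarrow> y \<notin> vs.span {x} \<Longrightarrow> sd 2 (vs.span {x, y :: nat \<Rightarrow> 'a::{field,finite}})"
  using sd_span_insert[of 1 "{x}" y] sd_span1[of x] by (simp add: insert_commute numeral_2_eq_2)

lemma sd_span3: "x \<noteq> 0 \<Longrightarrow> y \<notin> vs.span {x} \<Longrightarrow> z \<notin> vs.span {x,y}
   \<Longrightarrow> sd 3 (vs.span {x, y, z :: nat \<Rightarrow> 'a::{field,finite}})"
  using sd_span_insert[of 2 "{x,y}" z] sd_span2[of x y] by (simp add: insert_commute numeral_3_eq_3 numeral_2_eq_2)

lemma span1_iff: "y \<in> vs.span {x} \<longleftrightarrow> (\<exists>c. y = c *s x)"
  by (auto simp: vs.span_singleton)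

lemma span2_iff: "z \<in> vs.span {x,y} \<longleftrightarrow> (\<exists>a b. z = a *s x + b *s y)"
proof -
  have "z \<in> vs.span {x,y} \<longleftrightarrow> (\<exists>a. z - a *s x \<in> vs.span {y})" by (simp add: vs.span_insert)
  also have "\<dots> \<longleftrightarrow> (\<exists>a b. z = a *s x + b *s y)" by (auto simp: span1_iff algebra_simps)
  finally show ?thesis .
qed

lemma span3_iff: "w \<in> vs.span {x,y,z} \<longleftrightarrow> (\<exists>a b c. w = a *s x + b *s y + c *s z)"
proof -
  have "w \<in> vs.span {x,y,z} \<longleftrightarrow> (\<exists>a. w - a *s x \<in> vs.span {y,z})" by (simp add: vs.span_insert[of x])
  also have "\<dots> \<longleftrightarrow> (\<exists>a b c. w = a *s x + b *s y + c *s z)" by (auto simp: span2_iff algebra_simps)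
  finally show ?thesis .
qed

lemma sd_span_mem: "sd d S \<Longrightarrow> x \<in> S \<Longrightarrow> vs.span {x} \<subseteq> S"
  using sd_span_le[of d S "{x}"] by simp

lemma span1_eq:
  assumes "x \<noteq> 0" "x \<in> vs.span {y :: nat \<Rightarrow> 'a::{field,finite}}" shows "vs.span {x} = vs.span {y}"
proof -
  have "y \<noteq> 0" using assms by auto
  then show ?thesis using sd_eq[OF sd_span1[OF assms(1)] sd_span1[of y]] assms(2)
    by (simp add: vs.span_minimal)
qed

lemma span1_sym: "x \<noteq> 0 \<Longrightarrow> x \<in> vs.span {y :: nat \<Rightarrow> 'a::{field,finite}} \<Longrightarrow> y \<in> vs.span {x}"
  using span1_eq vs.span_base by (metis insertI1)

lemma sd_line_span:
  assumes "sd 2 (l :: (nat \<Rightarrow> 'a::{field,finite}) set)" "x \<in> l" "y \<in> l" "x \<noteq> 0" "y \<notin> vs.span {x}"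
  shows "l = vs.span {x,y}"
  using sd_eq[OF sd_span2[OF assms(4,5)] assms(1)] sd_span_le[OF assms(1)] assms by simp

lemma sd_plane_span:
  assumes "sd 3 (l :: (nat \<Rightarrow> 'a::{field,finite}) set)" "x \<in> l" "y \<in> l" "z \<in> l" "x \<noteq> 0" "y \<notin> vs.span {x}" "z \<notin> vs.span {x,y}"
  shows "l = vs.span {x,y,z}"
  using sd_eq[OF sd_span3[OF assms(5,6,7)] assms(1)] sd_span_le[OF assms(1)] assms by simp

lemma sd_exists_notin:
  assumes "sd d (S :: (nat \<Rightarrow> 'a::{field,finite}) set)" "sd e T" "e < d" obtains x where "x \<in> S" "x \<notin> T"
  using sd_mono[OF assms(1,2)] assms(3) by (meson not_le subsetI)

text \<open>Double counting of pairs (x, T) with x in T - A: a vector x outside A raises the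
  dimension of the lower end by one, so induction on e - k counts the T through x. The factor q - 1
  avoids dividing geometric sums in \<open>nat\<close>.\<close>

lemma card_between:
  fixes A U :: "(nat \<Rightarrow> 'a::{field,finite}) set"
  assumes "sd k A" "sd (Suc e) U" "A \<subseteq> U" "k \<le> e"
  shows "card {T. sd e T \<and> A \<subseteq> T \<and> T \<subseteq> U} * (CARD('a) - 1) = CARD('a) ^ (Suc e - k) - 1"
  using assms
proof (induction "e - k" arbitrary: k A)
  case 0
  then have "k = e" by simp
  then have "{T. sd e T \<and> A \<subseteq> T \<and> T \<subseteq> U} = {A}"
    using 0 sd_eq[of e A e] by auto
  then show ?case using \<open>k = e\<close> by simp
next
  case (Suc m)
  let ?q = "CARD('a)"
  let ?H = "\<lambda>A. {T. sd e T \<and> A \<subseteq> T \<and> T \<subseteq> U}"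
  have fU: "finite U" using Suc.prems(2) sd_finite by blast
  have fH: "finite (?H B)" for B
    by (rule finite_subset[of _ "Pow U"]) (use fU in auto)
  have ke: "k < e" using Suc by simp
  let ?h = "\<lambda>x. vs.span (insert x A)"
  have spA: "vs.span A = A" using Suc.prems(1) by (simp add: sd_def vs.span_eq_iff)
  have IH: "card (?H (?h x)) * (?q - 1) = ?q ^ (e - k) - 1" if "x \<in> U - A" for x
  proof -
    have "sd (Suc k) (?h x)" using sd_span_insert[of k A x] that Suc.prems(1) spA by simp
    moreover have "?h x \<subseteq> U" using that Suc.prems by (simp add: sd_def vs.span_minimal)
    ultimately show ?thesis using Suc.hyps(1)[of "Suc k" "?h x"] Suc.hyps(2) Suc.prems ke by simp
  qed
  have q1: "?q \<ge> 2" by (rule CARD_field_ge2)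
  have pair1: "(\<Sum>x\<in>U-A. card (?H (?h x))) = (\<Sum>T\<in>?H A. card (T - A))"
  proof -
    have "(\<Sum>x\<in>U-A. card (?H (?h x))) = (\<Sum>x\<in>U-A. \<Sum>T\<in>?H A. if x \<in> T then 1 else 0)"
    proof (rule sum.cong[OF refl])
      fix x assume x: "x \<in> U - A"
      have "?H (?h x) = {T \<in> ?H A. x \<in> T}"
      proof (intro set_eqI iffI)
        fix T assume "T \<in> ?H (?h x)"
        then show "T \<in> {T \<in> ?H A. x \<in> T}" using vs.span_superset[of "insert x A"] by auto
      next
        fix T assume "T \<in> {T \<in> ?H A. x \<in> T}"
        then show "T \<in> ?H (?h x)" using sd_span_le[of e T "insert x A"] by simp
      qed
      then show "card (?H (?h x)) = (\<Sum>T\<in>?H A. if x \<in> T then 1 else 0)"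
        using fH[of A] by (simp add: sum.If_cases Int_def)
    qed
    also have "\<dots> = (\<Sum>T\<in>?H A. \<Sum>x\<in>U-A. if x \<in> T then 1 else 0)" by (rule sum.swap)
    also have "\<dots> = (\<Sum>T\<in>?H A. card (T - A))"
    proof (rule sum.cong[OF refl])
      fix T assume T: "T \<in> ?H A"
      have "(U - A) \<inter> {x. x \<in> T} = T - A" using T by auto
      then show "(\<Sum>x\<in>U-A. if x \<in> T then 1 else 0) = card (T - A)"
        using fU by (simp add: sum.If_cases)
    qed
    finally show ?thesis .
  qed
  have cT: "card (T - A) = ?q ^ e - ?q ^ k" if "T \<in> ?H A" for T
    using that Suc.prems(1) by (subst card_Diff_subset) (auto simp: sd_def intro: sd_finite[OF Suc.prems(1)])
  have cU: "card (U - A) = ?q ^ (Suc e) - ?q ^ k"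
    using Suc.prems by (subst card_Diff_subset) (auto simp: sd_def intro: sd_finite[OF Suc.prems(1)])
  have "card (?H A) * (?q ^ e - ?q ^ k) * (?q - 1) = (\<Sum>x\<in>U-A. card (?H (?h x))) * (?q - 1)"
    using pair1 cT by simp
  also have "\<dots> = (\<Sum>x\<in>U-A. card (?H (?h x)) * (?q - 1))" by (simp add: sum_distrib_right)
  also have "\<dots> = card (U - A) * (?q ^ (e - k) - 1)" using IH by simp
  also have "\<dots> = (?q ^ Suc e - ?q ^ k) * (?q ^ (e - k) - 1)" using cU by simp
  also have "\<dots> = ?q ^ k * (?q ^ (Suc e - k) - 1) * (?q ^ (e - k) - 1)"
  proof -
    have "?q ^ Suc e = ?q ^ k * ?q ^ (Suc e - k)" using ke by (simp flip: power_add del: power_Suc)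
    then show ?thesis by (simp add: diff_mult_distrib2)
  qed
  finally have main: "card (?H A) * (?q ^ e - ?q ^ k) * (?q - 1) = ?q ^ k * (?q ^ (Suc e - k) - 1) * (?q ^ (e - k) - 1)" .
  have "?q ^ e = ?q ^ k * ?q ^ (e - k)" using ke by (simp flip: power_add)
  then have "?q ^ e - ?q ^ k = ?q ^ k * (?q ^ (e - k) - 1)" by (simp add: diff_mult_distrib2)
  then have "(?q ^ k * (?q ^ (e - k) - 1)) * (card (?H A) * (?q - 1)) = (?q ^ k * (?q ^ (e - k) - 1)) * (?q ^ (Suc e - k) - 1)"
    using main by (simp add: mult_ac)
  moreover have "?q ^ k * (?q ^ (e - k) - 1) \<noteq> 0"
    using ke q1 one_less_power[of ?q "e - k"] by simp
  ultimately show ?case by (simp only: mult_cancel1) simp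
qed

lemma card_hyperplanes:
  fixes A U :: "(nat \<Rightarrow> 'a::{field,finite}) set"
  assumes "sd k A" "sd (Suc e) U" "A \<subseteq> U" "k \<le> e"
  shows "card {T. sd e T \<and> A \<subseteq> T \<and> T \<subseteq> U} = (\<Sum>i\<le>e - k. CARD('a) ^ i)"
proof -
  have q1: "1 < CARD('a)" by (rule CARD_field_gt1)
  have "(\<Sum>i\<le>e - k. CARD('a) ^ i) * (CARD('a) - 1) = CARD('a) ^ (Suc e - k) - 1"
  proof -
    have "int ((\<Sum>i\<le>e - k. CARD('a) ^ i) * (CARD('a) - 1)) = int (CARD('a) ^ Suc (e - k) - 1)"
      using power_diff_1_eq[of "int CARD('a)" "Suc (e - k)"] q1
      by (simp add: of_nat_diff lessThan_Suc_atMost mult.commute)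
    then show ?thesis using assms(4) by (simp add: Suc_diff_le flip: of_nat_mult)
  qed
  then have "card {T. sd e T \<and> A \<subseteq> T \<and> T \<subseteq> U} * (CARD('a) - 1) = (\<Sum>i\<le>e - k. CARD('a) ^ i) * (CARD('a) - 1)"
    using card_between[OF assms] by simp
  then show ?thesis using q1 by simp
qed

section \<open>Spanning lists and linear combinations in terms of spans and cardinalities\<close>

lemma sum_fun_apply: "(\<Sum>i\<in>A. f i) j = (\<Sum>i\<in>A. f i j)" for f :: "'b \<Rightarrow> nat \<Rightarrow> 'a::comm_monoid_add"
  by (induction A rule: infinite_finite_induct) auto

lemma lcomb_sum: "lcomb vs c = (\<Sum>i<length vs. c i *s vs ! i)"
  by (rule ext) (simp add: lcomb_def sum_fun_apply scl_apply)

lemma span_list_eq: "span_list vs = vs.span (set vs)"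
proof
  show "span_list vs \<subseteq> vs.span (set vs)"
  proof
    fix x assume "x \<in> span_list vs"
    then obtain c where x: "x = (\<Sum>i<length vs. c i *s vs ! i)" unfolding span_list_def lcomb_sum by blast
    show "x \<in> vs.span (set vs)" unfolding x by (rule vs.span_sum, rule vs.span_scale, rule vs.span_base) simp
  qed
  have "vs.subspace (span_list vs)"
  proof (rule vs.subspaceI)
    show "0 \<in> span_list vs" unfolding span_list_def lcomb_sum by (auto intro!: exI[of _ "\<lambda>_. 0"])
    fix x y assume "x \<in> span_list vs" "y \<in> span_list vs"
    then obtain c d where "x = lcomb vs c" "y = lcomb vs d" unfolding span_list_def by blast
    then have "x + y = lcomb vs (\<lambda>i. c i + d i)"
      by (simp add: lcomb_sum vs.scale_left_distrib sum.distrib)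
    then show "x + y \<in> span_list vs" unfolding span_list_def by blast
  next
    fix c x assume "x \<in> span_list vs"
    then obtain d where "x = lcomb vs d" unfolding span_list_def by blast
    then have "c *s x = lcomb vs (\<lambda>i. c * d i)"
      by (simp add: lcomb_sum vs.scale_sum_right)
    then show "c *s x \<in> span_list vs" unfolding span_list_def by blast
  qed
  moreover have "set vs \<subseteq> span_list vs"
  proof
    fix x assume "x \<in> set vs"
    then obtain i where i: "i < length vs" "x = vs ! i" by (auto simp: in_set_conv_nth)
    have "lcomb vs (\<lambda>j. if j = i then 1 else 0) = (\<Sum>j<length vs. if j = i then vs ! j else 0)"
      unfolding lcomb_sum by (rule sum.cong) auto
    also have "\<dots> = x" using i by simp
    finally show "x \<in> span_list vs" unfolding span_list_def by (metis (mono_tags, lifting) mem_Collect_eq)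
  qed
  ultimately show "vs.span (set vs) \<subseteq> span_list vs" by (simp add: vs.span_minimal)
qed

text \<open>Coefficient functions have the infinite domain \<open>nat\<close>. Restricted to the
  positions of the list they form a set of size q^d, on which independence is injectivity of
  \<open>lcomb\<close> and can be tested by counting.\<close>

lemma span_list_image: "span_list vs = lcomb vs ` (\<Pi>\<^sub>E i\<in>{..<length vs}. UNIV)"
proof -
  have "lcomb vs c = lcomb vs (restrict c {..<length vs})" for c :: "nat \<Rightarrow> 'a"
    unfolding lcomb_sum by (rule sum.cong) auto
  then have "lcomb vs c \<in> lcomb vs ` (\<Pi>\<^sub>E i\<in>{..<length vs}. UNIV)" for c
    by (metis image_eqI restrict_PiE_iff UNIV_I)
  then show ?thesis unfolding span_list_def by auto
qed

lemma card_coeffs: "card (\<Pi>\<^sub>E i\<in>{..<d::nat}. (UNIV :: 'a::finite set)) = CARD('a) ^ d"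
  by (simp add: card_PiE)

lemma lcomb_inj_iff: "inj_on (lcomb vs) (\<Pi>\<^sub>E i\<in>{..<length vs}. UNIV) \<longleftrightarrow> lin_indep vs"
proof
  assume inj: "inj_on (lcomb vs) (\<Pi>\<^sub>E i\<in>{..<length vs}. UNIV)"
  show "lin_indep vs" unfolding lin_indep_def
  proof (intro allI impI)
    fix c i assume c: "lcomb vs c = (\<lambda>_. 0)" and i: "i < length vs"
    have r: "lcomb vs c = lcomb vs (restrict c {..<length vs})"
      unfolding lcomb_sum by (rule sum.cong) auto
    have z: "lcomb vs (restrict (\<lambda>_. 0) {..<length vs}) = (\<lambda>_. 0)"
      by (auto simp: lcomb_def)
    have "restrict c {..<length vs} = restrict (\<lambda>_. 0) {..<length vs}"
      by (rule inj_onD[OF inj]) (use r z c in auto)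
    then show "c i = 0" using i by (metis lessThan_iff restrict_apply')
  qed
next
  assume ind: "lin_indep vs"
  show "inj_on (lcomb vs) (\<Pi>\<^sub>E i\<in>{..<length vs}. UNIV)"
  proof (rule inj_onI)
    fix c d assume c: "c \<in> (\<Pi>\<^sub>E i\<in>{..<length vs}. UNIV)" and d: "d \<in> (\<Pi>\<^sub>E i\<in>{..<length vs}. UNIV)"
      and e: "lcomb vs c = lcomb vs d"
    have "lcomb vs (\<lambda>i. c i - d i) = lcomb vs c - lcomb vs d"
      by (simp add: lcomb_sum vs.scale_left_diff_distrib sum_subtractf)
    also have "\<dots> = (\<lambda>_. 0)" using e by (simp add: zero_fun_def)
    finally have z: "\<forall>i<length vs. c i - d i = 0" using ind unfolding lin_indep_def by blast
    show "c = d"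
    proof
      fix i show "c i = d i" using z c d by (cases "i < length vs") (auto simp: PiE_def extensional_def)
    qed
  qed
qed

lemma lin_indep_iff_card:
  fixes vs :: "(nat \<Rightarrow> 'a::{field,finite}) list"
  shows "lin_indep vs \<longleftrightarrow> card (span_list vs) = CARD('a) ^ length vs"
proof -
  have fin: "finite (\<Pi>\<^sub>E i\<in>{..<length vs}. (UNIV :: 'a set))" by (simp add: finite_PiE)
  show ?thesis
    unfolding span_list_image lcomb_inj_iff[symmetric] card_coeffs[symmetric]
    using inj_on_iff_eq_card[OF fin] by blast
qed

lemma subspace_vecs: "vs.subspace (vecs n)"
  by (rule vs.subspaceI) (auto simp: vecs_def scl_apply)

lemma finite_vecs: "finite (vecs n :: (nat \<Rightarrow> 'a::{field,finite}) set)"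
proof -
  have "finite {f :: nat \<Rightarrow> 'a. \<forall>x. (x \<in> {..n} \<longrightarrow> f x \<in> UNIV) \<and> (x \<notin> {..n} \<longrightarrow> f x = 0)}"
    by (rule finite_set_of_finite_funs) auto
  moreover have "vecs n = {f :: nat \<Rightarrow> 'a. \<forall>x. (x \<in> {..n} \<longrightarrow> f x \<in> UNIV) \<and> (x \<notin> {..n} \<longrightarrow> f x = 0)}"
    by (auto simp: vecs_def)
  ultimately show ?thesis by simp
qed

lemma vsubspace_iff:
  fixes S :: "(nat \<Rightarrow> 'a::{field,finite}) set"
  shows "vsubspace n d S \<longleftrightarrow> sd d S \<and> S \<subseteq> vecs n"
proof
  assume "vsubspace n d S"
  then obtain vs where vs: "length vs = d" "set vs \<subseteq> vecs n" "lin_indep vs" "S = span_list vs"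
    unfolding vsubspace_def by blast
  then have "card S = CARD('a) ^ d" using lin_indep_iff_card by blast
  moreover have "S \<subseteq> vecs n" using vs by (simp add: span_list_eq vs.span_minimal subspace_vecs)
  ultimately show "sd d S \<and> S \<subseteq> vecs n" using vs by (simp add: sd_def span_list_eq)
next
  assume S: "sd d S \<and> S \<subseteq> vecs n"
  then obtain B where B: "B \<subseteq> S" "finite B" "vs.span B = S" "sd (card B) S"
    using sd_basis[of S] sd_finite by (auto simp: sd_def)
  have "card B = d" using sd_unique B S by blast
  obtain vs where vs: "set vs = B" "distinct vs" using finite_distinct_list[OF B(2)] by blast
  have len: "length vs = d" using vs \<open>card B = d\<close> distinct_card by fastforce
  have sp: "S = span_list vs" using vs B by (simp add: span_list_eq)
  have "lin_indep vs" using lin_indep_iff_card[of vs] sp len S by (simp add: sd_def)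
  then show "vsubspace n d S" unfolding vsubspace_def using len sp vs B S by blast
qed

lemma span_set_eq: "span_set S = vs.span S"
proof
  show "span_set S \<subseteq> vs.span S"
  proof
    fix x assume "x \<in> span_set S"
    then obtain vs c where "set vs \<subseteq> S" "x = lcomb vs c" unfolding span_set_def by blast
    then have "x \<in> vs.span (set vs)" unfolding span_list_eq[symmetric] span_list_def by blast
    then show "x \<in> vs.span S" using \<open>set vs \<subseteq> S\<close> vs.span_mono by blast
  qed
  show "vs.span S \<subseteq> span_set S"
  proof
    fix x assume "x \<in> vs.span S"
    then obtain t r where t: "finite t" "t \<subseteq> S" "x = (\<Sum>a\<in>t. r a *s a)"
      unfolding vs.span_explicit by blast
    obtain vs where vs: "set vs = t" using finite_list[OF t(1)] by blast
    have "x \<in> vs.span (set vs)" unfolding t(3) vs by (rule vs.span_sum, rule vs.span_scale, rule vs.span_base)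
    then show "x \<in> span_set S" unfolding span_list_eq[symmetric] span_list_def span_set_def using vs t by blast
  qed
qed

section \<open>Flat line sets\<close>

locale lines0 =
  fixes V :: "(nat \<Rightarrow> 'a::{field,finite}) set" and L :: "(nat \<Rightarrow> 'a) set set" and q :: nat
  assumes q_def: "q = CARD('a)"
    and V: "vs.subspace V" "finite V"
    and L_sd: "\<And>l. l \<in> L \<Longrightarrow> sd 2 l" and L_V: "\<And>l. l \<in> L \<Longrightarrow> l \<subseteq> V"
begin

lemmas sd_q = sd_def[where 'a = 'a, folded q_def]

text \<open>\<open>P\<close> is the set of vectors representing points on some line of \<open>L\<close>; for such a point \<open>x\<close>, \<open>Pi x\<close> is the union of the lines
  of \<open>L\<close> on \<open>x\<close>, so \<open>y \<in> Pi x\<close> expresses collinearity.\<close>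
definition P where "P = \<Union>L - {0}"
definition Pi where "Pi x = \<Union>{l\<in>L. x \<in> l}"

lemma q2: "2 \<le> q" unfolding q_def by (rule CARD_field_ge2)

lemma fin_L: "finite L"
  by (rule finite_subset[of _ "Pow V"]) (use L_V V in auto)

lemma fin_sub: "finite {l\<in>L. Q l}" using fin_L by simp

lemma P_nz: "x \<in> P \<Longrightarrow> x \<noteq> 0" by (simp add: P_def)

lemma P_I: "l \<in> L \<Longrightarrow> x \<in> l \<Longrightarrow> x \<noteq> 0 \<Longrightarrow> x \<in> P" unfolding P_def by blast

lemma P_V: "x \<in> P \<Longrightarrow> x \<in> V" unfolding P_def using L_V by blast

lemma line_eq:
  assumes "l \<in> L" "m \<in> L" "x \<in> l" "x \<in> m" "y \<in> l" "y \<in> m" "x \<noteq> 0" "y \<notin> vs.span {x}"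
  shows "l = m"
  using sd_line_span[OF L_sd] assms by metis

lemma line_int:
  assumes "l \<in> L" "m \<in> L" "l \<noteq> m" "x \<in> l" "x \<in> m" "x \<noteq> 0"
  shows "l \<inter> m = vs.span {x}" "sd 3 (ssum l m)"
proof -
  show e: "l \<inter> m = vs.span {x}"
  proof
    show "l \<inter> m \<subseteq> vs.span {x}" using line_eq assms by blast
    show "vs.span {x} \<subseteq> l \<inter> m" using sd_span_mem L_sd assms by blast
  qed
  obtain k where k: "sd k (l \<inter> m)" "sd (2 + 2 - k) (ssum l m)"
    using sd_int_sum[OF L_sd[OF assms(1)] L_sd[OF assms(2)]] by blast
  have "k = 1" using sd_unique[OF k(1)] sd_span1[OF assms(6)] unfolding e by blast
  then show "sd 3 (ssum l m)" using k(2) by simp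
qed

lemma ssum_line_V: "A \<subseteq> V \<Longrightarrow> B \<subseteq> V \<Longrightarrow> ssum A B \<subseteq> V"
  using ssum_le V by blast

lemma plane_int:
  assumes "sd 3 E" "sd 3 E'" "E \<noteq> E'" "l \<in> L" "l \<subseteq> E" "l \<subseteq> E'"
  shows "E \<inter> E' = l"
proof -
  obtain k where k: "sd k (E \<inter> E')" "k \<le> 3" using sd_int_sum[OF assms(1,2)] by blast
  have "k \<noteq> 3" using sd_eq[OF k(1) assms(1)] sd_eq[OF k(1) assms(2)] assms(3) by blast
  then have "k \<le> 2" using k by simp
  then show ?thesis using sd_eq[OF L_sd[OF assms(4)] k(1)] assms by auto
qed

lemma line_sub_eq: "l \<in> L \<Longrightarrow> m \<in> L \<Longrightarrow> l \<subseteq> m \<Longrightarrow> l = m"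
  using sd_eq[OF L_sd L_sd] by blast

text \<open>For three pencils in a solid with pairwise at most one common line this gives 3 (q + 1)
  - 3 = 3 q lines, more than the 2 q + 1 allowed by (Sd).\<close>

lemma card3_union:
  assumes "finite A" "finite B" "finite C" "A \<inter> B \<subseteq> {a}" "A \<inter> C \<subseteq> {b}" "B \<inter> C \<subseteq> {c}"
    "card A = r" "card B = r" "card C = r"
  shows "3 * r \<le> card (A \<union> B \<union> C) + 3"
proof -
  have 1: "card (A \<union> B) + card (A \<inter> B) = 2 * r" using assms card_Un_Int[of A B] by simp
  have 2: "card (A \<inter> B) \<le> 1" using card_mono[OF _ assms(4)] by simp
  have 3: "card (A \<union> B \<union> C) + card ((A \<union> B) \<inter> C) = card (A \<union> B) + r"
    using assms card_Un_Int[of "A \<union> B" C] by simp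
  have "(A \<union> B) \<inter> C \<subseteq> {b,c}" using assms by blast
  then have "card ((A \<union> B) \<inter> C) \<le> card {b,c}" by (rule card_mono[rotated]) simp
  also have "\<dots> \<le> 2" by (simp add: card_insert_if)
  finally show ?thesis using 1 2 3 by linarith
qed

lemma Pi_V: "Pi x \<subseteq> V" unfolding Pi_def using L_V by blast

lemma adj_iff: "y \<in> Pi x \<longleftrightarrow> (\<exists>l\<in>L. x \<in> l \<and> y \<in> l)" unfolding Pi_def by blast

lemma adj_sym: "y \<in> Pi x \<longleftrightarrow> x \<in> Pi y" unfolding adj_iff by blast

lemma Pi_self: "x \<in> P \<Longrightarrow> x \<in> Pi x" unfolding adj_iff P_def by blast

lemma adj_P: "y \<in> Pi x \<Longrightarrow> y \<noteq> 0 \<Longrightarrow> y \<in> P" unfolding adj_iff by (blast intro: P_I)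

lemma line_sub_Pi: "l \<in> L \<Longrightarrow> x \<in> l \<Longrightarrow> l \<subseteq> Pi x" unfolding Pi_def by blast

lemma adj_line:
  assumes "x \<in> P" "y \<in> Pi x" "y \<notin> vs.span {x}" shows "vs.span {x,y} \<in> L"
  using assms sd_line_span[OF L_sd] P_nz unfolding adj_iff by metis

lemma adj_nz: "x \<in> P \<Longrightarrow> y \<notin> vs.span {x} \<Longrightarrow> y \<noteq> 0" using vs.span_zero by metis

lemma Pi_scale:
  assumes "x \<noteq> 0" "y \<noteq> 0" "y \<in> vs.span {x}" shows "Pi y = Pi x"
proof -
  have "x \<in> l \<longleftrightarrow> y \<in> l" if "l \<in> L" for l
    using sd_span_mem[OF L_sd[OF that]] span1_sym[OF assms(2,3)] assms(3) by blast
  then show ?thesis unfolding Pi_def by blast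
qed

lemma scale_in_Pi: "x \<noteq> 0 \<Longrightarrow> k \<noteq> 0 \<Longrightarrow> Pi (k *s x) = Pi x"
  by (rule Pi_scale) (auto simp: span1_iff)

end

text \<open>The common core of both directions. For \<open>flat_lines\<close> the axioms are derived
  from (Pt), (Pl) and (Sd); for the standard model they are verified by computation with octonions.
  The last two keep what (Sd) says about whole pencils inside a solid.\<close>

locale line_geom = lines0 +
  assumes lines_card: "\<And>x. x \<in> P \<Longrightarrow> card {l\<in>L. x \<in> l} = q + 1"
    and Pi_sd: "\<And>x. x \<in> P \<Longrightarrow> sd 3 (Pi x)"
    and Pi_lines: "\<And>x. x \<in> P \<Longrightarrow> {k\<in>L. k \<subseteq> Pi x} = {k\<in>L. x \<in> k}"
    and pencils_adj: "\<And>S x y. sd 4 S \<Longrightarrow> S \<subseteq> V \<Longrightarrow> x \<in> P \<Longrightarrow> y \<in> P \<Longrightarrow> Pi x \<subseteq> S \<Longrightarrow> Pi y \<subseteq> S \<Longrightarrow> y \<in> Pi x"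
    and pencils3: "\<And>S x y z. sd 4 S \<Longrightarrow> S \<subseteq> V \<Longrightarrow> x \<in> P \<Longrightarrow> y \<in> P \<Longrightarrow> z \<in> P \<Longrightarrow>
      Pi x \<subseteq> S \<Longrightarrow> Pi y \<subseteq> S \<Longrightarrow> Pi z \<subseteq> S \<Longrightarrow>
      y \<notin> vs.span {x} \<Longrightarrow> z \<notin> vs.span {x} \<Longrightarrow> z \<notin> vs.span {y} \<Longrightarrow> False"
begin

lemma two_lines:
  assumes "x \<in> P" obtains l m where "l \<in> L" "m \<in> L" "l \<noteq> m" "x \<in> l" "x \<in> m"
proof -
  have "\<not> card {l\<in>L. x \<in> l} \<le> Suc 0" using lines_card[OF assms] q2 by simp
  then obtain l m where "l \<in> {l\<in>L. x \<in> l}" "m \<in> {l\<in>L. x \<in> l}" "l \<noteq> m"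
    unfolding card_le_Suc0_iff_eq[OF fin_sub] by blast
  then show thesis using that by blast
qed

lemma Pi_eq_ssum:
  assumes "l \<in> L" "m \<in> L" "l \<noteq> m" "x \<in> l" "x \<in> m" "x \<noteq> 0"
  shows "Pi x = ssum l m"
proof -
  have x: "x \<in> P" using P_I assms by blast
  have "ssum l m \<subseteq> Pi x" using ssum_le[OF sd_subspace[OF Pi_sd[OF x]]] line_sub_Pi assms by blast
  then show ?thesis using sd_eq[OF line_int(2)[OF assms] Pi_sd[OF x]] by simp
qed

lemma Pi_le:
  assumes U: "vs.subspace U" and l: "l \<in> L" "m \<in> L" "l \<noteq> m" "x \<in> l" "x \<in> m" "x \<noteq> 0" "l \<subseteq> U" "m \<subseteq> U"
  shows "Pi x \<subseteq> U"
  using Pi_eq_ssum[OF l(1-6)] ssum_le[OF U l(7,8)] by simp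

lemma Pi_span:
  assumes "x \<in> P" "y \<in> Pi x" "z \<in> Pi x" "y \<notin> vs.span {x}" "z \<notin> vs.span {x,y}"
  shows "Pi x = vs.span {x,y,z}"
  using sd_plane_span[OF Pi_sd[OF assms(1)] Pi_self[OF assms(1)] assms(2,3) P_nz[OF assms(1)] assms(4,5)] .

text \<open>The line yz lies in the plane \<open>Pi x\<close>, and by \<open>Pi_lines\<close> every
  line of \<open>L\<close> in that plane passes through x.\<close>

lemma no_triangle:
  assumes x: "x \<in> P" and y: "y \<in> Pi x" "y \<notin> vs.span {x}" and z: "z \<in> Pi x" "z \<in> Pi y"
  shows "z \<in> vs.span {x,y}"
proof (rule ccontr)
  assume n: "z \<notin> vs.span {x,y}"
  have y0: "y \<noteq> 0" using adj_nz x y by blast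
  have yP: "y \<in> P" using adj_P y y0 by blast
  have "z \<notin> vs.span {y}" using n vs.span_mono[of "{y}" "{x,y}"] by blast
  then have m: "vs.span {y,z} \<in> L" using adj_line yP z by blast
  have "vs.span {y,z} \<subseteq> Pi x" using sd_span_le[OF Pi_sd[OF x]] y z by simp
  then have "x \<in> vs.span {y,z}" using Pi_lines[OF x] m by blast
  then obtain a b where ab: "x = a *s y + b *s z" unfolding span2_iff by blast
  have "b \<noteq> 0"
  proof
    assume "b = 0"
    then have "x \<in> vs.span {y}" using ab by (auto simp: span1_iff)
    then show False using span1_sym[of x y] P_nz[OF x] y by blast
  qed
  then have "z = inverse b *s x + (- (inverse b * a)) *s y" unfolding ab
    by (simp add: vs.scale_right_distrib)
  then show False using n unfolding span2_iff by blast
qed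

lemma Pi_inj:
  assumes "x \<in> P" "y \<in> P" "Pi x = Pi y" shows "y \<in> vs.span {x}"
proof (rule ccontr)
  assume n: "y \<notin> vs.span {x}"
  obtain l m where l: "l \<in> L" "m \<in> L" "l \<noteq> m" "x \<in> l" "x \<in> m" using two_lines[OF assms(1)] .
  have "y \<in> l" "y \<in> m" using Pi_lines[OF assms(1)] Pi_lines[OF assms(2)] assms(3) l by blast+
  then show False using line_eq[OF l(1,2,4,5)] n P_nz[OF assms(1)] l(3) by blast
qed

lemma Pi_int_adj:
  assumes "x \<in> P" "y \<in> Pi x" "y \<notin> vs.span {x}"
  shows "Pi x \<inter> Pi y = vs.span {x,y}" "sd 4 (ssum (Pi x) (Pi y))"
proof -
  have y: "y \<in> P" using adj_P adj_nz assms by blast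
  have l: "vs.span {x,y} \<in> L" using adj_line assms by blast
  have sub: "vs.span {x,y} \<subseteq> Pi x \<inter> Pi y" using line_sub_Pi[OF l] vs.span_base by blast
  have ne: "Pi x \<noteq> Pi y" using Pi_inj assms y by blast
  show e: "Pi x \<inter> Pi y = vs.span {x,y}" using plane_int[OF Pi_sd Pi_sd ne l] assms(1) y sub by blast
  obtain k where k: "sd k (Pi x \<inter> Pi y)" "sd (3 + 3 - k) (ssum (Pi x) (Pi y))"
    using sd_int_sum[OF Pi_sd[OF assms(1)] Pi_sd[OF y]] by blast
  have "k = 2" using sd_unique[OF k(1)] L_sd[OF l] unfolding e by blast
  then show "sd 4 (ssum (Pi x) (Pi y))" using k(2) by simp
qed

text \<open>Two independent common neighbours make the planes \<open>Pi x\<close> and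
  \<open>Pi z\<close> meet in a line, so they span only a solid; \<open>pencils_adj\<close> then
  makes x and z collinear.\<close>

lemma no_quad:
  assumes x: "x \<in> P" "z \<in> P" "z \<notin> Pi x" and y: "y \<in> Pi x" "y \<in> Pi z" "y \<noteq> 0" "w \<in> Pi x" "w \<in> Pi z"
  shows "w \<in> vs.span {y}"
proof (rule ccontr)
  assume n: "w \<notin> vs.span {y}"
  obtain k where k: "sd k (Pi x \<inter> Pi z)" "sd (3 + 3 - k) (ssum (Pi x) (Pi z))" "k \<le> 3"
    using sd_int_sum[OF Pi_sd[OF x(1)] Pi_sd[OF x(2)]] by blast
  have "2 \<le> k" using sd_mono[OF sd_span2[OF y(3) n] k(1)] sd_span_le[OF k(1), of "{y,w}"] y by auto
  moreover have "k \<noteq> 3" using sd_eq[OF k(1) Pi_sd[OF x(2)]] x Pi_self by blast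
  ultimately have "k = 2" using k(3) by simp
  then have S: "sd 4 (ssum (Pi x) (Pi z))" using k(2) by simp
  have "Pi x \<subseteq> ssum (Pi x) (Pi z)" "Pi z \<subseteq> ssum (Pi x) (Pi z)"
    using ssum_ge1 ssum_ge2 sd_subspace[OF Pi_sd] x by blast+
  then show False using pencils_adj[OF S ssum_line_V[OF Pi_V Pi_V]] x by blast
qed

end

section \<open>Planar pencils from the conditions on points, planes and solids\<close>

locale flat_lines = lines0 +
  assumes L_ne: "L \<noteq> {}"
    and Pt: "\<And>x. x \<in> V \<Longrightarrow> x \<noteq> 0 \<Longrightarrow> card {l\<in>L. x \<in> l} \<in> {0, q + 1}"
    and Pl: "\<And>S. sd 3 S \<Longrightarrow> S \<subseteq> V \<Longrightarrow> card {l\<in>L. l \<subseteq> S} \<in> {0, 1, q + 1}"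
    and Sd: "\<And>S. sd 4 S \<Longrightarrow> S \<subseteq> V \<Longrightarrow> card {l\<in>L. l \<subseteq> S} \<in> {0, 1, q + 1, 2 * q + 1}"
    and F4: "\<And>S. sd 5 S \<Longrightarrow> S \<subseteq> V \<Longrightarrow> card {l\<in>L. l \<subseteq> S} \<le> q^3 - q^2 + 4 * q"
    and To: "card L \<le> q^5 + q^4 + q^3 + q^2 + q + 1"
begin

lemma lines_card0: "x \<in> P \<Longrightarrow> card {l\<in>L. x \<in> l} = q + 1"
proof -
  assume x: "x \<in> P"
  then obtain l where "l \<in> {l\<in>L. x \<in> l}" unfolding P_def by blast
  then have "card {l\<in>L. x \<in> l} \<noteq> 0" using fin_sub by (metis card_0_eq empty_iff)
  then show ?thesis using Pt[of x] P_V[OF x] P_nz[OF x] by simp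
qed

lemma two_lines0:
  assumes "x \<in> P" obtains l m where "l \<in> L" "m \<in> L" "l \<noteq> m" "x \<in> l" "x \<in> m"
proof -
  have "\<not> card {l\<in>L. x \<in> l} \<le> Suc 0" using lines_card0[OF assms] q2 by simp
  then obtain l m where "l \<in> {l\<in>L. x \<in> l}" "m \<in> {l\<in>L. x \<in> l}" "l \<noteq> m"
    unfolding card_le_Suc0_iff_eq[OF fin_sub] by blast
  then show thesis using that by blast
qed

lemma plane_card:
  assumes "sd 3 E" "E \<subseteq> V" "l \<in> L" "m \<in> L" "l \<noteq> m" "l \<subseteq> E" "m \<subseteq> E"
  shows "card {k\<in>L. k \<subseteq> E} = q + 1"
proof -
  have "card {l,m} \<le> card {k\<in>L. k \<subseteq> E}" by (rule card_mono) (use fin_sub assms in auto)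
  then show ?thesis using Pl[OF assms(1,2)] assms(5) by auto
qed

text \<open>Three lines on x that span a solid would give three planes with q + 1 lines each, too
  many for (Sd). So the q + 1 lines on x are the q + 1 lines of one plane, and they cover it because
  q + (q + 1)(q^2 - q) = q^3.\<close>

lemma flat:
  assumes x: "x \<in> P" and l: "l \<in> L" "m \<in> L" "l \<noteq> m" "x \<in> l" "x \<in> m"
  shows "{k\<in>L. x \<in> k} = {k\<in>L. k \<subseteq> ssum l m}" "Pi x = ssum l m"
proof -
  let ?E = "ssum l m"
  note x0 = P_nz[OF x]
  have sub: "A \<subseteq> ssum A B \<and> B \<subseteq> ssum A B" if "sd a A" "sd b B" for A B :: "(nat \<Rightarrow> 'a) set" and a b
    using ssum_ge1[OF sd_subspace[OF that(2)]] ssum_ge2[OF sd_subspace[OF that(1)]] by blast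
  have E: "sd 3 ?E" using line_int(2)[OF l x0] .
  have EV: "?E \<subseteq> V" using ssum_line_V L_V l by blast
  have lE: "l \<subseteq> ?E" "m \<subseteq> ?E" using sub[OF L_sd[OF l(1)] L_sd[OF l(2)]] by simp_all
  have cE: "card {k\<in>L. k \<subseteq> ?E} = q + 1" using plane_card[OF E EV l(1,2,3) lE] .
  have in_E: "k \<subseteq> ?E" if k: "k \<in> L" "x \<in> k" for k
  proof (rule ccontr)
    assume n: "\<not> k \<subseteq> ?E"
    then have kl: "l \<noteq> k" "m \<noteq> k" using lE by auto
    let ?E1 = "ssum l k" and ?E2 = "ssum m k" and ?S = "ssum ?E k"
    have E1: "sd 3 ?E1" "?E1 \<subseteq> V" "l \<subseteq> ?E1" "k \<subseteq> ?E1"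
      using line_int(2)[OF l(1) k(1) kl(1) l(4) k(2) x0] ssum_line_V[OF L_V[OF l(1)] L_V[OF k(1)]]
        sub[OF L_sd[OF l(1)] L_sd[OF k(1)]] by simp_all
    have E2: "sd 3 ?E2" "?E2 \<subseteq> V" "m \<subseteq> ?E2" "k \<subseteq> ?E2"
      using line_int(2)[OF l(2) k(1) kl(2) l(5) k(2) x0] ssum_line_V[OF L_V[OF l(2)] L_V[OF k(1)]]
        sub[OF L_sd[OF l(2)] L_sd[OF k(1)]] by simp_all
    have c1: "card {k\<in>L. k \<subseteq> ?E1} = q + 1" using plane_card[OF E1(1,2) l(1) k(1) kl(1) E1(3,4)] .
    have c2: "card {k\<in>L. k \<subseteq> ?E2} = q + 1" using plane_card[OF E2(1,2) l(2) k(1) kl(2) E2(3,4)] .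
    obtain j where j: "sd j (?E \<inter> k)" "sd (3 + 2 - j) ?S" "j \<le> 2"
      using sd_int_sum[OF E L_sd[OF k(1)]] by blast
    have "j \<noteq> 2" using sd_eq[OF j(1) L_sd[OF k(1)]] n by blast
    moreover have "j \<noteq> 0"
    proof
      assume "j = 0"
      then have "?E \<inter> k = {0}" using j(1) sd_0_iff[of "?E \<inter> k"] by simp
      then show False using x0 k(2) l(4) lE by blast
    qed
    ultimately have "j = 1" using j(3) by simp
    then have S: "sd 4 ?S" using j(2) by simp
    have SV: "?S \<subseteq> V" using ssum_line_V EV L_V k by blast
    have ES: "?E \<subseteq> ?S" "k \<subseteq> ?S" using sub[OF E L_sd[OF k(1)]] by simp_all
    have "l \<subseteq> ?S" "m \<subseteq> ?S" using ES lE by auto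
    then have E1S: "?E1 \<subseteq> ?S" "?E2 \<subseteq> ?S" using ssum_le[OF sd_subspace[OF S]] ES by blast+
    have ne: "?E \<noteq> ?E1" "?E \<noteq> ?E2" using n E1(4) E2(4) by auto
    have ne12: "?E1 \<noteq> ?E2"
    proof
      assume "?E1 = ?E2"
      then have "?E \<subseteq> ?E1" using ssum_le[OF sd_subspace[OF E1(1)]] E1 E2 by simp
      then show False using sd_eq[OF E E1(1)] ne by blast
    qed
    have i1: "{j\<in>L. j \<subseteq> ?E} \<inter> {j\<in>L. j \<subseteq> ?E1} \<subseteq> {l}"
      using plane_int[OF E E1(1) ne(1) l(1) lE(1) E1(3)] line_sub_eq[OF _ l(1)] by blast
    have i2: "{j\<in>L. j \<subseteq> ?E} \<inter> {j\<in>L. j \<subseteq> ?E2} \<subseteq> {m}"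
      using plane_int[OF E E2(1) ne(2) l(2) lE(2) E2(3)] line_sub_eq[OF _ l(2)] by blast
    have i3: "{j\<in>L. j \<subseteq> ?E1} \<inter> {j\<in>L. j \<subseteq> ?E2} \<subseteq> {k}"
      using plane_int[OF E1(1) E2(1) ne12 k(1) E1(4) E2(4)] line_sub_eq[OF _ k(1)] by blast
    have "3 * (q + 1) \<le> card ({j\<in>L. j \<subseteq> ?E} \<union> {j\<in>L. j \<subseteq> ?E1} \<union> {j\<in>L. j \<subseteq> ?E2}) + 3"
      using card3_union[OF fin_sub fin_sub fin_sub i1 i2 i3 cE c1 c2] .
    also have "\<dots> \<le> card {j\<in>L. j \<subseteq> ?S} + 3"
      by (intro add_right_mono card_mono fin_sub) (use ES E1S in blast)
    also have "\<dots> \<le> 2 * q + 1 + 3" using Sd[OF S SV] by auto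
    finally show False using q2 by simp
  qed
  have "{k\<in>L. x \<in> k} \<subseteq> {k\<in>L. k \<subseteq> ?E}" using in_E by blast
  then show lines: "{k\<in>L. x \<in> k} = {k\<in>L. k \<subseteq> ?E}"
    by (rule card_subset_eq[OF fin_sub]) (simp add: cE lines_card0[OF x])
  have sx: "sd 1 (vs.span {x})" using sd_span1[OF x0] .
  have Pi_e: "Pi x = vs.span {x} \<union> (\<Union>k\<in>{k\<in>L. x \<in> k}. k - vs.span {x})"
    unfolding Pi_def using l(1,4) sd_span_mem[OF L_sd] by blast
  have dj: "(k - vs.span {x}) \<inter> (k' - vs.span {x}) = {}" if "k \<in> {k\<in>L. x \<in> k}" "k' \<in> {k\<in>L. x \<in> k}" "k \<noteq> k'" for k k'
    using line_int(1)[of k k' x] that x0 by blast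
  have ck: "card (k - vs.span {x}) = q^2 - q" if "k \<in> {k\<in>L. x \<in> k}" for k
    using that sd_span_mem[OF L_sd, of k x] sx L_sd[of k]
    by (subst card_Diff_subset) (auto simp: sd_q sd_finite[OF sx])
  have "card (\<Union>k\<in>{k\<in>L. x \<in> k}. k - vs.span {x}) = (\<Sum>k\<in>{k\<in>L. x \<in> k}. card (k - vs.span {x}))"
    by (rule card_UN_disjoint) (use dj fin_sub sd_finite[OF L_sd] in auto)
  also have "\<dots> = (q + 1) * (q^2 - q)" using ck lines_card0[OF x] by simp
  finally have cu: "card (\<Union>k\<in>{k\<in>L. x \<in> k}. k - vs.span {x}) = (q + 1) * (q^2 - q)" .
  have "card (Pi x) = q + (q + 1) * (q^2 - q)"
    unfolding Pi_e by (subst card_Un_disjoint) (use cu sx fin_sub sd_finite[OF L_sd] sd_finite[OF sx] in \<open>auto simp: sd_q\<close>)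
  also have "\<dots> = q ^ 3"
  proof -
    obtain r where r: "q = r + 2" using q2 by (metis add.commute le_Suc_ex)
    then have "q^2 - q = (r+2)*(r+1)" by (simp add: power2_eq_square algebra_simps)
    then show ?thesis unfolding r by (simp add: power3_eq_cube algebra_simps)
  qed
  finally have "card (Pi x) = card ?E" using E by (simp add: sd_q)
  moreover have "Pi x \<subseteq> ?E" unfolding Pi_def using in_E by blast
  ultimately show "Pi x = ?E" using card_subset_eq[OF sd_finite[OF E]] by metis
qed

lemma Pi_sd0: "x \<in> P \<Longrightarrow> sd 3 (Pi x)"
proof -
  assume x: "x \<in> P"
  obtain l m where l: "l \<in> L" "m \<in> L" "l \<noteq> m" "x \<in> l" "x \<in> m" using two_lines0[OF x] .
  show ?thesis using flat(2)[OF x l] line_int(2)[OF l P_nz[OF x]] by simp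
qed

lemma Pi_lines0: "x \<in> P \<Longrightarrow> {k\<in>L. k \<subseteq> Pi x} = {k\<in>L. x \<in> k}"
proof -
  assume x: "x \<in> P"
  obtain l m where l: "l \<in> L" "m \<in> L" "l \<noteq> m" "x \<in> l" "x \<in> m" using two_lines0[OF x] .
  show ?thesis using flat[OF x l] by simp
qed

text \<open>Points that are not collinear have disjoint pencils, which would put 2 q + 2 lines into
  the solid.\<close>

lemma pencils_adj0:
  assumes S: "sd 4 S" "S \<subseteq> V" and x: "x \<in> P" "y \<in> P" "Pi x \<subseteq> S" "Pi y \<subseteq> S"
  shows "y \<in> Pi x"
proof (rule ccontr)
  assume n: "y \<notin> Pi x"
  have "{k\<in>L. x \<in> k} \<inter> {k\<in>L. y \<in> k} = {}" using n unfolding adj_iff by blast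
  then have "card ({k\<in>L. x \<in> k} \<union> {k\<in>L. y \<in> k}) = 2 * (q + 1)"
    using card_Un_disjoint[OF fin_sub fin_sub] lines_card0 x by simp
  moreover have "card ({k\<in>L. x \<in> k} \<union> {k\<in>L. y \<in> k}) \<le> card {k\<in>L. k \<subseteq> S}"
    by (rule card_mono[OF fin_sub]) (use x line_sub_Pi in blast)
  ultimately show False using Sd[OF S] by auto
qed

lemma pencils30:
  assumes S: "sd 4 S" "S \<subseteq> V" and x: "x \<in> P" "y \<in> P" "z \<in> P" "Pi x \<subseteq> S" "Pi y \<subseteq> S" "Pi z \<subseteq> S"
    and n: "y \<notin> vs.span {x}" "z \<notin> vs.span {x}" "z \<notin> vs.span {y}"
  shows False
proof -
  have i: "{k\<in>L. a \<in> k} \<inter> {k\<in>L. b \<in> k} \<subseteq> {vs.span {a,b}}" if "a \<in> P" "b \<notin> vs.span {a}" for a b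
    using sd_line_span[OF L_sd, of _ a b] that P_nz by blast
  have "3 * (q + 1) \<le> card ({k\<in>L. x \<in> k} \<union> {k\<in>L. y \<in> k} \<union> {k\<in>L. z \<in> k}) + 3"
    using card3_union[OF fin_sub fin_sub fin_sub i i i lines_card0 lines_card0 lines_card0] x n by blast
  also have "\<dots> \<le> card {k\<in>L. k \<subseteq> S} + 3"
    by (intro add_right_mono card_mono fin_sub) (use x line_sub_Pi in blast)
  also have "\<dots> \<le> 2 * q + 1 + 3" using Sd[OF S] by auto
  finally show False using q2 by simp
qed

end

sublocale flat_lines \<subseteq> line_geom
  by unfold_locales (fact lines_card0, fact Pi_sd0, fact Pi_lines0, fact pencils_adj0, erule (10) pencils30)

section \<open>Exclusion of pentagons\<close>

lemma sd_span_card: "finite B \<Longrightarrow> \<exists>d\<le>card B. sd d (vs.span (B :: (nat \<Rightarrow> 'a::{field,finite}) set))"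
proof (induction B rule: finite_induct)
  case empty
  then show ?case using sd_0_iff by auto
next
  case (insert a B)
  then obtain d where d: "d \<le> card B" "sd d (vs.span B)" by blast
  show ?case
  proof (cases "a \<in> vs.span B")
    case True
    then have "vs.span (insert a B) = vs.span B" by (rule vs.span_redundant)
    then show ?thesis using d insert.hyps by (metis card_insert_disjoint le_SucI)
  next
    case False
    then show ?thesis using sd_span_insert[OF d(2) False] d insert.hyps by auto
  qed
qed

text \<open>Here b is the number of lines in a 4-space containing a pentagon. The quadratic in
  \<open>F\<close> is convex in b, so between the two bounds it lies below its chord. The chord has
  slope 4 q - 1, so its value at the upper bound decides.\<close>

lemma pentagon_arith:
  fixes q b :: int
  assumes q: "q \<ge> 2" and lb: "b \<ge> 2*q^2 + 2*q + 1" and ub: "b \<le> q^3 - q^2 + 4*q" and dv: "q dvd b - 1"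
    and F: "b^2 - b*(q^3+q^2+2*q+2) + (q^5+2*q^4+2*q^3+2*q^2+2*q+1) \<ge> 5*q^2"
  shows False
proof -
  consider "q = 2" | "q = 3" | "q \<ge> 4" using q by linarith
  then show False
  proof cases
    \<comment> \<open>For q = 2 the bounds already cross: b would be at least 13 and at most
      12.\<close>
    case 1 then show ?thesis using lb ub by simp
  next
    case 2
    then have "b \<ge> 25" "b \<le> 30" "3 dvd b - 1" using lb ub dv by simp_all
    \<comment> \<open>The inequality \<open>F\<close> alone would admit b = 29 and b = 30; the
      congruence modulo 3 removes them.\<close>
    then have "b = 25 \<or> b = 28" by presburger
    then show ?thesis using F 2 by auto
  next
    case 3
    let ?l = "2*q^2 + 2*q + 1" and ?B = "q^3 - q^2 + 4*q"
    have "(b - ?l) * (b - ?B) \<le> 0" using lb ub by (simp add: mult_nonneg_nonpos)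
    moreover have "(4*q - 1) * b \<le> (4*q - 1) * ?B" using ub 3 by (intro mult_left_mono) auto
    moreover have "b^2 - b*(q^3+q^2+2*q+2) + (q^5+2*q^4+2*q^3+2*q^2+2*q+1)
       = (b - ?l) * (b - ?B) + (4*q - 1) * b + (q^5+2*q^4+2*q^3+2*q^2+2*q+1) - ?l * ?B"
      by (simp add: algebra_simps power2_eq_square)
    ultimately have 1: "5*q^2 \<le> (4*q - 1) * ?B + (q^5+2*q^4+2*q^3+2*q^2+2*q+1) - ?l * ?B" using F by linarith
    obtain r where r: "q = r + 4" "r \<ge> 0" using 3 by (metis add.commute diff_add_cancel diff_ge_0_iff_ge)
    have "(4*q - 1) * ?B + (q^5+2*q^4+2*q^3+2*q^2+2*q+1) - ?l * ?B - 5*q^2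
       = - (r^5 + 14*r^4 + 74*r^3 + 177*r^2 + 174*r + 39)"
      unfolding r(1) by algebra
    moreover have "r^5 + 14*r^4 + 74*r^3 + 177*r^2 + 174*r + 39 > 0" using r(2) by (simp add: add_nonneg_pos)
    ultimately show ?thesis using 1 by linarith
  qed
qed

text \<open>Trades the number of full points on a line for the number of pairs of them, which
  \<open>choose_le_solids\<close> controls.\<close>

lemma choose2_bound: "k \<le> 1 + (k choose 2)" for k :: nat
  by (induction k) (auto simp: numeral_2_eq_2 simp del: binomial_Suc_Suc simp: binomial_Suc_Suc)

context line_geom begin

text \<open>A point \<open>x\<close> is full in \<open>U\<close> if all lines of \<open>L\<close> on \<open>x\<close> lie in \<open>U\<close>; \<open>fpl U m\<close> is the set of points on \<open>m\<close> that are full in \<open>U\<close>.\<close>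
definition LU where "LU U = {l\<in>L. l \<subseteq> U}"
definition FP where "FP U = {vs.span {x} |x. x \<in> P \<and> Pi x \<subseteq> U}"
definition fpl where "fpl U m = {p \<in> FP U. p \<subseteq> m}"

lemma fin_LU: "finite (LU U)" unfolding LU_def by (rule fin_sub)

lemma P_line: "x \<in> P \<Longrightarrow> \<exists>l\<in>L. x \<in> l" unfolding P_def by blast

lemma fpl_iff: "m \<in> L \<Longrightarrow> p \<in> fpl U m \<longleftrightarrow> (\<exists>x. p = vs.span {x} \<and> x \<in> m \<and> x \<noteq> 0 \<and> Pi x \<subseteq> U)"
proof
  assume m: "m \<in> L" and p: "p \<in> fpl U m"
  then obtain x where x: "p = vs.span {x}" "x \<in> P" "Pi x \<subseteq> U" "p \<subseteq> m" unfolding fpl_def FP_def by blast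
  then have "x \<in> m" using vs.span_base[of x "{x}"] by blast
  then show "\<exists>x. p = vs.span {x} \<and> x \<in> m \<and> x \<noteq> 0 \<and> Pi x \<subseteq> U" using x P_nz by blast
next
  assume m: "m \<in> L" and "\<exists>x. p = vs.span {x} \<and> x \<in> m \<and> x \<noteq> 0 \<and> Pi x \<subseteq> U"
  then obtain x where x: "p = vs.span {x}" "x \<in> m" "x \<noteq> 0" "Pi x \<subseteq> U" by blast
  then show "p \<in> fpl U m" unfolding fpl_def FP_def using P_I[OF m] sd_span_mem[OF L_sd[OF m]] by blast
qed

lemma fin_fpl: "m \<in> L \<Longrightarrow> finite (fpl U m)"
  by (rule finite_subset[of _ "Pow m"]) (use sd_finite[OF L_sd[of m]] in \<open>auto simp: fpl_def\<close>)

lemma int_zero: "l \<in> L \<Longrightarrow> m \<in> L \<Longrightarrow> l \<inter> m \<noteq> {0} \<longleftrightarrow> (\<exists>x. x \<in> l \<and> x \<in> m \<and> x \<noteq> 0)"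
  using sd_zero[OF L_sd] by blast

text \<open>A point where m meets another line of U is full, because its pencil plane is spanned by
  these two lines. Each full point contributes q lines besides m, and no line is counted at two
  points of m.\<close>

lemma meet_card:
  assumes U: "vs.subspace U" and m: "m \<in> LU U"
  shows "card {k\<in>LU U. k \<noteq> m \<and> k \<inter> m \<noteq> {0}} = q * card (fpl U m)"
proof -
  have mL: "m \<in> L" "m \<subseteq> U" using m by (auto simp: LU_def)
  have e: "{k\<in>LU U. k \<noteq> m \<and> k \<inter> m \<noteq> {0}} = (\<Union>p\<in>fpl U m. {k\<in>L. p \<subseteq> k} - {m})"
  proof (intro set_eqI iffI)
    fix k assume "k \<in> {k\<in>LU U. k \<noteq> m \<and> k \<inter> m \<noteq> {0}}"
    then have k: "k \<in> L" "k \<subseteq> U" "k \<noteq> m" "k \<inter> m \<noteq> {0}" by (auto simp: LU_def)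
    then obtain x where x: "x \<in> k" "x \<in> m" "x \<noteq> 0" using int_zero mL by blast
    have "Pi x \<subseteq> U" using Pi_le[OF U k(1) mL(1) k(3) x k(2) mL(2)] .
    then have "vs.span {x} \<in> fpl U m" using fpl_iff[OF mL(1)] x by blast
    moreover have "vs.span {x} \<subseteq> k" using sd_span_mem[OF L_sd[OF k(1)] x(1)] .
    ultimately show "k \<in> (\<Union>p\<in>fpl U m. {k\<in>L. p \<subseteq> k} - {m})" using k by blast
  next
    fix k assume "k \<in> (\<Union>p\<in>fpl U m. {k\<in>L. p \<subseteq> k} - {m})"
    then obtain p where p: "p \<in> fpl U m" "k \<in> L" "p \<subseteq> k" "k \<noteq> m" by blast
    then obtain x where x: "p = vs.span {x}" "x \<in> m" "x \<noteq> 0" "Pi x \<subseteq> U" using fpl_iff[OF mL(1)] by blast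
    have xk: "x \<in> k" using p(3) x(1) vs.span_base[of x "{x}"] by blast
    then have "k \<subseteq> U" using line_sub_Pi p x by blast
    then show "k \<in> {k\<in>LU U. k \<noteq> m \<and> k \<inter> m \<noteq> {0}}" using p x xk by (auto simp: LU_def)
  qed
  have c: "card ({k\<in>L. p \<subseteq> k} - {m}) = q" if pm: "p \<in> fpl U m" for p
  proof -
    obtain x where x: "p = vs.span {x}" "x \<in> m" "x \<noteq> 0" using fpl_iff[OF mL(1), THEN iffD1, OF pm] by blast
    have "{k\<in>L. p \<subseteq> k} = {k\<in>L. x \<in> k}"
      using x(1) vs.span_base[of x "{x}"] sd_span_mem[OF L_sd] by blast
    then show ?thesis using lines_card[OF P_I[OF mL(1) x(2,3)]] x mL by simp
  qed
  have "card (\<Union>p\<in>fpl U m. {k\<in>L. p \<subseteq> k} - {m}) = (\<Sum>p\<in>fpl U m. card ({k\<in>L. p \<subseteq> k} - {m}))"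
  proof (rule card_UN_disjoint)
    show "\<forall>p\<in>fpl U m. \<forall>p'\<in>fpl U m. p \<noteq> p' \<longrightarrow> ({k \<in> L. p \<subseteq> k} - {m}) \<inter> ({k \<in> L. p' \<subseteq> k} - {m}) = {}"
    proof (intro ballI impI)
      fix p p' assume p: "p \<in> fpl U m" "p' \<in> fpl U m" "p \<noteq> p'"
      obtain x where x: "p = vs.span {x}" "x \<in> m" "x \<noteq> 0" using p fpl_iff[OF mL(1)] by blast
      obtain y where y: "p' = vs.span {y}" "y \<in> m" "y \<noteq> 0" using p fpl_iff[OF mL(1)] by blast
      have n: "y \<notin> vs.span {x}" using span1_eq[OF y(3)] p x y by blast
      have "k = m" if "k \<in> L" "p \<subseteq> k" "p' \<subseteq> k" for k
      proof -
        have "x \<in> k" "y \<in> k" using that x y vs.span_base[of x "{x}"] vs.span_base[of y "{y}"] by blast+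
        then show ?thesis using line_eq[OF that(1) mL(1) _ x(2) _ y(2) x(3) n] by blast
      qed
      then show "({k \<in> L. p \<subseteq> k} - {m}) \<inter> ({k \<in> L. p' \<subseteq> k} - {m}) = {}" by blast
    qed
  qed (use fin_fpl[OF mL(1)] fin_sub in auto)
  then show ?thesis unfolding e using c by simp
qed

lemma skew_ssum:
  assumes "l \<in> L" "m \<in> L" "l \<inter> m = {0}" shows "sd 4 (ssum l m)"
proof -
  obtain k where k: "sd k (l \<inter> m)" "sd (2 + 2 - k) (ssum l m)"
    using sd_int_sum[OF L_sd[OF assms(1)] L_sd[OF assms(2)]] by blast
  have "k = 0" using sd_unique[OF k(1)] sd_0_iff[of "l \<inter> m"] assms by simp
  then show ?thesis using k(2) by simp
qed

end

section \<open>Double counting over the solids of a 4-space\<close>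

context flat_lines begin

definition Sol :: "(nat \<Rightarrow> 'a) set \<Rightarrow> (nat \<Rightarrow> 'a) set set" where "Sol U = {T. sd 4 T \<and> T \<subseteq> U}"

lemma fin_Sol: "finite U \<Longrightarrow> finite (Sol U)"
  by (rule finite_subset[of _ "Pow U"]) (auto simp: Sol_def)

lemma Sol_through:
  assumes "sd 5 U" "sd k A" "A \<subseteq> U" "k \<le> 4"
  shows "card {T\<in>Sol U. A \<subseteq> T} = (\<Sum>i\<le>4-k. q ^ i)"
proof -
  have "{T\<in>Sol U. A \<subseteq> T} = {T. sd 4 T \<and> A \<subseteq> T \<and> T \<subseteq> U}" unfolding Sol_def by blast
  then show ?thesis using card_hyperplanes[of k A 4 U] assms unfolding q_def by simp
qed

text \<open>Counts pairs (k, T) of a line k other than m and a solid T of U containing both. A line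
  skew to m spans one solid with it; a line meeting m spans a plane with it, which lies in q + 1
  solids of U. The surplus q per meeting line is evaluated by \<open>meet_card\<close>.\<close>

lemma sum_solids_line:
  assumes U: "sd 5 U" and m: "m \<in> LU U"
  shows "(\<Sum>T\<in>{T\<in>Sol U. m \<subseteq> T}. card (LU T) - 1) = (card (LU U) - 1) + q * (q * card (fpl U m))"
proof -
  have mL: "m \<in> L" "m \<subseteq> U" using m by (auto simp: LU_def)
  have fU: "finite U" using sd_finite[OF U] .
  let ?T = "{T\<in>Sol U. m \<subseteq> T}"
  have "(\<Sum>T\<in>?T. card (LU T) - 1) = (\<Sum>T\<in>?T. \<Sum>k\<in>LU U - {m}. if k \<subseteq> T then 1 else 0)"
  proof (rule sum.cong[OF refl])
    fix T assume T: "T \<in> ?T"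
    have "(LU U - {m}) \<inter> {k. k \<subseteq> T} = LU T - {m}" using T by (auto simp: LU_def Sol_def)
    moreover have "m \<in> LU T" using T mL by (auto simp: LU_def)
    ultimately show "card (LU T) - 1 = (\<Sum>k\<in>LU U - {m}. if k \<subseteq> T then 1 else 0)"
      using fin_LU by (simp add: sum.If_cases)
  qed
  also have "\<dots> = (\<Sum>k\<in>LU U - {m}. \<Sum>T\<in>?T. if k \<subseteq> T then 1 else 0)" by (rule sum.swap)
  also have "\<dots> = (\<Sum>k\<in>LU U - {m}. 1 + (if k \<inter> m \<noteq> {0} then q else 0))"
  proof (rule sum.cong[OF refl])
    fix k assume k: "k \<in> LU U - {m}"
    then have kL: "k \<in> L" "k \<subseteq> U" "m \<noteq> k" by (auto simp: LU_def)
    have sU: "ssum m k \<subseteq> U" using ssum_le[OF sd_subspace[OF U]] mL kL by blast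
    have eq: "?T \<inter> {T. k \<subseteq> T} = {T\<in>Sol U. ssum m k \<subseteq> T}"
    proof (intro set_eqI iffI)
      fix T assume "T \<in> ?T \<inter> {T. k \<subseteq> T}"
      then show "T \<in> {T\<in>Sol U. ssum m k \<subseteq> T}" using ssum_le[of T m k] by (auto simp: Sol_def sd_def)
    next
      fix T assume "T \<in> {T\<in>Sol U. ssum m k \<subseteq> T}"
      then show "T \<in> ?T \<inter> {T. k \<subseteq> T}"
        using ssum_ge1[OF sd_subspace[OF L_sd[OF kL(1)]], of m] ssum_ge2[OF sd_subspace[OF L_sd[OF mL(1)]], of k] by auto
    qed
    have "(\<Sum>T\<in>?T. if k \<subseteq> T then 1 else 0) = card (?T \<inter> {T. k \<subseteq> T})"
      using fin_Sol[OF fU] by (simp add: sum.If_cases)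
    also have "\<dots> = 1 + (if k \<inter> m \<noteq> {0} then q else 0)"
    proof (cases "k \<inter> m = {0}")
      case True
      then have "sd 4 (ssum m k)" using skew_ssum[OF mL(1) kL(1)] by (simp add: Int_commute)
      then show ?thesis unfolding eq using Sol_through[OF U _ sU] True by simp
    next
      case False
      then obtain x where x: "x \<in> k" "x \<in> m" "x \<noteq> 0" using int_zero kL mL by blast
      have "sd 3 (ssum m k)" using line_int(2)[OF mL(1) kL(1) kL(3) x(2,1,3)] .
      then show ?thesis unfolding eq using Sol_through[OF U _ sU] False by simp
    qed
    finally show "(\<Sum>T\<in>?T. if k \<subseteq> T then 1 else 0) = 1 + (if k \<inter> m \<noteq> {0} then q else 0)" .
  qed
  also have "\<dots> = card (LU U - {m}) + q * card {k\<in>LU U. k \<noteq> m \<and> k \<inter> m \<noteq> {0}}"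
  proof -
    have "(LU U - {m}) \<inter> {k. k \<inter> m \<noteq> {0}} = {k\<in>LU U. k \<noteq> m \<and> k \<inter> m \<noteq> {0}}" by blast
    then show ?thesis using fin_LU by (simp only: sum.distrib) (simp add: sum.If_cases)
  qed
  also have "\<dots> = (card (LU U) - 1) + q * (q * card (fpl U m))"
    using meet_card[OF sd_subspace[OF U] m] m fin_LU by simp
  finally show ?thesis .
qed

lemma Sol_LU_card: "sd 5 U \<Longrightarrow> U \<subseteq> V \<Longrightarrow> T \<in> Sol U \<Longrightarrow> card (LU T) \<in> {0, 1, q + 1, 2 * q + 1}"
  using Sd[of T] unfolding Sol_def LU_def by auto

text \<open>By (Sd), each solid through m contributes 0, q or 2 q to the sum in
  \<open>sum_solids_line\<close>.\<close>

lemma LU_mod: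
  assumes U: "sd 5 U" "U \<subseteq> V" and m: "m \<in> LU U"
  shows "q dvd card (LU U) - 1"
proof -
  have "q dvd (\<Sum>T\<in>{T\<in>Sol U. m \<subseteq> T}. card (LU T) - 1)"
  proof (rule dvd_sum)
    fix T assume "T \<in> {T\<in>Sol U. m \<subseteq> T}"
    then show "q dvd card (LU T) - 1" using Sol_LU_card[OF U, of T] by auto
  qed
  then show ?thesis unfolding sum_solids_line[OF U(1) m] by (simp add: dvd_add_left_iff)
qed

text \<open>The first and second moments of the number of lines in a solid of U, together with the
  number of solids: the input for a quadratic inequality summed over the solids.\<close>

lemma sum_solids:
  assumes U: "sd 5 U"
  shows "(\<Sum>T\<in>Sol U. card (LU T)) = card (LU U) * (1 + q + q^2)"
    "(\<Sum>T\<in>Sol U. card (LU T) * (card (LU T) - 1)) = card (LU U) * (card (LU U) - 1) + q^2 * (\<Sum>m\<in>LU U. card (fpl U m))"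
    "card (Sol U) = 1 + q + q^2 + q^3 + q^4"
proof -
  have fS: "finite (Sol U)" using fin_Sol[OF sd_finite[OF U]] .
  have LUT: "LU T = LU U \<inter> {l. l \<subseteq> T}" if "T \<in> Sol U" for T using that by (auto simp: LU_def Sol_def)
  have swap: "(\<Sum>T\<in>Sol U. \<Sum>m\<in>LU T. g T) = (\<Sum>m\<in>LU U. \<Sum>T\<in>{T\<in>Sol U. m \<subseteq> T}. g T)" for g :: "_ \<Rightarrow> nat"
  proof -
    have "(\<Sum>T\<in>Sol U. \<Sum>m\<in>LU T. g T) = (\<Sum>T\<in>Sol U. \<Sum>m\<in>LU U. if m \<subseteq> T then g T else 0)"
      using fin_LU by (intro sum.cong[OF refl]) (simp add: LUT sum.If_cases)
    also have "\<dots> = (\<Sum>m\<in>LU U. \<Sum>T\<in>Sol U. if m \<subseteq> T then g T else 0)" by (rule sum.swap)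
    also have "\<dots> = (\<Sum>m\<in>LU U. \<Sum>T\<in>{T\<in>Sol U. m \<subseteq> T}. g T)"
      using fS by (intro sum.cong[OF refl]) (simp add: sum.If_cases Int_def)
    finally show ?thesis .
  qed
  have "(\<Sum>T\<in>Sol U. card (LU T)) = (\<Sum>m\<in>LU U. card {T\<in>Sol U. m \<subseteq> T})"
    using swap[of "\<lambda>_. 1"] by simp
  also have "\<dots> = (\<Sum>m\<in>LU U. 1 + q + q^2)"
  proof (rule sum.cong[OF refl])
    fix m assume "m \<in> LU U"
    then have "sd 2 m" "m \<subseteq> U" using L_sd by (auto simp: LU_def)
    then show "card {T\<in>Sol U. m \<subseteq> T} = 1 + q + q^2" using Sol_through[OF U] by (simp add: numeral_2_eq_2)
  qed
  finally show "(\<Sum>T\<in>Sol U. card (LU T)) = card (LU U) * (1 + q + q^2)" by simp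
  have "(\<Sum>T\<in>Sol U. card (LU T) * (card (LU T) - 1)) = (\<Sum>m\<in>LU U. \<Sum>T\<in>{T\<in>Sol U. m \<subseteq> T}. card (LU T) - 1)"
    using swap[of "\<lambda>T. card (LU T) - 1"] by simp
  also have "\<dots> = (\<Sum>m\<in>LU U. (card (LU U) - 1) + q^2 * card (fpl U m))"
    using sum_solids_line[OF U] by (intro sum.cong[OF refl]) (simp add: power2_eq_square)
  finally show "(\<Sum>T\<in>Sol U. card (LU T) * (card (LU T) - 1)) = card (LU U) * (card (LU U) - 1) + q^2 * (\<Sum>m\<in>LU U. card (fpl U m))"
    by (simp add: sum.distrib sum_distrib_left)
  have "{T \<in> Sol U. {0} \<subseteq> T} = Sol U" using sd_zero by (auto simp: Sol_def)
  then show "card (Sol U) = 1 + q + q^2 + q^3 + q^4"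
    using Sol_through[OF U, of 0 "{0}"] sd_0_iff[of "{0}"] sd_zero[OF U] by (simp add: eval_nat_numeral)
qed

text \<open>Two pencils share at most one line, so they supply at least 2 q + 1 lines, which is
  already the maximum in (Sd).\<close>

lemma pencil2_card:
  assumes x: "x \<in> P" "y \<in> P" "y \<notin> vs.span {x}" and T: "sd 4 T" "T \<subseteq> V" "Pi x \<subseteq> T" "Pi y \<subseteq> T"
  shows "card (LU T) = 2 * q + 1" "LU T = {k\<in>L. x \<in> k} \<union> {k\<in>L. y \<in> k}"
proof -
  have "{k\<in>L. x \<in> k} \<inter> {k\<in>L. y \<in> k} \<subseteq> {vs.span {x,y}}"
    using sd_line_span[OF L_sd, of _ x y] x P_nz by blast
  from card_mono[OF _ this] have "card ({k\<in>L. x \<in> k} \<inter> {k\<in>L. y \<in> k}) \<le> 1" by simp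
  then have 1: "card ({k\<in>L. x \<in> k} \<union> {k\<in>L. y \<in> k}) \<ge> 2 * q + 1"
    using card_Un_Int[OF fin_sub fin_sub, of "\<lambda>k. x \<in> k" "\<lambda>k. y \<in> k"] lines_card x by simp
  have sub: "{k\<in>L. x \<in> k} \<union> {k\<in>L. y \<in> k} \<subseteq> LU T" unfolding LU_def using T line_sub_Pi by blast
  have "card (LU T) \<le> 2 * q + 1" using Sd[OF T(1,2)] unfolding LU_def by auto
  then show "card (LU T) = 2 * q + 1" using 1 card_mono[OF fin_LU sub] by linarith
  then show "LU T = {k\<in>L. x \<in> k} \<union> {k\<in>L. y \<in> k}" using 1 card_seteq[OF fin_LU sub] by simp
qed

text \<open>Two full points on a line of U generate, through their pencils, a solid of U with 2 q +
  1 lines. By \<open>pencils3\<close> the solid determines the pair, so different pairs give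
  different solids.\<close>

lemma choose_le_solids:
  assumes U: "sd 5 U" "U \<subseteq> V"
  shows "(\<Sum>m\<in>LU U. card (fpl U m) choose 2) \<le> card {T\<in>Sol U. card (LU T) = 2 * q + 1}"
proof -
  let ?E = "\<lambda>m. {s. s \<subseteq> fpl U m \<and> card s = 2}"
  let ?A = "(\<Union>m\<in>LU U. ?E m)"
  have finE: "finite (?E m)" if "m \<in> LU U" for m
  proof -
    have "?E m \<subseteq> Pow (fpl U m)" by blast
    then show ?thesis using fin_fpl[of m U] that finite_subset by (auto simp: LU_def)
  qed
  have two: "\<exists>x y. s = {vs.span {x}, vs.span {y}} \<and> x \<in> m \<and> y \<in> m \<and> x \<noteq> 0 \<and> y \<noteq> 0 \<and> y \<notin> vs.span {x} \<and> Pi x \<subseteq> U \<and> Pi y \<subseteq> U"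
    if m: "m \<in> LU U" and s: "s \<in> ?E m" for m s
  proof -
    have mL: "m \<in> L" using m by (simp add: LU_def)
    obtain p p' where p: "s = {p,p'}" "p \<noteq> p'" using s by (auto simp: card_2_iff)
    have pp: "p \<in> fpl U m" "p' \<in> fpl U m" using p s by auto
    obtain x where x: "p = vs.span {x}" "x \<in> m" "x \<noteq> 0" "Pi x \<subseteq> U" using fpl_iff[OF mL, THEN iffD1, OF pp(1)] by blast
    obtain y where y: "p' = vs.span {y}" "y \<in> m" "y \<noteq> 0" "Pi y \<subseteq> U" using fpl_iff[OF mL, THEN iffD1, OF pp(2)] by blast
    have "y \<notin> vs.span {x}" using span1_eq[OF y(3)] p x y by blast
    then show ?thesis using p x y by blast
  qed
  define G where "G s T \<longleftrightarrow> T \<in> Sol U \<and> card (LU T) = 2 * q + 1 \<and> (\<forall>p\<in>s. \<exists>x\<in>P. p = vs.span {x} \<and> Pi x \<subseteq> T)" for s T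
  have ex: "\<exists>T. G s T" if sA: "s \<in> ?A" for s
  proof -
    obtain m where m: "m \<in> LU U" "s \<in> ?E m" using sA by blast
    then have mL: "m \<in> L" by (simp add: LU_def)
    obtain x y where x: "s = {vs.span {x}, vs.span {y}}" "x \<in> m" "y \<in> m" "x \<noteq> 0" "y \<noteq> 0" "y \<notin> vs.span {x}" "Pi x \<subseteq> U" "Pi y \<subseteq> U"
      using two[OF m] by blast
    have xP: "x \<in> P" "y \<in> P" using P_I[OF mL] x by blast+
    have yx: "y \<in> Pi x" unfolding adj_iff using mL x by blast
    let ?T = "ssum (Pi x) (Pi y)"
    have T: "sd 4 ?T" using Pi_int_adj(2)[OF xP(1) yx x(6)] .
    have TU: "?T \<subseteq> U" using ssum_le[OF sd_subspace[OF U(1)]] x by blast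
    have s: "Pi x \<subseteq> ?T" "Pi y \<subseteq> ?T" using ssum_ge1 ssum_ge2 sd_subspace[OF Pi_sd] xP by blast+
    have "card (LU ?T) = 2 * q + 1" using pencil2_card(1)[OF xP x(6) T _ s] TU U by blast
    then have "G s ?T" unfolding G_def Sol_def using T TU x(1) s xP by blast
    then show ?thesis by blast
  qed
  define g where "g s = (SOME T. G s T)" for s
  have g: "G s (g s)" if "s \<in> ?A" for s using someI_ex[OF ex[OF that]] unfolding g_def .
  have inj: "inj_on g ?A"
  proof (rule inj_onI)
    fix s s' assume s: "s \<in> ?A" "s' \<in> ?A" "g s = g s'"
    show "s = s'"
    proof (rule ccontr)
      assume n: "s \<noteq> s'"
      have c: "card s = 2" "card s' = 2" using s by auto
      then obtain p p' where p: "s = {p,p'}" "p \<noteq> p'" by (auto simp: card_2_iff)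
      have "\<not> s' \<subseteq> s" using n c card_seteq[of s s'] by (metis card.infinite le_refl zero_neq_numeral)
      then obtain r where r: "r \<in> s'" "r \<noteq> p" "r \<noteq> p'" using p by blast
      have T: "sd 4 (g s)" "g s \<subseteq> V" using g[OF s(1)] U unfolding G_def Sol_def by auto
      obtain x where x: "x \<in> P" "p = vs.span {x}" "Pi x \<subseteq> g s" using g[OF s(1)] p unfolding G_def by blast
      obtain y where y: "y \<in> P" "p' = vs.span {y}" "Pi y \<subseteq> g s" using g[OF s(1)] p unfolding G_def by blast
      obtain z where z: "z \<in> P" "r = vs.span {z}" "Pi z \<subseteq> g s" using g[OF s(2), unfolded G_def] r(1) unfolding s(3) by blast
      have "y \<notin> vs.span {x}" "z \<notin> vs.span {x}" "z \<notin> vs.span {y}"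
        using span1_eq[of y x] span1_eq[of z x] span1_eq[of z y] P_nz x y z p r by blast+
      then show False using pencils3[OF T x(1) y(1) z(1) x(3) y(3) z(3)] by blast
    qed
  qed
  have "(\<Sum>m\<in>LU U. card (fpl U m) choose 2) = (\<Sum>m\<in>LU U. card (?E m))"
    by (rule sum.cong[OF refl]) (simp add: n_subsets fin_fpl LU_def)
  also have "\<dots> = card ?A"
  proof (rule card_UN_disjoint[symmetric])
    show "\<forall>m\<in>LU U. \<forall>m'\<in>LU U. m \<noteq> m' \<longrightarrow> ?E m \<inter> ?E m' = {}"
    proof (intro ballI impI, rule ccontr)
      fix m m' assume m: "m \<in> LU U" "m' \<in> LU U" "m \<noteq> m'" and "?E m \<inter> ?E m' \<noteq> {}"
      then obtain s where s: "s \<in> ?E m" "s \<in> ?E m'" by blast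
      obtain x y where x: "s = {vs.span {x}, vs.span {y}}" "x \<in> m" "y \<in> m" "x \<noteq> 0" "y \<notin> vs.span {x}"
        using two[OF m(1) s(1)] by blast
      have "x \<in> m'" "y \<in> m'" using s(2) x(1) vs.span_base[of x "{x}"] vs.span_base[of y "{y}"] unfolding fpl_def by blast+
      then show False using line_eq[of m m' x y] x m by (auto simp: LU_def)
    qed
  qed (use finE fin_LU in auto)
  also have "\<dots> = card (g ` ?A)" using card_image[OF inj] by simp
  also have "\<dots> \<le> card {T\<in>Sol U. card (LU T) = 2 * q + 1}"
    by (rule card_mono) (use fin_Sol[OF sd_finite[OF U(1)]] g in \<open>auto simp: G_def\<close>)
  finally show ?thesis .
qed

text \<open>Sum over the solids \<open>T\<close> of \<open>U\<close> of the inequality \<open>(q + 1) - (q + 1) n + n (n - 1) \<ge> 2 q\<^sup>2 [n = 2 q + 1]\<close>,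
  which holds for each admissible number \<open>n\<close> of lines in \<open>T\<close>.\<close>
lemma solid_inequality:
  assumes U: "sd 5 U" "U \<subseteq> V"
  defines "b \<equiv> int (card (LU U))" and "e \<equiv> int (\<Sum>m\<in>LU U. card (fpl U m) choose 2)" and "Q \<equiv> int q"
  shows "b^2 - b*(Q^3+Q^2+2*Q+2) + (Q^5+2*Q^4+2*Q^3+2*Q^2+2*Q+1) \<ge> Q^2 * e"
proof -
  have fS: "finite (Sol U)" using fin_Sol[OF sd_finite[OF U(1)]] .
  let ?n = "\<lambda>T. int (card (LU T))"
  define A3 where "A3 = int (card {T\<in>Sol U. card (LU T) = 2 * q + 1})"
  define fm where "fm = int (\<Sum>m\<in>LU U. card (fpl U m))"
  \<comment> \<open>The quadratic is (n - 1)(n - (q + 1)): it vanishes at n = 1 and n = q + 1,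
    equals q + 1 at n = 0 and 2 q^2 at n = 2 q + 1.\<close>
  have pt: "0 \<le> (Q+1) - (Q+1) * ?n T + int (card (LU T) * (card (LU T) - 1)) - 2*Q^2 * (if card (LU T) = 2*q+1 then 1 else 0)"
    if TS: "T \<in> Sol U" for T
  proof -
    have q0: "q \<ge> 2" by (rule q2)
    consider "card (LU T) = 0" | "card (LU T) = 1" | "card (LU T) = q + 1" | "card (LU T) = 2*q+1"
      using Sol_LU_card[OF U TS] by auto
    then show ?thesis
    proof cases
      case 1 then show ?thesis using q0 unfolding Q_def by simp
    next
      case 2 then show ?thesis using q0 unfolding Q_def by simp
    next
      case 3 then show ?thesis using q0 unfolding Q_def by (simp add: algebra_simps)
    next
      case 4 then show ?thesis using q0 unfolding Q_def by (simp add: algebra_simps power2_eq_square)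
    qed
  qed
  have "0 \<le> (\<Sum>T\<in>Sol U. (Q+1) - (Q+1) * ?n T + int (card (LU T) * (card (LU T) - 1)) - 2*Q^2 * (if card (LU T) = 2*q+1 then 1 else 0))"
    by (rule sum_nonneg) (rule pt)
  also have "\<dots> = (\<Sum>T\<in>Sol U. (Q+1)) - (Q+1) * (\<Sum>T\<in>Sol U. ?n T) + (\<Sum>T\<in>Sol U. int (card (LU T) * (card (LU T) - 1)))
      - 2*Q^2 * (\<Sum>T\<in>Sol U. (if card (LU T) = 2*q+1 then 1 else 0))"
    by (simp only: sum.distrib sum_subtractf sum_distrib_left)
  also have "(\<Sum>T\<in>Sol U. (if card (LU T) = 2*q+1 then 1 else 0::int)) = A3"
    using fS by (simp add: A3_def sum.If_cases Int_def)
  also have "(\<Sum>T\<in>Sol U. ?n T) = b * (1 + Q + Q^2)"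
    using arg_cong[OF sum_solids(1)[OF U(1)], of int] by (simp add: b_def Q_def algebra_simps)
  also have "(\<Sum>T\<in>Sol U. int (card (LU T) * (card (LU T) - 1))) = b * (b - 1) + Q^2 * fm"
  proof -
    have "(\<Sum>T\<in>Sol U. int (card (LU T) * (card (LU T) - 1))) = int (card (LU U) * (card (LU U) - 1) + q^2 * (\<Sum>m\<in>LU U. card (fpl U m)))"
      using arg_cong[OF sum_solids(2)[OF U(1)], of int] by (simp only: of_nat_sum)
    moreover have "int (card (LU U) * (card (LU U) - 1)) = b * (b - 1)" unfolding b_def
      by (cases "card (LU U)") (simp_all add: algebra_simps)
    ultimately show ?thesis by (simp add: fm_def Q_def del: of_nat_mult)  (simp add: Q_def)
  qed
  also have "(\<Sum>T\<in>Sol U. (Q+1)) = (1 + Q + Q^2 + Q^3 + Q^4) * (Q+1)"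
    using sum_solids(3)[OF U(1)] by (simp add: Q_def)
  finally have 1: "0 \<le> (1 + Q + Q^2 + Q^3 + Q^4) * (Q+1) - (Q+1) * (b * (1 + Q + Q^2)) + (b * (b - 1) + Q^2 * fm) - 2*Q^2 * A3" .
  \<comment> \<open>\<open>A3\<close> enters with coefficient -2 q^2 and \<open>fm\<close> with
    coefficient q^2. Replacing \<open>A3\<close> by its lower bound e and \<open>fm\<close> by its
    upper bound b + e leaves -q^2 e.\<close>
  have "e \<le> A3" using choose_le_solids[OF U] unfolding e_def A3_def by (simp only: of_nat_le_iff)
  then have 2: "Q^2 * e \<le> Q^2 * A3" by (intro mult_left_mono) auto
  have "(\<Sum>m\<in>LU U. card (fpl U m)) \<le> (\<Sum>m\<in>LU U. 1 + (card (fpl U m) choose 2))" by (rule sum_mono) (rule choose2_bound)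
  also have "\<dots> = card (LU U) + (\<Sum>m\<in>LU U. card (fpl U m) choose 2)" by (simp only: sum.distrib) simp
  finally have "fm \<le> b + e" unfolding fm_def b_def e_def by (simp only: of_nat_add[symmetric] of_nat_le_iff)
  then have 3: "Q^2 * fm \<le> Q^2 * (b + e)" by (intro mult_left_mono) auto
  have 4: "(1 + Q + Q^2 + Q^3 + Q^4) * (Q+1) - (Q+1) * (b * (1 + Q + Q^2)) + (b * (b - 1) + Q^2 * (b + e)) - 2*(Q^2 * e)
     = b^2 - b*(Q^3+Q^2+2*Q+2) + (Q^5+2*Q^4+2*Q^3+2*Q^2+2*Q+1) - Q^2 * e" by algebra
  show ?thesis using 1 2 3 4 by linarith
qed

text \<open>The \<open>2 q + 1\<close> lines in the solid spanned by the two pencils span with \<open>m\<close> distinct solids, each of which contains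
  \<open>q\<close> further lines skew to \<open>m\<close>.\<close>
lemma lower_bound:
  assumes U: "sd 5 U" "U \<subseteq> V" and x: "x \<in> P" "y \<in> Pi x" "y \<notin> vs.span {x}" "Pi x \<subseteq> U" "Pi y \<subseteq> U"
    and m: "m \<in> LU U" "m \<inter> Pi x = {0}" "m \<inter> Pi y = {0}"
  shows "1 + q * card (fpl U m) + q * (2 * q + 1) \<le> card (LU U)"
proof -
  have mL: "m \<in> L" "m \<subseteq> U" using m by (auto simp: LU_def)
  have y: "y \<in> P" using adj_P adj_nz x by blast
  let ?S = "ssum (Pi x) (Pi y)"
  have S: "sd 4 ?S" using Pi_int_adj(2)[OF x(1,2,3)] .
  have SU: "?S \<subseteq> U" using ssum_le[OF sd_subspace[OF U(1)]] x by blast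
  have SV: "?S \<subseteq> V" using SU U by blast
  have PS: "Pi x \<subseteq> ?S" "Pi y \<subseteq> ?S" using ssum_ge1 ssum_ge2 sd_subspace[OF Pi_sd] x y by blast+
  note TS = pencil2_card[OF x(1) y x(3) S SV PS]
  have TL: "t \<in> L" "t \<subseteq> ?S" "t \<inter> m = {0}" if "t \<in> LU ?S" for t
  proof -
    show "t \<in> L" "t \<subseteq> ?S" using that by (auto simp: LU_def)
    then have "t \<subseteq> Pi x \<or> t \<subseteq> Pi y" using that TS(2) line_sub_Pi by blast
    then show "t \<inter> m = {0}" using m sd_zero[OF L_sd[OF \<open>t \<in> L\<close>]] sd_zero[OF L_sd[OF mL(1)]] by blast
  qed
  define sk where "sk t = {k\<in>LU U. k \<subseteq> ssum m t \<and> k \<inter> m = {0}}" for t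
  have T: "sd 4 (ssum m t)" "ssum m t \<subseteq> U" "m \<subseteq> ssum m t" "t \<subseteq> ssum m t" if "t \<in> LU ?S" for t
  proof -
    show "sd 4 (ssum m t)" using skew_ssum[OF mL(1) TL(1)[OF that]] TL(3)[OF that] by (simp add: Int_commute)
    show "ssum m t \<subseteq> U" using ssum_le[OF sd_subspace[OF U(1)] mL(2)] TL(2)[OF that] SU by blast
    show "m \<subseteq> ssum m t" "t \<subseteq> ssum m t" using ssum_ge1 ssum_ge2 sd_subspace[OF L_sd] mL TL(1)[OF that] by blast+
  qed
  \<comment> \<open>The solid spanned by m and t contains 1 + q f + card (sk t) lines, f being the
    number of its full points on m. By (Sd) this is 1 modulo q, so q divides card (sk t), which is
    positive since t itself is skew to m.\<close>
  have sk_card: "q \<le> card (sk t)" if t: "t \<in> LU ?S" for t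
  proof -
    let ?T = "ssum m t"
    have mT: "m \<in> LU ?T" "t \<in> LU ?T" using T[OF t] mL TL[OF t] by (auto simp: LU_def)
    have tsk: "t \<in> sk t" unfolding sk_def using T[OF t] TL[OF t] SU by (auto simp: LU_def)
    have LUe: "LU ?T = insert m ({k\<in>LU ?T. k \<noteq> m \<and> k \<inter> m \<noteq> {0}} \<union> sk t)"
      unfolding sk_def using T[OF t] mL mT by (auto simp: LU_def)
    have m2: "m \<inter> m \<noteq> {0}" using sd_0_iff[of m] sd_unique[OF L_sd[OF mL(1)], of 0] by auto
    have "card (LU ?T) = 1 + (q * card (fpl ?T m) + card (sk t))"
    proof -
      have "finite (sk t)" unfolding sk_def using fin_LU by simp
      moreover have "m \<notin> {k\<in>LU ?T. k \<noteq> m \<and> k \<inter> m \<noteq> {0}} \<union> sk t" unfolding sk_def using m2 by blast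
      moreover have "{k\<in>LU ?T. k \<noteq> m \<and> k \<inter> m \<noteq> {0}} \<inter> sk t = {}" unfolding sk_def by blast
      ultimately show ?thesis
        using meet_card[OF sd_subspace[OF T(1)[OF t]] mT(1)] fin_LU
        by (subst LUe) (simp add: card_Un_disjoint)
    qed
    moreover have "card (LU ?T) \<in> {0, 1, q + 1, 2 * q + 1}"
      using Sd[OF T(1)[OF t]] T(2)[OF t] U unfolding LU_def by blast
    moreover have "card (sk t) > 0"
    proof -
      have "finite (sk t)" unfolding sk_def using fin_LU by simp
      then show ?thesis using tsk card_gt_0_iff by blast
    qed
    ultimately have d: "q dvd q * card (fpl ?T m) + card (sk t)" and p: "card (sk t) > 0" by auto
    then have "q dvd card (sk t)" by (simp add: dvd_add_right_iff)
    then show ?thesis using p dvd_imp_le by blast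
  qed
  \<comment> \<open>The point where m meets the solid \<open>?S\<close>. By assumption it lies
    outside \<open>Pi x\<close> and \<open>Pi y\<close>, and this is what keeps the sets
    \<open>sk t\<close> apart.\<close>
  obtain w where w: "w \<in> m" "w \<in> ?S" "w \<noteq> 0" using sd_int_nz[OF L_sd[OF mL(1)] S U(1) mL(2) SU] by auto
  have mS: "\<not> m \<subseteq> ?S"
  proof
    assume "m \<subseteq> ?S"
    then obtain p where "p \<in> m" "p \<in> Pi x" "p \<noteq> 0" using sd_int_nz[OF L_sd[OF mL(1)] Pi_sd[OF x(1)] S _ PS(1)] by auto
    then show False using m(2) by blast
  qed
  \<comment> \<open>A common line would make the two solids equal. Then t and t' lie in one plane of
    \<open>?S\<close> and meet in a point z whose pencil is that plane; by \<open>pencils3\<close> z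
    is x or y up to a scalar. But the plane contains w, which is neither in \<open>Pi x\<close> nor
    in \<open>Pi y\<close>.\<close>
  have disj: "sk t \<inter> sk t' = {}" if t: "t \<in> LU ?S" "t' \<in> LU ?S" "t \<noteq> t'" for t t'
  proof (rule ccontr)
    assume "sk t \<inter> sk t' \<noteq> {}"
    then obtain k where "k \<in> sk t" "k \<in> sk t'" by blast
    then have k: "k \<in> L" "k \<subseteq> ssum m t" "k \<subseteq> ssum m t'" "k \<inter> m = {0}" by (simp_all add: sk_def LU_def)
    have mk: "sd 4 (ssum m k)" using skew_ssum[OF mL(1) k(1)] k(4) by (simp add: Int_commute)
    have "ssum m k = ssum m t" using sd_eq[OF mk T(1)[OF t(1)]] ssum_le[OF sd_subspace[OF T(1)[OF t(1)]] T(3)[OF t(1)] k(2)] by simp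
    moreover have "ssum m k = ssum m t'" using sd_eq[OF mk T(1)[OF t(2)]] ssum_le[OF sd_subspace[OF T(1)[OF t(2)]] T(3)[OF t(2)] k(3)] by simp
    ultimately have tt: "t' \<subseteq> ssum m t" using T(4)[OF t(2)] by simp
    let ?T = "ssum m t"
    obtain j where j: "sd j (?T \<inter> ?S)" "j \<le> 4" using sd_int_sum[OF T(1)[OF t(1)] S] by blast
    have "j \<noteq> 4" using sd_eq[OF j(1) T(1)[OF t(1)]] T(3)[OF t(1)] mS by blast
    then have j3: "j \<le> 3" using j by simp
    have ti: "t \<subseteq> ?T \<inter> ?S" "t' \<subseteq> ?T \<inter> ?S" using T(4)[OF t(1)] TL(2) t tt by blast+
    obtain z where z: "z \<in> t" "z \<in> t'" "z \<noteq> 0" using sd_int_nz[OF L_sd L_sd j(1) ti] TL(1) t j3 by auto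
    have zP: "z \<in> P" using P_I TL(1) t z by blast
    have Pz: "Pi z \<subseteq> ?T \<inter> ?S" using Pi_le[OF sd_subspace[OF j(1)] TL(1)[OF t(1)] TL(1)[OF t(2)] t(3) z ti] .
    have eq: "Pi z = ?T \<inter> ?S" using sd_eq[OF Pi_sd[OF zP] j(1) Pz j3] .
    have "z \<in> vs.span {x} \<or> z \<in> vs.span {y}"
      using pencils3[OF S SV x(1) y zP PS _ x(3)] Pz by blast
    then have "Pi z = Pi x \<or> Pi z = Pi y" using Pi_scale[of x z] Pi_scale[of y z] z P_nz x(1) y by blast
    moreover have "w \<in> Pi z" using eq w T(3)[OF t(1)] by blast
    ultimately show False using w m by blast
  qed
  have sub: "insert m ({k\<in>LU U. k \<noteq> m \<and> k \<inter> m \<noteq> {0}} \<union> (\<Union>t\<in>LU ?S. sk t)) \<subseteq> LU U"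
    using m(1) unfolding sk_def by blast
  have m2: "m \<inter> m \<noteq> {0}" using sd_0_iff[of m] sd_unique[OF L_sd[OF mL(1)], of 0] by auto
  have fsk: "finite (sk t)" for t unfolding sk_def using fin_LU by simp
  have "card (\<Union>t\<in>LU ?S. sk t) = (\<Sum>t\<in>LU ?S. card (sk t))"
    by (rule card_UN_disjoint) (use disj fsk fin_LU in auto)
  also have "\<dots> \<ge> (\<Sum>t\<in>LU ?S. q)" by (rule sum_mono) (rule sk_card)
  finally have c: "q * (2 * q + 1) \<le> card (\<Union>t\<in>LU ?S. sk t)" using TS(1) by (simp add: mult.commute)
  have "m \<notin> {k\<in>LU U. k \<noteq> m \<and> k \<inter> m \<noteq> {0}} \<union> (\<Union>t\<in>LU ?S. sk t)" unfolding sk_def using m2 by blast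
  moreover have "{k\<in>LU U. k \<noteq> m \<and> k \<inter> m \<noteq> {0}} \<inter> (\<Union>t\<in>LU ?S. sk t) = {}" unfolding sk_def by blast
  moreover have fu: "finite (\<Union>t\<in>LU ?S. sk t)" using fsk fin_LU by blast
  ultimately have "card (insert m ({k\<in>LU U. k \<noteq> m \<and> k \<inter> m \<noteq> {0}} \<union> (\<Union>t\<in>LU ?S. sk t)))
     = 1 + (q * card (fpl U m) + card (\<Union>t\<in>LU ?S. sk t))"
    using meet_card[OF sd_subspace[OF U(1)] m(1)] fin_LU by (simp add: card_Un_disjoint)
  then show ?thesis using card_mono[OF fin_LU sub] c by linarith
qed

lemma line_two_full:
  assumes m: "m \<in> L" and x: "x \<in> m" "y \<in> m" "x \<noteq> 0" "y \<noteq> 0" "y \<notin> vs.span {x}" "Pi x \<subseteq> U" "Pi y \<subseteq> U"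
  shows "1 \<le> card (fpl U m) choose 2"
proof -
  have "vs.span {x} \<noteq> vs.span {y}" using x(5) vs.span_base[of y "{y}"] by blast
  moreover have "{vs.span {x}, vs.span {y}} \<subseteq> fpl U m" using fpl_iff[OF m] x by blast
  then have "card {vs.span {x}, vs.span {y}} \<le> card (fpl U m)" by (rule card_mono[OF fin_fpl[OF m]])
  ultimately have "2 \<le> card (fpl U m)" by simp
  then show ?thesis using binomial_eq_0_iff[of "card (fpl U m)" 2] by linarith
qed

lemma indep_sym: "x \<noteq> 0 \<Longrightarrow> y \<noteq> 0 \<Longrightarrow> y \<notin> vs.span {x} \<Longrightarrow> x \<notin> vs.span {y :: nat \<Rightarrow> 'a}"
  using span1_sym[of x y] by blast

text \<open>All five vertices are full in the span U of the pentagon, and U has vector dimension 5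
  because no solid has three full points. A third line on u is skew to \<open>Pi x\<close> and
  \<open>Pi y\<close> and yields the lower bound for the number of lines in U. The five sides, with
  two full points each, contribute at least 5 pairs to \<open>solid_inequality\<close>;
  \<open>pentagon_arith\<close> finishes.\<close>

lemma no_pentagon:
  assumes x: "x \<in> P" and y: "y \<in> Pi x" "y \<notin> vs.span {x}" and w: "w \<in> Pi x" "w \<notin> vs.span {x,y}"
    and z: "z \<in> Pi y" "z \<notin> Pi x" and u: "u \<in> Pi w" "u \<notin> Pi x" "u \<in> Pi z"
  shows False
proof -
  note sdx = Pi_sd[OF x]
  have x0: "x \<noteq> 0" using P_nz[OF x] .
  have y0: "y \<noteq> 0" and w0: "w \<noteq> 0" using y(2) w(2) vs.span_zero by metis+
  have z0: "z \<noteq> 0" and u0: "u \<noteq> 0" using z(2) u(2) sd_zero[OF sdx] by metis+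
  have yP: "y \<in> P" and wP: "w \<in> P" using adj_P y w y0 w0 by blast+
  have zP: "z \<in> P" and uP: "u \<in> P" using adj_P z u z0 u0 by blast+
  have wx: "w \<notin> vs.span {x}" using w(2) vs.span_mono[of "{x}" "{x,y}"] by blast
  have wy: "w \<notin> vs.span {y}" using w(2) vs.span_mono[of "{y}" "{x,y}"] by blast
  have zx: "z \<notin> vs.span {x}" "z \<notin> vs.span {y}" "z \<notin> vs.span {w}"
    using z(2) sd_span_mem[OF sdx Pi_self[OF x]] sd_span_mem[OF sdx y(1)] sd_span_mem[OF sdx w(1)] by blast+
  have ux: "u \<notin> vs.span {x}" "u \<notin> vs.span {y}" "u \<notin> vs.span {w}"
    using u(2) sd_span_mem[OF sdx Pi_self[OF x]] sd_span_mem[OF sdx y(1)] sd_span_mem[OF sdx w(1)] by blast+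
  have uy: "u \<notin> Pi y"
  proof
    assume "u \<in> Pi y"
    then have "y \<in> Pi u" "w \<in> Pi u" using u adj_sym by blast+
    then show False using no_quad[OF x uP u(2) y(1) _ y0 w(1)] wy by blast
  qed
  have uz: "u \<notin> vs.span {z}"
  proof
    assume "u \<in> vs.span {z}"
    then have "u \<in> Pi y" using sd_span_mem[OF Pi_sd[OF yP] z(1)] by blast
    then show False using uy by blast
  qed
  have lxy: "vs.span {x,y} \<in> L" using adj_line[OF x y] .
  have lxw: "vs.span {x,w} \<in> L" using adj_line[OF x w(1) wx] .
  have lyz: "vs.span {y,z} \<in> L" using adj_line[OF yP z(1) zx(2)] .
  have lwu: "vs.span {w,u} \<in> L" using adj_line[OF wP u(1) ux(3)] .
  have lzu: "vs.span {z,u} \<in> L" using adj_line[OF zP u(3) uz] .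
  let ?B = "{x,y,z,u,w}"
  let ?U = "vs.span ?B"
  have m: "x \<in> ?U" "y \<in> ?U" "z \<in> ?U" "u \<in> ?U" "w \<in> ?U" by (simp_all add: vs.span_base)
  have sU: "vs.subspace ?U" by (rule vs.subspace_span)
  have lU: "vs.span {x,y} \<subseteq> ?U" "vs.span {x,w} \<subseteq> ?U" "vs.span {y,z} \<subseteq> ?U" "vs.span {w,u} \<subseteq> ?U" "vs.span {z,u} \<subseteq> ?U"
    by (rule vs.span_mono; blast)+
  have in2: "a \<in> vs.span {a,b}" "b \<in> vs.span {a,b}" for a b :: "nat \<Rightarrow> 'a" by (simp_all add: vs.span_base)
  have notin_xy: "z \<notin> vs.span {x,y}" "u \<notin> vs.span {x,y}" "u \<notin> vs.span {x,w}" "z \<notin> vs.span {x,w}"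
    using z(2) u(2) line_sub_Pi[OF lxy in2(1)] line_sub_Pi[OF lxw in2(1)] by blast+
  have u_yz: "u \<notin> vs.span {y,z}" using uy line_sub_Pi[OF lyz in2(1)] by blast
  have n1: "vs.span {x,y} \<noteq> vs.span {x,w}" using w(2) in2 by metis
  have n2: "vs.span {x,y} \<noteq> vs.span {y,z}" using notin_xy in2 by metis
  have n3: "vs.span {x,y} \<noteq> vs.span {w,u}" using notin_xy in2 by metis
  have n4: "vs.span {x,y} \<noteq> vs.span {z,u}" using notin_xy in2 by metis
  have n5: "vs.span {x,w} \<noteq> vs.span {y,z}" using notin_xy in2 by metis
  have n6: "vs.span {x,w} \<noteq> vs.span {w,u}" using notin_xy in2 by metis
  have n7: "vs.span {x,w} \<noteq> vs.span {z,u}" using notin_xy in2 by metis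
  have n8: "vs.span {y,z} \<noteq> vs.span {w,u}" using u_yz in2 by metis
  have n9: "vs.span {y,z} \<noteq> vs.span {z,u}" using u_yz in2 by metis
  have n10: "vs.span {w,u} \<noteq> vs.span {z,u}"
  proof
    assume a: "vs.span {w,u} = vs.span {z,u}"
    then have "w \<in> vs.span {z,u}" using in2 by metis
    then have "w \<in> Pi z" using line_sub_Pi[OF lzu in2(1)] by blast
    then show False using no_quad[OF x zP z(2) y(1) _ y0 w(1)] wy z adj_sym by blast
  qed
  have px: "Pi x \<subseteq> ?U" using Pi_le[OF sU lxy lxw n1 in2(1) in2(1) x0 lU(1,2)] .
  have py: "Pi y \<subseteq> ?U" using Pi_le[OF sU lxy lyz n2 in2(2) in2(1) y0 lU(1,3)] .
  have pw: "Pi w \<subseteq> ?U" using Pi_le[OF sU lxw lwu n6 in2(2) in2(1) w0 lU(2,4)] .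
  have pz: "Pi z \<subseteq> ?U" using Pi_le[OF sU lyz lzu n9 in2(2) in2(1) z0 lU(3,5)] .
  have pu: "Pi u \<subseteq> ?U" using Pi_le[OF sU lwu lzu n10 in2(2) in2(2) u0 lU(4,5)] .
  have UV: "?U \<subseteq> V" using vs.span_minimal[OF _ V(1)] P_V x yP zP uP wP by simp
  obtain d where d: "d \<le> card ?B" "sd d ?U" using sd_span_card[of ?B] by auto
  have "card ?B \<le> 5" by (simp add: card_insert_if)
  then have d5: "d \<le> 5" using d by simp
  have S4: "sd 4 (ssum (Pi x) (Pi y))" using Pi_int_adj(2)[OF x y] .
  have SU: "ssum (Pi x) (Pi y) \<subseteq> ?U" using ssum_le[OF sU px py] .
  have "4 \<le> d" using sd_mono[OF S4 d(2) SU] .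
  moreover have "d \<noteq> 4" using pencils3[OF _ UV x yP zP px py pz y(2) zx(1,2)] d(2) by blast
  ultimately have "d = 5" using d5 by simp
  then have U: "sd 5 ?U" using d(2) by simp
  \<comment> \<open>At least three lines pass through u, and only two of them are sides of the
    pentagon.\<close>
  obtain mm where mm: "mm \<in> L" "u \<in> mm" "mm \<noteq> vs.span {w,u}" "mm \<noteq> vs.span {z,u}"
  proof -
    have "card {vs.span {w,u}, vs.span {z,u}} \<le> 2" by (simp add: card_insert_if)
    then have "\<not> {k\<in>L. u \<in> k} \<subseteq> {vs.span {w,u}, vs.span {z,u}}"
      using card_mono[of "{vs.span {w,u}, vs.span {z,u}}" "{k\<in>L. u \<in> k}"] lines_card[OF uP] q2 by fastforce
    then show thesis using that by blast
  qed
  have mPu: "mm \<subseteq> Pi u" using line_sub_Pi[OF mm(1,2)] .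
  have mU: "mm \<in> LU ?U" unfolding LU_def using mm mPu pu by blast
  have m0: "0 \<in> mm" "0 \<in> Pi x" "0 \<in> Pi y" using sd_zero L_sd mm Pi_sd x yP by blast+
  have mx: "mm \<inter> Pi x = {0}"
  proof -
    have "p = 0" if p: "p \<in> mm" "p \<in> Pi x" for p
    proof (rule ccontr)
      assume p0: "p \<noteq> 0"
      have "p \<in> vs.span {w}" using no_quad[OF x uP u(2) w(1) _ w0 p(2)] p mPu u adj_sym by blast
      then have "w \<in> mm" using span1_sym[OF p0] sd_span_mem[OF L_sd[OF mm(1)] p(1)] by blast
      then have "mm = vs.span {w,u}" using line_eq[OF mm(1) lwu _ in2(1) mm(2) in2(2) w0 ux(3)] by blast
      then show False using mm by blast
    qed
    then show ?thesis using m0 by blast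
  qed
  have my: "mm \<inter> Pi y = {0}"
  proof -
    have "p = 0" if p: "p \<in> mm" "p \<in> Pi y" for p
    proof (rule ccontr)
      assume p0: "p \<noteq> 0"
      have "p \<in> vs.span {z}" using no_quad[OF yP uP uy z(1) _ z0 p(2)] p mPu u adj_sym by blast
      then have "z \<in> mm" using span1_sym[OF p0] sd_span_mem[OF L_sd[OF mm(1)] p(1)] by blast
      then have "mm = vs.span {z,u}" using line_eq[OF mm(1) lzu _ in2(1) mm(2) in2(2) z0 uz] by blast
      then show False using mm by blast
    qed
    then show ?thesis using m0 by blast
  qed
  have "vs.span {u} \<in> fpl ?U mm" using fpl_iff[OF mm(1)] mm(2) u0 pu by blast
  then have f1: "1 \<le> card (fpl ?U mm)" using card_mono[OF fin_fpl[OF mm(1), of ?U], of "{vs.span {u}}"] by simp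
  have lb: "1 + q * card (fpl ?U mm) + q * (2 * q + 1) \<le> card (LU ?U)"
    using lower_bound[OF U UV x y px py mU mx my] .
  have "q * 1 \<le> q * card (fpl ?U mm)" using f1 by (rule mult_left_mono) simp
  moreover have "2*q^2 + 2*q + 1 = 1 + q * 1 + q * (2 * q + 1)" by (simp add: power2_eq_square algebra_simps)
  ultimately have lb: "2*q^2 + 2*q + 1 \<le> card (LU ?U)" using lb by linarith
  let ?Ls = "{vs.span {x,y}, vs.span {x,w}, vs.span {y,z}, vs.span {w,u}, vs.span {z,u}}"
  have c5: "card ?Ls = 5" using n1 n2 n3 n4 n5 n6 n7 n8 n9 n10 by (simp add: card_insert_if)
  have LsU: "?Ls \<subseteq> LU ?U" unfolding LU_def using lxy lxw lyz lwu lzu lU by blast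
  have "1 \<le> card (fpl ?U m) choose 2" if "m \<in> ?Ls" for m
    using that line_two_full[OF lxy in2 x0 y0 y(2) px py] line_two_full[OF lxw in2 x0 w0 wx px pw]
      line_two_full[OF lyz in2 y0 z0 zx(2) py pz] line_two_full[OF lwu in2 w0 u0 ux(3) pw pu] line_two_full[OF lzu in2 z0 u0 uz pz pu] by blast
  then have "(\<Sum>m\<in>?Ls. 1) \<le> (\<Sum>m\<in>?Ls. card (fpl ?U m) choose 2)" by (rule sum_mono)
  also have "\<dots> \<le> (\<Sum>m\<in>LU ?U. card (fpl ?U m) choose 2)" by (rule sum_mono2[OF fin_LU LsU]) simp
  finally have e5: "5 \<le> (\<Sum>m\<in>LU ?U. card (fpl ?U m) choose 2)" using c5 by simp
  have "int 5 \<le> int (\<Sum>m\<in>LU ?U. card (fpl ?U m) choose 2)" using e5 by (simp only: of_nat_le_iff)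
  then have "int q ^ 2 * 5 \<le> int q^2 * int (\<Sum>m\<in>LU ?U. card (fpl ?U m) choose 2)"
    by (intro mult_left_mono) simp_all
  then have F: "5 * int q^2 \<le> int (card (LU ?U))^2 - int (card (LU ?U))*(int q^3+int q^2+2*int q+2) + (int q^5+2*int q^4+2*int q^3+2*int q^2+2*int q+1)"
    using solid_inequality[OF U UV] by linarith
  have ub: "card (LU ?U) \<le> q^3 - q^2 + 4*q" using F4[OF U UV] unfolding LU_def .
  have "q^2 \<le> q^3" using q2 by (intro power_increasing) auto
  then have ub': "int (card (LU ?U)) \<le> int q^3 - int q^2 + 4 * int q"
    using ub by (metis (mono_tags, lifting) of_nat_add of_nat_diff of_nat_le_iff of_nat_mult of_nat_numeral of_nat_power)
  have lb': "2 * int q^2 + 2 * int q + 1 \<le> int (card (LU ?U))" using lb by (simp flip: of_nat_power of_nat_mult of_nat_add)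
  have "card (LU ?U) \<ge> 1" using lb by simp
  then have dv: "int q dvd int (card (LU ?U)) - 1" using LU_mod[OF U UV mU] by (metis of_nat_1 of_nat_diff of_nat_dvd_iff)
  show False using pentagon_arith[OF _ lb' ub' dv F] q2 by simp
qed

end

section \<open>The generalized hexagon property\<close>

context line_geom begin

lemma sd1_iff: "sd 1 T \<longleftrightarrow> (\<exists>x. x \<noteq> 0 \<and> T = vs.span {x})" for T :: "(nat \<Rightarrow> 'a) set"
proof
  assume T: "sd 1 T"
  then obtain x where x: "x \<in> T" "x \<noteq> 0" using sd_nz[OF T] by auto
  have "vs.span {x} = T" using sd_eq[OF sd_span1[OF x(2)] T sd_span_mem[OF T x(1)]] by simp
  then show "\<exists>x. x \<noteq> 0 \<and> T = vs.span {x}" using x by blast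
qed (use sd_span1 in blast)

definition pts :: "(nat \<Rightarrow> 'a) set \<Rightarrow> (nat \<Rightarrow> 'a) set set" where "pts l = {T. sd 1 T \<and> T \<subseteq> l}"

lemma pts_card: "sd 2 l \<Longrightarrow> card (pts l) = q + 1"
proof -
  assume l: "sd 2 l"
  have "pts l = {T. sd 1 T \<and> {0} \<subseteq> T \<and> T \<subseteq> l}" unfolding pts_def using sd_zero by blast
  then show ?thesis using card_hyperplanes[of 0 "{0}" 1 l] l sd_0_iff[of "{0::nat\<Rightarrow>'a}"] sd_zero[OF l]
    unfolding q_def by (simp add: numeral_2_eq_2)
qed

lemma fin_pts: "finite l \<Longrightarrow> finite (pts l)"
  by (rule finite_subset[of _ "Pow l"]) (auto simp: pts_def)

lemma fpl_V: "l \<in> L \<Longrightarrow> fpl V l = pts l"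
proof (intro set_eqI)
  fix p assume l: "l \<in> L"
  show "p \<in> fpl V l \<longleftrightarrow> p \<in> pts l"
    unfolding fpl_iff[OF l] pts_def sd1_iff mem_Collect_eq
    using Pi_V vs.span_base[of _ "{_}"] sd_span_mem[OF L_sd[OF l]] by (metis insertI1 subset_iff)
qed

lemma LU_V: "LU V = L" unfolding LU_def using L_V by blast

text \<open>When l is closest to a base point at its point p, these are the lines one step further
  away from the base point.\<close>

definition child where "child l p = {k\<in>L. k \<noteq> l \<and> k \<inter> l \<noteq> {0} \<and> p \<notin> k}"

lemma child_card:
  assumes l: "l \<in> L" "p \<in> l" "p \<noteq> 0" shows "card (child l p) = q^2"
proof -
  let ?M = "{k\<in>L. k \<noteq> l \<and> k \<inter> l \<noteq> {0}}"
  have M: "card ?M = q * (q + 1)"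
    using meet_card[OF V(1), of l] l by (simp add: LU_V fpl_V pts_card[OF L_sd])
  have e: "child l p = ?M - ({k\<in>L. p \<in> k} - {l})" unfolding child_def by blast
  have s: "{k\<in>L. p \<in> k} - {l} \<subseteq> ?M" using l by auto
  have "card ({k\<in>L. p \<in> k} - {l}) = q" using lines_card[OF P_I[OF l]] l by simp
  then have "card (child l p) = q * (q + 1) - q"
    unfolding e using card_Diff_subset[OF _ s] fin_L M by simp
  then show ?thesis by (simp add: power2_eq_square)
qed

text \<open>Two independent common points would put k into the plane \<open>Pi x\<close> and hence
  through x.\<close>

lemma line_Pi_int:
  assumes x: "x \<in> P" and k: "k \<in> L" "x \<notin> k" "p \<in> k" "p \<in> Pi x" "p \<noteq> 0" "r \<in> k" "r \<in> Pi x"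
  shows "r \<in> vs.span {p}"
proof (rule ccontr)
  assume n: "r \<notin> vs.span {p}"
  have "k = vs.span {p,r}" using sd_line_span[OF L_sd[OF k(1)] k(3,6,5) n] .
  also have "\<dots> \<subseteq> Pi x" using sd_span_le[OF Pi_sd[OF x]] k by simp
  finally show False using Pi_lines[OF x] k by blast
qed

end

section \<open>The lines sorted by their distance from a point\<close>

context flat_lines begin

lemma child_disj0:
  assumes x: "x \<in> P" and l: "l \<in> L" "l' \<in> L" "x \<in> l" "x \<in> l'" "l \<noteq> l'"
  shows "child l x \<inter> child l' x = {}"
proof (rule ccontr)
  assume "child l x \<inter> child l' x \<noteq> {}"
  then obtain k where k: "k \<in> L" "k \<inter> l \<noteq> {0}" "k \<inter> l' \<noteq> {0}" "x \<notin> k" unfolding child_def by blast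
  obtain a where a: "a \<in> k" "a \<in> l" "a \<noteq> 0" using int_zero k l by blast
  obtain b where b: "b \<in> k" "b \<in> l'" "b \<noteq> 0" using int_zero k l by blast
  have "a \<in> vs.span {b}"
    using line_Pi_int[OF x k(1,4) b(1) _ b(3) a(1)] line_sub_Pi l a b by blast
  then have "a \<in> l'" using sd_span_mem[OF L_sd[OF l(2)] b(2)] by blast
  then have "a \<in> vs.span {x}" using line_int(1)[OF l(1,2,5,3,4) P_nz[OF x]] a by blast
  then have "x \<in> vs.span {a}" using span1_sym a by blast
  then show False using sd_span_mem[OF L_sd[OF k(1)] a(1)] k by blast
qed

lemma child_far:
  assumes x: "x \<in> P" and k: "k \<in> L" "x \<notin> k" "p \<in> k" "p \<in> Pi x" "p \<noteq> 0" and j: "j \<in> child k p"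
  shows "j \<inter> Pi x = {0}" "\<exists>w. w \<in> j \<and> w \<in> k \<and> w \<noteq> 0 \<and> w \<notin> Pi x"
proof -
  have jL: "j \<in> L" "j \<noteq> k" "p \<notin> j" using j unfolding child_def by auto
  obtain w where w: "w \<in> j" "w \<in> k" "w \<noteq> 0" using j int_zero k unfolding child_def by blast
  have wx: "w \<notin> Pi x"
  proof
    assume "w \<in> Pi x"
    then have "w \<in> vs.span {p}" using line_Pi_int[OF x k w(2)] by blast
    then have "p \<in> vs.span {w}" using span1_sym w by blast
    then show False using sd_span_mem[OF L_sd[OF jL(1)] w(1)] jL by blast
  qed
  then show "\<exists>w. w \<in> j \<and> w \<in> k \<and> w \<noteq> 0 \<and> w \<notin> Pi x" using w by blast
  have wP: "w \<in> P" using P_I k w by blast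
  have "r = 0" if r: "r \<in> j" "r \<in> Pi x" for r
  proof (rule ccontr)
    assume r0: "r \<noteq> 0"
    have "p \<in> Pi w" "r \<in> Pi w" using line_sub_Pi[OF k(1) w(2)] line_sub_Pi[OF jL(1) w(1)] k r by blast+
    then have "r \<in> vs.span {p}" using no_quad[OF x wP wx k(4) _ k(5) r(2)] by blast
    then have "p \<in> vs.span {r}" using span1_sym r0 by blast
    then show False using sd_span_mem[OF L_sd[OF jL(1)] r(1)] jL by blast
  qed
  then show "j \<inter> Pi x = {0}" using sd_zero[OF L_sd[OF jL(1)]] sd_zero[OF Pi_sd[OF x]] by blast
qed

text \<open>A common child j closes the circuit x, p, w, w', p', where w and w' are the points of j
  on k and k'. If w and w' coincide, or p and p' are collinear, this is a quadrangle; otherwise it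
  is a pentagon.\<close>

lemma child_disj1:
  assumes x: "x \<in> P" and k: "k \<in> L" "x \<notin> k" "p \<in> k" "p \<in> Pi x" "p \<noteq> 0"
    and k': "k' \<in> L" "x \<notin> k'" "p' \<in> k'" "p' \<in> Pi x" "p' \<noteq> 0" and ne: "k \<noteq> k'"
  shows "child k p \<inter> child k' p' = {}"
proof (rule ccontr)
  assume "child k p \<inter> child k' p' \<noteq> {}"
  then obtain j where j: "j \<in> child k p" "j \<in> child k' p'" by blast
  have jL: "j \<in> L" "j \<noteq> k" "j \<noteq> k'" using j unfolding child_def by auto
  obtain w where w: "w \<in> j" "w \<in> k" "w \<noteq> 0" "w \<notin> Pi x" using child_far(2)[OF x k j(1)] by blast
  obtain w' where w': "w' \<in> j" "w' \<in> k'" "w' \<noteq> 0" "w' \<notin> Pi x" using child_far(2)[OF x k' j(2)] by blast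
  have wP: "w \<in> P" "w' \<in> P" using P_I k k' w w' by blast+
  have pP: "p \<in> P" "p' \<in> P" using P_I k k' by blast+
  have pw: "p \<in> Pi w" "p' \<in> Pi w'" "w' \<in> Pi w" using line_sub_Pi[OF k(1) w(2)] line_sub_Pi[OF k'(1) w'(2)] line_sub_Pi[OF jL(1) w(1)] k k' w' by blast+
  have npw: "w \<notin> vs.span {p}" using w(4) sd_span_mem[OF Pi_sd[OF x] k(4)] by blast
  have npw': "w' \<notin> vs.span {p'}" using w'(4) sd_span_mem[OF Pi_sd[OF x] k'(4)] by blast
  show False
  proof (cases "w' \<in> vs.span {w}")
    case True
    then have wk: "w \<in> k'" using span1_sym[OF w'(3)] sd_span_mem[OF L_sd[OF k'(1)] w'(2)] by blast
    then have "p' \<in> Pi w" using line_sub_Pi[OF k'(1)] k' by blast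
    then have "p' \<in> vs.span {p}" using no_quad[OF x wP(1) w(4) k(4) pw(1) k(5) k'(4)] by blast
    then have "p' \<in> k" using sd_span_mem[OF L_sd[OF k(1)] k(3)] by blast
    moreover have "w \<notin> vs.span {p'}" using w(4) sd_span_mem[OF Pi_sd[OF x] k'(4)] by blast
    ultimately show False using line_eq[OF k(1) k'(1) _ k'(3) w(2) wk k'(5)] ne by blast
  next
    case False
    have je: "j = vs.span {w,w'}" using sd_line_span[OF L_sd[OF jL(1)] w(1) w'(1) w(3) False] .
    have tri: "w' \<notin> Pi p"
    proof
      assume a: "w' \<in> Pi p"
      have "w \<in> Pi p" using pw adj_sym by blast
      then have "w' \<in> vs.span {p,w}" using no_triangle[OF pP(1) _ npw a pw(3)] by blast
      also have "vs.span {p,w} \<subseteq> k" using sd_span_le[OF L_sd[OF k(1)]] k w by simp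
      finally have "j \<subseteq> k" unfolding je using sd_span_le[OF L_sd[OF k(1)]] w by simp
      then show False using line_sub_eq jL k by blast
    qed
    show False
    proof (cases "p' \<in> vs.span {x,p}")
      case True
      show False
      proof (cases "p \<in> vs.span {x}")
        case True2: True
        then have "x \<in> vs.span {p}" using span1_sym k(5) by blast
        then show False using sd_span_mem[OF L_sd[OF k(1)] k(3)] k(2) by blast
      next
        case False2: False
        have "vs.span {x,p} \<in> L" using adj_line[OF x k(4) False2] .
        then have "p' \<in> Pi p" using True line_sub_Pi[of "vs.span {x,p}" p] vs.span_base[of p "{x,p}"] by blast
        moreover have "p' \<in> Pi w'" "w \<in> Pi w'" "w \<in> Pi p" using pw adj_sym by blast+
        ultimately have "w \<in> vs.span {p'}" using no_quad[OF pP(1) wP(2) tri _ _ k'(5)] by blast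
        then show False using sd_span_mem[OF Pi_sd[OF x] k'(4)] w by blast
      qed
    next
      case False2: False
      have px: "p \<notin> vs.span {x}"
      proof
        assume "p \<in> vs.span {x}"
        then have "x \<in> vs.span {p}" using span1_sym k(5) by blast
        then show False using sd_span_mem[OF L_sd[OF k(1)] k(3)] k(2) by blast
      qed
      show False using no_pentagon[OF x k(4) px k'(4) False2 _ w(4) _ w'(4) pw(3)] pw adj_sym by blast
    qed
  qed
qed

text \<open>Distance at most two in the collinearity graph, since v may coincide with one of the two
  points. Its negation is opposition.\<close>

definition near where "near x w \<longleftrightarrow> (\<exists>v. v \<noteq> 0 \<and> v \<in> Pi x \<and> v \<in> Pi w)"

lemma near_sym: "near x y \<longleftrightarrow> near y x" unfolding near_def by blast

lemma near_span: "near x y \<Longrightarrow> y \<noteq> 0 \<Longrightarrow> z \<noteq> 0 \<Longrightarrow> z \<in> vs.span {y} \<Longrightarrow> near x z"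
  unfolding near_def using Pi_scale by blast

lemma adj_near: "x \<in> P \<Longrightarrow> y \<in> Pi x \<Longrightarrow> near x y"
  unfolding near_def using adj_sym Pi_self P_nz by blast

lemma theta5: "(q + 1) + (q + 1) * q^2 + (q + 1) * q^2 * q^2 = q^5 + q^4 + q^3 + q^2 + q + 1"
  by (simp add: algebra_simps eval_nat_numeral)

text \<open>The pencil of x and two generations of children are pairwise disjoint and number (q +
  1)(1 + q^2 + q^4), which is the bound in (To). So they exhaust \<open>L\<close>, and each line has
  a point near x.\<close>

lemma layers:
  assumes x: "x \<in> P" shows "card L = q^5 + q^4 + q^3 + q^2 + q + 1" "m \<in> L \<Longrightarrow> \<exists>w\<in>m. w \<noteq> 0 \<and> near x w"
proof -
  note x0 = P_nz[OF x]
  let ?A0 = "{l\<in>L. x \<in> l}"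
  define A1 where "A1 = (\<Union>l\<in>?A0. child l x)"
  define p where "p k = (SOME p. p \<in> k \<and> p \<in> Pi x \<and> p \<noteq> 0)" for k
  define A2 where "A2 = (\<Union>k\<in>A1. child k (p k))"
  have fc: "finite (child l r)" for l r unfolding child_def using fin_L by simp
  have A1: "k \<in> L" "x \<notin> k" "p k \<in> k" "p k \<in> Pi x" "p k \<noteq> 0" if k: "k \<in> A1" for k
  proof -
    obtain l where l: "l \<in> L" "x \<in> l" "k \<in> child l x" using k unfolding A1_def by blast
    then show kL: "k \<in> L" "x \<notin> k" unfolding child_def by auto
    have "k \<inter> l \<noteq> {0}" using l unfolding child_def by blast
    then obtain r where "r \<in> k" "r \<in> l" "r \<noteq> 0" using int_zero kL l by blast
    then have "\<exists>p. p \<in> k \<and> p \<in> Pi x \<and> p \<noteq> 0" using line_sub_Pi l by blast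
    from someI_ex[OF this] show "p k \<in> k" "p k \<in> Pi x" "p k \<noteq> 0" unfolding p_def by blast+
  qed
  have c1: "card A1 = (q + 1) * q^2"
  proof -
    have "card A1 = (\<Sum>l\<in>?A0. card (child l x))" unfolding A1_def
      by (rule card_UN_disjoint) (use child_disj0[OF x] fc fin_L in auto)
    also have "\<dots> = (q + 1) * q^2" using child_card x0 lines_card[OF x] by simp
    finally show ?thesis .
  qed
  have f1: "finite A1" unfolding A1_def using fc fin_L by simp
  have c2: "card A2 = (q + 1) * q^2 * q^2"
  proof -
    have "card A2 = (\<Sum>k\<in>A1. card (child k (p k)))" unfolding A2_def
    proof (rule card_UN_disjoint)
      show "\<forall>i\<in>A1. \<forall>j\<in>A1. i \<noteq> j \<longrightarrow> child i (p i) \<inter> child j (p j) = {}"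
        using child_disj1[OF x A1 A1] by simp
    qed (use fc f1 in auto)
    also have "\<dots> = (q + 1) * q^2 * q^2" using child_card A1 c1 by simp
    finally show ?thesis .
  qed
  have f2: "finite A2" unfolding A2_def using fc f1 by simp
  have d01: "?A0 \<inter> A1 = {}" using A1 by blast
  have d2: "(?A0 \<union> A1) \<inter> A2 = {}"
  proof (rule ccontr)
    assume "(?A0 \<union> A1) \<inter> A2 \<noteq> {}"
    then obtain j where j: "j \<in> ?A0 \<union> A1" "j \<in> A2" by blast
    then obtain k where k: "k \<in> A1" "j \<in> child k (p k)" unfolding A2_def by blast
    have "j \<inter> Pi x = {0}" using child_far(1)[OF x A1[OF k(1)] k(2)] .
    then show False using j(1) A1[of j] x0 Pi_self[OF x] by blast
  qed
  have c: "card (?A0 \<union> A1 \<union> A2) = q^5 + q^4 + q^3 + q^2 + q + 1"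
    using card_Un_disjoint[OF fin_sub f1 d01] card_Un_disjoint[OF _ f2 d2] c1 c2 lines_card[OF x] fin_L f1 theta5 by simp
  have sub: "?A0 \<union> A1 \<union> A2 \<subseteq> L" unfolding A2_def child_def using A1 by blast
  have eq: "?A0 \<union> A1 \<union> A2 = L" using card_seteq[OF fin_L sub] c To by simp
  then show "card L = q^5 + q^4 + q^3 + q^2 + q + 1" using c by simp
  assume "m \<in> L"
  then consider "m \<in> ?A0" | "m \<in> A1" | "m \<in> A2" using eq by blast
  then show "\<exists>w\<in>m. w \<noteq> 0 \<and> near x w"
  proof cases
    case 1
    then show ?thesis using x0 adj_near[OF x Pi_self[OF x]] by blast
  next
    case 2
    then show ?thesis using A1[OF 2] adj_near[OF x] by blast
  next
    case 3
    then obtain k where k: "k \<in> A1" "m \<in> child k (p k)" unfolding A2_def by blast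
    note kk = A1[OF k(1)]
    obtain w where w: "w \<in> m" "w \<in> k" "w \<noteq> 0" using child_far(2)[OF x kk k(2)] by blast
    have "p k \<in> Pi w" using line_sub_Pi[OF kk(1) w(2)] kk by blast
    then show ?thesis using kk w unfolding near_def by blast
  qed
qed

lemma hexagon_proj: "x \<in> P \<Longrightarrow> m \<in> L \<Longrightarrow> \<exists>w\<in>m. w \<noteq> 0 \<and> near x w"
  by (rule layers(2))

lemma adj_trans_sub: "v \<in> P \<Longrightarrow> w \<in> Pi v \<Longrightarrow> w \<notin> vs.span {v} \<Longrightarrow> vs.subspace U \<Longrightarrow> v \<in> U \<Longrightarrow> w \<in> U \<Longrightarrow>
   vs.span {v,w} \<in> L \<and> vs.span {v,w} \<subseteq> U"
  using adj_line vs.span_minimal[of "{v,w}" U] by blast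

text \<open>A point on two different lines inside U is full. The path from x to m provided by
  \<open>hexagon_proj\<close> runs inside U, so its points v and w are full.\<close>

lemma proj_full:
  assumes U: "vs.subspace U" and x: "x \<in> P" "Pi x \<subseteq> U" and m: "m \<in> L" "m \<subseteq> U"
  shows "\<exists>w v. w \<in> m \<and> w \<noteq> 0 \<and> Pi w \<subseteq> U \<and> v \<noteq> 0 \<and> v \<in> Pi x \<and> v \<in> Pi w \<and> Pi v \<subseteq> U"
proof -
  note x0 = P_nz[OF x(1)]
  have in2: "a \<in> vs.span {a,b}" "b \<in> vs.span {a,b}" for a b :: "nat \<Rightarrow> 'a" by (simp_all add: vs.span_base)
  consider "x \<in> m" | "x \<notin> m" "\<exists>p. p \<in> m \<and> p \<in> Pi x \<and> p \<noteq> 0" | "x \<notin> m" "\<forall>p. p \<in> m \<longrightarrow> p \<in> Pi x \<longrightarrow> p = 0" by blast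
  then show ?thesis
  proof cases
    case 1
    then show ?thesis using x x0 Pi_self by blast
  next
    case 2
    then obtain p where p: "p \<in> m" "p \<in> Pi x" "p \<noteq> 0" by blast
    have "p \<notin> vs.span {x}" using span1_sym[OF p(3)] sd_span_mem[OF L_sd[OF m(1)] p(1)] 2 by blast
    then have l: "vs.span {x,p} \<in> L" using adj_line x p by blast
    have "vs.span {x,p} \<subseteq> U" using line_sub_Pi[OF l in2(1)] x by blast
    moreover have "vs.span {x,p} \<noteq> m" using 2 in2 by blast
    ultimately have "Pi p \<subseteq> U" using Pi_le[OF U l m(1) _ in2(2) p(1,3) _ m(2)] by blast
    moreover have "p \<in> Pi p" using Pi_self[OF P_I[OF m(1) p(1,3)]] .
    ultimately show ?thesis using p by blast
  next
    case 3
    obtain w v where w: "w \<in> m" "w \<noteq> 0" and v: "v \<noteq> 0" "v \<in> Pi x" "v \<in> Pi w"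
      using hexagon_proj[OF x(1) m(1)] unfolding near_def by blast
    have wx: "w \<notin> Pi x" using 3 w by blast
    have vm: "v \<notin> m" using 3 v by blast
    have vP: "v \<in> P" using adj_P v by blast
    have wv: "w \<in> Pi v" using v adj_sym by blast
    have nwv: "w \<notin> vs.span {v}" using wx sd_span_mem[OF Pi_sd[OF x(1)] v(2)] by blast
    have nvx: "v \<notin> vs.span {x}"
    proof
      assume "v \<in> vs.span {x}"
      then have "Pi v = Pi x" using Pi_scale x0 v by blast
      then show False using wv wx by blast
    qed
    have l: "vs.span {v,w} \<in> L" "vs.span {v,w} \<subseteq> U" using adj_trans_sub[OF vP wv nwv U] v x m w by blast+
    have l2: "vs.span {x,v} \<in> L" using adj_line[OF x(1) v(2) nvx] .
    have l2U: "vs.span {x,v} \<subseteq> U" using line_sub_Pi[OF l2 in2(1)] x by blast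
    have ne: "vs.span {v,w} \<noteq> m" using vm in2 by blast
    have ne2: "vs.span {v,w} \<noteq> vs.span {x,v}" using wx line_sub_Pi[OF l2 in2(1)] in2(2)[of w v] by blast
    have "Pi w \<subseteq> U" using Pi_le[OF U l(1) m(1) ne in2(2) w l(2) m(2)] .
    moreover have "Pi v \<subseteq> U" using Pi_le[OF U l(1) l2 ne2 in2(1) in2(2) v(1) l(2) l2U] .
    ultimately show ?thesis using w v by blast
  qed
qed

text \<open>Two full points of a 4-space at distance 3 would generate a subhexagon with two points per line, which has
  too many lines for a 4-space.\<close>
lemma no_full_opp:
  assumes U: "sd 5 U" "U \<subseteq> V" and x: "x \<in> P" "x' \<in> P" "Pi x \<subseteq> U" "Pi x' \<subseteq> U"
  shows "near x x'"
proof (rule ccontr)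
  assume nn: "\<not> near x x'"
  note sU = sd_subspace[OF U(1)]
  have in2: "a \<in> vs.span {a,b}" "b \<in> vs.span {a,b}" for a b :: "nat \<Rightarrow> 'a" by (simp_all add: vs.span_base)
  \<comment> \<open>Full points that have a full point opposite to them. The next step shows that
    each line on such a point carries a second one.\<close>
  define F where "F x \<longleftrightarrow> x \<in> P \<and> Pi x \<subseteq> U \<and> (\<exists>x'\<in>P. Pi x' \<subseteq> U \<and> \<not> near x x')" for x
  have step: "\<exists>y\<in>m. y \<notin> vs.span {x} \<and> F y" if Fx: "F x" and m: "m \<in> L" "x \<in> m" for x m
  proof -
    obtain x' where x': "x' \<in> P" "Pi x' \<subseteq> U" "\<not> near x x'" and x: "x \<in> P" "Pi x \<subseteq> U" using Fx unfolding F_def by blast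
    note x0 = P_nz[OF x(1)]
    have pr: "\<exists>w v. w \<in> k \<and> w \<noteq> 0 \<and> Pi w \<subseteq> U \<and> v \<noteq> 0 \<and> v \<in> Pi x' \<and> v \<in> Pi w \<and> Pi v \<subseteq> U \<and> w \<notin> vs.span {x}" if k: "k \<in> L" "x \<in> k" for k
    proof -
      have "k \<subseteq> U" using line_sub_Pi[OF k] x by blast
      then obtain w v where w: "w \<in> k" "w \<noteq> 0" "Pi w \<subseteq> U" "v \<noteq> 0" "v \<in> Pi x'" "v \<in> Pi w" "Pi v \<subseteq> U"
        using proj_full[OF sU x'(1,2) k(1)] by blast
      have "near x' w" using w unfolding near_def by blast
      then have "w \<notin> vs.span {x}" using x'(3) near_span[of x' w x] span1_sym[of w x] near_sym w x0 by blast
      then show ?thesis using w by blast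
    qed
    obtain w v where w: "w \<in> m" "w \<noteq> 0" "Pi w \<subseteq> U" "v \<noteq> 0" "v \<in> Pi x'" "v \<in> Pi w" "w \<notin> vs.span {x}" using pr[OF m] by blast
    obtain k where k: "k \<in> L" "x \<in> k" "k \<noteq> m" using two_lines[OF x(1)] by metis
    obtain w' v' where w': "w' \<in> k" "w' \<noteq> 0" "Pi w' \<subseteq> U" "v' \<noteq> 0" "v' \<in> Pi x'" "v' \<in> Pi w'" "Pi v' \<subseteq> U" "w' \<notin> vs.span {x}"
      using pr[OF k(1,2)] by blast
    have me: "m = vs.span {x,w}" using sd_line_span[OF L_sd[OF m(1)] m(2) w(1) x0 w(7)] .
    have w'm: "w' \<notin> m" using line_eq[OF k(1) m(1) k(2) m(2) w'(1) _ x0 w'(8)] k by blast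
    have wx: "w \<in> Pi x" "w' \<in> Pi x" using line_sub_Pi m k w w' by blast+
    have v'x: "v' \<notin> Pi x" using x'(3) w' unfolding near_def by blast
    have v'P: "v' \<in> P" using adj_P w' by blast
    \<comment> \<open>A common neighbour c of w and v' would complete the pentagon x, w, c, v', w'.
      So v' is a full point opposite w.\<close>
    have "\<not> near w v'"
    proof
      assume "near w v'"
      then obtain c where c: "c \<noteq> 0" "c \<in> Pi w" "c \<in> Pi v'" unfolding near_def by blast
      have w'v: "w' \<in> Pi v'" using w' adj_sym by blast
      have cx: "c \<notin> Pi x"
      proof
        assume cx: "c \<in> Pi x"
        then have "c \<in> vs.span {w'}" using no_quad[OF x(1) v'P v'x wx(2) w'v w'(2) _ c(3)] by blast
        then have "w' \<in> vs.span {c}" using span1_sym c by blast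
        then have "w' \<in> Pi w" using sd_span_mem[OF Pi_sd[OF adj_P[OF wx(1) w(2)]] c(2)] by blast
        then have "w' \<in> vs.span {x,w}" using no_triangle[OF x(1) wx(1) w(7) wx(2)] by blast
        then show False using w'm me by blast
      qed
      show False
        by (rule no_pentagon[OF x(1) wx(1) w(7) wx(2) _ c(2) cx w'(6) v'x]) (use w'm me c adj_sym in blast)+
    qed
    then have "F w" unfolding F_def using adj_P[OF wx(1) w(2)] w w' v'P by blast
    then show ?thesis using w by blast
  qed
  have Fx: "F x" unfolding F_def using x nn by blast
  note x0 = P_nz[OF x(1)]
  define nx where "nx x m = (SOME y. y \<in> m \<and> y \<notin> vs.span {x} \<and> F y)" for x m
  have nx: "nx x m \<in> m" "nx x m \<notin> vs.span {x}" "F (nx x m)" if "F x" "m \<in> L" "x \<in> m" for x m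
  proof -
    have "\<exists>y. y \<in> m \<and> y \<notin> vs.span {x} \<and> F y" using step[OF that] by blast
    from someI_ex[OF this] show "nx x m \<in> m" "nx x m \<notin> vs.span {x}" "F (nx x m)" unfolding nx_def by blast+
  qed
  let ?A0 = "{l\<in>L. x \<in> l}"
  let ?B = "\<lambda>y l. {k\<in>L. y \<in> k} - {l}"
  have FP: "y \<in> P" "y \<noteq> 0" "Pi y \<subseteq> U" if "F y" for y using that P_nz unfolding F_def by blast+
  have Bc: "card (?B y l) = q" if "F y" "l \<in> L" "y \<in> l" for y l
    using lines_card[OF FP(1)[OF that(1)]] that by simp
  have Bchild: "?B y l \<subseteq> child l r" if y: "F y" and l: "l \<in> L" "y \<in> l" and r: "r \<in> l" "r \<noteq> 0" "y \<notin> vs.span {r}" for y l r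
  proof
    fix k assume k: "k \<in> ?B y l"
    have "k \<inter> l \<noteq> {0}" using k l FP(2)[OF y] by blast
    moreover have "r \<notin> k" using line_eq[of k l r y] k l r by blast
    ultimately show "k \<in> child l r" unfolding child_def using k by blast
  qed
  \<comment> \<open>Unlike in \<open>layers\<close>, only one further point per line is used, so the
    layers have q + 1, (q + 1) q and (q + 1) q^2 lines. All of them lie in U, against (4d).\<close>
  define A1 where "A1 = (\<Union>l\<in>?A0. ?B (nx x l) l)"
  have fB: "finite (?B y l)" for y l using fin_L by simp
  have f1: "finite A1" unfolding A1_def using fin_L by simp
  have B0: "?B (nx x l) l \<subseteq> child l x" if "l \<in> ?A0" for l using Bchild[of "nx x l" l x] nx[OF Fx] that x0 by blast
  have c1: "card A1 = (q + 1) * q"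
  proof -
    have "card A1 = (\<Sum>l\<in>?A0. card (?B (nx x l) l))" unfolding A1_def
    proof (rule card_UN_disjoint)
      show "\<forall>i\<in>?A0. \<forall>j\<in>?A0. i \<noteq> j \<longrightarrow> ?B (nx x i) i \<inter> ?B (nx x j) j = {}"
        using child_disj0[OF x(1)] B0 by blast
    qed (use fin_L in auto)
    also have "\<dots> = (\<Sum>l\<in>?A0. q)" using Bc nx[OF Fx] by (intro sum.cong[OF refl]) blast
    finally show ?thesis using lines_card[OF x(1)] by simp
  qed
  define p where "p k = (SOME p. p \<in> k \<and> p \<in> Pi x \<and> F p)" for k
  have A1: "k \<in> L" "x \<notin> k" "p k \<in> k" "p k \<in> Pi x" "F (p k)" if k: "k \<in> A1" for k
  proof -
    obtain l where l: "l \<in> ?A0" "k \<in> ?B (nx x l) l" using k unfolding A1_def by blast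
    show kL: "k \<in> L" "x \<notin> k" using B0[OF l(1)] l(2) unfolding child_def by blast+
    have "nx x l \<in> Pi x" "F (nx x l)" using nx[OF Fx, of l] line_sub_Pi[of l x] l(1) by blast+
    then have "\<exists>p. p \<in> k \<and> p \<in> Pi x \<and> F p" using l by blast
    from someI_ex[OF this] show "p k \<in> k" "p k \<in> Pi x" "F (p k)" unfolding p_def by blast+
  qed
  let ?z = "\<lambda>k. nx (p k) k"
  define A2 where "A2 = (\<Union>k\<in>A1. ?B (?z k) k)"
  have f2: "finite A2" unfolding A2_def using fin_L f1 by simp
  have zz: "?z k \<in> k" "?z k \<notin> vs.span {p k}" "F (?z k)" if "k \<in> A1" for k using nx[OF A1(5,1,3)] that by blast+
  have B1: "?B (?z k) k \<subseteq> child k (p k)" if k: "k \<in> A1" for k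
    using Bchild[OF zz(3)[OF k] A1(1)[OF k] zz(1)[OF k] A1(3)[OF k] FP(2)[OF A1(5)[OF k]] zz(2)[OF k]] .
  have c2: "card A2 = (q + 1) * q * q"
  proof -
    have "card A2 = (\<Sum>k\<in>A1. card (?B (?z k) k))" unfolding A2_def
    proof (rule card_UN_disjoint)
      show "\<forall>i\<in>A1. \<forall>j\<in>A1. i \<noteq> j \<longrightarrow> ?B (?z i) i \<inter> ?B (?z j) j = {}"
      proof (intro ballI impI)
        fix i j assume ij: "i \<in> A1" "j \<in> A1" "i \<noteq> j"
        show "?B (?z i) i \<inter> ?B (?z j) j = {}"
          using child_disj1[OF x(1) A1(1-4)[OF ij(1)] FP(2)[OF A1(5)[OF ij(1)]] A1(1-4)[OF ij(2)] FP(2)[OF A1(5)[OF ij(2)]] ij(3)]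
            B1[OF ij(1)] B1[OF ij(2)] by blast
      qed
    qed (use fin_L f1 in auto)
    also have "\<dots> = (\<Sum>k\<in>A1. q)" using Bc[OF zz(3) A1(1) zz(1)] by (intro sum.cong[OF refl]) blast
    finally show ?thesis using c1 by simp
  qed
  have d01: "?A0 \<inter> A1 = {}" using A1 by blast
  have d2: "(?A0 \<union> A1) \<inter> A2 = {}"
  proof (rule ccontr)
    assume "(?A0 \<union> A1) \<inter> A2 \<noteq> {}"
    then obtain j where j: "j \<in> ?A0 \<union> A1" "j \<in> A2" by blast
    then obtain k where k: "k \<in> A1" "j \<in> ?B (?z k) k" unfolding A2_def by blast
    have "j \<in> child k (p k)" using B1[OF k(1)] k(2) by blast
    then have "j \<inter> Pi x = {0}" using child_far(1)[OF x(1) A1(1-4)[OF k(1)] FP(2)[OF A1(5)[OF k(1)]]] by blast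
    then show False using j(1) A1(3,4)[of j] FP(2)[OF A1(5), of j] x0 Pi_self[OF x(1)] by blast
  qed
  have c: "card (?A0 \<union> A1 \<union> A2) = (q + 1) + (q + 1) * q + (q + 1) * q * q"
    using card_Un_disjoint[OF fin_sub f1 d01] card_Un_disjoint[OF _ f2 d2] c1 c2 lines_card[OF x(1)] fin_L f1 by simp
  have "?A0 \<union> A1 \<union> A2 \<subseteq> LU U"
  proof
    fix k assume "k \<in> ?A0 \<union> A1 \<union> A2"
    then have "k \<in> L \<and> (\<exists>y. y \<in> k \<and> Pi y \<subseteq> U)"
    proof (elim UnE)
      assume "k \<in> A2"
      then obtain j where j: "j \<in> A1" "k \<in> ?B (?z j) j" unfolding A2_def by blast
      then show ?thesis using FP(3)[OF zz(3)[OF j(1)]] by blast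
    qed (use x A1 FP(3) in blast)+
    then show "k \<in> LU U" unfolding LU_def using line_sub_Pi by blast
  qed
  from card_mono[OF fin_LU this] have "(q + 1) + (q + 1) * q + (q + 1) * q * q \<le> q^3 - q^2 + 4 * q"
    using c F4[OF U] unfolding LU_def by simp
  moreover have "(q + 1) + (q + 1) * q + (q + 1) * q * q = q^3 + 2 * q^2 + 2 * q + 1"
    by (simp add: power3_eq_cube power2_eq_square algebra_simps)
  moreover have "q^2 \<le> q^3" using q2 by (intro power_increasing) auto
  moreover have "2 * q \<le> q^2" using q2 by (simp add: power2_eq_square)
  ultimately show False by linarith
qed

lemma near_P:
  assumes "x \<in> P" "y \<in> P" "near x y" "y \<notin> Pi x"
  obtains v where "v \<in> P" "v \<in> Pi x" "y \<in> Pi v" "v \<notin> vs.span {x}" "y \<notin> vs.span {v}"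
proof -
  obtain v where v: "v \<noteq> 0" "v \<in> Pi x" "v \<in> Pi y" using assms(3) unfolding near_def by blast
  have "v \<notin> vs.span {x}"
  proof
    assume "v \<in> vs.span {x}"
    then have "Pi v = Pi x" using Pi_scale P_nz assms v by blast
    then show False using v assms adj_sym by blast
  qed
  moreover have "y \<notin> vs.span {v}" using sd_span_mem[OF Pi_sd[OF assms(1)] v(2)] assms by blast
  ultimately show thesis using that v adj_P adj_sym by blast
qed

section \<open>Four-spaces spanned by the pencils of three points in one plane\<close>

lemma tripod_sd:
  assumes x: "x \<in> P" and z: "z \<in> Pi x" "z \<notin> vs.span {x}" and z': "z' \<in> Pi x" "z' \<notin> vs.span {x,z}"
  shows "sd 5 (ssum (ssum (Pi x) (Pi z)) (Pi z'))" "Pi x \<subseteq> ssum (ssum (Pi x) (Pi z)) (Pi z')"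
    "Pi z \<subseteq> ssum (ssum (Pi x) (Pi z)) (Pi z')" "Pi z' \<subseteq> ssum (ssum (Pi x) (Pi z)) (Pi z')"
    "ssum (ssum (Pi x) (Pi z)) (Pi z') \<subseteq> V" "z \<in> P" "z' \<in> P" "z' \<notin> vs.span {x}" "z' \<notin> vs.span {z}"
proof -
  let ?S = "ssum (Pi x) (Pi z)"
  show zP: "z \<in> P" using adj_P adj_nz x z by blast
  have "z' \<noteq> 0" using z'(2) vs.span_zero by metis
  then show z'P: "z' \<in> P" using adj_P z' by blast
  show nz'x: "z' \<notin> vs.span {x}" using z'(2) vs.span_mono[of "{x}" "{x,z}"] by blast
  show nz'z: "z' \<notin> vs.span {z}" using z'(2) vs.span_mono[of "{z}" "{x,z}"] by blast
  have S: "sd 4 ?S" using Pi_int_adj(2)[OF x z] .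
  have PS: "Pi x \<subseteq> ?S" "Pi z \<subseteq> ?S" using ssum_ge1[OF sd_subspace[OF Pi_sd[OF zP]]] ssum_ge2[OF sd_subspace[OF Pi_sd[OF x]]] by blast+
  have SV: "?S \<subseteq> V" using ssum_line_V[OF Pi_V Pi_V] .
  obtain k where k: "sd k (?S \<inter> Pi z')" "sd (4 + 3 - k) (ssum ?S (Pi z'))" "k \<le> 3"
    using sd_int_sum[OF S Pi_sd[OF z'P]] by blast
  have "k \<noteq> 3"
  proof
    assume "k = 3"
    then have "Pi z' \<subseteq> ?S" using sd_eq[OF k(1) Pi_sd[OF z'P]] by blast
    then show False using pencils3[OF S SV x zP z'P PS _ z(2) nz'x nz'z] by blast
  qed
  moreover have "2 \<le> k"
  proof -
    have "x \<in> Pi z'" using z' adj_sym by blast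
    then have "vs.span {x,z'} \<subseteq> ?S \<inter> Pi z'"
      using sd_span_le[OF k(1), of "{x,z'}"] PS z'(1) Pi_self[OF x] Pi_self[OF z'P] by blast
    then show ?thesis using sd_mono[OF sd_span2[OF P_nz[OF x] nz'x] k(1)] by blast
  qed
  ultimately have "k = 2" using k(3) by simp
  then show "sd 5 (ssum ?S (Pi z'))" using k(2) by simp
  have "?S \<subseteq> ssum ?S (Pi z')" using ssum_ge1[OF sd_subspace[OF Pi_sd[OF z'P]]] .
  then show "Pi x \<subseteq> ssum ?S (Pi z')" "Pi z \<subseteq> ssum ?S (Pi z')" using PS by blast+
  show "Pi z' \<subseteq> ssum ?S (Pi z')" using ssum_ge2[OF sd_subspace[OF S]] .
  show "ssum ?S (Pi z') \<subseteq> V" using ssum_line_V[OF SV Pi_V] .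
qed

text \<open>Otherwise m carries a full point w not collinear with x, reached through some v in
  \<open>Pi x\<close>. By \<open>no_full_opp\<close>, w is near every full point y of
  \<open>Pi x\<close>, and for y off the line xv this closes a pentagon. But z and z' cannot both
  lie on xv.\<close>

lemma tripod_meet:
  assumes x: "x \<in> P" and z: "z \<in> Pi x" "z \<notin> vs.span {x}" and z': "z' \<in> Pi x" "z' \<notin> vs.span {x,z}"
    and m: "m \<in> L" "m \<subseteq> ssum (ssum (Pi x) (Pi z)) (Pi z')"
  obtains p where "p \<in> m" "p \<in> Pi x" "p \<noteq> 0"
proof (rule ccontr)
  let ?U = "ssum (ssum (Pi x) (Pi z)) (Pi z')"
  assume "\<not> thesis"
  then have no: "\<And>p. p \<in> m \<Longrightarrow> p \<in> Pi x \<Longrightarrow> p = 0" using that by blast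
  note t = tripod_sd[OF x z z']
  obtain w v where w: "w \<in> m" "w \<noteq> 0" "Pi w \<subseteq> ?U" "v \<noteq> 0" "v \<in> Pi x" "v \<in> Pi w" "Pi v \<subseteq> ?U"
    using proj_full[OF sd_subspace[OF t(1)] x t(2) m] by blast
  have wx: "w \<notin> Pi x" using no w by blast
  have wP: "w \<in> P" using P_I m w by blast
  have nvx: "v \<notin> vs.span {x}"
  proof
    assume "v \<in> vs.span {x}"
    then have "Pi v = Pi x" using Pi_scale P_nz x w by blast
    then show False using w wx adj_sym by blast
  qed
  have key: False if y: "y \<in> Pi x" "y \<in> P" "Pi y \<subseteq> ?U" "y \<notin> vs.span {x,v}" for y
  proof -
    obtain c where c: "c \<noteq> 0" "c \<in> Pi y" "c \<in> Pi w" using no_full_opp[OF t(1,5) y(2) wP y(3) w(3)] unfolding near_def by blast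
    have cx: "c \<notin> Pi x"
    proof
      assume "c \<in> Pi x"
      then have "c \<in> vs.span {v}" using no_quad[OF x wP wx w(5,6,4) _ c(3)] by blast
      then have "v \<in> vs.span {c}" using span1_sym c by blast
      then have "v \<in> Pi y" using sd_span_mem[OF Pi_sd[OF y(2)] c(2)] by blast
      then have "y \<in> vs.span {x,v}" using no_triangle[OF x w(5) nvx y(1)] adj_sym by blast
      then show False using y by blast
    qed
    have "w \<in> Pi v" using w adj_sym by blast
    then show False using no_pentagon[OF x w(5) nvx y(1) y(4) _ wx c(2) cx c(3)] by blast
  qed
  have "z \<in> vs.span {x,v}" using key[OF z(1) t(6,3)] by blast
  then have l: "vs.span {x,v} = vs.span {x,z}"
    using sd_line_span[OF sd_span2[OF P_nz[OF x] nvx], of x z] z vs.span_base[of x "{x,v}"] P_nz[OF x] by blast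
  have "z' \<in> vs.span {x,v}" using key[OF z'(1) t(7,4)] by blast
  then show False using l z' by blast
qed

lemma line_in_Pi: "x \<in> P \<Longrightarrow> sd 2 k \<Longrightarrow> k \<subseteq> Pi x \<Longrightarrow> x \<in> k \<Longrightarrow> k \<in> L"
proof -
  assume x: "x \<in> P" and k: "sd 2 k" "k \<subseteq> Pi x" "x \<in> k"
  obtain r where r: "r \<in> k" "r \<notin> vs.span {x}" using sd_exists_notin[OF k(1) sd_span1[OF P_nz[OF x]]] by auto
  have "k = vs.span {x,r}" using sd_line_span[OF k(1,3) r(1) P_nz[OF x] r(2)] .
  then show ?thesis using adj_line[OF x _ r(2)] k r by blast
qed

text \<open>Take a solid T of the 4-space that contains zz' but not x. Each line of \<open>L\<close>
  in T meets \<open>Pi x\<close> in one point of zz', and no two in the same point, since the pencil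
  of that point would bring x into T. As T contains at least q + 1 lines, each point w of zz' is on
  one of them; together with the line xw it makes w full.\<close>

lemma tripod_full:
  assumes x: "x \<in> P" and z: "z \<in> Pi x" "z \<notin> vs.span {x}" and z': "z' \<in> Pi x" "z' \<notin> vs.span {x,z}"
    and w: "w \<in> vs.span {z,z'}" "w \<noteq> 0"
  shows "Pi w \<subseteq> ssum (ssum (Pi x) (Pi z)) (Pi z')"
proof -
  let ?U = "ssum (ssum (Pi x) (Pi z)) (Pi z')" and ?t = "vs.span {z,z'}"
  note t = tripod_sd[OF x z z']
  note sU = sd_subspace[OF t(1)]
  have z0: "z \<noteq> 0" using P_nz[OF t(6)] .
  have tsd: "sd 2 ?t" using sd_span2[OF z0 t(9)] .
  have tx: "?t \<subseteq> Pi x" using sd_span_le[OF Pi_sd[OF x]] z z' by simp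
  have zt: "z \<in> ?t" "z' \<in> ?t" by (simp_all add: vs.span_base)
  have tU: "?t \<subseteq> ?U" using tx t(2) by blast
  have finS: "finite (Sol ?U)" using fin_Sol[OF sd_finite[OF t(1)]] .
  have Pe: "Pi x = vs.span {x,z,z'}" using Pi_span[OF x z(1) z'(1) z(2) z'(2)] .
  \<comment> \<open>There are 1 + q + q^2 solids through zz' but only 1 + q through the plane
    \<open>Pi x\<close>.\<close>
  have "\<not> {T\<in>Sol ?U. ?t \<subseteq> T} \<subseteq> {T\<in>Sol ?U. Pi x \<subseteq> T}"
  proof
    assume a: "{T\<in>Sol ?U. ?t \<subseteq> T} \<subseteq> {T\<in>Sol ?U. Pi x \<subseteq> T}"
    have "card {T\<in>Sol ?U. ?t \<subseteq> T} \<le> card {T\<in>Sol ?U. Pi x \<subseteq> T}" by (rule card_mono[OF _ a]) (use finS in simp)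
    then have "1 + q + q^2 \<le> 1 + q"
      using Sol_through[OF t(1) tsd tU] Sol_through[OF t(1) Pi_sd[OF x] t(2)] by (simp add: numeral_2_eq_2)
    then show False using q2 by simp
  qed
  then obtain T where T: "T \<in> Sol ?U" "?t \<subseteq> T" "\<not> Pi x \<subseteq> T" by blast
  have T4: "sd 4 T" "T \<subseteq> ?U" using T unfolding Sol_def by auto
  have TV: "T \<subseteq> V" using T4 t(5) by blast
  have xT: "x \<notin> T"
  proof
    assume "x \<in> T"
    then have "vs.span {x,z,z'} \<subseteq> T" using sd_span_le[OF T4(1), of "{x,z,z'}"] T(2) zt by blast
    then show False using T(3) Pe by simp
  qed
  have Tx: "T \<inter> Pi x = ?t"
  proof -
    obtain k where k: "sd k (T \<inter> Pi x)" "k \<le> 3" using sd_int_sum[OF T4(1) Pi_sd[OF x]] by blast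
    have "k \<noteq> 3" using sd_eq[OF k(1) Pi_sd[OF x]] T(3) by blast
    then show ?thesis using sd_eq[OF tsd k(1)] T(2) tx k(2) by auto
  qed
  have line: "T \<inter> Pi y \<in> L" "y \<in> T \<inter> Pi y" if y: "y \<in> P" "y \<in> ?t" "Pi y \<subseteq> ?U" for y
  proof -
    have xy: "x \<in> Pi y" using y tx adj_sym by blast
    obtain k where k: "sd k (T \<inter> Pi y)" "4 + 3 \<le> 5 + k" "k \<le> 3" using sd_int_ge[OF T4(1) Pi_sd[OF y(1)] t(1) T4(2) y(3)] by blast
    have "k \<noteq> 3" using sd_eq[OF k(1) Pi_sd[OF y(1)]] xy xT by blast
    then have "k = 2" using k by simp
    then have k2: "sd 2 (T \<inter> Pi y)" using k by simp
    show yT: "y \<in> T \<inter> Pi y" using y T(2) Pi_self by blast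
    show "T \<inter> Pi y \<in> L" using line_in_Pi[OF y(1) k2 _ yT] by blast
  qed
  note l1 = line[OF t(6) zt(1) t(3)] and l2 = line[OF t(7) zt(2) t(4)]
  have lne: "T \<inter> Pi z \<noteq> T \<inter> Pi z'"
  proof
    assume "T \<inter> Pi z = T \<inter> Pi z'"
    then have "z' \<in> Pi z" using l2(2) by blast
    then show False using no_triangle[OF x z z'(1)] z'(2) by blast
  qed
  have "card {T \<inter> Pi z, T \<inter> Pi z'} \<le> card (LU T)"
    by (rule card_mono[OF fin_LU]) (use l1 l2 in \<open>auto simp: LU_def\<close>)
  then have nT: "q + 1 \<le> card (LU T)" using lne Sd[OF T4(1) TV] unfolding LU_def by auto
  have kx: "\<exists>p. p \<noteq> 0 \<and> k \<inter> Pi x = vs.span {p} \<and> p \<in> k \<and> p \<in> ?t" if k: "k \<in> LU T" for k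
  proof -
    have kL: "k \<in> L" "k \<subseteq> T" using k unfolding LU_def by auto
    have kU: "k \<subseteq> ?U" using kL T4 by blast
    obtain p where p: "p \<in> k" "p \<in> Pi x" "p \<noteq> 0" using tripod_meet[OF x z z' kL(1) kU] by blast
    have xk: "x \<notin> k" using xT kL by blast
    have "k \<inter> Pi x = vs.span {p}"
    proof
      show "k \<inter> Pi x \<subseteq> vs.span {p}" using line_Pi_int[OF x kL(1) xk p] by blast
      show "vs.span {p} \<subseteq> k \<inter> Pi x" using sd_span_mem[OF L_sd[OF kL(1)] p(1)] sd_span_mem[OF Pi_sd[OF x] p(2)] by blast
    qed
    then show ?thesis using p Tx kL by blast
  qed
  have himg: "(\<lambda>k. k \<inter> Pi x) ` LU T \<subseteq> pts ?t"
  proof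
    fix p assume "p \<in> (\<lambda>k. k \<inter> Pi x) ` LU T"
    then obtain k where k: "k \<in> LU T" "p = k \<inter> Pi x" by blast
    obtain r where r: "r \<noteq> 0" "k \<inter> Pi x = vs.span {r}" "r \<in> ?t" using kx[OF k(1)] by blast
    show "p \<in> pts ?t" unfolding pts_def k(2) r(2) using sd_span1[OF r(1)] sd_span_mem[OF tsd r(3)] by blast
  qed
  have hinj: "inj_on (\<lambda>k. k \<inter> Pi x) (LU T)"
  proof (rule inj_onI)
    fix k k' assume k: "k \<in> LU T" "k' \<in> LU T" "k \<inter> Pi x = k' \<inter> Pi x"
    obtain r where r: "r \<noteq> 0" "r \<in> k" "k \<inter> Pi x = vs.span {r}" using kx[OF k(1)] by blast
    have rx: "r \<in> Pi x" "r \<in> k'" using r(3) k(3) vs.span_base[of r "{r}"] by blast+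
    show "k = k'"
    proof (rule ccontr)
      assume "k \<noteq> k'"
      then have "Pi r \<subseteq> T" using Pi_le[OF sd_subspace[OF T4(1)], of k k' r] k r rx unfolding LU_def by blast
      then show False using rx adj_sym xT by blast
    qed
  qed
  have "card ((\<lambda>k. k \<inter> Pi x) ` LU T) \<ge> card (pts ?t)" using card_image[OF hinj] nT pts_card[OF tsd] by simp
  then have onto: "(\<lambda>k. k \<inter> Pi x) ` LU T = pts ?t" using card_seteq[OF fin_pts[OF sd_finite[OF tsd]] himg] by blast
  have "vs.span {w} \<in> pts ?t" unfolding pts_def using sd_span1[OF w(2)] sd_span_mem[OF tsd w(1)] by blast
  then obtain k where k: "k \<in> LU T" "k \<inter> Pi x = vs.span {w}" using onto by (metis (mono_tags, lifting) imageE)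
  have kL: "k \<in> L" "k \<subseteq> T" using k unfolding LU_def by auto
  have wk: "w \<in> k" "w \<in> Pi x" using k(2) vs.span_base[of w "{w}"] by blast+
  have wnx: "w \<notin> vs.span {x}"
  proof
    assume "w \<in> vs.span {x}"
    then have "x \<in> vs.span {w}" using span1_sym w by blast
    then show False using sd_span_mem[OF tsd w(1)] T(2) xT by blast
  qed
  have l: "vs.span {x,w} \<in> L" using adj_line[OF x wk(2) wnx] .
  have xl: "x \<in> vs.span {x,w}" "w \<in> vs.span {x,w}" by (simp_all add: vs.span_base)
  have lU: "vs.span {x,w} \<subseteq> ?U" using line_sub_Pi[OF l xl(1)] t(2) by blast
  have "k \<noteq> vs.span {x,w}" using xT kL xl by blast
  then show ?thesis using Pi_le[OF sU kL(1) l _ wk(1) xl(2) w(2) _ lU] kL T4 by blast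
qed

text \<open>By \<open>pencils3\<close> each of the q + 1 solids through \<open>Pi x\<close> has room
  for the pencil of only one point besides x, and by \<open>tripod_full\<close> the q + 1 points of
  zz' already occupy all of them.\<close>

lemma tripod_only:
  assumes x: "x \<in> P" and z: "z \<in> Pi x" "z \<notin> vs.span {x}" and z': "z' \<in> Pi x" "z' \<notin> vs.span {x,z}"
    and y: "y \<in> Pi x" "y \<noteq> 0" "Pi y \<subseteq> ssum (ssum (Pi x) (Pi z)) (Pi z')" "y \<notin> vs.span {x}"
  shows "y \<in> vs.span {z,z'}"
proof -
  let ?U = "ssum (ssum (Pi x) (Pi z)) (Pi z')" and ?t = "vs.span {z,z'}"
  note t = tripod_sd[OF x z z']
  have z0: "z \<noteq> 0" using P_nz[OF t(6)] .
  have tsd: "sd 2 ?t" using sd_span2[OF z0 t(9)] .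
  have tx: "?t \<subseteq> Pi x" using sd_span_le[OF Pi_sd[OF x]] z z' by simp
  have nx: "w \<notin> vs.span {x}" if w: "w \<in> ?t" "w \<noteq> 0" for w
  proof
    assume "w \<in> vs.span {x}"
    then have "x \<in> ?t" using span1_sym[OF w(2)] sd_span_mem[OF tsd w(1)] by blast
    then obtain a b where ab: "x = a *s z + b *s z'" unfolding span2_iff by blast
    have "b \<noteq> 0"
    proof
      assume "b = 0"
      then have "x \<in> vs.span {z}" using ab by (auto simp: span1_iff)
      then show False using span1_sym[OF P_nz[OF x]] z by blast
    qed
    then have "z' = inverse b *s x + (- (inverse b * a)) *s z" unfolding ab by (simp add: vs.scale_right_distrib)
    then show False using z'(2) unfolding span2_iff by blast
  qed
  define w0 where "w0 p = (SOME w. w \<noteq> 0 \<and> p = vs.span {w})" for p :: "(nat \<Rightarrow> 'a) set"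
  have w0: "w0 p \<noteq> 0" "p = vs.span {w0 p}" "w0 p \<in> ?t" if p: "p \<in> pts ?t" for p
  proof -
    have "\<exists>w. w \<noteq> 0 \<and> p = vs.span {w}" using p unfolding pts_def sd1_iff by blast
    from someI_ex[OF this] show a: "w0 p \<noteq> 0" "p = vs.span {w0 p}" unfolding w0_def by blast+
    have "p \<subseteq> ?t" using p unfolding pts_def by blast
    moreover have "w0 p \<in> vs.span {w0 p}" by (simp add: vs.span_base)
    ultimately show "w0 p \<in> ?t" using a(2) by blast
  qed
  let ?f = "\<lambda>p. ssum (Pi x) (Pi (w0 p))"
  have solid: "ssum (Pi x) (Pi w) \<in> {T\<in>Sol ?U. Pi x \<subseteq> T}" "Pi w \<subseteq> ssum (Pi x) (Pi w)" "w \<in> P"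
    if w: "w \<in> Pi x" "w \<noteq> 0" "w \<notin> vs.span {x}" "Pi w \<subseteq> ?U" for w
  proof -
    show wP: "w \<in> P" using adj_P w by blast
    have "sd 4 (ssum (Pi x) (Pi w))" using Pi_int_adj(2)[OF x w(1,3)] .
    moreover have "ssum (Pi x) (Pi w) \<subseteq> ?U" using ssum_le[OF sd_subspace[OF t(1)] t(2) w(4)] .
    moreover have "Pi x \<subseteq> ssum (Pi x) (Pi w)" using ssum_ge1[OF sd_subspace[OF Pi_sd[OF wP]]] .
    ultimately show "ssum (Pi x) (Pi w) \<in> {T\<in>Sol ?U. Pi x \<subseteq> T}" unfolding Sol_def by blast
    show "Pi w \<subseteq> ssum (Pi x) (Pi w)" using ssum_ge2[OF sd_subspace[OF Pi_sd[OF x]]] .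
  qed
  have pw: "w0 p \<in> Pi x" "w0 p \<notin> vs.span {x}" "Pi (w0 p) \<subseteq> ?U" if p: "p \<in> pts ?t" for p
    using w0[OF p] tx nx tripod_full[OF x z z'] by blast+
  have same: "w' \<in> vs.span {w}" if w: "w \<in> Pi x" "w \<noteq> 0" "w \<notin> vs.span {x}" "Pi w \<subseteq> ?U"
    and w': "w' \<in> Pi x" "w' \<noteq> 0" "w' \<notin> vs.span {x}" "Pi w' \<subseteq> ?U" and e: "ssum (Pi x) (Pi w) = ssum (Pi x) (Pi w')" for w w'
  proof (rule ccontr)
    assume n: "w' \<notin> vs.span {w}"
    note s = solid[OF w] and s' = solid[OF w']
    show False
      using pencils3[of "ssum (Pi x) (Pi w)" x w w'] s s' e x w w' n t(5) unfolding Sol_def by blast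
  qed
  have img: "?f ` pts ?t \<subseteq> {T\<in>Sol ?U. Pi x \<subseteq> T}" using solid(1) pw w0 by blast
  have inj: "inj_on ?f (pts ?t)"
  proof (rule inj_onI)
    fix p p' assume p: "p \<in> pts ?t" "p' \<in> pts ?t" "?f p = ?f p'"
    have "w0 p' \<in> vs.span {w0 p}" using same[OF pw(1)[OF p(1)] w0(1)[OF p(1)] pw(2,3)[OF p(1)] pw(1)[OF p(2)] w0(1)[OF p(2)] pw(2,3)[OF p(2)] p(3)] .
    then have "vs.span {w0 p'} = vs.span {w0 p}" using span1_eq[OF w0(1)[OF p(2)]] by blast
    then show "p = p'" using w0(2)[OF p(1)] w0(2)[OF p(2)] by simp
  qed
  have finS: "finite {T\<in>Sol ?U. Pi x \<subseteq> T}" using fin_Sol[OF sd_finite[OF t(1)]] by simp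
  have "card {T\<in>Sol ?U. Pi x \<subseteq> T} = q + 1" using Sol_through[OF t(1) Pi_sd[OF x] t(2)] by simp
  then have "?f ` pts ?t = {T\<in>Sol ?U. Pi x \<subseteq> T}"
    using card_seteq[OF finS img] card_image[OF inj] pts_card[OF tsd] by simp
  then have "ssum (Pi x) (Pi y) \<in> ?f ` pts ?t" using solid(1)[OF y(1,2,4,3)] by simp
  then obtain p where p: "p \<in> pts ?t" "ssum (Pi x) (Pi y) = ?f p" by blast
  have "y \<in> vs.span {w0 p}" using same[OF pw(1)[OF p(1)] w0(1)[OF p(1)] pw(2,3)[OF p(1)] y(1,2,4,3)] p(2) by simp
  then show ?thesis using sd_span_mem[OF tsd w0(3)[OF p(1)]] by blast
qed

end

section \<open>The hyperplanes of points not opposite a point\<close>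

lemma indep3:
  assumes "x \<noteq> 0" "a \<notin> vs.span {x}" "b \<notin> vs.span {x,a}" "k *s x + l *s a + m *s b = 0"
  shows "k = 0 \<and> l = 0 \<and> m = 0"
proof -
  have m: "m = 0"
  proof (rule ccontr)
    assume m: "m \<noteq> 0"
    have "m *s b = (- k) *s x + (- l) *s a" using assms(4)
      by (simp add: eq_neg_iff_add_eq_0 algebra_simps)
    then have "inverse m *s (m *s b) = inverse m *s ((- k) *s x + (- l) *s a)" by simp
    then have "b = (inverse m * (- k)) *s x + (inverse m * (- l)) *s a" using m
      by (simp add: vs.scale_right_distrib vs.scale_right_diff_distrib)
    then show False using assms(3) unfolding span2_iff by blast
  qed
  then have e: "k *s x + l *s a = 0" using assms(4) by simp
  have l: "l = 0"
  proof (rule ccontr)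
    assume l: "l \<noteq> 0"
    have "l *s a = (- k) *s x" using e by (simp add: eq_neg_iff_add_eq_0 add.commute)
    then have "inverse l *s (l *s a) = inverse l *s ((- k) *s x)" by simp
    then have "a = (inverse l * (- k)) *s x" using l by simp
    then show False using assms(2) unfolding span1_iff by blast
  qed
  then have "k *s x = 0" using e by simp
  then show ?thesis using m l assms(1) by simp
qed

context flat_lines begin

definition N2 where "N2 x = {w. \<exists>v. v \<noteq> 0 \<and> v \<in> Pi x \<and> w \<in> Pi v}"
definition H where "H x = vs.span (N2 x)"

lemma N2_near: "w \<in> N2 x \<longleftrightarrow> near x w" unfolding N2_def near_def using adj_sym by blast

lemma N2_H: "N2 x \<subseteq> H x" unfolding H_def by (rule vs.span_superset)

lemma near_H: "near x y \<Longrightarrow> y \<in> H x" using N2_near N2_H by blast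

lemma Pi_H: "y \<in> Pi x \<Longrightarrow> y \<noteq> 0 \<Longrightarrow> Pi y \<subseteq> H x" using N2_H unfolding N2_def by blast

lemma Pi_basis:
  assumes x: "x \<in> P" obtains a b where "a \<in> Pi x" "b \<in> Pi x" "a \<notin> vs.span {x}" "b \<notin> vs.span {x,a}"
proof -
  obtain a where a: "a \<in> Pi x" "a \<notin> vs.span {x}" using sd_exists_notin[OF Pi_sd[OF x] sd_span1[OF P_nz[OF x]]] by auto
  obtain b where "b \<in> Pi x" "b \<notin> vs.span {x,a}" using sd_exists_notin[OF Pi_sd[OF x] sd_span2[OF P_nz[OF x] a(2)]] by auto
  then show thesis using that a by blast
qed

text \<open>By \<open>tripod_only\<close> the pencil of c = a + x, a point of the line xa off the
  line ab, is not in the 4-space of x, a, b; adding it raises the dimension by one. Now the pencils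
  of all points of ab and of cb are inside. Every point of \<open>Pi x\<close> other than x and b
  lies on a line joining one point of each kind, so \<open>tripod_full\<close> applies once
  more.\<close>

lemma H_sd:
  assumes x: "x \<in> P" shows "sd 6 (H x)"
proof -
  obtain a b where a: "a \<in> Pi x" "a \<notin> vs.span {x}" and b: "b \<in> Pi x" "b \<notin> vs.span {x,a}" using Pi_basis[OF x] by metis
  note x0 = P_nz[OF x]
  have ind: "k = 0 \<and> l = 0 \<and> m = 0" if "k *s x + l *s a + m *s b = 0" for k l m
    using indep3[OF x0 a(2) b(2) that] .
  let ?c = "a + x"
  let ?U = "ssum (ssum (Pi x) (Pi a)) (Pi b)"
  let ?E = "ssum ?U (Pi ?c)"
  note t = tripod_sd[OF x a b]
  have cx: "?c \<in> Pi x" using sd_add[OF Pi_sd[OF x] a(1) Pi_self[OF x]] .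
  have ncx: "?c \<notin> vs.span {x}"
  proof
    assume "?c \<in> vs.span {x}"
    then have "?c - x \<in> vs.span {x}" by (intro vs.span_diff) (simp_all add: vs.span_base)
    then show False using a(2) by simp
  qed
  then have c0: "?c \<noteq> 0" using vs.span_zero by metis
  have cP: "?c \<in> P" using adj_P[OF cx c0] .
  have nbc: "b \<notin> vs.span {x, ?c}"
  proof
    assume "b \<in> vs.span {x, ?c}"
    moreover have "vs.span {x, ?c} \<subseteq> vs.span {x,a}"
      by (rule vs.span_minimal) (auto intro: vs.span_base vs.span_add)
    ultimately show False using b by blast
  qed
  have cU: "\<not> Pi ?c \<subseteq> ?U"
  proof
    assume "Pi ?c \<subseteq> ?U"
    then have "?c \<in> vs.span {a,b}" using tripod_only[OF x a b cx c0 _ ncx] by blast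
    then obtain k l where "a + x = k *s a + l *s b" unfolding span2_iff by blast
    then have "1 *s x + (1 - k) *s a + (- l) *s b = 0" by (simp add: algebra_simps vs.scale_left_diff_distrib)
    then show False using ind by fastforce
  qed
  obtain k where k: "sd k (?U \<inter> Pi ?c)" "sd (5 + 3 - k) ?E" "k \<le> 3" using sd_int_sum[OF t(1) Pi_sd[OF cP]] by blast
  have "k \<noteq> 3" using sd_eq[OF k(1) Pi_sd[OF cP]] cU by blast
  moreover have "2 \<le> k"
  proof -
    have "x \<in> ?U \<inter> Pi ?c" "?c \<in> ?U \<inter> Pi ?c" using t(2) Pi_self[OF x] Pi_self[OF cP] cx adj_sym by blast+
    then have "vs.span {x,?c} \<subseteq> ?U \<inter> Pi ?c" using sd_span_le[OF k(1)] by simp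
    then show ?thesis using sd_mono[OF sd_span2[OF x0 ncx] k(1)] by blast
  qed
  ultimately have "k = 2" using k(3) by simp
  then have E: "sd 6 ?E" using k(2) by simp
  have UE: "?U \<subseteq> ?E" using ssum_ge1[OF sd_subspace[OF Pi_sd[OF cP]]] .
  have cE: "Pi ?c \<subseteq> ?E" using ssum_ge2[OF sd_subspace[OF t(1)]] .
  have xE: "Pi x \<subseteq> ?E" "Pi a \<subseteq> ?E" "Pi b \<subseteq> ?E" using t UE by blast+
  note sE = sd_subspace[OF E]
  have tri: "ssum (ssum (Pi x) (Pi w)) (Pi w') \<subseteq> ?E" if "Pi w \<subseteq> ?E" "Pi w' \<subseteq> ?E" for w w'
    using ssum_le[OF sE ssum_le[OF sE xE(1) that(1)] that(2)] .
  have ab: "Pi w \<subseteq> ?E" if "w \<in> vs.span {a,b}" "w \<noteq> 0" for w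
    using tripod_full[OF x a b that] UE by blast
  have cb: "Pi w \<subseteq> ?E" if "w \<in> vs.span {?c,b}" "w \<noteq> 0" for w
    using tripod_full[OF x cx ncx b(1) nbc that] tri[OF cE xE(3)] by blast
  have all: "Pi y \<subseteq> ?E" if y: "y \<in> Pi x" "y \<noteq> 0" for y
  proof -
    have "y \<in> vs.span {x,a,b}" using y Pi_span[OF x a(1) b(1) a(2) b(2)] by simp
    then obtain \<alpha> \<beta> \<gamma> where ye: "y = \<alpha> *s x + \<beta> *s a + \<gamma> *s b" unfolding span3_iff by blast
    \<comment> \<open>The vector y is split into \<open>?w\<close> on ab and \<open>?w'\<close> on
      cb, with \<gamma>1 as the free parameter. The determinant condition says that x,
      \<open>?w\<close> and \<open>?w'\<close> are independent.\<close>
    have main: "Pi y \<subseteq> ?E" if D: "(\<beta> - \<alpha>) * (\<gamma> - \<gamma>1) - \<alpha> * \<gamma>1 \<noteq> 0" for \<gamma>1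
    proof -
      let ?w = "(\<beta> - \<alpha>) *s a + \<gamma>1 *s b" and ?w' = "\<alpha> *s ?c + (\<gamma> - \<gamma>1) *s b"
      have e: "?w + ?w' = y" unfolding ye by (simp add: algebra_simps vs.scale_left_diff_distrib vs.scale_right_distrib)
      have nw: "?w \<notin> vs.span {x}"
      proof
        assume "?w \<in> vs.span {x}"
        then obtain k where "?w = k *s x" unfolding span1_iff by blast
        then have "(- k) *s x + (\<beta> - \<alpha>) *s a + \<gamma>1 *s b = 0" by (simp add: algebra_simps)
        then show False using ind D by fastforce
      qed
      have nw': "?w' \<notin> vs.span {x,?w}"
      proof
        assume "?w' \<in> vs.span {x,?w}"
        then obtain k m where km: "?w' = k *s x + m *s ?w" unfolding span2_iff by blast
        have "(\<alpha> - k) *s x + (\<alpha> - m * (\<beta> - \<alpha>)) *s a + ((\<gamma> - \<gamma>1) - m * \<gamma>1) *s b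
          = ?w' - (k *s x + m *s ?w)"
          by (simp add: algebra_simps vs.scale_left_diff_distrib vs.scale_right_distrib)
        also have "\<dots> = 0" using km by simp
        finally have z: "\<alpha> - m * (\<beta> - \<alpha>) = 0" "(\<gamma> - \<gamma>1) - m * \<gamma>1 = 0" using ind by blast+
        have "(\<beta> - \<alpha>) * (\<gamma> - \<gamma>1) - \<alpha> * \<gamma>1 = 0" using z by algebra
        then show False using D by blast
      qed
      have w0: "?w \<noteq> 0" using nw vs.span_zero by metis
      have w'0: "?w' \<noteq> 0" using nw' vs.span_zero by metis
      have wx: "?w \<in> Pi x" "?w' \<in> Pi x"
        using sd_add[OF Pi_sd[OF x] sd_scale[OF Pi_sd[OF x]] sd_scale[OF Pi_sd[OF x]]] a b cx by blast+
      have wE: "Pi ?w \<subseteq> ?E" by (rule ab[OF _ w0]) (auto simp: span2_iff)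
      have w'E: "Pi ?w' \<subseteq> ?E" by (rule cb[OF _ w'0]) (unfold span2_iff, blast)
      have "y = 1 *s ?w + 1 *s ?w'" using e by simp
      then have "y \<in> vs.span {?w,?w'}" unfolding span2_iff by blast
      then show ?thesis using tripod_full[OF x wx(1) nw wx(2) nw' _ y(2)] tri[OF wE w'E] by blast
    qed
    show ?thesis
    proof (cases "\<beta> = 0")
      case False
      \<comment> \<open>The determinant equals (\<beta> - \<alpha>) \<gamma> - \<beta> \<gamma>1, so
        a single value of \<gamma>1 has to be avoided.\<close>
      have q: "\<exists>g. g \<noteq> (\<beta> - \<alpha>) * \<gamma> / \<beta>" by (metis zero_neq_one)
      then obtain g where g: "g \<noteq> (\<beta> - \<alpha>) * \<gamma> / \<beta>" by blast
      have "(\<beta> - \<alpha>) * (\<gamma> - g) - \<alpha> * g = (\<beta> - \<alpha>) * \<gamma> - \<beta> * g" by (simp add: algebra_simps)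
      moreover have "(\<beta> - \<alpha>) * \<gamma> - \<beta> * g \<noteq> 0" using g False by (simp add: field_simps)
      ultimately show ?thesis using main[of g] by simp
    next
      case b0: True
      show ?thesis
      proof (cases "\<alpha> = 0 \<or> \<gamma> = 0")
        case False
        then show ?thesis using main[of 0] b0 by simp
      next
        case True
        then have "y \<in> vs.span {x} \<or> y \<in> vs.span {b}" using ye b0 by (auto simp: span1_iff)
        then show ?thesis using Pi_scale[of x y] Pi_scale[of b y] x0 P_nz[OF t(7)] y xE by auto
      qed
    qed
  qed
  have "N2 x \<subseteq> ?E" unfolding N2_def using all by blast
  then have "H x \<subseteq> ?E" unfolding H_def using vs.span_minimal[OF _ sE] by blast
  moreover have "?E \<subseteq> H x"
  proof -
    have sH: "vs.subspace (H x)" unfolding H_def by (rule vs.subspace_span)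
    have h: "Pi x \<subseteq> H x" "Pi a \<subseteq> H x" "Pi b \<subseteq> H x" "Pi ?c \<subseteq> H x"
      using Pi_H[OF Pi_self[OF x] x0] Pi_H[OF a(1) P_nz[OF t(6)]] Pi_H[OF b(1) P_nz[OF t(7)]] Pi_H[OF cx c0] by blast+
    show ?thesis using ssum_le[OF sH ssum_le[OF sH ssum_le[OF sH h(1,2)] h(3)] h(4)] .
  qed
  ultimately have "H x = ?E" by (rule subset_antisym)
  then show ?thesis using E by simp
qed

text \<open>If no point of k were collinear with x, then k would be a child of the lines that join u
  and u' to \<open>Pi x\<close>. By \<open>child_disj1\<close> these two lines coincide, hence equal
  k, and a line is not its own child.\<close>

lemma near_line:
  assumes x: "x \<in> P" and k: "k \<in> L" and u: "u \<in> k" "u \<noteq> 0" "near x u" and u': "u' \<in> k" "near x u'" "u' \<notin> vs.span {u}"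
  shows "\<exists>p\<in>k. p \<noteq> 0 \<and> p \<in> Pi x"
proof (rule ccontr)
  assume no: "\<not> ?thesis"
  have u'0: "u' \<noteq> 0" using u'(3) vs.span_zero by metis
  have uP: "u \<in> P" "u' \<in> P" using P_I k u u' u'0 by blast+
  have ux: "u \<notin> Pi x" "u' \<notin> Pi x" using no u u' u'0 by blast+
  have ch: "\<exists>k1 p. k1 \<in> L \<and> x \<notin> k1 \<and> p \<in> k1 \<and> p \<in> Pi x \<and> p \<noteq> 0 \<and> w \<in> k1 \<and> k \<in> child k1 p"
    if w: "w \<in> k" "w \<in> P" "near x w" "w \<notin> Pi x" for w
  proof -
    obtain p where p: "p \<in> P" "p \<in> Pi x" "w \<in> Pi p" "p \<notin> vs.span {x}" "w \<notin> vs.span {p}" using near_P[OF x w(2,3,4)] .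
    let ?k = "vs.span {p,w}"
    have l: "?k \<in> L" using adj_line[OF p(1,3,5)] .
    have i: "p \<in> ?k" "w \<in> ?k" by (simp_all add: vs.span_base)
    have "x \<notin> ?k"
    proof
      assume "x \<in> ?k"
      then have "w \<in> Pi x" using line_sub_Pi[OF l] i by blast
      then show False using w by blast
    qed
    moreover have pk: "p \<notin> k" using no p P_nz by blast
    moreover have "k \<in> child ?k p" unfolding child_def using k pk i w P_nz[OF w(2)] by blast
    ultimately show ?thesis using l i p P_nz by blast
  qed
  obtain k1 p where k1: "k1 \<in> L" "x \<notin> k1" "p \<in> k1" "p \<in> Pi x" "p \<noteq> 0" "u \<in> k1" "k \<in> child k1 p"
    using ch[OF u(1) uP(1) u(3) ux(1)] by blast
  obtain k2 r where k2: "k2 \<in> L" "x \<notin> k2" "r \<in> k2" "r \<in> Pi x" "r \<noteq> 0" "u' \<in> k2" "k \<in> child k2 r"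
    using ch[OF u'(1) uP(2) u'(2) ux(2)] by blast
  have "k1 = k2" using child_disj1[OF x k1(1-5) k2(1-5)] k1 k2 by blast
  then have "k = k1" using line_eq[OF k k1(1) u(1) k1(6) u'(1) _ u(2) u'(3)] k2 by blast
  then show False using k1 unfolding child_def by blast
qed

lemma opp_line:
  assumes x: "x \<in> P" and v: "v \<in> P" "\<not> near x v" and k: "k \<in> L" "v \<in> k"
    and u: "u \<in> k" "u \<noteq> 0" "near x u" "u' \<in> k" "near x u'"
  shows "u' \<in> vs.span {u}"
proof (rule ccontr)
  assume "u' \<notin> vs.span {u}"
  then obtain p where p: "p \<in> k" "p \<noteq> 0" "p \<in> Pi x" using near_line[OF x k(1) u] by blast
  then have "p \<in> Pi v" using line_sub_Pi[OF k] by blast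
  then show False using v p unfolding near_def by blast
qed

text \<open>The span of \<open>H x\<close> and y absorbs the pencil of each of its points opposite
  x, since every line on such a point has a point near x. Iterating, it contains everything near
  such a point. For a point v left out, the paths to v from y and from a second opposite point y + w
  must run through points near x; these turn out to lie on one line, and \<open>no_quad\<close>
  gives the contradiction.\<close>

lemma opp_span:
  assumes x: "x \<in> P" and y: "y \<in> P" "\<not> near x y" and v: "v \<in> P"
  shows "v \<in> ssum (H x) (vs.span {y})"
proof -
  let ?W = "ssum (H x) (vs.span {y})"
  have sW: "vs.subspace ?W" using subspace_ssum[OF sd_subspace[OF H_sd[OF x]] vs.subspace_span] .
  have HW: "H x \<subseteq> ?W" using ssum_ge1[OF vs.subspace_span] .
  have yW: "y \<in> ?W" using ssum_ge2[OF sd_subspace[OF H_sd[OF x]]] vs.span_base[of y "{y}"] by blast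
  have nW: "w \<in> ?W" if "near x w" for w using near_H[OF that] HW by blast
  have in2: "a \<in> vs.span {a,b}" "b \<in> vs.span {a,b}" for a b :: "nat \<Rightarrow> 'a" by (simp_all add: vs.span_base)
  have nspan: "\<not> near x w" if "\<not> near x z" "w \<in> vs.span {z}" "z \<noteq> 0" "w \<noteq> 0" for w z
    using near_span[of x w z] span1_sym[of w z] that by blast
  have a: "Pi z \<subseteq> ?W" if z: "z \<in> P" "z \<in> ?W" "\<not> near x z" for z
  proof
    fix r assume r: "r \<in> Pi z"
    show "r \<in> ?W"
    proof (cases "r \<in> vs.span {z}")
      case True
      then show ?thesis using vs.span_minimal[of "{z}" ?W] z sW by blast
    next
      case False
      have l: "vs.span {z,r} \<in> L" using adj_line[OF z(1) r False] .
      obtain w where w: "w \<in> vs.span {z,r}" "w \<noteq> 0" "near x w" using hexagon_proj[OF x l] by blast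
      have "w \<notin> vs.span {z}" using nspan[OF z(3) _ P_nz[OF z(1)] w(2)] w by blast
      then have "vs.span {z,r} = vs.span {z,w}" using sd_line_span[OF L_sd[OF l] in2(1) w(1) P_nz[OF z(1)]] by blast
      also have "\<dots> \<subseteq> ?W" using vs.span_minimal[of "{z,w}" ?W] z nW[OF w(3)] sW by blast
      finally show ?thesis using in2(2) by blast
    qed
  qed
  have b: "Pi c \<subseteq> ?W" if z: "z \<in> P" "z \<in> ?W" "\<not> near x z" and c: "c \<in> Pi z" "c \<noteq> 0" for z c
  proof (cases "near x c")
    case False
    then show ?thesis using a[OF adj_P[OF c] _ False] a[OF z] c by blast
  next
    case True
    have cP: "c \<in> P" using adj_P[OF c] .
    have cx: "c \<notin> Pi x" using z(3) c unfolding near_def by blast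
    obtain p where p: "p \<in> P" "p \<in> Pi x" "c \<in> Pi p" "p \<notin> vs.span {x}" "c \<notin> vs.span {p}" using near_P[OF x cP True cx] .
    have l1: "vs.span {p,c} \<in> L" using adj_line[OF p(1,3,5)] .
    have "vs.span {p,c} \<subseteq> Pi p" using line_sub_Pi[OF l1 in2(1)] .
    then have l1W: "vs.span {p,c} \<subseteq> ?W" using Pi_H[OF p(2) P_nz[OF p(1)]] HW by blast
    have "c \<notin> vs.span {z}" using nspan[OF z(3) _ P_nz[OF z(1)] c(2)] True by blast
    then have l2: "vs.span {z,c} \<in> L" using adj_line[OF z(1) c(1)] by blast
    have l2W: "vs.span {z,c} \<subseteq> ?W" using line_sub_Pi[OF l2 in2(1)] a[OF z] by blast
    have "vs.span {p,c} \<noteq> vs.span {z,c}"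
    proof
      assume "vs.span {p,c} = vs.span {z,c}"
      then have "p \<in> Pi z" using line_sub_Pi[OF l2 in2(1)] in2(1)[of p c] by blast
      then show False using z(3) p P_nz unfolding near_def by blast
    qed
    then show ?thesis using Pi_le[OF sW l1 l2 _ in2(2) in2(2) c(2) l1W l2W] by blast
  qed
  have b': "w \<in> ?W" if z: "z \<in> P" "z \<in> ?W" "\<not> near x z" and w: "near z w" for z w
    using w b[OF z] adj_sym unfolding near_def by blast
  \<comment> \<open>If u or s on the path z, s, u, v is opposite x, it is itself a point of
    \<open>?W\<close> to which the previous step applies, and v is near it.\<close>
  have step: "v \<in> ?W" if z: "z \<in> P" "z \<in> ?W" "\<not> near x z" and u: "u \<in> P" "u \<in> Pi v" "s \<in> P" "s \<in> Pi z" "s \<in> Pi u" and no: "\<not> (near x u \<and> near x s)" for z u s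
  proof (cases "near x u")
    case False
    have "near z u" unfolding near_def using u P_nz by blast
    then have "u \<in> ?W" using b'[OF z] by blast
    moreover have "near u v" using adj_near[OF u(1)] u adj_sym by blast
    ultimately show ?thesis using b'[OF u(1) _ False] by blast
  next
    case True
    then have ns: "\<not> near x s" using no by blast
    have "s \<in> ?W" using a[OF z] u by blast
    moreover have "near s v" unfolding near_def using u P_nz adj_sym by blast
    ultimately show ?thesis using b'[OF u(3) _ ns] by blast
  qed
  show ?thesis
  proof (rule ccontr)
    assume nv: "v \<notin> ?W"
    have vx: "\<not> near x v" using nW nv by blast
    obtain k where k: "k \<in> L" "v \<in> k" using P_line[OF v] by blast
    have pr: "\<exists>u s. u \<in> k \<and> u \<in> P \<and> u \<in> Pi v \<and> s \<in> P \<and> s \<in> Pi z \<and> s \<in> Pi u \<and> near x u \<and> near x s"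
      if z: "z \<in> P" "z \<in> ?W" "\<not> near x z" for z
    proof -
      obtain u s where us: "u \<in> k" "u \<noteq> 0" "s \<noteq> 0" "s \<in> Pi z" "s \<in> Pi u" using hexagon_proj[OF z(1) k(1)] unfolding near_def by blast
      have uP: "u \<in> P" using P_I k us by blast
      have sP: "s \<in> P" using adj_P us by blast
      have uv: "u \<in> Pi v" using line_sub_Pi[OF k] us by blast
      show ?thesis using step[OF z uP uv sP us(4,5)] nv us uP uv sP by blast
    qed
    obtain u s where u: "u \<in> k" "u \<in> P" "u \<in> Pi v" "s \<in> P" "s \<in> Pi y" "s \<in> Pi u" "near x u" "near x s" using pr[OF y(1) yW y(2)] by blast
    have vy: "\<not> near y v" using b'[OF y(1) yW y(2)] nv by blast
    have sy: "s \<notin> vs.span {y}" using nspan[OF y(2) _ P_nz[OF y(1)] P_nz[OF u(4)]] u by blast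
    have lys: "vs.span {y,s} \<in> L" using adj_line[OF y(1) u(5) sy] .
    obtain n where n: "n \<in> L" "y \<in> n" "n \<noteq> vs.span {y,s}" using two_lines[OF y(1)] by metis
    obtain w where w: "w \<in> n" "w \<noteq> 0" "near x w" using hexagon_proj[OF x n(1)] by blast
    have wy: "w \<notin> vs.span {y}" using nspan[OF y(2) _ P_nz[OF y(1)] w(2)] w by blast
    \<comment> \<open>By \<open>opp_line\<close> the point w is the only one near x on the line n,
      so the sum is a second point of n opposite x.\<close>
    let ?y = "y + w"
    have yn: "?y \<in> n" using sd_add[OF L_sd[OF n(1)] n(2) w(1)] .
    have yny: "?y \<notin> vs.span {y}"
    proof
      assume "?y \<in> vs.span {y}"
      then have "?y - y \<in> vs.span {y}" by (intro vs.span_diff) (simp_all add: vs.span_base)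
      then show False using wy by simp
    qed
    have ynw: "?y \<notin> vs.span {w}"
    proof
      assume "?y \<in> vs.span {w}"
      then have "?y - w \<in> vs.span {w}" by (intro vs.span_diff) (simp_all add: vs.span_base)
      then show False using span1_sym[of y w] P_nz[OF y(1)] wy by simp
    qed
    have y'0: "?y \<noteq> 0" using yny vs.span_zero by metis
    have y'P: "?y \<in> P" using P_I n yn y'0 by blast
    have y'x: "\<not> near x ?y" using opp_line[OF x y n(1,2) w yn] ynw by blast
    have y'y: "?y \<in> Pi y" using line_sub_Pi[OF n(1,2)] yn by blast
    have y'W: "?y \<in> ?W" using a[OF y(1) yW y(2)] y'y by blast
    have y'l: "?y \<notin> vs.span {y,s}"
      using line_eq[OF n(1) lys n(2) in2(1) yn _ P_nz[OF y(1)] yny] n(3) by blast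
    obtain u' s' where u': "u' \<in> k" "u' \<in> P" "u' \<in> Pi v" "s' \<in> P" "s' \<in> Pi ?y" "s' \<in> Pi u'" "near x u'" "near x s'"
      using pr[OF y'P y'W y'x] by blast
    have "u' \<in> vs.span {u}" using opp_line[OF x v vx k u(1) P_nz[OF u(2)] u(7) u'(1,7)] .
    then have Pu: "Pi u' = Pi u" using Pi_scale P_nz u u' by blast
    have ux: "u \<notin> Pi x" using vx u P_nz unfolding near_def by blast
    obtain p where p: "p \<in> P" "p \<in> Pi x" "u \<in> Pi p" "p \<notin> vs.span {x}" "u \<notin> vs.span {p}" using near_P[OF x u(2,7) ux] .
    have pu: "p \<in> Pi u" "p \<notin> vs.span {u}" using p adj_sym indep_sym[of p u] P_nz u by blast+
    let ?l = "vs.span {u,p}"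
    have l: "?l \<in> L" using adj_line[OF u(2) pu] .
    \<comment> \<open>By \<open>near_line\<close> the line ur has a point collinear with x, and by
      \<open>no_quad\<close> that point can only be p. So all such r lie on the line up.\<close>
    have onl: "r \<in> ?l" if r: "r \<in> P" "r \<in> Pi u" "near x r" "z \<in> P" "r \<in> Pi z" "\<not> near z v" for r z
    proof -
      have ru: "r \<notin> vs.span {u}"
      proof
        assume "r \<in> vs.span {u}"
        then have "Pi r = Pi u" using Pi_scale P_nz r u by blast
        then have "r \<in> Pi v" using u(3) adj_sym by blast
        then show False using r P_nz unfolding near_def by blast
      qed
      have l': "vs.span {u,r} \<in> L" using adj_line[OF u(2) r(2) ru] .
      obtain t where t: "t \<in> vs.span {u,r}" "t \<noteq> 0" "t \<in> Pi x"
        using near_line[OF x l' in2(1) P_nz[OF u(2)] u(7) in2(2) r(3) ru] by blast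
      have "t \<in> Pi u" using line_sub_Pi[OF l' in2(1)] t by blast
      then have "t \<in> vs.span {p}" using no_quad[OF x u(2) ux p(2) pu(1) P_nz[OF p(1)] t(3)] by blast
      then have "p \<in> vs.span {u,r}" using span1_sym[OF t(2)] sd_span_mem[OF L_sd[OF l'] t(1)] by blast
      then have "vs.span {u,r} = ?l" using sd_line_span[OF L_sd[OF l'] in2(1) _ P_nz[OF u(2)] pu(2)] by blast
      then show ?thesis using in2(2) by blast
    qed
    have sl: "s \<in> ?l" using onl[OF u(4,6,8) y(1) u(5) vy] .
    have vy': "\<not> near ?y v" using b'[OF y'P y'W y'x] nv by blast
    have s'l: "s' \<in> ?l" using onl[OF u'(4) _ u'(8) y'P u'(5) vy'] u'(6) Pu by blast
    have ss: "s' \<in> Pi s" using line_sub_Pi[OF l sl] s'l by blast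
    have y's: "?y \<notin> Pi s" using no_triangle[OF y(1) u(5) sy y'y] y'l by blast
    have "s' \<in> vs.span {y}"
      using no_quad[OF u(4) y'P y's _ _ P_nz[OF y(1)] ss u'(5)] u(5) y'y adj_sym by blast
    then show False using nspan[OF y(2) _ P_nz[OF y(1)] P_nz[OF u'(4)]] u' by blast
  qed
qed

text \<open>By \<open>layers\<close>, \<open>L\<close> has as many lines as E has hyperplanes, so on
  average a hyperplane would contain 1 + q + q^2 + q^3 of them, more than (4d) permits.\<close>

lemma not_in_sd6:
  assumes E: "sd 6 E" "E \<subseteq> V" shows "\<not> \<Union>L \<subseteq> E"
proof
  assume LE: "\<Union>L \<subseteq> E"
  obtain l where "l \<in> L" using L_ne by blast
  then obtain x where x: "x \<in> P" using P_I sd_nz[OF L_sd] by fastforce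
  let ?Y = "{U. sd 5 U \<and> U \<subseteq> E}"
  have fY: "finite ?Y" by (rule finite_subset[of _ "Pow E"]) (use sd_finite[OF E(1)] in auto)
  have cY: "card ?Y = (\<Sum>i\<le>5. q ^ i)"
  proof -
    have "?Y = {U. sd 5 U \<and> {0} \<subseteq> U \<and> U \<subseteq> E}" using sd_zero by blast
    then show ?thesis using card_hyperplanes[of 0 "{0}" 5 E] E sd_0_iff[of "{0::nat\<Rightarrow>'a}"] sd_zero[OF E(1)] unfolding q_def by simp
  qed
  have "(\<Sum>U\<in>?Y. card {l\<in>L. l \<subseteq> U}) = (\<Sum>U\<in>?Y. \<Sum>l\<in>L. if l \<subseteq> U then 1 else 0)"
    using fin_L by (intro sum.cong[OF refl]) (simp add: sum.If_cases Int_def)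
  also have "\<dots> = (\<Sum>l\<in>L. \<Sum>U\<in>?Y. if l \<subseteq> U then 1 else 0)" by (rule sum.swap)
  also have "\<dots> = (\<Sum>l\<in>L. \<Sum>i\<le>3. q ^ i)"
  proof (rule sum.cong[OF refl])
    fix l assume l: "l \<in> L"
    have "?Y \<inter> {U. l \<subseteq> U} = {U. sd 5 U \<and> l \<subseteq> U \<and> U \<subseteq> E}" by blast
    moreover have "card {U. sd 5 U \<and> l \<subseteq> U \<and> U \<subseteq> E} = (\<Sum>i\<le>3. q ^ i)"
      using card_hyperplanes[of 2 l 5 E] E L_sd[OF l] LE l unfolding q_def by auto
    ultimately show "(\<Sum>U\<in>?Y. if l \<subseteq> U then 1 else 0) = (\<Sum>i\<le>3. q ^ i)" using fY by (simp add: sum.If_cases)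
  qed
  finally have 1: "(\<Sum>U\<in>?Y. card {l\<in>L. l \<subseteq> U}) = card L * (\<Sum>i\<le>3. q ^ i)" by simp
  have "(\<Sum>U\<in>?Y. card {l\<in>L. l \<subseteq> U}) \<le> (\<Sum>U\<in>?Y. q^3 - q^2 + 4 * q)"
    by (rule sum_mono) (use F4 E in blast)
  then have 2: "card L * (\<Sum>i\<le>3. q ^ i) \<le> card ?Y * (q^3 - q^2 + 4 * q)" using 1 by simp
  have "card L = card ?Y" using layers(1)[OF x] cY by (simp add: eval_nat_numeral)
  moreover have "card L > 0" using L_ne fin_L by auto
  ultimately have "(\<Sum>i\<le>3. q ^ i) \<le> q^3 - q^2 + 4 * q" using 2 by simp
  moreover have "(\<Sum>i\<le>3. q ^ i) = 1 + q + q^2 + q^3" by (simp add: eval_nat_numeral)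
  moreover have "2 * q \<le> q^2" using q2 by (simp add: power2_eq_square)
  moreover have "q^2 \<le> q^3" using q2 by (intro power_increasing) auto
  ultimately show False by linarith
qed

definition W where "W = vs.span (\<Union>L)"

lemma W_V: "W \<subseteq> V" unfolding W_def using vs.span_minimal[OF _ V(1)] L_V by blast

lemma L_W: "l \<in> L \<Longrightarrow> l \<subseteq> W" unfolding W_def using vs.span_superset by blast

lemma W_subspace: "vs.subspace W" unfolding W_def by (rule vs.subspace_span)

lemma P_W: "x \<in> P \<Longrightarrow> x \<in> W" using L_W P_line by blast

lemma H_W: "x \<in> P \<Longrightarrow> H x \<subseteq> W"
  unfolding H_def by (rule vs.span_minimal[OF _ W_subspace]) (auto simp: N2_def adj_iff dest: L_W)

lemma ex_opp: assumes x: "x \<in> P" shows "\<exists>y\<in>P. \<not> near x y"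
proof (rule ccontr)
  assume "\<not> ?thesis"
  then have "y \<in> H x" if "y \<in> P" for y using near_H that by blast
  then have "\<Union>L \<subseteq> H x" using sd_zero[OF H_sd[OF x]] unfolding P_def by blast
  moreover have "H x \<subseteq> V" using H_W[OF x] W_V by blast
  ultimately show False using not_in_sd6[OF H_sd[OF x]] by blast
qed

lemma opp_W:
  assumes x: "x \<in> P" and y: "y \<in> P" "\<not> near x y"
  shows "y \<notin> H x" "W = ssum (H x) (vs.span {y})" "sd 7 W"
proof -
  note sH = sd_subspace[OF H_sd[OF x]]
  let ?W = "ssum (H x) (vs.span {y})"
  have "\<Union>L \<subseteq> ?W" using opp_span[OF x y] sd_zero[OF H_sd[OF x]] ssum_ge1[OF vs.subspace_span, of "H x" "{y}"] unfolding P_def by blast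
  then have "W \<subseteq> ?W" unfolding W_def using vs.span_minimal[OF _ subspace_ssum[OF sH vs.subspace_span]] by blast
  moreover have "?W \<subseteq> W" using ssum_le[OF W_subspace H_W[OF x]] vs.span_minimal[of "{y}" W] W_subspace P_W[OF y(1)] by blast
  ultimately show e: "W = ?W" by blast
  show n: "y \<notin> H x"
  proof
    assume "y \<in> H x"
    then have "?W \<subseteq> H x" using ssum_le[OF sH] vs.span_minimal[OF _ sH, of "{y}"] by blast
    then have "\<Union>L \<subseteq> H x" using e L_W by blast
    moreover have "H x \<subseteq> V" using H_W[OF x] W_V by blast
    ultimately show False using not_in_sd6[OF H_sd[OF x]] by blast
  qed
  obtain k where k: "sd k (H x \<inter> vs.span {y})" "sd (6 + 1 - k) ?W" "k \<le> 1"
    using sd_int_sum[OF H_sd[OF x] sd_span1[OF P_nz[OF y(1)]]] by blast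
  have "k \<noteq> 1" using sd_eq[OF k(1) sd_span1[OF P_nz[OF y(1)]]] n vs.span_base[of y "{y}"] by blast
  then have "k = 0" using k(3) by simp
  then show "sd 7 W" using k(2) e by simp
qed

lemma H_iff: "x \<in> P \<Longrightarrow> y \<in> P \<Longrightarrow> y \<in> H x \<longleftrightarrow> near x y"
  using near_H opp_W(1) by blast

lemma W_sd: "sd 7 W"
proof -
  obtain l where "l \<in> L" using L_ne by blast
  then obtain x where x: "x \<in> P" using P_I sd_nz[OF L_sd] by fastforce
  then show ?thesis using ex_opp opp_W(3) by blast
qed

end

section \<open>Coordinates from an apartment\<close>

context flat_lines begin

text \<open>A frame: the six points of an apartment together with a vector in the intersection of their hyperplanes.\<close>
definition Fr where
  "Fr a0 a1 a2 a3 a4 a5 e \<longleftrightarrow>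
     a0 \<in> P \<and> a1 \<in> P \<and> a2 \<in> P \<and> a3 \<in> P \<and> a4 \<in> P \<and> a5 \<in> P \<and>
     a1 \<in> Pi a0 \<and> a2 \<in> Pi a1 \<and> a3 \<in> Pi a2 \<and> a4 \<in> Pi a3 \<and> a5 \<in> Pi a4 \<and> a0 \<in> Pi a5 \<and>
     \<not> near a0 a3 \<and> \<not> near a1 a4 \<and> \<not> near a2 a5 \<and>
     e \<noteq> 0 \<and> e \<in> H a0 \<and> e \<in> H a1 \<and> e \<in> H a2 \<and> e \<in> H a3 \<and> e \<in> H a4 \<and> e \<in> H a5"

lemma Fr_rot: "Fr a0 a1 a2 a3 a4 a5 e \<Longrightarrow> Fr a1 a2 a3 a4 a5 a0 e"
  unfolding Fr_def using near_sym[of a0 a3] by blast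

lemma Fr_ref: "Fr a0 a1 a2 a3 a4 a5 e \<Longrightarrow> Fr a0 a5 a4 a3 a2 a1 e"
  unfolding Fr_def
  using adj_sym[of a0 a1] adj_sym[of a1 a2] adj_sym[of a2 a3] adj_sym[of a3 a4] adj_sym[of a4 a5] adj_sym[of a5 a0]
    near_sym[of a1 a4] near_sym[of a2 a5] by blast

end

locale frame = flat_lines V L q for V :: "(nat \<Rightarrow> 'a::{field,finite}) set" and L q +
  fixes a0 a1 a2 a3 a4 a5 e :: "nat \<Rightarrow> 'a"
  assumes Fr: "Fr a0 a1 a2 a3 a4 a5 e"
begin

lemma aP: "a0 \<in> P" "a1 \<in> P" "a2 \<in> P" "a3 \<in> P" "a4 \<in> P" "a5 \<in> P" using Fr unfolding Fr_def by auto

lemma adj: "a1 \<in> Pi a0" "a2 \<in> Pi a1" "a3 \<in> Pi a2" "a4 \<in> Pi a3" "a5 \<in> Pi a4" "a0 \<in> Pi a5"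
  "a0 \<in> Pi a1" "a1 \<in> Pi a2" "a2 \<in> Pi a3" "a3 \<in> Pi a4" "a4 \<in> Pi a5" "a5 \<in> Pi a0"
  using Fr adj_sym unfolding Fr_def by blast+

lemma opp: "\<not> near a0 a3" "\<not> near a1 a4" "\<not> near a2 a5" "\<not> near a3 a0" "\<not> near a4 a1" "\<not> near a5 a2"
  using Fr near_sym unfolding Fr_def by blast+

lemma e0: "e \<noteq> 0" using Fr unfolding Fr_def by auto

lemma eH: "e \<in> H a0" "e \<in> H a1" "e \<in> H a2" "e \<in> H a3" "e \<in> H a4" "e \<in> H a5" using Fr unfolding Fr_def by auto

lemma near2: assumes "x \<in> Pi y" "z \<in> Pi y" "y \<in> P" shows "near x z"
  unfolding near_def using assms adj_sym P_nz by blast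

lemma self_near: "x \<in> P \<Longrightarrow> near x x" using adj_near Pi_self by blast

lemma aH:
  "a0 \<in> H a0" "a1 \<in> H a0" "a2 \<in> H a0" "a4 \<in> H a0" "a5 \<in> H a0"
  "a0 \<in> H a1" "a1 \<in> H a1" "a2 \<in> H a1" "a3 \<in> H a1" "a5 \<in> H a1"
  "a0 \<in> H a2" "a1 \<in> H a2" "a2 \<in> H a2" "a3 \<in> H a2" "a4 \<in> H a2"
  "a1 \<in> H a3" "a2 \<in> H a3" "a3 \<in> H a3" "a4 \<in> H a3" "a5 \<in> H a3"
  "a0 \<in> H a4" "a2 \<in> H a4" "a3 \<in> H a4" "a4 \<in> H a4" "a5 \<in> H a4"
  "a0 \<in> H a5" "a1 \<in> H a5" "a3 \<in> H a5" "a4 \<in> H a5" "a5 \<in> H a5"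
proof -
  note n = self_near[OF aP(1)] self_near[OF aP(2)] self_near[OF aP(3)] self_near[OF aP(4)] self_near[OF aP(5)] self_near[OF aP(6)]
    adj_near[OF aP(1) adj(1)] adj_near[OF aP(2) adj(2)] adj_near[OF aP(3) adj(3)] adj_near[OF aP(4) adj(4)] adj_near[OF aP(5) adj(5)] adj_near[OF aP(6) adj(6)]
    near2[OF adj(7,2) aP(2)] near2[OF adj(8,3) aP(3)] near2[OF adj(9,4) aP(4)] near2[OF adj(10,5) aP(5)] near2[OF adj(11,6) aP(6)] near2[OF adj(12,1) aP(1)]
  note n' = n[THEN near_sym[THEN iffD1]]
  note h = n[THEN near_H] n'[THEN near_H]
  show "a0 \<in> H a0" "a1 \<in> H a0" "a2 \<in> H a0" "a4 \<in> H a0" "a5 \<in> H a0"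
  "a0 \<in> H a1" "a1 \<in> H a1" "a2 \<in> H a1" "a3 \<in> H a1" "a5 \<in> H a1"
  "a0 \<in> H a2" "a1 \<in> H a2" "a2 \<in> H a2" "a3 \<in> H a2" "a4 \<in> H a2"
  "a1 \<in> H a3" "a2 \<in> H a3" "a3 \<in> H a3" "a4 \<in> H a3" "a5 \<in> H a3"
  "a0 \<in> H a4" "a2 \<in> H a4" "a3 \<in> H a4" "a4 \<in> H a4" "a5 \<in> H a4"
  "a0 \<in> H a5" "a1 \<in> H a5" "a3 \<in> H a5" "a4 \<in> H a5" "a5 \<in> H a5" by (fact h)+
qed

definition lc :: "(nat \<Rightarrow> 'a) \<Rightarrow> nat \<Rightarrow> 'a" where
  "lc c = c 0 *s a0 + c 1 *s a1 + c 2 *s a2 + c 3 *s a3 + c 4 *s a4 + c 5 *s a5 + c 6 *s e"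

lemma HsubI: "x \<in> P \<Longrightarrow> u \<in> H x \<Longrightarrow> v \<in> H x \<Longrightarrow> u + v \<in> H x" "x \<in> P \<Longrightarrow> u \<in> H x \<Longrightarrow> k *s u \<in> H x"
  "x \<in> P \<Longrightarrow> u \<in> H x \<Longrightarrow> v \<in> H x \<Longrightarrow> u - v \<in> H x"
  using sd_add[OF H_sd] sd_scale[OF H_sd] sd_diff[OF H_sd] by blast+

lemma opp_coeff:
  assumes "x \<in> P" "y \<in> P" "\<not> near x y" "h \<in> H x" shows "k *s y + h \<in> H x \<longleftrightarrow> k = 0"
proof
  assume a: "k *s y + h \<in> H x"
  have "(k *s y + h) - h \<in> H x" by (rule HsubI(3)[OF assms(1) a assms(4)])
  then have b: "k *s y \<in> H x" by simp
  show "k = 0"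
  proof (rule ccontr)
    assume "k \<noteq> 0"
    then have "y = inverse k *s (k *s y)" by simp
    then have "y \<in> H x" using HsubI(2)[OF assms(1) b, of "inverse k"] by simp
    then show False using opp_W(1)[OF assms(1,2,3)] by blast
  qed
next
  assume "k = 0" then show "k *s y + h \<in> H x" using assms by simp
qed

text \<open>The hyperplane of a vertex contains e and all vertices but the opposite one, so
  membership reads off a single coordinate, with the pairing 0-3, 1-4, 2-5. Independence of the
  frame follows from this.\<close>

lemma lc_H:
  "lc c \<in> H a0 \<longleftrightarrow> c 3 = 0" "lc c \<in> H a1 \<longleftrightarrow> c 4 = 0" "lc c \<in> H a2 \<longleftrightarrow> c 5 = 0"
  "lc c \<in> H a3 \<longleftrightarrow> c 0 = 0" "lc c \<in> H a4 \<longleftrightarrow> c 1 = 0" "lc c \<in> H a5 \<longleftrightarrow> c 2 = 0"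
proof -
  have 0: "lc c = c 3 *s a3 + (c 0 *s a0 + c 1 *s a1 + c 2 *s a2 + c 4 *s a4 + c 5 *s a5 + c 6 *s e)"
    and 1: "lc c = c 4 *s a4 + (c 0 *s a0 + c 1 *s a1 + c 2 *s a2 + c 3 *s a3 + c 5 *s a5 + c 6 *s e)"
    and 2: "lc c = c 5 *s a5 + (c 0 *s a0 + c 1 *s a1 + c 2 *s a2 + c 3 *s a3 + c 4 *s a4 + c 6 *s e)"
    and 3: "lc c = c 0 *s a0 + (c 1 *s a1 + c 2 *s a2 + c 3 *s a3 + c 4 *s a4 + c 5 *s a5 + c 6 *s e)"
    and 4: "lc c = c 1 *s a1 + (c 0 *s a0 + c 2 *s a2 + c 3 *s a3 + c 4 *s a4 + c 5 *s a5 + c 6 *s e)"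
    and 5: "lc c = c 2 *s a2 + (c 0 *s a0 + c 1 *s a1 + c 3 *s a3 + c 4 *s a4 + c 5 *s a5 + c 6 *s e)"
    unfolding lc_def by (simp_all add: add_ac)
  show "lc c \<in> H a0 \<longleftrightarrow> c 3 = 0" unfolding 0
    by (rule opp_coeff[OF aP(1) aP(4) opp(1)]) (intro HsubI aP aH eH)
  show "lc c \<in> H a1 \<longleftrightarrow> c 4 = 0" unfolding 1
    by (rule opp_coeff[OF aP(2) aP(5) opp(2)]) (intro HsubI aP aH eH)
  show "lc c \<in> H a2 \<longleftrightarrow> c 5 = 0" unfolding 2
    by (rule opp_coeff[OF aP(3) aP(6) opp(3)]) (intro HsubI aP aH eH)
  show "lc c \<in> H a3 \<longleftrightarrow> c 0 = 0" unfolding 3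
    by (rule opp_coeff[OF aP(4) aP(1) opp(4)]) (intro HsubI aP aH eH)
  show "lc c \<in> H a4 \<longleftrightarrow> c 1 = 0" unfolding 4
    by (rule opp_coeff[OF aP(5) aP(2) opp(5)]) (intro HsubI aP aH eH)
  show "lc c \<in> H a5 \<longleftrightarrow> c 2 = 0" unfolding 5
    by (rule opp_coeff[OF aP(6) aP(3) opp(6)]) (intro HsubI aP aH eH)
qed

lemma lc_0: "lc c = 0 \<Longrightarrow> i \<le> 6 \<Longrightarrow> c i = 0"
proof -
  assume z: "lc c = 0" and i: "i \<le> 6"
  have "c 0 = 0" "c 1 = 0" "c 2 = 0" "c 3 = 0" "c 4 = 0" "c 5 = 0"
    using lc_H[of c] sd_zero[OF H_sd] aP unfolding z by blast+
  moreover from this have "c 6 *s e = 0" using z unfolding lc_def by simp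
  then have "c 6 = 0" using e0 by simp
  moreover have "i = 0 \<or> i = 1 \<or> i = 2 \<or> i = 3 \<or> i = 4 \<or> i = 5 \<or> i = 6" using i by linarith
  ultimately show "c i = 0" by blast
qed

lemma lc_diff: "lc c - lc d = lc (\<lambda>i. c i - d i)"
  unfolding lc_def by (simp add: vs.scale_left_diff_distrib algebra_simps)

lemma lc_eq: "lc c = lc d \<Longrightarrow> i \<le> 6 \<Longrightarrow> c i = d i"
  using lc_0[of "\<lambda>i. c i - d i" i] lc_diff[of c d] by simp

lemma aW [simp]: "a0 \<in> W" "a1 \<in> W" "a2 \<in> W" "a3 \<in> W" "a4 \<in> W" "a5 \<in> W" "e \<in> W"
  using P_W aP H_W[OF aP(1)] eH by blast+

lemma W_closed [simp]: "x \<in> W \<Longrightarrow> y \<in> W \<Longrightarrow> x + y \<in> W" "x \<in> W \<Longrightarrow> k *s x \<in> W" "x \<in> W \<Longrightarrow> y \<in> W \<Longrightarrow> x - y \<in> W" "0 \<in> W"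
  using sd_add[OF W_sd] sd_scale[OF W_sd] sd_diff[OF W_sd] sd_zero[OF W_sd] by blast+

lemma lc_W: "lc c \<in> W" unfolding lc_def by simp

lemma W_lc: assumes w: "w \<in> W" shows "\<exists>c. w = lc c"
proof -
  let ?D = "\<Pi>\<^sub>E i\<in>{..<7::nat}. (UNIV :: 'a set)"
  have inj: "inj_on lc ?D"
  proof (rule inj_onI)
    fix c d assume c: "c \<in> ?D" "d \<in> ?D" "lc c = lc d"
    show "c = d"
    proof
      fix i show "c i = d i" using lc_eq[OF c(3), of i] c(1,2) by (cases "i < 7") (auto simp: PiE_def extensional_def)
    qed
  qed
  have "card (lc ` ?D) = q ^ 7" using card_image[OF inj] card_coeffs[of 7, where 'a='a] unfolding q_def by simp
  moreover have "lc ` ?D \<subseteq> W" using lc_W by blast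
  moreover have "card W = q ^ 7" using W_sd by (simp add: sd_q)
  ultimately have "lc ` ?D = W" using card_subset_eq[OF sd_finite[OF W_sd]] by metis
  then show ?thesis using w by blast
qed

text \<open>The value 0 at indices above 6 lets the linearity rules on \<open>W\<close> hold for
  every index.\<close>

definition co :: "nat \<Rightarrow> (nat \<Rightarrow> 'a) \<Rightarrow> 'a" where
  "co i v = (if v \<in> W \<and> i \<le> 6 then (SOME c. v = lc c) i else 0)"

lemma co_lc: "i \<le> 6 \<Longrightarrow> co i (lc c) = c i"
proof -
  assume i: "i \<le> 6"
  have "lc c = lc (SOME d. lc c = lc d)" by (rule someI[of "\<lambda>d. lc c = lc d" c]) simp
  then have "(SOME d. lc c = lc d) i = c i" using lc_eq[OF _ i] by metis
  then show ?thesis unfolding co_def using lc_W i by simp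
qed

lemma lc_co: "v \<in> W \<Longrightarrow> v = lc (\<lambda>i. co i v)"
proof -
  assume v: "v \<in> W"
  then obtain c where c: "v = lc c" using W_lc by blast
  have "lc c = lc (\<lambda>i. co i v)" unfolding c by (subst (1 2) lc_def) (simp add: co_lc)
  then show ?thesis using c by simp
qed

lemma co_add [simp]: "x \<in> W \<Longrightarrow> y \<in> W \<Longrightarrow> co i (x + y) = co i x + co i y"
proof (cases "i \<le> 6")
  case True
  assume w: "x \<in> W" "y \<in> W"
  then obtain c d where c: "x = lc c" "y = lc d" using W_lc by metis
  have "x + y = lc (\<lambda>i. c i + d i)" unfolding c lc_def by (simp add: vs.scale_left_distrib add_ac)
  then show ?thesis using True c by (simp add: co_lc)
qed (simp add: co_def)

lemma co_scl [simp]: "x \<in> W \<Longrightarrow> co i (k *s x) = k * co i x"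
proof (cases "i \<le> 6")
  case True
  assume w: "x \<in> W"
  then obtain c where c: "x = lc c" using W_lc by metis
  have "k *s x = lc (\<lambda>i. k * c i)" unfolding c lc_def by (simp add: vs.scale_right_distrib)
  then show ?thesis using True c by (simp add: co_lc)
qed (simp add: co_def)

lemma co_diff [simp]: "x \<in> W \<Longrightarrow> y \<in> W \<Longrightarrow> co i (x - y) = co i x - co i y"
proof -
  assume w: "x \<in> W" "y \<in> W"
  have "co i (x + (-1) *s y) = co i x + (-1) * co i y" using w by (simp only: co_add co_scl W_closed)
  then show ?thesis by simp
qed

lemma co_zero [simp]: "co i 0 = 0" using co_scl[of 0 i 0] by simp

lemma co_basis [simp]:
  "co i a0 = (if i = 0 then 1 else 0)" "co i a1 = (if i = 1 then 1 else 0)" "co i a2 = (if i = 2 then 1 else 0)"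
  "co i a3 = (if i = 3 then 1 else 0)" "co i a4 = (if i = 4 then 1 else 0)" "co i a5 = (if i = 5 then 1 else 0)"
  "co i e = (if i = 6 then 1 else 0)"
proof -
  have b: "a0 = lc (\<lambda>i. if i = 0 then 1 else 0)" "a1 = lc (\<lambda>i. if i = 1 then 1 else 0)" "a2 = lc (\<lambda>i. if i = 2 then 1 else 0)"
    "a3 = lc (\<lambda>i. if i = 3 then 1 else 0)" "a4 = lc (\<lambda>i. if i = 4 then 1 else 0)" "a5 = lc (\<lambda>i. if i = 5 then 1 else 0)"
    "e = lc (\<lambda>i. if i = 6 then 1 else 0)" unfolding lc_def by simp_all
  have g: "co i (lc (\<lambda>i. if i = j then 1 else 0)) = (if i = j then 1 else 0)" if "j \<le> 6" for j
  proof (cases "i \<le> 6")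
    case True
    then show ?thesis by (rule co_lc)
  next
    case False
    then show ?thesis using that by (auto simp: co_def)
  qed
  show "co i a0 = (if i = 0 then 1 else 0)" "co i a1 = (if i = 1 then 1 else 0)" "co i a2 = (if i = 2 then 1 else 0)"
  "co i a3 = (if i = 3 then 1 else 0)" "co i a4 = (if i = 4 then 1 else 0)" "co i a5 = (if i = 5 then 1 else 0)"
  "co i e = (if i = 6 then 1 else 0)"
    by (subst b, rule g, simp)+
qed

lemma H_co:
  assumes "v \<in> W"
  shows "v \<in> H a0 \<longleftrightarrow> co 3 v = 0" "v \<in> H a1 \<longleftrightarrow> co 4 v = 0" "v \<in> H a2 \<longleftrightarrow> co 5 v = 0"
  "v \<in> H a3 \<longleftrightarrow> co 0 v = 0" "v \<in> H a4 \<longleftrightarrow> co 1 v = 0" "v \<in> H a5 \<longleftrightarrow> co 2 v = 0"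
  using lc_H[of "\<lambda>i. co i v"] lc_co[OF assms] by simp_all

lemma near_co:
  assumes "v \<in> P"
  shows "near a0 v \<longleftrightarrow> co 3 v = 0" "near a1 v \<longleftrightarrow> co 4 v = 0" "near a2 v \<longleftrightarrow> co 5 v = 0"
  "near a3 v \<longleftrightarrow> co 0 v = 0" "near a4 v \<longleftrightarrow> co 1 v = 0" "near a5 v \<longleftrightarrow> co 2 v = 0"
  using H_co[OF P_W[OF assms]] H_iff[OF aP(1) assms] H_iff[OF aP(2) assms] H_iff[OF aP(3) assms]
    H_iff[OF aP(4) assms] H_iff[OF aP(5) assms] H_iff[OF aP(6) assms] by simp_all

lemma co_expand: "v \<in> W \<Longrightarrow> v = co 0 v *s a0 + co 1 v *s a1 + co 2 v *s a2 + co 3 v *s a3 + co 4 v *s a4 + co 5 v *s a5 + co 6 v *s e"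
  using lc_co[of v] unfolding lc_def .

lemma co_nz: "co i v \<noteq> 0 \<Longrightarrow> v \<noteq> 0" by auto

lemma not_span1: "y \<in> W \<Longrightarrow> co i y = 0 \<Longrightarrow> co i x \<noteq> 0 \<Longrightarrow> x \<notin> vs.span {y}"
  by (auto simp: span1_iff)

lemma Pi_a0: "Pi a0 = vs.span {a0, a1, a5}"
  by (rule Pi_span[OF aP(1) adj(1) adj(12)]) (rule not_span1[of _ 1] , simp_all, auto simp: span2_iff dest!: arg_cong[where f = "co 5"])

lemma in_Pi_a0: "v \<in> Pi a0 \<longleftrightarrow> v \<in> W \<and> co 2 v = 0 \<and> co 3 v = 0 \<and> co 4 v = 0 \<and> co 6 v = 0"
proof
  assume "v \<in> Pi a0"
  then obtain x y z where "v = x *s a0 + y *s a1 + z *s a5" unfolding Pi_a0 span3_iff by blast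
  then show "v \<in> W \<and> co 2 v = 0 \<and> co 3 v = 0 \<and> co 4 v = 0 \<and> co 6 v = 0" by simp
next
  assume a: "v \<in> W \<and> co 2 v = 0 \<and> co 3 v = 0 \<and> co 4 v = 0 \<and> co 6 v = 0"
  then have "v = co 0 v *s a0 + co 1 v *s a1 + co 5 v *s a5" using co_expand[of v] by simp
  then show "v \<in> Pi a0" unfolding Pi_a0 span3_iff by blast
qed

end

context flat_lines begin

lemma frameI: "Fr a0 a1 a2 a3 a4 a5 e \<Longrightarrow> frame V L q a0 a1 a2 a3 a4 a5 e"
  by unfold_locales

end

section \<open>Structure constants of an apartment\<close>

context frame begin

lemma PiI: "x \<in> P \<Longrightarrow> u \<in> Pi x \<Longrightarrow> v \<in> Pi x \<Longrightarrow> u + v \<in> Pi x" "x \<in> P \<Longrightarrow> u \<in> Pi x \<Longrightarrow> k *s u \<in> Pi x"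
  "x \<in> P \<Longrightarrow> u \<in> Pi x \<Longrightarrow> v \<in> Pi x \<Longrightarrow> u - v \<in> Pi x"
  using sd_add[OF Pi_sd] sd_scale[OF Pi_sd] sd_diff[OF Pi_sd] by blast+

lemma Pi_W: "x \<in> Pi y \<Longrightarrow> x \<in> W" using L_W unfolding adj_iff by blast

lemma Pi_a1: "v \<in> Pi a1 \<Longrightarrow> co 3 v = 0 \<and> co 4 v = 0 \<and> co 5 v = 0 \<and> co 6 v = 0"
  and Pi_a2: "v \<in> Pi a2 \<Longrightarrow> co 0 v = 0 \<and> co 4 v = 0 \<and> co 5 v = 0 \<and> co 6 v = 0"
  and Pi_a4: "v \<in> Pi a4 \<Longrightarrow> co 0 v = 0 \<and> co 1 v = 0 \<and> co 2 v = 0 \<and> co 6 v = 0"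
proof -
  note r1 = Fr_rot[OF Fr] note r2 = Fr_rot[OF r1] note r3 = Fr_rot[OF r2] note r4 = Fr_rot[OF r3]
  show "v \<in> Pi a1 \<Longrightarrow> co 3 v = 0 \<and> co 4 v = 0 \<and> co 5 v = 0 \<and> co 6 v = 0"
    unfolding frame.Pi_a0[OF frameI[OF r1]] span3_iff by auto
  show "v \<in> Pi a2 \<Longrightarrow> co 0 v = 0 \<and> co 4 v = 0 \<and> co 5 v = 0 \<and> co 6 v = 0"
    unfolding frame.Pi_a0[OF frameI[OF r2]] span3_iff by auto
  show "v \<in> Pi a4 \<Longrightarrow> co 0 v = 0 \<and> co 1 v = 0 \<and> co 2 v = 0 \<and> co 6 v = 0"
    unfolding frame.Pi_a0[OF frameI[OF r4]] span3_iff by auto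
qed

text \<open>The point p = a5 + \<sigma> a3 has no a4-coordinate, so it has a common neighbour v with
  a1. In turn v is near a4 and loses its a1-coordinate, which leaves a combination of a0 and
  a2.\<close>

lemma diagonal_partner: "\<exists>s. a5 + \<sigma> *s a3 \<in> Pi (a0 + s *s a2) \<and> (\<sigma> \<noteq> 0 \<longrightarrow> s \<noteq> 0)"
proof -
  let ?p = "a5 + \<sigma> *s a3"
  have p4: "?p \<in> Pi a4" by (intro PiI aP adj)
  have p0: "?p \<noteq> 0" by (rule co_nz[of 5]) simp
  have pP: "?p \<in> P" using adj_P[OF p4 p0] .
  have "near a1 ?p" using near_co(2)[OF pP] by simp
  then obtain v where v: "v \<noteq> 0" "v \<in> Pi a1" "v \<in> Pi ?p" unfolding near_def by blast
  have vP: "v \<in> P" using adj_P v by blast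
  have vW: "v \<in> W" using P_W[OF vP] .
  have "near a4 v" unfolding near_def using p4 p0 v adj_sym by blast
  then have "co 1 v = 0" using near_co(5)[OF vP] by simp
  then have ve: "v = co 0 v *s a0 + co 2 v *s a2" using co_expand[OF vW] Pi_a1[OF v(2)] by simp
  have x0: "co 0 v \<noteq> 0"
  proof
    assume z: "co 0 v = 0"
    then have "v = co 2 v *s a2" using ve by simp
    moreover from this have "co 2 v \<noteq> 0" using v by auto
    ultimately have "Pi v = Pi a2" using scale_in_Pi[OF P_nz[OF aP(3)]] by metis
    then have "?p \<in> Pi a2" using v adj_sym by blast
    then show False using Pi_a2[of ?p] by simp
  qed
  let ?s = "co 2 v / co 0 v"
  have "v = co 0 v *s (a0 + ?s *s a2)" using ve x0 by (simp add: vs.scale_right_distrib)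
  moreover have z0: "a0 + ?s *s a2 \<noteq> 0" by (rule co_nz[of 0]) simp
  ultimately have e: "Pi v = Pi (a0 + ?s *s a2)" using scale_in_Pi[OF z0 x0] by simp
  have m: "?p \<in> Pi (a0 + ?s *s a2)" using e v adj_sym by blast
  moreover have "?s \<noteq> 0" if "\<sigma> \<noteq> 0"
  proof
    assume "?s = 0"
    then have "a0 + ?s *s a2 = a0" by (simp only:) simp
    then have "?p \<in> Pi a0" using m by (simp only:)
    then show False using in_Pi_a0[of ?p] that by simp
  qed
  ultimately show ?thesis by blast
qed

text \<open>The edge a2a3 has a point near a0 + \<tau> a5, and a common neighbour of these two
  points is near a0, a5, a2 and a3, hence a combination of a1, e and a4. The substance is that no
  coefficient vanishes: for a1 and a4 this follows from \<open>near_line\<close>; without an e-part,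
  the pencil of a0 + \<tau> a5 would be a third one in the solid spanned by \<open>Pi a0\<close> and
  \<open>Pi a5\<close>.\<close>

lemma edge_common_neighbour:
  assumes t: "\<tau> \<noteq> 0"
  shows "\<exists>\<tau>' c d. \<tau>' \<noteq> 0 \<and> c \<noteq> 0 \<and> d \<noteq> 0 \<and> a1 + c *s e + d *s a4 \<in> Pi (a0 + \<tau> *s a5) \<and> a1 + c *s e + d *s a4 \<in> Pi (a2 + \<tau>' *s a3)"
proof -
  let ?y = "a0 + \<tau> *s a5"
  have y05: "?y \<in> Pi a0" "?y \<in> Pi a5" by (intro PiI aP adj Pi_self)+
  have y0: "?y \<noteq> 0" by (rule co_nz[of 0]) simp
  have yP: "?y \<in> P" using adj_P[OF y05(1) y0] .
  have n23: "a3 \<notin> vs.span {a2}" by (rule not_span1[of _ 3]) simp_all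
  have m: "vs.span {a2,a3} \<in> L" using adj_line[OF aP(3) adj(3) n23] .
  obtain w where w: "w \<in> vs.span {a2,a3}" "w \<noteq> 0" "near ?y w" using hexagon_proj[OF yP m] by blast
  obtain \<mu> \<nu> where we: "w = \<mu> *s a2 + \<nu> *s a3" using w(1) unfolding span2_iff by blast
  have mu: "\<mu> \<noteq> 0"
  proof
    assume z: "\<mu> = 0"
    then have "a3 \<in> vs.span {w}" using w(2) we span1_sym[of w a3] by (auto simp: span1_iff)
    then have "near ?y a3" using near_span[OF w(3,2) P_nz[OF aP(4)]] by blast
    then show False using near_co(4)[OF yP] near_sym[of ?y a3] by simp
  qed
  have nu: "\<nu> \<noteq> 0"
  proof
    assume z: "\<nu> = 0"
    then have "a2 \<in> vs.span {w}" using w(2) we span1_sym[of w a2] by (auto simp: span1_iff)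
    then have "near ?y a2" using near_span[OF w(3,2) P_nz[OF aP(3)]] by blast
    then show False using near_co(3)[OF yP] near_sym[of ?y a2] t by simp
  qed
  let ?t = "\<nu> / \<mu>"
  let ?y' = "a2 + ?t *s a3"
  have we': "w = \<mu> *s ?y'" using we mu by (simp add: vs.scale_right_distrib)
  have y'0: "?y' \<noteq> 0" by (rule co_nz[of 2]) simp
  have Pw: "Pi w = Pi ?y'" using scale_in_Pi[OF y'0 mu] we' by simp
  have y'23: "?y' \<in> Pi a2" "?y' \<in> Pi a3" by (intro PiI aP adj Pi_self)+
  have y'P: "?y' \<in> P" using adj_P[OF y'23(1) y'0] .
  obtain v where v: "v \<noteq> 0" "v \<in> Pi ?y" "v \<in> Pi ?y'" using w(3) Pw unfolding near_def by blast
  have vP: "v \<in> P" using adj_P v by blast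
  have vW: "v \<in> W" using P_W[OF vP] .
  have vy: "?y \<in> Pi v" "?y' \<in> Pi v" using v adj_sym by blast+
  have "near a0 v" "near a5 v" "near a2 v" "near a3 v"
    using near2[of _ ?y v] near2[of _ ?y' v] y05 y'23 yP y'P v adj_sym by blast+
  then have c0: "co 3 v = 0" "co 2 v = 0" "co 5 v = 0" "co 0 v = 0" using near_co[OF vP] by simp_all
  have ve: "v = co 1 v *s a1 + co 6 v *s e + co 4 v *s a4" using co_expand[OF vW] c0 by (simp add: add_ac)
  have nvy: "v \<notin> vs.span {?y}"
  proof
    assume "v \<in> vs.span {?y}"
    then obtain k where k: "v = k *s ?y" unfolding span1_iff by blast
    have "co 0 v = k" unfolding k by simp
    then show False using c0 k v by simp
  qed
  have l: "vs.span {?y,v} \<in> L" using adj_line[OF yP v(2) nvy] .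
  have in2: "?y \<in> vs.span {?y,v}" "v \<in> vs.span {?y,v}" by (simp_all add: vs.span_base)
  have d4: "co 4 v \<noteq> 0"
  proof
    assume z: "co 4 v = 0"
    then have n1: "near a1 v" using near_co(2)[OF vP] by simp
    have n2: "near a1 ?y" using near_co(2)[OF yP] by simp
    obtain p where p: "p \<in> vs.span {?y,v}" "p \<noteq> 0" "p \<in> Pi a1"
      using near_line[OF aP(2) l in2(1) y0 n2 in2(2) n1 nvy] by blast
    obtain \<alpha> \<beta> where pe: "p = \<alpha> *s ?y + \<beta> *s v" using p(1) unfolding span2_iff by blast
    have "co 5 p = \<alpha> * \<tau>" unfolding pe using vW c0 by simp
    then have "\<alpha> = 0" using Pi_a1[OF p(3)] t by simp
    then have pv: "p = \<beta> *s v" using pe by simp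
    then have b0: "\<beta> \<noteq> 0" using p by auto
    have "co 6 p = \<beta> * co 6 v" unfolding pv using vW by simp
    then have "co 6 v = 0" using Pi_a1[OF p(3)] b0 by simp
    then have v1: "v = co 1 v *s a1" using ve z by simp
    then have k0: "co 1 v \<noteq> 0" using v(1) by auto
    have "Pi v = Pi a1" using scale_in_Pi[OF P_nz[OF aP(2)] k0] v1 by simp
    then have "?y \<in> Pi a1" using vy by simp
    then show False using Pi_a1[of ?y] t by simp
  qed
  have d1: "co 1 v \<noteq> 0"
  proof
    assume z: "co 1 v = 0"
    then have n1: "near a4 v" using near_co(5)[OF vP] by simp
    have n2: "near a4 ?y" using near_co(5)[OF yP] by simp
    obtain p where p: "p \<in> vs.span {?y,v}" "p \<noteq> 0" "p \<in> Pi a4"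
      using near_line[OF aP(5) l in2(1) y0 n2 in2(2) n1 nvy] by blast
    obtain \<alpha> \<beta> where pe: "p = \<alpha> *s ?y + \<beta> *s v" using p(1) unfolding span2_iff by blast
    have "co 0 p = \<alpha>" unfolding pe using vW c0 by simp
    then have "\<alpha> = 0" using Pi_a4[OF p(3)] by simp
    then have pv: "p = \<beta> *s v" using pe by simp
    then have b0: "\<beta> \<noteq> 0" using p by auto
    have "co 6 p = \<beta> * co 6 v" unfolding pv using vW by simp
    then have "co 6 v = 0" using Pi_a4[OF p(3)] b0 by simp
    then have v1: "v = co 4 v *s a4" using ve z by simp
    then have k0: "co 4 v \<noteq> 0" using v(1) by auto
    have "Pi v = Pi a4" using scale_in_Pi[OF P_nz[OF aP(5)] k0] v1 by simp
    then have "?y \<in> Pi a4" using vy by simp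
    then show False using Pi_a4[of ?y] by simp
  qed
  have d6: "co 6 v \<noteq> 0"
  proof
    assume z: "co 6 v = 0"
    have n05: "a5 \<notin> vs.span {a0}" by (rule not_span1[of _ 5]) simp_all
    let ?S = "ssum (Pi a0) (Pi a5)"
    have S: "sd 4 ?S" using Pi_int_adj(2)[OF aP(1) adj(12) n05] .
    have SS: "Pi a0 \<subseteq> ?S" "Pi a5 \<subseteq> ?S" using ssum_ge1[OF sd_subspace[OF Pi_sd[OF aP(6)]]] ssum_ge2[OF sd_subspace[OF Pi_sd[OF aP(1)]]] by blast+
    have vS: "v \<in> ?S"
    proof -
      have "v = co 1 v *s a1 + co 4 v *s a4" using ve z by simp
      moreover have "a1 \<in> ?S" "a4 \<in> ?S" using SS adj by blast+
      ultimately show ?thesis using sd_add[OF S sd_scale[OF S] sd_scale[OF S]] by metis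
    qed
    have a0y: "a0 \<in> Pi ?y" using y05 adj_sym by blast
    have n1: "a0 \<notin> vs.span {?y}"
    proof
      assume "a0 \<in> vs.span {?y}"
      then obtain k where k: "a0 = k *s ?y" unfolding span1_iff by blast
      have "co 5 a0 = k * \<tau>" "co 0 a0 = k" by (subst k, simp)+
      then show False using t by simp
    qed
    have n2: "v \<notin> vs.span {?y, a0}"
    proof
      assume "v \<in> vs.span {?y,a0}"
      then obtain k j where k: "v = k *s ?y + j *s a0" unfolding span2_iff by blast
      have "co 1 v = 0" unfolding k by simp
      then show False using d1 by simp
    qed
    have "Pi ?y = vs.span {?y, a0, v}" using Pi_span[OF yP a0y v(2) n1 n2] .
    also have "\<dots> \<subseteq> ?S" using sd_span_le[OF S, of "{?y,a0,v}"] vS SS y05(1) Pi_self[OF aP(1)] by blast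
    finally have yS: "Pi ?y \<subseteq> ?S" .
    have n3: "?y \<notin> vs.span {a0}" by (rule not_span1[of _ 5]) (use t in simp_all)
    have n4: "?y \<notin> vs.span {a5}" by (rule not_span1[of _ 0]) simp_all
    show False using pencils3[OF S ssum_line_V[OF Pi_V Pi_V] aP(1) aP(6) yP SS yS n05 n3 n4] .
  qed
  let ?c = "co 6 v / co 1 v" and ?d = "co 4 v / co 1 v"
  let ?v = "a1 + ?c *s e + ?d *s a4"
  have "?v = inverse (co 1 v) *s (co 1 v *s a1 + co 6 v *s e + co 4 v *s a4)" using d1
    by (simp add: vs.scale_right_distrib divide_inverse mult.commute)
  then have v': "?v = inverse (co 1 v) *s v" using ve by simp
  have "?v \<in> Pi ?y" "?v \<in> Pi ?y'" unfolding v' using PiI(2) yP y'P v by blast+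
  then show ?thesis using d1 d4 d6 mu nu by (intro exI[of _ ?t] exI[of _ ?c] exI[of _ ?d]) simp
qed

text \<open>The line joining the two diagonal points lies in the 4-space spanned by the pencils of v
  = a1 + c e + d a4 and of its two neighbours on the edges. By \<open>tripod_meet\<close> it meets
  \<open>Pi v\<close>, and the coordinates of the meeting point give the relation.\<close>

lemma diagonal_edge_relation:
  assumes p: "a5 + \<sigma> *s a3 \<in> Pi (a0 + s *s a2)"
    and v: "a1 + c *s e + d *s a4 \<in> Pi (a0 + \<tau> *s a5)" "a1 + c *s e + d *s a4 \<in> Pi (a2 + \<tau>' *s a3)" "c \<noteq> 0"
  shows "\<tau> * \<sigma> = s * \<tau>'"
proof -
  let ?p = "a5 + \<sigma> *s a3" and ?z = "a0 + s *s a2" and ?y = "a0 + \<tau> *s a5" and ?y' = "a2 + \<tau>' *s a3" and ?v = "a1 + c *s e + d *s a4"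
  have v0: "?v \<noteq> 0" by (rule co_nz[of 1]) simp
  have vP: "?v \<in> P" using adj_P v v0 by blast
  have z0: "?z \<noteq> 0" by (rule co_nz[of 0]) simp
  have "?z \<in> Pi a1" by (intro PiI aP adj)
  then have zP: "?z \<in> P" using adj_P z0 by blast
  have npz: "?p \<notin> vs.span {?z}" by (rule not_span1[of _ 5]) simp_all
  have n: "vs.span {?z,?p} \<in> L" using adj_line[OF zP p npz] .
  have yv: "?y \<in> Pi ?v" "?y' \<in> Pi ?v" using v adj_sym by blast+
  have n1: "?y \<notin> vs.span {?v}" by (rule not_span1[of _ 0]) simp_all
  have n2: "?y' \<notin> vs.span {?v,?y}"
  proof
    assume "?y' \<in> vs.span {?v,?y}"
    then obtain k j where k: "?y' = k *s ?v + j *s ?y" unfolding span2_iff by blast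
    have "co 2 ?y' = 0" by (subst k) simp
    then show False by simp
  qed
  let ?U = "ssum (ssum (Pi ?v) (Pi ?y)) (Pi ?y')"
  note t = tripod_sd[OF vP yv(1) n1 yv(2) n2]
  have "?y \<in> Pi a0" "?y \<in> Pi a5" "?y' \<in> Pi a2" "?y' \<in> Pi a3" by (intro PiI aP adj Pi_self)+
  then have "a0 \<in> Pi ?y" "a5 \<in> Pi ?y" "a2 \<in> Pi ?y'" "a3 \<in> Pi ?y'" using adj_sym by blast+
  then have "a0 \<in> ?U" "a5 \<in> ?U" "a2 \<in> ?U" "a3 \<in> ?U" using t(3,4) by blast+
  then have "?z \<in> ?U" "?p \<in> ?U" using sd_add[OF t(1)] sd_scale[OF t(1)] by blast+
  then have nU: "vs.span {?z,?p} \<subseteq> ?U" using sd_span_le[OF t(1), of "{?z,?p}"] by simp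
  obtain r where r: "r \<in> vs.span {?z,?p}" "r \<in> Pi ?v" "r \<noteq> 0" using tripod_meet[OF vP yv(1) n1 yv(2) n2 n nU] by blast
  obtain \<xi> \<eta> where r1: "r = \<xi> *s ?z + \<eta> *s ?p" using r(1) unfolding span2_iff by blast
  have "r \<in> vs.span {?v,?y,?y'}" using r(2) Pi_span[OF vP yv n1 n2] by simp
  then obtain \<alpha> \<beta> \<gamma> where r2: "r = \<alpha> *s ?v + \<beta> *s ?y + \<gamma> *s ?y'" unfolding span3_iff by blast
  have eq: "co i (\<xi> *s ?z + \<eta> *s ?p) = co i (\<alpha> *s ?v + \<beta> *s ?y + \<gamma> *s ?y')" for i using r1 r2 by simp
  have "\<xi> = \<beta>" "\<xi> * s = \<gamma>" "\<eta> * \<sigma> = \<gamma> * \<tau>'" "\<eta> = \<beta> * \<tau>" using eq[of 0] eq[of 2] eq[of 3] eq[of 5] by simp_all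
  then have "\<xi> * (\<tau> * \<sigma>) = \<xi> * (s * \<tau>')" by (metis mult.assoc)
  moreover have "\<xi> \<noteq> 0"
  proof
    assume "\<xi> = 0"
    then have "\<eta> = 0" using \<open>\<xi> = \<beta>\<close> \<open>\<eta> = \<beta> * \<tau>\<close> by simp
    then show False using r1 r(3) \<open>\<xi> = 0\<close> by simp
  qed
  ultimately show ?thesis by simp
qed

text \<open>In \<open>diagonal_edge_relation\<close>, one fixed pair of edge points makes the
  matching of the diagonals linear with factor \<kappa>; then one fixed pair of diagonal points
  makes the matching of the edges linear with the same factor.\<close>

lemma kappa_exists: "\<exists>\<kappa>. \<kappa> \<noteq> 0 \<and> (\<forall>s. a5 + (\<kappa> * s) *s a3 \<in> Pi (a0 + s *s a2)) \<and>
   (\<forall>\<tau>. \<tau> \<noteq> 0 \<longrightarrow> (\<exists>c d. c \<noteq> 0 \<and> d \<noteq> 0 \<and> a1 + c *s e + d *s a4 \<in> Pi (a0 + \<tau> *s a5) \<and> a1 + c *s e + d *s a4 \<in> Pi (a2 + (\<kappa> * \<tau>) *s a3)))"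
proof -
  obtain \<kappa> c d where k: "\<kappa> \<noteq> 0" "c \<noteq> 0" "d \<noteq> 0" "a1 + c *s e + d *s a4 \<in> Pi (a0 + 1 *s a5)" "a1 + c *s e + d *s a4 \<in> Pi (a2 + \<kappa> *s a3)"
    using edge_common_neighbour[of 1] by auto
  have s1: "a5 + (\<kappa> * s) *s a3 \<in> Pi (a0 + s *s a2)" for s
  proof -
    obtain s' where s': "a5 + (\<kappa> * s) *s a3 \<in> Pi (a0 + s' *s a2)" using diagonal_partner by blast
    have "1 * (\<kappa> * s) = s' * \<kappa>" using diagonal_edge_relation[OF s' k(4,5,2)] .
    then have "s' = s" using k(1) by simp
    then show ?thesis using s' by simp
  qed
  have "\<exists>c d. c \<noteq> 0 \<and> d \<noteq> 0 \<and> a1 + c *s e + d *s a4 \<in> Pi (a0 + \<tau> *s a5) \<and> a1 + c *s e + d *s a4 \<in> Pi (a2 + (\<kappa> * \<tau>) *s a3)"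
    if t: "\<tau> \<noteq> 0" for \<tau>
  proof -
    obtain \<tau>' c d where t': "c \<noteq> 0" "d \<noteq> 0" "a1 + c *s e + d *s a4 \<in> Pi (a0 + \<tau> *s a5)" "a1 + c *s e + d *s a4 \<in> Pi (a2 + \<tau>' *s a3)"
      using edge_common_neighbour[OF t] by blast
    have "\<tau> * (\<kappa> * 1) = 1 * \<tau>'" using diagonal_edge_relation[OF s1[of 1] t'(3,4,1)] .
    then have "\<tau>' = \<kappa> * \<tau>" by (simp add: mult.commute)
    then show ?thesis using t' by blast
  qed
  then show ?thesis using k(1) s1 by blast
qed

end

context flat_lines begin

text \<open>The structure constants \<open>\<kappa>\<close> and \<open>\<rho>\<close> of a frame at its vertex \<open>a1\<close>; those at the other vertices are obtained by rotating the frame.\<close>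
definition VD where
  "VD a0 a1 a2 a3 a4 a5 e \<kappa> \<rho> \<longleftrightarrow> \<kappa> \<noteq> 0 \<and> \<rho> \<noteq> 0 \<and>
    (\<forall>s. a5 + (\<kappa> * s) *s a3 \<in> Pi (a0 + s *s a2)) \<and>
    (\<forall>\<tau>. \<tau> \<noteq> 0 \<longrightarrow> (\<exists>c d. c \<noteq> 0 \<and> d \<noteq> 0 \<and> a1 + c *s e + d *s a4 \<in> Pi (a0 + \<tau> *s a5) \<and> a1 + c *s e + d *s a4 \<in> Pi (a2 + (\<kappa> * \<tau>) *s a3))) \<and>
    (\<forall>t. \<exists>\<delta>. a5 + (\<rho> * t) *s e + \<delta> *s a2 \<in> Pi (a0 + t *s a1)) \<and>
    (\<forall>t. \<exists>d. a3 + (\<rho> * t / \<kappa>) *s e + d *s a0 \<in> Pi (a2 + t *s a1))"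

lemma VD_dest:
  assumes "VD a0 a1 a2 a3 a4 a5 e \<kappa> \<rho>"
  shows VD_k: "\<kappa> \<noteq> 0" and VD_r: "\<rho> \<noteq> 0" and VD1: "a5 + (\<kappa> * s) *s a3 \<in> Pi (a0 + s *s a2)"
    and VD2: "\<tau> \<noteq> 0 \<Longrightarrow> \<exists>c d. c \<noteq> 0 \<and> d \<noteq> 0 \<and> a1 + c *s e + d *s a4 \<in> Pi (a0 + \<tau> *s a5) \<and> a1 + c *s e + d *s a4 \<in> Pi (a2 + (\<kappa> * \<tau>) *s a3)"
    and VD3: "\<exists>\<delta>. a5 + (\<rho> * t) *s e + \<delta> *s a2 \<in> Pi (a0 + t *s a1)"
    and VD4: "\<exists>d. a3 + (\<rho> * t / \<kappa>) *s e + d *s a0 \<in> Pi (a2 + t *s a1)"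
  using assms unfolding VD_def by blast+

lemma Fr_ref1: "Fr a0 a1 a2 a3 a4 a5 e \<Longrightarrow> Fr a2 a1 a0 a5 a4 a3 e"
  by (rule Fr_rot, rule Fr_rot, rule Fr_rot, rule Fr_rot, rule Fr_ref)

end

context frame begin

lemma edge_neighbour: "t \<noteq> 0 \<Longrightarrow> \<exists>c d. c \<noteq> 0 \<and> d \<noteq> 0 \<and> a5 + c *s e + d *s a2 \<in> Pi (a0 + t *s a1)"
  using frame.kappa_exists[OF frameI[OF Fr_ref[OF Fr]]] by blast

lemma vert: "x \<in> Pi a1 \<Longrightarrow> co i x \<noteq> 0 \<Longrightarrow> x \<in> P" using adj_P co_nz by blast

lemma zP: "a0 + s *s a2 + t *s a1 \<in> P" "a0 + t *s a1 \<in> P" "a2 + t *s a1 \<in> P" "a0 + s *s a2 \<in> P"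
proof -
  have m: "a0 + s *s a2 + t *s a1 \<in> Pi a1" "a0 + t *s a1 \<in> Pi a1" "a2 + t *s a1 \<in> Pi a1" "a0 + s *s a2 \<in> Pi a1" by (intro PiI aP adj Pi_self)+
  show "a0 + s *s a2 + t *s a1 \<in> P" by (rule vert[OF m(1), of 0]) simp
  show "a0 + t *s a1 \<in> P" by (rule vert[OF m(2), of 0]) simp
  show "a2 + t *s a1 \<in> P" by (rule vert[OF m(3), of 2]) simp
  show "a0 + s *s a2 \<in> P" by (rule vert[OF m(4), of 0]) simp
qed

lemma z_a1: "a1 \<in> Pi (a0 + s *s a2 + t *s a1)" "a1 \<in> Pi (a0 + t *s a1)" "a1 \<in> Pi (a2 + t *s a1)" "a1 \<in> Pi (a0 + s *s a2)"
proof -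
  have m: "a0 + s *s a2 + t *s a1 \<in> Pi a1" "a0 + t *s a1 \<in> Pi a1" "a2 + t *s a1 \<in> Pi a1" "a0 + s *s a2 \<in> Pi a1" by (intro PiI aP adj Pi_self)+
  show "a1 \<in> Pi (a0 + s *s a2 + t *s a1)" "a1 \<in> Pi (a0 + t *s a1)" "a1 \<in> Pi (a2 + t *s a1)" "a1 \<in> Pi (a0 + s *s a2)"
    using m adj_sym by blast+
qed

lemma Pi_edge0:
  assumes m: "m \<in> Pi (a0 + t *s a1)" "co 5 m \<noteq> 0"
  shows "Pi (a0 + t *s a1) = vs.span {a0 + t *s a1, a1, m}"
proof (rule Pi_span[OF zP(2) z_a1(2) m(1)])
  show "a1 \<notin> vs.span {a0 + t *s a1}" by (auto simp: span1_iff dest!: arg_cong[where f = "\<lambda>v. (co 0 v, co 1 v)"])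
  show "m \<notin> vs.span {a0 + t *s a1, a1}"
  proof
    assume "m \<in> vs.span {a0 + t *s a1, a1}"
    then obtain x y where "m = x *s (a0 + t *s a1) + y *s a1" unfolding span2_iff by blast
    then have "co 5 m = 0" by simp
    then show False using m by simp
  qed
qed

lemma Pi_edge2:
  assumes m: "m \<in> Pi (a2 + t *s a1)" "co 3 m \<noteq> 0"
  shows "Pi (a2 + t *s a1) = vs.span {a2 + t *s a1, a1, m}"
proof (rule Pi_span[OF zP(3) z_a1(3) m(1)])
  show "a1 \<notin> vs.span {a2 + t *s a1}" by (auto simp: span1_iff dest!: arg_cong[where f = "\<lambda>v. (co 2 v, co 1 v)"])
  show "m \<notin> vs.span {a2 + t *s a1, a1}"
  proof
    assume "m \<in> vs.span {a2 + t *s a1, a1}"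
    then obtain x y where "m = x *s (a2 + t *s a1) + y *s a1" unfolding span2_iff by blast
    then have "co 3 m = 0" by simp
    then show False using m by simp
  qed
qed

lemma edge_unique:
  assumes "a5 + x *s e + y *s a2 \<in> Pi (a0 + t *s a1)" "a5 + x' *s e + y' *s a2 \<in> Pi (a0 + t *s a1)"
  shows "x = x' \<and> y = y'"
proof -
  have "a5 + x' *s e + y' *s a2 \<in> vs.span {a0 + t *s a1, a1, a5 + x *s e + y *s a2}"
    using assms(2) Pi_edge0[OF assms(1)] by simp
  then obtain i j k where "a5 + x' *s e + y' *s a2 = i *s (a0 + t *s a1) + j *s a1 + k *s (a5 + x *s e + y *s a2)"
    unfolding span3_iff by blast
  then have eq: "co n (a5 + x' *s e + y' *s a2) = co n (i *s (a0 + t *s a1) + j *s a1 + k *s (a5 + x *s e + y *s a2))" for n by simp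
  show ?thesis using eq[of 5] eq[of 6] eq[of 2] by simp
qed

lemma kappa_unique:
  assumes "a5 + k *s a3 \<in> Pi (a0 + s *s a2)" "a5 + k' *s a3 \<in> Pi (a0 + s *s a2)"
  shows "k = k'"
proof (rule ccontr)
  assume n: "k \<noteq> k'"
  have "(a5 + k *s a3) - (a5 + k' *s a3) \<in> Pi (a0 + s *s a2)" using PiI(3)[OF zP(4) assms] .
  moreover have "(a5 + k *s a3) - (a5 + k' *s a3) = (k - k') *s a3" by (simp add: vs.scale_left_diff_distrib)
  ultimately have "inverse (k - k') *s ((k - k') *s a3) \<in> Pi (a0 + s *s a2)" using PiI(2)[OF zP(4)] by metis
  then have "a3 \<in> Pi (a0 + s *s a2)" using n by simp
  then have "near a3 (a0 + s *s a2)" using adj_near[OF zP(4)] near_sym by blast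
  then show False using near_co(4)[OF zP(4)] by simp
qed

text \<open>The third point lies on the line joining the first two, so by \<open>tripod_full\<close>
  its pencil lies in the 4-space spanned by their pencils and \<open>Pi a1\<close>. The functional
  \<open>f\<close> vanishes on that 4-space.\<close>

lemma rho_affine:
  assumes 1: "a5 + r *s e + d1 *s a2 \<in> Pi (a0 + \<alpha> *s a1)" and 2: "a3 + c *s e + d2 *s a0 \<in> Pi (a2 + \<beta> *s a1)"
    and 3: "a5 + k *s a3 + \<rho> *s e + d3 *s a2 \<in> Pi (a0 + s *s a2 + (\<alpha> + \<beta> * s) *s a1)"
  shows "\<rho> = r + k * c"
proof -
  let ?z = "a0 + \<alpha> *s a1" and ?z' = "a2 + \<beta> *s a1" and ?w = "a0 + s *s a2 + (\<alpha> + \<beta> * s) *s a1"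
  have zz: "?z \<in> Pi a1" "?z' \<in> Pi a1" by (intro PiI aP adj Pi_self)+
  have n1: "?z \<notin> vs.span {a1}" by (rule not_span1[of _ 0]) simp_all
  have n2: "?z' \<notin> vs.span {a1,?z}"
  proof
    assume "?z' \<in> vs.span {a1,?z}"
    then obtain x y where k: "?z' = x *s a1 + y *s ?z" unfolding span2_iff by blast
    have "co 2 ?z' = 0" by (subst k) simp
    then show False by simp
  qed
  have "?w = 1 *s ?z + s *s ?z'" by (simp add: vs.scale_right_distrib vs.scale_left_distrib add_ac mult.commute)
  then have w: "?w \<in> vs.span {?z,?z'}" unfolding span2_iff by blast
  let ?U = "ssum (ssum (Pi a1) (Pi ?z)) (Pi ?z')"
  have "Pi ?w \<subseteq> ?U" using tripod_full[OF aP(2) zz(1) n1 zz(2) n2 w P_nz[OF zP(1)]] .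
  then have m: "a5 + k *s a3 + \<rho> *s e + d3 *s a2 \<in> ?U" using 3 by blast
  define f where "f x = co 6 x - r * co 5 x - c * co 3 x" for x
  have fadd: "f (x + y) = f x + f y" if "x \<in> W" "y \<in> W" for x y using that unfolding f_def by (simp add: algebra_simps)
  have f1: "f x = 0" if "x \<in> Pi a1" for x using Pi_a1[OF that] unfolding f_def by simp
  have fz: "f x = 0" if "x \<in> Pi ?z" for x
  proof -
    have "x \<in> vs.span {?z, a1, a5 + r *s e + d1 *s a2}" using Pi_edge0[OF 1] that by simp
    then obtain i j l where "x = i *s ?z + j *s a1 + l *s (a5 + r *s e + d1 *s a2)" unfolding span3_iff by blast
    then show ?thesis unfolding f_def by simp
  qed
  have fz': "f x = 0" if "x \<in> Pi ?z'" for x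
  proof -
    have "x \<in> vs.span {?z', a1, a3 + c *s e + d2 *s a0}" using Pi_edge2[OF 2] that by simp
    then obtain i j l where "x = i *s ?z' + j *s a1 + l *s (a3 + c *s e + d2 *s a0)" unfolding span3_iff by blast
    then show ?thesis unfolding f_def by simp
  qed
  have "f x = 0" if "x \<in> ?U" for x
  proof -
    from that obtain u v w where "x = (u + v) + w" "u \<in> Pi a1" "v \<in> Pi ?z" "w \<in> Pi ?z'" unfolding ssum_def by blast
    then show ?thesis using fadd f1 fz fz' Pi_W by simp
  qed
  from this[OF m] show ?thesis unfolding f_def by (simp add: algebra_simps)
qed

text \<open>The sum of the two new points is collinear with v = a1 + c e + d a4 and with both of
  them. Hence v, a1 and a4 lie in both new hyperplanes, and so does e, which is a combination of
  these three.\<close>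

lemma shear:
  assumes S1: "\<forall>s. a5 + (\<kappa> * s) *s a3 \<in> Pi (a0 + s *s a2)"
    and v: "c \<noteq> 0" "a1 + c *s e + d *s a4 \<in> Pi (a0 + 1 *s a5)" "a1 + c *s e + d *s a4 \<in> Pi (a2 + \<kappa> *s a3)"
  shows "Fr (a0 + s *s a2) a1 a2 a3 a4 (a5 + (\<kappa> * s) *s a3) e"
proof -
  let ?z = "a0 + s *s a2" and ?p = "a5 + (\<kappa> * s) *s a3" and ?v = "a1 + c *s e + d *s a4"
  have zP': "?z \<in> P" by (rule zP)
  have p4: "?p \<in> Pi a4" by (intro PiI aP adj)
  have p0: "?p \<noteq> 0" by (rule co_nz[of 5]) simp
  have pP: "?p \<in> P" using adj_P[OF p4 p0] .
  have v0: "?v \<noteq> 0" by (rule co_nz[of 1]) simp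
  have vP: "?v \<in> P" using adj_P v v0 by blast
  have pz: "?p \<in> Pi ?z" using S1 by blast
  have zp: "?z \<in> Pi ?p" using pz adj_sym by blast
  have yv: "a0 + 1 *s a5 \<in> Pi ?v" "a2 + \<kappa> *s a3 \<in> Pi ?v"
    using v(2)[THEN adj_sym[THEN iffD1]] v(3)[THEN adj_sym[THEN iffD1]] by blast+
  have v1: "(a0 + 1 *s a5) + s *s (a2 + \<kappa> *s a3) \<in> Pi ?v" by (rule PiI(1)[OF vP yv(1) PiI(2)[OF vP yv(2)]])
  have v2: "(a0 + 1 *s a5) + s *s (a2 + \<kappa> *s a3) = ?z + ?p" by (simp add: vs.scale_right_distrib add_ac mult.commute)
  have zpv: "?z + ?p \<in> Pi ?v" using v1 by (simp only: v2)
  have zp0: "?z + ?p \<noteq> 0" by (rule co_nz[of 0]) simp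
  have zpz: "?z + ?p \<in> Pi ?z" "?z + ?p \<in> Pi ?p" by (intro PiI zP' pP pz zp Pi_self)+
  have nz: "near ?z ?v" "near ?p ?v" unfolding near_def using zp0 zpz zpv by blast+
  have n14: "near ?z a1" "near ?p a1" "near ?z a4" "near ?p a4"
    using adj_near[OF zP' z_a1(4)] near_co(2)[OF pP] near_co(5)[OF zP'] near_co(5)[OF pP] near_sym by simp_all
  have eh: "e \<in> H x" if x: "x \<in> P" "near x ?v" "near x a1" "near x a4" for x
  proof -
    have "?v - a1 - d *s a4 \<in> H x" by (intro HsubI x(1) near_H x)
    then have "c *s e \<in> H x" by simp
    from HsubI(2)[OF x(1) this, of "inverse c"] have "inverse c *s (c *s e) \<in> H x" .
    then show ?thesis using v(1) by simp
  qed
  have "e \<in> H ?z" "e \<in> H ?p" using eh[OF zP' nz(1) n14(1,3)] eh[OF pP nz(2) n14(2,4)] by blast+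
  moreover have "\<not> near ?z a3" using near_co(4)[OF zP'] near_sym[of ?z a3] by simp
  moreover have "\<not> near a2 ?p" using near_co(3)[OF pP] by simp
  moreover have "?p \<in> Pi a4" by (rule p4)
  ultimately show ?thesis unfolding Fr_def using zP' pP aP adj z_a1(4) zp e0 eH opp by blast
qed

end

context flat_lines begin

text \<open>Applying \<open>edge_neighbour\<close> in all sheared frames attaches an e-coefficient
  \<open>r s t\<close> to each point a0 + s a2 + t a1. By \<open>rho_affine\<close> it satisfies the
  functional equation \<open>core\<close>, which makes it independent of s and linear in t.\<close>

lemma VD_exists:
  assumes F: "Fr a0 a1 a2 a3 a4 a5 e" shows "\<exists>\<kappa> \<rho>. VD a0 a1 a2 a3 a4 a5 e \<kappa> \<rho>"
proof -
  interpret frame V L q a0 a1 a2 a3 a4 a5 e by (rule frameI[OF F])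
  obtain \<kappa> where k: "\<kappa> \<noteq> 0" "\<forall>s. a5 + (\<kappa> * s) *s a3 \<in> Pi (a0 + s *s a2)"
    "\<forall>\<tau>. \<tau> \<noteq> 0 \<longrightarrow> (\<exists>c d. c \<noteq> 0 \<and> d \<noteq> 0 \<and> a1 + c *s e + d *s a4 \<in> Pi (a0 + \<tau> *s a5) \<and> a1 + c *s e + d *s a4 \<in> Pi (a2 + (\<kappa> * \<tau>) *s a3))"
    using kappa_exists by blast
  obtain c d where cd: "c \<noteq> 0" "a1 + c *s e + d *s a4 \<in> Pi (a0 + 1 *s a5)" "a1 + c *s e + d *s a4 \<in> Pi (a2 + \<kappa> *s a3)"
    using k(3)[rule_format, of 1] by auto
  have ex: "\<exists>\<rho> \<delta>. a5 + (\<kappa> * s) *s a3 + \<rho> *s e + \<delta> *s a2 \<in> Pi (a0 + s *s a2 + t *s a1) \<and> (t = 0 \<longrightarrow> \<rho> = 0) \<and> (t \<noteq> 0 \<longrightarrow> \<rho> \<noteq> 0)" for s t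
  proof (cases "t = 0")
    case True
    have "a5 + (\<kappa> * s) *s a3 + 0 *s e + 0 *s a2 \<in> Pi (a0 + s *s a2 + t *s a1)" using k(2) True by simp
    then show ?thesis using True by blast
  next
    case False
    show ?thesis using frame.edge_neighbour[OF frameI[OF shear[OF k(2) cd, of s]] False] False by blast
  qed
  define r where "r s t = (SOME \<rho>. (\<exists>\<delta>. a5 + (\<kappa> * s) *s a3 + \<rho> *s e + \<delta> *s a2 \<in> Pi (a0 + s *s a2 + t *s a1)) \<and> (t = 0 \<longrightarrow> \<rho> = 0) \<and> (t \<noteq> 0 \<longrightarrow> \<rho> \<noteq> 0))" for s t
  have r: "\<exists>\<delta>. a5 + (\<kappa> * s) *s a3 + r s t *s e + \<delta> *s a2 \<in> Pi (a0 + s *s a2 + t *s a1)" "t = 0 \<Longrightarrow> r s t = 0" "t \<noteq> 0 \<Longrightarrow> r s t \<noteq> 0" for s t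
  proof -
    have "\<exists>\<rho>. (\<exists>\<delta>. a5 + (\<kappa> * s) *s a3 + \<rho> *s e + \<delta> *s a2 \<in> Pi (a0 + s *s a2 + t *s a1)) \<and> (t = 0 \<longrightarrow> \<rho> = 0) \<and> (t \<noteq> 0 \<longrightarrow> \<rho> \<noteq> 0)"
      using ex[of s t] by blast
    from someI_ex[OF this] show "\<exists>\<delta>. a5 + (\<kappa> * s) *s a3 + r s t *s e + \<delta> *s a2 \<in> Pi (a0 + s *s a2 + t *s a1)" "t = 0 \<Longrightarrow> r s t = 0" "t \<noteq> 0 \<Longrightarrow> r s t \<noteq> 0"
      unfolding r_def by blast+
  qed
  have r0: "\<exists>\<delta>. a5 + r 0 t *s e + \<delta> *s a2 \<in> Pi (a0 + t *s a1)" for t using r(1)[of 0 t] by simp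
  have ex2: "\<exists>c. \<exists>d. a3 + c *s e + d *s a0 \<in> Pi (a2 + t *s a1)" for t
  proof (cases "t = 0")
    case True
    have "a3 + 0 *s e + 0 *s a0 \<in> Pi (a2 + t *s a1)" using adj(3) True by simp
    then show ?thesis by blast
  next
    case False
    show ?thesis using frame.edge_neighbour[OF frameI[OF Fr_ref1[OF F]] False] by blast
  qed
  define g where "g t = (SOME c. \<exists>d. a3 + c *s e + d *s a0 \<in> Pi (a2 + t *s a1))" for t
  have g: "\<exists>d. a3 + g t *s e + d *s a0 \<in> Pi (a2 + t *s a1)" for t using someI_ex[OF ex2[of t]] unfolding g_def .
  have core: "r s (\<alpha> + \<beta> * s) = r 0 \<alpha> + (\<kappa> * s) * g \<beta>" for s \<alpha> \<beta>
  proof -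
    obtain d1 where "a5 + r 0 \<alpha> *s e + d1 *s a2 \<in> Pi (a0 + \<alpha> *s a1)" using r0 by blast
    moreover obtain d2 where "a3 + g \<beta> *s e + d2 *s a0 \<in> Pi (a2 + \<beta> *s a1)" using g by blast
    moreover obtain d3 where "a5 + (\<kappa> * s) *s a3 + r s (\<alpha> + \<beta> * s) *s e + d3 *s a2 \<in> Pi (a0 + s *s a2 + (\<alpha> + \<beta> * s) *s a1)" using r(1) by blast
    ultimately show ?thesis by (rule rho_affine)
  qed
  \<comment> \<open>Specialisations of \<open>core\<close>: \<beta> = 0 removes the dependence on s;
    \<alpha> = 0 with s = 1 identifies \<kappa> g with r; \<beta> = 1 with variable s gives
    linearity.\<close>
  have g0: "g 0 = 0" using core[of 1 0 0] r(2)[of 0] k(1) by simp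
  have rs: "r s \<alpha> = r 0 \<alpha>" for s \<alpha> using core[of s \<alpha> 0] g0 by simp
  have gr: "\<kappa> * g \<beta> = r 0 \<beta>" for \<beta> using core[of 1 0 \<beta>] rs[of 1 \<beta>] r(2)[of 0 0] by simp
  have lin: "r 0 t = r 0 1 * t" for t
  proof -
    have "r t (0 + 1 * t) = r 0 0 + (\<kappa> * t) * g 1" by (rule core)
    then have "r 0 t = \<kappa> * g 1 * t" using rs[of t t] r(2)[of 0 0] by (simp add: mult_ac)
    then show ?thesis using gr[of 1] by simp
  qed
  have g_lin: "g t = r 0 1 * t / \<kappa>" for t using gr[of t] lin[of t] k(1) by (simp add: field_simps)
  have "\<exists>\<delta>. a5 + (r 0 1 * t) *s e + \<delta> *s a2 \<in> Pi (a0 + t *s a1)" for t using r0[of t] lin[of t] by simp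
  moreover have "\<exists>d. a3 + (r 0 1 * t / \<kappa>) *s e + d *s a0 \<in> Pi (a2 + t *s a1)" for t using g[of t] g_lin[of t] by simp
  ultimately have "VD a0 a1 a2 a3 a4 a5 e \<kappa> (r 0 1)" unfolding VD_def using k r(3)[of 1 0] by simp
  then show ?thesis by blast
qed

lemma VD_shear:
  assumes F: "Fr a0 a1 a2 a3 a4 a5 e" and D: "VD a0 a1 a2 a3 a4 a5 e \<kappa> \<rho>"
  shows "Fr (a0 + s *s a2) a1 a2 a3 a4 (a5 + (\<kappa> * s) *s a3) e"
proof -
  have S1: "\<forall>s. a5 + (\<kappa> * s) *s a3 \<in> Pi (a0 + s *s a2)"
    and O: "\<forall>\<tau>. \<tau> \<noteq> 0 \<longrightarrow> (\<exists>c d. c \<noteq> 0 \<and> d \<noteq> 0 \<and> a1 + c *s e + d *s a4 \<in> Pi (a0 + \<tau> *s a5) \<and> a1 + c *s e + d *s a4 \<in> Pi (a2 + (\<kappa> * \<tau>) *s a3))"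
    using D unfolding VD_def by blast+
  obtain c d where cd: "c \<noteq> 0" "a1 + c *s e + d *s a4 \<in> Pi (a0 + 1 *s a5)" "a1 + c *s e + d *s a4 \<in> Pi (a2 + \<kappa> *s a3)"
    using O[rule_format, of 1] by auto
  show ?thesis by (rule frame.shear[OF frameI[OF F] S1 cd])
qed

text \<open>The pencil plane of a0 + t a1 is described by the data at a1 and, after division by t,
  also by the data at a0. Comparing the two descriptions of one plane yields the coefficient of
  a2.\<close>

lemma VD_edge:
  assumes F: "Fr a0 a1 a2 a3 a4 a5 e" and E1: "VD a0 a1 a2 a3 a4 a5 e \<kappa>1 \<rho>1" and E0: "VD a5 a0 a1 a2 a3 a4 e \<kappa>0 \<rho>0"
  shows "a5 + (\<rho>1 * t) *s e + (\<kappa>0 * \<rho>1 / \<rho>0 * t^2) *s a2 \<in> Pi (a0 + t *s a1)"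
proof -
  interpret frame V L q a0 a1 a2 a3 a4 a5 e by (rule frameI[OF F])
  show ?thesis
  proof (cases "t = 0")
    case True
    then show ?thesis using adj(12) by simp
  next
    case False
    have nz: "\<kappa>0 \<noteq> 0" "\<rho>0 \<noteq> 0" "\<rho>1 \<noteq> 0" using VD_k[OF E0] VD_r[OF E0] VD_r[OF E1] by blast+
    obtain \<delta> where \<delta>: "a5 + (\<rho>1 * t) *s e + \<delta> *s a2 \<in> Pi (a0 + t *s a1)" using VD3[OF E1] by blast
    obtain d where d: "a2 + (\<rho>0 * (1/t) / \<kappa>0) *s e + d *s a5 \<in> Pi (a1 + (1/t) *s a0)" using VD4[OF E0] by blast
    have sc: "t *s (a1 + (1/t) *s a0) = a0 + t *s a1" using False by (simp add: vs.scale_right_distrib add.commute)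
    have "a1 + (1/t) *s a0 \<noteq> 0" by (rule co_nz[of 1]) simp
    then have Pe: "Pi (a1 + (1/t) *s a0) = Pi (a0 + t *s a1)" using scale_in_Pi[of "a1 + (1/t) *s a0" t] False sc by simp
    let ?m = "a2 + (\<rho>0 * (1/t) / \<kappa>0) *s e + d *s a5"
    have mP: "?m \<in> Pi (a0 + t *s a1)" using d Pe by simp
    then have "?m \<in> vs.span {a0 + t *s a1, a1, a5 + (\<rho>1 * t) *s e + \<delta> *s a2}" using Pi_edge0[OF \<delta>] by simp
    then obtain i j l where "?m = i *s (a0 + t *s a1) + j *s a1 + l *s (a5 + (\<rho>1 * t) *s e + \<delta> *s a2)" unfolding span3_iff by blast
    then have eq: "co n ?m = co n (i *s (a0 + t *s a1) + j *s a1 + l *s (a5 + (\<rho>1 * t) *s e + \<delta> *s a2))" for n by simp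
    have e2: "1 = l * \<delta>" and e6: "\<rho>0 / (t * \<kappa>0) = l * (\<rho>1 * t)" using eq[of 2] eq[of 6] by simp_all
    have l0: "l \<noteq> 0" using e2 by auto
    have "\<rho>0 = l * (\<rho>1 * t) * (t * \<kappa>0)" using e6 False nz by (simp add: field_simps)
    then have "\<delta> * \<rho>0 = (l * \<delta>) * \<rho>1 * t * t * \<kappa>0" by (simp add: algebra_simps)
    then have "\<delta> * \<rho>0 = \<rho>1 * t * t * \<kappa>0" using e2 by simp
    then have "\<delta> = \<kappa>0 * \<rho>1 / \<rho>0 * t^2" using nz by (simp add: field_simps power2_eq_square)
    then show ?thesis using \<delta> by simp
  qed
qed

text \<open>Both constants describe the same matching of the diagonals a0a2 and a3a5, read from
  opposite sides.\<close>

lemma VD_opp: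
  assumes F: "Fr a0 a1 a2 a3 a4 a5 e" and D: "VD a0 a1 a2 a3 a4 a5 e \<kappa> \<rho>" and D': "VD a3 a4 a5 a0 a1 a2 e \<kappa>' \<rho>'"
  shows "\<kappa>' = \<kappa>"
proof -
  interpret frame V L q a0 a1 a2 a3 a4 a5 e by (rule frameI[OF F])
  have F3: "Fr a3 a4 a5 a0 a1 a2 e" by (rule Fr_rot, rule Fr_rot, rule Fr_rot, rule F)
  interpret R: frame V L q a3 a4 a5 a0 a1 a2 e by (rule frameI[OF F3])
  have k: "\<kappa> \<noteq> 0" "a5 + (\<kappa> * 1) *s a3 \<in> Pi (a0 + 1 *s a2)" using VD_k[OF D] VD1[OF D] by blast+
  have k': "a2 + (\<kappa>' * (1/\<kappa>)) *s a0 \<in> Pi (a3 + (1/\<kappa>) *s a5)" using VD1[OF D'] by blast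
  have p0: "a3 + (1/\<kappa>) *s a5 \<noteq> 0" by (rule co_nz[of 3]) simp
  have "\<kappa> *s (a3 + (1/\<kappa>) *s a5) = a5 + (\<kappa> * 1) *s a3" using k(1) by (simp add: vs.scale_right_distrib add.commute)
  then have "Pi (a3 + (1/\<kappa>) *s a5) = Pi (a5 + (\<kappa> * 1) *s a3)" using scale_in_Pi[OF p0 k(1)] by simp
  then have "a0 + 1 *s a2 \<in> Pi (a3 + (1/\<kappa>) *s a5)" using k(2) adj_sym by blast
  then have "a2 + 1 *s a0 \<in> Pi (a3 + (1/\<kappa>) *s a5)" by (simp add: add.commute)
  then have "\<kappa>' * (1/\<kappa>) = 1" by (rule R.kappa_unique[OF k'])
  then show ?thesis using k(1) by (simp add: field_simps)
qed

text \<open>The point a0 + a2 + a4 is collinear with one point on each of the diagonals a3a5, a1a3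
  and a1a5. These three lie in its pencil plane and are therefore dependent modulo it, which forces
  the sign.\<close>

lemma VD_prod:
  assumes F: "Fr a0 a1 a2 a3 a4 a5 e" and E1: "VD a0 a1 a2 a3 a4 a5 e k1 r1" and E2: "VD a1 a2 a3 a4 a5 a0 e k2 r2"
    and E3: "VD a2 a3 a4 a5 a0 a1 e k3 r3"
  shows "k1 * k2 * k3 = -1"
proof -
  interpret frame V L q a0 a1 a2 a3 a4 a5 e by (rule frameI[OF F])
  have k0: "k1 \<noteq> 0" "k2 \<noteq> 0" "k3 \<noteq> 0" using VD_k[OF E1] VD_k[OF E2] VD_k[OF E3] by blast+
  let ?w = "a0 + a2 + a4"
  let ?p1 = "a5 + (k1 * 1) *s a3" and ?p2 = "a1 + (1/k2) *s a3" and ?p3 = "a1 + (k3 * 1) *s a5"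
  have m: "?p1 \<in> Pi a4" "?p2 \<in> Pi a2" "?p3 \<in> Pi a0" by (intro PiI aP adj)+
  have "?p1 \<noteq> 0" "?p2 \<noteq> 0" "?p3 \<noteq> 0" by (rule co_nz[of 5], simp) (rule co_nz[of 1], simp)+
  then have pP: "?p1 \<in> P" "?p2 \<in> P" "?p3 \<in> P" using adj_P m by blast+
  have "?p1 \<in> Pi (a0 + 1 *s a2)" by (rule VD1[OF E1])
  then have z1: "a0 + 1 *s a2 \<in> Pi ?p1" using adj_sym by blast
  have "a0 + (k2 * (1/k2)) *s a4 \<in> Pi (a1 + (1/k2) *s a3)" by (rule VD1[OF E2])
  then have z2: "a0 + 1 *s a4 \<in> Pi ?p2" using k0 by simp
  have "?p3 \<in> Pi (a2 + 1 *s a4)" by (rule VD1[OF E3])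
  then have z3: "a2 + 1 *s a4 \<in> Pi ?p3" using adj_sym by blast
  have a: "a4 \<in> Pi ?p1" "a2 \<in> Pi ?p2" "a0 \<in> Pi ?p3" using m adj_sym by blast+
  have "?w \<in> Pi ?p1" using PiI(1)[OF pP(1) z1 a(1)] by simp
  moreover have "?w \<in> Pi ?p2" using PiI(1)[OF pP(2) z2 a(2)] by (simp add: add_ac)
  moreover have "?w \<in> Pi ?p3" using PiI(1)[OF pP(3) z3 a(3)] by (simp add: add_ac)
  ultimately have p: "?p1 \<in> Pi ?w" "?p2 \<in> Pi ?w" "?p3 \<in> Pi ?w" and w: "?w \<in> Pi ?p1" using adj_sym by blast+
  have "?w \<noteq> 0" by (rule co_nz[of 0]) simp
  then have wP: "?w \<in> P" using adj_P[OF w] by blast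
  have n1: "?p1 \<notin> vs.span {?w}" by (rule not_span1[of _ 5]) simp_all
  have n2: "?p2 \<notin> vs.span {?w,?p1}"
  proof
    assume "?p2 \<in> vs.span {?w,?p1}"
    then obtain x y where k: "?p2 = x *s ?w + y *s ?p1" unfolding span2_iff by blast
    have "co 1 ?p2 = 0" by (subst k) simp
    then show False by simp
  qed
  have "?p3 \<in> vs.span {?w,?p1,?p2}" using p(3) Pi_span[OF wP p(1,2) n1 n2] by simp
  then obtain x y z where "?p3 = x *s ?w + y *s ?p1 + z *s ?p2" unfolding span3_iff by blast
  then have eq: "co n ?p3 = co n (x *s ?w + y *s ?p1 + z *s ?p2)" for n by simp
  have "k3 = y" "1 = z" "0 = y * k1 + z / k2" using eq[of 5] eq[of 1] eq[of 3] by simp_all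
  then have "k3 * k1 + 1 / k2 = 0" by simp
  moreover have "(k3 * k1 + 1 / k2) * k2 = k3 * k1 * k2 + 1" using k0 by (simp add: distrib_right)
  ultimately have "k3 * k1 * k2 + 1 = 0" by simp
  then show ?thesis by (simp add: eq_neg_iff_add_eq_0 mult_ac)
qed

text \<open>The e-coefficient of a common neighbour a1 + c e + d a4 of points on the edges a0a5 and
  a2a3 is computed once from the data at a5 and once from the data at a3.\<close>

lemma VD_rho:
  assumes F: "Fr a0 a1 a2 a3 a4 a5 e" and D1: "VD a0 a1 a2 a3 a4 a5 e k1 r1" and D5: "VD a4 a5 a0 a1 a2 a3 e k5 r5"
    and D3: "VD a2 a3 a4 a5 a0 a1 e k3 r3"
  shows "r5 / k5 = k1 * r3"
proof -
  have F2: "Fr a2 a3 a4 a5 a0 a1 e" by (rule Fr_rot, rule Fr_rot, rule F)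
  interpret A: frame V L q a0 a5 a4 a3 a2 a1 e by (rule frameI[OF Fr_ref[OF F]])
  interpret B: frame V L q a2 a3 a4 a5 a0 a1 e by (rule frameI[OF F2])
  obtain c d where v: "a1 + c *s e + d *s a4 \<in> Pi (a0 + 1 *s a5)" "a1 + c *s e + d *s a4 \<in> Pi (a2 + (k1 * 1) *s a3)"
    using VD2[OF D1 one_neq_zero] by blast
  obtain d' where d': "a1 + (r5 * 1 / k5) *s e + d' *s a4 \<in> Pi (a0 + 1 *s a5)" using VD4[OF D5] by blast
  obtain d'' where d'': "a1 + (r3 * (k1 * 1)) *s e + d'' *s a4 \<in> Pi (a2 + (k1 * 1) *s a3)" using VD3[OF D3] by blast
  have "c = r5 / k5" using A.edge_unique[OF v(1) d'] by simp
  moreover have "c = r3 * k1" using B.edge_unique[OF v(2) d''] by simp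
  ultimately show ?thesis by (simp add: mult.commute)
qed

end

section \<open>The split octonion model\<close>

definition mk :: "'a \<Rightarrow> 'a \<Rightarrow> 'a \<Rightarrow> 'a \<Rightarrow> 'a \<Rightarrow> 'a \<Rightarrow> 'a \<Rightarrow> nat \<Rightarrow> 'a::field" where
  "mk c0 c1 c2 c3 c4 c5 c6 = (\<lambda>i. if i = 0 then c0 else if i = 1 then c1 else if i = 2 then c2 else if i = 3 then c3
     else if i = 4 then c4 else if i = 5 then c5 else if i = 6 then c6 else 0)"

lemma mk_simps [simp]: "mk c0 c1 c2 c3 c4 c5 c6 0 = c0" "mk c0 c1 c2 c3 c4 c5 c6 1 = c1" "mk c0 c1 c2 c3 c4 c5 c6 (Suc 0) = c1"
  "mk c0 c1 c2 c3 c4 c5 c6 2 = c2" "mk c0 c1 c2 c3 c4 c5 c6 3 = c3" "mk c0 c1 c2 c3 c4 c5 c6 4 = c4"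
  "mk c0 c1 c2 c3 c4 c5 c6 5 = c5" "mk c0 c1 c2 c3 c4 c5 c6 6 = c6"
  by (simp_all add: mk_def)

lemma mk_vecs [simp]: "mk c0 c1 c2 c3 c4 c5 c6 \<in> vecs 6"
  by (simp add: mk_def vecs_def)

lemma vecs_eqI:
  assumes "x \<in> vecs 6" "y \<in> vecs 6" "x 0 = y 0" "x 1 = y 1" "x 2 = y 2" "x 3 = y 3" "x 4 = y 4" "x 5 = y 5" "x 6 = y 6"
  shows "x = y"
proof
  fix i :: nat
  consider "i = 0" | "i = 1" | "i = 2" | "i = 3" | "i = 4" | "i = 5" | "i = 6" | "i > 6" by linarith
  then show "x i = y i" using assms by cases (auto simp: vecs_def)
qed

lemma vecs_add: "x \<in> vecs n \<Longrightarrow> y \<in> vecs n \<Longrightarrow> x + y \<in> vecs n" and vecs_scl: "x \<in> vecs n \<Longrightarrow> k *s x \<in> vecs n"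
  and vecs_0: "0 \<in> vecs n"
  using subspace_vecs vs.subspace_add vs.subspace_scale vs.subspace_0 by blast+

text \<open>The components of the product of two trace-zero split octonions in Zorn's vector matrix form.\<close>
definition cr :: "nat \<Rightarrow> (nat \<Rightarrow> 'a) \<Rightarrow> (nat \<Rightarrow> 'a) \<Rightarrow> 'a::field" where
  "cr j x y = (if j = 0 then x 1 * y 2 - x 2 * y 1 - (x 3 * y 4 - x 4 * y 3)
    else if j = 1 then x 2 * y 0 - x 0 * y 2 - (x 3 * y 5 - x 5 * y 3)
    else if j = 2 then x 0 * y 1 - x 1 * y 0 - (x 3 * y 6 - x 6 * y 3)
    else if j = 3 then x 6 * y 5 - x 5 * y 6 - (x 3 * y 0 - x 0 * y 3)
    else if j = 4 then x 4 * y 6 - x 6 * y 4 - (x 3 * y 1 - x 1 * y 3)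
    else if j = 5 then x 5 * y 4 - x 4 * y 5 - (x 3 * y 2 - x 2 * y 3)
    else if j = 6 then x 0 * y 4 + x 1 * y 5 + x 2 * y 6 - x 3 * y 3
    else x 4 * y 0 + x 5 * y 1 + x 6 * y 2 - x 3 * y 3)"

definition hx :: "(nat \<Rightarrow> 'a::field) \<Rightarrow> (nat \<Rightarrow> 'a) \<Rightarrow> bool" where "hx x y \<longleftrightarrow> (\<forall>j. cr j x y = 0)"

text \<open>The sum of the two scalar components of the octonion product, which is the polar form of
  the quadric (\<open>quad_add\<close>).\<close>

definition Bf :: "(nat \<Rightarrow> 'a::field) \<Rightarrow> (nat \<Rightarrow> 'a) \<Rightarrow> 'a" where "Bf x y = cr 6 x y + cr 7 x y"

text \<open>The first six equations are the Grassmann conditions of the embedding. The two scalar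
  ones follow from them for lines on the quadric (\<open>grass_hx\<close>).\<close>

lemma hx_iff: "hx x y \<longleftrightarrow>
   x 1 * y 2 - x 2 * y 1 = x 3 * y 4 - x 4 * y 3 \<and> x 2 * y 0 - x 0 * y 2 = x 3 * y 5 - x 5 * y 3 \<and>
   x 0 * y 1 - x 1 * y 0 = x 3 * y 6 - x 6 * y 3 \<and> x 6 * y 5 - x 5 * y 6 = x 3 * y 0 - x 0 * y 3 \<and>
   x 4 * y 6 - x 6 * y 4 = x 3 * y 1 - x 1 * y 3 \<and> x 5 * y 4 - x 4 * y 5 = x 3 * y 2 - x 2 * y 3 \<and>
   x 0 * y 4 + x 1 * y 5 + x 2 * y 6 = x 3 * y 3 \<and> x 4 * y 0 + x 5 * y 1 + x 6 * y 2 = x 3 * y 3"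
proof -
  have "hx x y \<longleftrightarrow> cr 0 x y = 0 \<and> cr 1 x y = 0 \<and> cr 2 x y = 0 \<and> cr 3 x y = 0 \<and> cr 4 x y = 0 \<and> cr 5 x y = 0 \<and> cr 6 x y = 0 \<and> cr 7 x y = 0"
    (is "_ \<longleftrightarrow> ?R")
  proof
    assume r: ?R
    have "cr j x y = 0" for j
    proof -
      consider "j = 0" | "j = 1" | "j = 2" | "j = 3" | "j = 4" | "j = 5" | "j = 6" | "j > 6" by linarith
      then show ?thesis
      proof cases
        case 8
        then have "cr j x y = cr 7 x y" by (simp add: cr_def)
        then show ?thesis using r by simp
      qed (use r in simp_all)
    qed
    then show "hx x y" unfolding hx_def by blast
  qed (simp add: hx_def)
  then show ?thesis unfolding cr_def by simp
qed

lemma cr_add: "cr j x (y + z) = cr j x y + cr j x z" "cr j (x + z) y = cr j x y + cr j z y"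
  and cr_scl: "cr j x (k *s y) = k * cr j x y" "cr j (k *s x) y = k * cr j x y"
  unfolding cr_def by (simp_all add: scl_apply algebra_simps)

lemma hx_add: "hx x y \<Longrightarrow> hx x z \<Longrightarrow> hx x (y + z)" and hx_scl: "hx x y \<Longrightarrow> hx x (k *s y)" and hx_0: "hx x 0"
  unfolding hx_def by (simp_all add: cr_add cr_scl) (simp add: cr_def)

lemma hx_scl_iff: "k \<noteq> 0 \<Longrightarrow> hx (k *s x) y \<longleftrightarrow> hx x y" unfolding hx_def by (simp add: cr_scl)

lemma hx_sym: "hx x y \<longleftrightarrow> hx y x"
  unfolding hx_iff by (auto simp: algebra_simps)

lemma quad_scl: "quadQ6 (k *s x) = k^2 * quadQ6 x"
  unfolding quadQ6_def by (simp add: scl_apply power2_eq_square algebra_simps)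

lemma quad_add: "quadQ6 (x + y) = quadQ6 x + quadQ6 y + Bf x y"
  unfolding quadQ6_def Bf_def cr_def by (simp add: power2_eq_square algebra_simps)

lemma Bf_bilin: "Bf x (y + z) = Bf x y + Bf x z" "Bf x (k *s y) = k * Bf x y" "Bf (k *s x) y = k * Bf x y"
  unfolding Bf_def by (simp_all add: cr_add cr_scl algebra_simps)

lemma hx_self: "hx x x \<longleftrightarrow> quadQ6 x = 0"
  unfolding hx_iff quadQ6_def by (auto simp: power2_eq_square algebra_simps)

section \<open>Automorphisms of the model and transitivity on singular points\<close>

definition lin :: "((nat \<Rightarrow> 'a::field) \<Rightarrow> nat \<Rightarrow> 'a) \<Rightarrow> bool" where
  "lin g \<longleftrightarrow> (\<forall>x y. g (x + y) = g x + g y) \<and> (\<forall>k x. g (k *s x) = k *s g x)"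

lemma lin_add: "lin g \<Longrightarrow> g (x + y) = g x + g y" and lin_scl: "lin g \<Longrightarrow> g (k *s x) = k *s g x"
  unfolding lin_def by blast+

lemma lin_0: "lin g \<Longrightarrow> g 0 = 0" using lin_scl[of g 0 0] by simp

lemma lin_span1: "lin g \<Longrightarrow> y \<in> vs.span {x} \<Longrightarrow> g y \<in> vs.span {g x}"
  unfolding span1_iff using lin_scl[of g] by blast

lemma lin_span2: "lin g \<Longrightarrow> z \<in> vs.span {x,y} \<Longrightarrow> g z \<in> vs.span {g x, g y}"
proof -
  assume g: "lin g" and "z \<in> vs.span {x,y}"
  then obtain a b where "z = a *s x + b *s y" unfolding span2_iff by blast
  then have "g z = a *s g x + b *s g y" by (simp add: lin_add[OF g] lin_scl[OF g])
  then show ?thesis unfolding span2_iff by blast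
qed

lemma lin_span2_image: "lin g \<Longrightarrow> g ` vs.span {x,y} = vs.span {g x, g y}"
proof
  assume g: "lin g"
  show "g ` vs.span {x,y} \<subseteq> vs.span {g x, g y}" using lin_span2[OF g] by blast
  show "vs.span {g x, g y} \<subseteq> g ` vs.span {x,y}"
  proof
    fix z assume "z \<in> vs.span {g x, g y}"
    then obtain a b where "z = a *s g x + b *s g y" unfolding span2_iff by blast
    then have "z = g (a *s x + b *s y)" by (simp add: lin_add[OF g] lin_scl[OF g])
    moreover have "a *s x + b *s y \<in> vs.span {x,y}" unfolding span2_iff by blast
    ultimately show "z \<in> g ` vs.span {x,y}" by blast
  qed
qed

text \<open>The inverse is carried along explicitly and is an inverse on \<open>vecs 6\<close> only,
  since the maps act on all sequences but discard coordinates above 6.\<close>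

definition autm :: "((nat \<Rightarrow> 'a::field) \<Rightarrow> nat \<Rightarrow> 'a) \<Rightarrow> ((nat \<Rightarrow> 'a) \<Rightarrow> nat \<Rightarrow> 'a) \<Rightarrow> bool" where
  "autm g h \<longleftrightarrow> lin g \<and> lin h \<and> (\<forall>x. g x \<in> vecs 6) \<and> (\<forall>x. h x \<in> vecs 6) \<and> (\<forall>x\<in>vecs 6. h (g x) = x \<and> g (h x) = x) \<and>
     (\<forall>x. quadQ6 (g x) = quadQ6 x) \<and> (\<forall>x. quadQ6 (h x) = quadQ6 x) \<and>
     (\<forall>x y. hx x y \<longrightarrow> hx (g x) (g y)) \<and> (\<forall>x y. hx x y \<longrightarrow> hx (h x) (h y))"

lemma autm_sym: "autm g h \<Longrightarrow> autm h g" unfolding autm_def by blast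

lemma autmD:
  assumes "autm g h"
  shows "lin g" "lin h" "g x \<in> vecs 6" "x \<in> vecs 6 \<Longrightarrow> h (g x) = x" "x \<in> vecs 6 \<Longrightarrow> g (h x) = x" "quadQ6 (g x) = quadQ6 x"
    "hx x y \<Longrightarrow> hx (g x) (g y)" "h x \<in> vecs 6"
  using assms unfolding autm_def by blast+

lemma autm_hx: assumes a: "autm g h" and "x \<in> vecs 6" "y \<in> vecs 6" shows "hx (g x) (g y) \<longleftrightarrow> hx x y"
  using autmD(7)[OF a, of x y] autmD(7)[OF autm_sym[OF a], of "g x" "g y"] autmD(4)[OF a] assms by auto

lemma autm_B: assumes a: "autm g h" shows "Bf (g x) (g y) = Bf x y"
proof -
  have "quadQ6 (g x + g y) = quadQ6 (x + y)" using autmD(6)[OF a, of "x + y"] lin_add[OF autmD(1)[OF a]] by simp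
  then show ?thesis unfolding quad_add using autmD(6)[OF a] by simp
qed

lemma autm_nz: "autm g h \<Longrightarrow> x \<in> vecs 6 \<Longrightarrow> x \<noteq> 0 \<Longrightarrow> g x \<noteq> 0"
  using autmD(4) lin_0[OF autmD(2)] by metis

lemma autm_span1: "autm g h \<Longrightarrow> x \<in> vecs 6 \<Longrightarrow> y \<in> vecs 6 \<Longrightarrow> g y \<in> vs.span {g x} \<longleftrightarrow> y \<in> vs.span {x}"
  using lin_span1[OF autmD(1)] lin_span1[OF autmD(2), of g h "g y" "g x"] autmD(4) by metis

lemma autm_span2: "autm g h \<Longrightarrow> x \<in> vecs 6 \<Longrightarrow> y \<in> vecs 6 \<Longrightarrow> z \<in> vecs 6 \<Longrightarrow> g z \<in> vs.span {g x, g y} \<longleftrightarrow> z \<in> vs.span {x,y}"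
  using lin_span2[OF autmD(1)] lin_span2[OF autmD(2), of g h "g z" "g x" "g y"] autmD(4) by metis

lemma autm_comp: assumes a: "autm g h" and b: "autm g' h'" shows "autm (\<lambda>x. g' (g x)) (\<lambda>x. h (h' x))"
proof -
  note 1 = autmD[OF a] note 2 = autmD[OF b] note 3 = autmD[OF autm_sym[OF a]] note 4 = autmD[OF autm_sym[OF b]]
  have "lin (\<lambda>x. g' (g x))" "lin (\<lambda>x. h (h' x))" using 1(1,2) 2(1,2) unfolding lin_def by simp_all
  then show ?thesis unfolding autm_def using 1(3-8) 2(3-8) 3(6,7) 4(6,7) by simp
qed

lemma lin_mkI: 
  assumes "\<And>x y i. g (x + y) i = g x i + g y i" "\<And>k x i. g (k *s x) i = k * g x i" shows "lin g"
  unfolding lin_def using assms by (auto simp: fun_eq_iff scl_apply)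

text \<open>Two kinds of root elations: \<open>gM1\<close> changes two coordinates,
  \<open>gM2\<close> and \<open>gM3\<close> change four, one of them quadratically in the parameter.
  The maps \<open>gR\<close>, \<open>gF\<close> and \<open>gF0\<close> act on the standard apartment
  as a rotation and two reflections; the sign at coordinate 3 makes them compatible with
  \<open>hx\<close>.\<close>

definition gM1 :: "'a::field \<Rightarrow> (nat \<Rightarrow> 'a) \<Rightarrow> nat \<Rightarrow> 'a" where
  "gM1 s x = mk (x 0) (x 1) (x 2 + s * x 0) (x 3) (x 4 - s * x 6) (x 5) (x 6)"
definition gM2 :: "'a::field \<Rightarrow> (nat \<Rightarrow> 'a) \<Rightarrow> nat \<Rightarrow> 'a" where
  "gM2 t x = mk (x 0) (x 1) (x 2 + t^2 * x 6 + 2 * t * x 3) (x 3 + t * x 6) (x 4 - t * x 1) (x 5 + t * x 0) (x 6)"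
definition gM3 :: "'a::field \<Rightarrow> (nat \<Rightarrow> 'a) \<Rightarrow> nat \<Rightarrow> 'a" where
  "gM3 t x = mk (x 0) (x 1 - t * x 6) (x 2 + t * x 5) (x 3 - t * x 0) (x 4 + t^2 * x 0 - 2 * t * x 3) (x 5) (x 6)"
definition gR :: "(nat \<Rightarrow> 'a) \<Rightarrow> nat \<Rightarrow> 'a::field" where
  "gR x = mk (x 6) (x 4) (x 5) (- x 3) (x 2) (x 0) (x 1)"
definition gRi :: "(nat \<Rightarrow> 'a) \<Rightarrow> nat \<Rightarrow> 'a::field" where
  "gRi x = mk (x 5) (x 6) (x 4) (- x 3) (x 1) (x 2) (x 0)"
definition gF :: "(nat \<Rightarrow> 'a) \<Rightarrow> nat \<Rightarrow> 'a::field" where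
  "gF x = mk (x 2) (x 1) (x 0) (- x 3) (x 6) (x 5) (x 4)"
definition gF0 :: "(nat \<Rightarrow> 'a) \<Rightarrow> nat \<Rightarrow> 'a::field" where
  "gF0 x = mk (x 0) (x 2) (x 1) (- x 3) (x 4) (x 6) (x 5)"

lemma lin_gens: "lin (gM1 s)" "lin (gM2 s)" "lin (gM3 s)" "lin gR" "lin gRi" "lin gF" "lin gF0"
  by (rule lin_mkI; simp add: gM1_def gM2_def gM3_def gR_def gRi_def gF_def gF0_def mk_def scl_apply algebra_simps)+

lemma gens_vecs [simp]: "gM1 s x \<in> vecs 6" "gM2 s x \<in> vecs 6" "gM3 s x \<in> vecs 6" "gR x \<in> vecs 6" "gRi x \<in> vecs 6" "gF x \<in> vecs 6" "gF0 x \<in> vecs 6"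
  by (simp_all add: gM1_def gM2_def gM3_def gR_def gRi_def gF_def gF0_def)

lemma gens_inv: assumes "x \<in> vecs 6"
  shows "gM1 (- s) (gM1 s x) = x" "gM2 (- s) (gM2 s x) = x" "gM3 (- s) (gM3 s x) = x" "gRi (gR x) = x" "gR (gRi x) = x" "gF (gF x) = x" "gF0 (gF0 x) = x"
  by (rule vecs_eqI; simp add: assms gM1_def gM2_def gM3_def gR_def gRi_def gF_def gF0_def power2_eq_square algebra_simps)+

lemma gens_quad: "quadQ6 (gM1 s x) = quadQ6 x" "quadQ6 (gM2 s x) = quadQ6 x" "quadQ6 (gM3 s x) = quadQ6 x" "quadQ6 (gR x) = quadQ6 x"
  "quadQ6 (gRi x) = quadQ6 x" "quadQ6 (gF x) = quadQ6 x" "quadQ6 (gF0 x) = quadQ6 x"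
  by (simp_all add: quadQ6_def gM1_def gM2_def gM3_def gR_def gRi_def gF_def gF0_def power2_eq_square algebra_simps)

lemma hx_perm: assumes "hx x y" shows "hx (gR x) (gR y)" "hx (gRi x) (gRi y)" "hx (gF x) (gF y)" "hx (gF0 x) (gF0 y)"
  using assms unfolding hx_iff gR_def gRi_def gF_def gF0_def by (simp_all add: algebra_simps)

lemma hx_gM1: assumes "hx x y" shows "hx (gM1 s x) (gM1 s y)"
  using assms unfolding hx_iff gM1_def mk_simps by (intro conjI; elim conjE) algebra+

lemma hx_gM2: assumes "hx x y" shows "hx (gM2 s x) (gM2 s y)"
  using assms unfolding hx_iff gM2_def mk_simps by (intro conjI; elim conjE) algebra+

lemma hx_gM3: assumes "hx x y" shows "hx (gM3 s x) (gM3 s y)"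
  using assms unfolding hx_iff gM3_def mk_simps by (intro conjI; elim conjE) algebra+

lemma autm_M1: "autm (gM1 s) (gM1 (- s))" and autm_M2: "autm (gM2 s) (gM2 (- s))" and autm_M3: "autm (gM3 s) (gM3 (- s))"
  and autm_R: "autm gR gRi" and autm_F: "autm gF gF" and autm_F0: "autm gF0 gF0"
  unfolding autm_def using lin_gens gens_quad hx_perm hx_gM1 hx_gM2 hx_gM3 gens_inv gens_inv(1-3)[of _ "- s"] by auto

abbreviation u0 :: "nat \<Rightarrow> 'a::field" where "u0 \<equiv> mk 1 0 0 0 0 0 0"

text \<open>Elations clear the coordinates 5, 6, 3, 2, 1 in this order, those for 6 and 1 being the
  conjugates under \<open>gF0\<close> of those for 5 and 2. The quadric then kills coordinate
  4.\<close>

lemma trans1: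
  assumes x: "x \<in> vecs 6" "quadQ6 x = 0" "x 0 = 1"
  shows "\<exists>g h. autm g h \<and> g x = u0"
proof -
  define x1 where "x1 = gM2 (- x 5) x"
  define x2 where "x2 = gF0 (gM2 (- x1 6) (gF0 x1))"
  define x3 where "x3 = gM3 (x2 3) x2"
  define x4 where "x4 = gM1 (- x3 2) x3"
  define x5 where "x5 = gF0 (gM1 (- x4 1) (gF0 x4))"
  have 1: "x1 0 = 1" "x1 5 = 0" unfolding x1_def gM2_def using x by simp_all
  have 2: "x2 0 = 1" "x2 5 = 0" "x2 6 = 0" unfolding x2_def gM2_def gF0_def using 1 by simp_all
  have 3: "x3 0 = 1" "x3 5 = 0" "x3 6 = 0" "x3 3 = 0" unfolding x3_def gM3_def using 2 by simp_all
  have 4: "x4 0 = 1" "x4 5 = 0" "x4 6 = 0" "x4 3 = 0" "x4 2 = 0" unfolding x4_def gM1_def using 3 by simp_all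
  have 5: "x5 0 = 1" "x5 5 = 0" "x5 6 = 0" "x5 3 = 0" "x5 2 = 0" "x5 1 = 0" unfolding x5_def gM1_def gF0_def using 4 by simp_all
  have q: "quadQ6 x5 = 0" unfolding x5_def x4_def x3_def x2_def x1_def gens_quad by (rule x(2))
  then have 6: "x5 4 = 0" unfolding quadQ6_def using 5 by simp
  have v: "x5 \<in> vecs 6" unfolding x5_def by simp
  have e: "x5 = u0" by (rule vecs_eqI) (use 5 6 v in simp_all)
  have step: "\<exists>g h. autm g h \<and> g y = u0" if "autm k l" "\<exists>g h. autm g h \<and> g (k y) = u0" for k l and y :: "nat \<Rightarrow> 'a"
    using that autm_comp[OF that(1)] by blast
  have "\<exists>g h. autm g h \<and> g (gM1 (- x4 1) (gF0 x4)) = u0" using autm_F0 e unfolding x5_def by blast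
  then have "\<exists>g h. autm g h \<and> g x4 = u0" using step[OF autm_F0, OF step[OF autm_M1]] by blast
  then have "\<exists>g h. autm g h \<and> g x2 = u0" unfolding x4_def using step[OF autm_M1] x3_def step[OF autm_M3] by metis
  then have "\<exists>g h. autm g h \<and> g x1 = u0" unfolding x2_def by (intro step[OF autm_F0, OF step[OF autm_M2, OF step[OF autm_F0]]])
  then show ?thesis unfolding x1_def by (rule step[OF autm_M2])
qed

lemma trans0:
  assumes x: "x \<in> vecs 6" "quadQ6 x = 0" "x 0 \<noteq> 0"
  shows "\<exists>g h k. autm g h \<and> k \<noteq> 0 \<and> g x = k *s u0"
proof -
  let ?y = "inverse (x 0) *s x"
  have "?y \<in> vecs 6" "quadQ6 ?y = 0" "?y 0 = 1" using x by (simp_all add: vecs_scl quad_scl scl_apply)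
  then obtain g h where g: "autm g h" "g ?y = u0" using trans1 by blast
  have "x = x 0 *s ?y" using x by simp
  then have "g x = x 0 *s u0" using g(2) lin_scl[OF autmD(1)[OF g(1)], of "x 0" ?y] by simp
  then show ?thesis using g x by blast
qed

text \<open>Powers of \<open>gR\<close> bring each of the coordinates 6, 1, 4, 2, 5 to position 0.
  If all of these and coordinate 0 were zero, the quadric would make coordinate 3 zero as
  well.\<close>

lemma trans:
  assumes x: "x \<in> vecs 6" "quadQ6 x = 0" "x \<noteq> 0"
  shows "\<exists>g h k. autm g h \<and> k \<noteq> 0 \<and> g x = k *s u0"
proof -
  have step: "\<exists>g h k. autm g h \<and> k \<noteq> 0 \<and> g y = k *s u0" if "\<exists>g h k. autm g h \<and> k \<noteq> 0 \<and> g (gR y) = k *s u0" for y :: "nat \<Rightarrow> 'a"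
    using that autm_comp[OF autm_R] by blast
  have "x 0 \<noteq> 0 \<or> x 6 \<noteq> 0 \<or> x 1 \<noteq> 0 \<or> x 4 \<noteq> 0 \<or> x 2 \<noteq> 0 \<or> x 5 \<noteq> 0"
  proof (rule ccontr)
    assume "\<not> ?thesis"
    then have z: "x 0 = 0" "x 1 = 0" "x 2 = 0" "x 4 = 0" "x 5 = 0" "x 6 = 0" by auto
    then have "x 3 = 0" using x(2) unfolding quadQ6_def by simp
    then have "x = 0" using z by (intro vecs_eqI x vecs_0) simp_all
    then show False using x by blast
  qed
  moreover have "\<exists>g h k. autm g h \<and> k \<noteq> 0 \<and> g y = k *s u0" if "y \<in> vecs 6" "quadQ6 y = 0" "y 0 \<noteq> 0" for y :: "nat \<Rightarrow> 'a"
    using trans0 that by blast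
  note t = this
  have c: "gR x 0 = x 6" "gR (gR x) 0 = x 1" "gR (gR (gR x)) 0 = x 4" "gR (gR (gR (gR x))) 0 = x 2" "gR (gR (gR (gR (gR x)))) 0 = x 5"
    unfolding gR_def by simp_all
  ultimately consider "x 0 \<noteq> 0" | "gR x 0 \<noteq> 0" | "gR (gR x) 0 \<noteq> 0" | "gR (gR (gR x)) 0 \<noteq> 0" | "gR (gR (gR (gR x))) 0 \<noteq> 0" | "gR (gR (gR (gR (gR x)))) 0 \<noteq> 0"
    by metis
  then show ?thesis
  proof cases
    case 1 then show ?thesis using t x by blast
  next
    case 2 show ?thesis by (rule step, rule t) (simp_all add: 2 x gens_quad)
  next
    case 3 show ?thesis by (rule step, rule step, rule t) (simp_all add: 3 x gens_quad)
  next
    case 4 show ?thesis by (rule step, rule step, rule step, rule t) (simp_all add: 4 x gens_quad)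
  next
    case 5 show ?thesis by (rule step, rule step, rule step, rule step, rule t) (simp_all add: 5 x gens_quad)
  next
    case 6 show ?thesis by (rule step, rule step, rule step, rule step, rule step, rule t) (simp_all add: 6 x gens_quad)
  qed
qed

section \<open>Collinearity in the model, reduced to the single point \<open>u0\<close>\<close>

definition Pm :: "(nat \<Rightarrow> 'a) \<Rightarrow> (nat \<Rightarrow> 'a::field) set" where "Pm x = {y \<in> vecs 6. hx x y}"

lemma Pm_subspace: "vs.subspace (Pm x)"
  by (rule vs.subspaceI) (auto simp: Pm_def vecs_add vecs_scl vecs_0 hx_add hx_scl hx_0)

lemma hx_u0: "hx u0 y \<longleftrightarrow> y 1 = 0 \<and> y 2 = 0 \<and> y 3 = 0 \<and> y 4 = 0"
  unfolding hx_iff by auto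

lemma Pm_u0: "sd 3 (Pm (u0 :: nat \<Rightarrow> 'a::{field,finite}))"
proof -
  let ?a = "u0 :: nat \<Rightarrow> 'a" and ?b = "mk 0 0 0 0 0 1 0 :: nat \<Rightarrow> 'a" and ?c = "mk 0 0 0 0 0 0 1 :: nat \<Rightarrow> 'a"
  have "sd 3 (vs.span {?a,?b,?c})"
  proof (rule sd_span3)
    show "?a \<noteq> 0" by (auto dest: arg_cong[where f = "\<lambda>v. v 0"])
    show "?b \<notin> vs.span {?a}" by (auto simp: span1_iff scl_apply dest!: arg_cong[where f = "\<lambda>v. v 5"])
    show "?c \<notin> vs.span {?a,?b}" by (auto simp: span2_iff scl_apply dest!: arg_cong[where f = "\<lambda>v. v 6"])
  qed
  moreover have "Pm ?a = vs.span {?a,?b,?c}"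
  proof (intro set_eqI iffI)
    fix y assume "y \<in> Pm ?a"
    then have y: "y \<in> vecs 6" "y 1 = 0" "y 2 = 0" "y 3 = 0" "y 4 = 0" unfolding Pm_def hx_u0 by auto
    have "y = y 0 *s ?a + y 5 *s ?b + y 6 *s ?c"
      by (rule vecs_eqI) (use y in \<open>simp_all add: vecs_add vecs_scl scl_apply\<close>)
    then show "y \<in> vs.span {?a,?b,?c}" unfolding span3_iff by blast
  next
    fix y assume "y \<in> vs.span {?a,?b,?c}"
    then obtain i j k where "y = i *s ?a + j *s ?b + k *s ?c" unfolding span3_iff by blast
    then show "y \<in> Pm ?a" unfolding Pm_def hx_u0 by (simp add: vecs_add vecs_scl scl_apply)
  qed
  ultimately show ?thesis by simp
qed

lemma Pm_sd:
  assumes x: "x \<in> vecs 6" "quadQ6 x = 0" "(x :: nat \<Rightarrow> 'a::{field,finite}) \<noteq> 0" shows "sd 3 (Pm x)"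
proof -
  obtain g h k where g: "autm g h" "k \<noteq> 0" "g x = k *s u0" using trans[OF x] by blast
  have "bij_betw g (Pm x) (Pm (u0 :: nat \<Rightarrow> 'a))"
  proof (rule bij_betwI[where g = h])
    show "g \<in> Pm x \<rightarrow> Pm (u0 :: nat \<Rightarrow> 'a)"
      using autm_hx[OF g(1) x(1)] autmD(3)[OF g(1)] hx_scl_iff[OF g(2), of u0] g(3) unfolding Pm_def by auto
    show "h \<in> Pm (u0 :: nat \<Rightarrow> 'a) \<rightarrow> Pm x"
    proof
      fix y assume "y \<in> Pm (u0 :: nat \<Rightarrow> 'a)"
      then have "hx (g x) y" "y \<in> vecs 6" using hx_scl_iff[OF g(2), of u0 y] g(3) unfolding Pm_def by auto
      then have "hx (h (g x)) (h y)" using autmD(7)[OF autm_sym[OF g(1)]] by blast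
      then show "h y \<in> Pm x" using autmD(4)[OF g(1) x(1)] autmD(8)[OF g(1)] unfolding Pm_def by simp
    qed
  qed (use autmD(4,5)[OF g(1)] in \<open>auto simp: Pm_def\<close>)
  then have "card (Pm x) = card (Pm (u0 :: nat \<Rightarrow> 'a))" by (rule bij_betw_same_card)
  then show ?thesis using Pm_u0 Pm_subspace[of x] unfolding sd_def by auto
qed

lemma hx_sing:
  assumes x: "x \<in> vecs 6" "quadQ6 x = 0" "x \<noteq> 0" and y: "y \<in> vecs 6" "hx x y" shows "quadQ6 y = 0"
proof -
  obtain g h k where g: "autm g h" "k \<noteq> 0" "g x = k *s u0" using trans[OF x] by blast
  have "hx u0 (g y)" using autmD(7)[OF g(1) y(2)] g(3) hx_scl_iff[OF g(2)] by metis
  then have "quadQ6 (g y) = 0" unfolding hx_u0 quadQ6_def by simp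
  then show ?thesis using autmD(6)[OF g(1)] by simp
qed

lemma m_triangle:
  assumes x: "x \<in> vecs 6" "quadQ6 x = 0" "x \<noteq> 0" and y: "y \<in> vecs 6" "hx x y" "y \<notin> vs.span {x}" and z: "z \<in> vecs 6" "hx x z" "hx y z"
  shows "z \<in> vs.span {x,y}"
proof -
  obtain g h k where g: "autm g h" "k \<noteq> 0" "g x = k *s u0" using trans[OF x] by blast
  have gy: "hx u0 (g y)" "hx u0 (g z)" "hx (g y) (g z)" using autmD(7)[OF g(1)] y z g(3) hx_scl_iff[OF g(2)] by metis+
  let ?y = "g y" and ?z = "g z"
  have c: "?y 1 = 0" "?y 2 = 0" "?y 3 = 0" "?y 4 = 0" "?z 1 = 0" "?z 2 = 0" "?z 3 = 0" "?z 4 = 0" using gy unfolding hx_u0 by auto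
  have d: "?y 6 * ?z 5 = ?y 5 * ?z 6" using gy(3) c unfolding hx_iff by simp
  have n: "?y 5 \<noteq> 0 \<or> ?y 6 \<noteq> 0"
  proof (rule ccontr)
    assume "\<not> ?thesis"
    then have "?y = (?y 0 / k) *s (k *s u0)" using g(2)
      by (intro vecs_eqI) (use c autmD(3)[OF g(1)] in \<open>simp_all add: vecs_scl scl_apply\<close>)
    then have "?y \<in> vs.span {g x}" unfolding g(3) span1_iff by blast
    then show False using autm_span1[OF g(1) x(1) y(1)] y(3) by blast
  qed
  have "\<exists>m. ?z 5 = m * ?y 5 \<and> ?z 6 = m * ?y 6"
  proof (cases "?y 5 = 0")
    case True
    then show ?thesis using n d by (intro exI[of _ "?z 6 / ?y 6"]) auto
  next
    case False
    then show ?thesis using d by (intro exI[of _ "?z 5 / ?y 5"]) (simp add: field_simps)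
  qed
  then obtain m where m: "?z 5 = m * ?y 5" "?z 6 = m * ?y 6" by blast
  have "?z = ((?z 0 - m * ?y 0) / k) *s (k *s u0) + m *s ?y"
    by (rule vecs_eqI) (use c m g(2) autmD(3)[OF g(1)] in \<open>simp_all add: vecs_add vecs_scl scl_apply\<close>)
  then have "?z \<in> vs.span {g x, g y}" unfolding g(3) span2_iff by blast
  then show ?thesis using autm_span2[OF g(1) x(1) y(1) z(1)] by blast
qed

text \<open>Together with \<open>m_common_B\<close> this identifies perpendicularity with distance
  at most two.\<close>

lemma m_common:
  assumes x: "x \<in> vecs 6" "quadQ6 x = 0" "x \<noteq> 0" and y: "y \<in> vecs 6" "quadQ6 y = 0" "y \<noteq> 0" and B: "Bf x y = 0"
  shows "\<exists>z\<in>vecs 6. z \<noteq> 0 \<and> hx x z \<and> hx y z"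
proof -
  obtain g h k where g: "autm g h" "k \<noteq> 0" "g x = k *s u0" using trans[OF x] by blast
  let ?y = "g y"
  have yv: "?y \<in> vecs 6" "quadQ6 ?y = 0" "?y \<noteq> 0" using autmD[OF g(1)] y autm_nz[OF g(1)] by simp_all
  have "Bf (k *s u0) ?y = 0" using autm_B[OF g(1), of x y] B g(3) by simp
  then have y4: "?y 4 = 0" using g(2) unfolding Bf_bilin by (simp add: Bf_def cr_def)
  have "\<exists>z\<in>vecs 6. z \<noteq> 0 \<and> hx u0 z \<and> hx ?y z"
  proof (cases "?y 1 = 0 \<and> ?y 2 = 0 \<and> ?y 3 = 0")
    case True
    then have "hx u0 ?y" unfolding hx_u0 using y4 by simp
    then show ?thesis using yv hx_self by blast
  next
    case False
    \<comment> \<open>The solution of the equations for a common neighbour inside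
      \<open>Pm u0\<close>, where only the coordinates 0, 5 and 6 are free.\<close>
    let ?z = "mk (?y 3) 0 0 0 0 (?y 2) (- ?y 1)"
    have "?z \<noteq> 0"
    proof
      assume z: "?z = 0"
      show False using fun_cong[OF z, of 0] fun_cong[OF z, of 5] fun_cong[OF z, of 6] False by simp
    qed
    moreover have "hx u0 ?z" unfolding hx_u0 by simp
    moreover have "hx ?y ?z"
      using yv(2) y4 unfolding hx_iff quadQ6_def by (simp add: power2_eq_square algebra_simps)
    ultimately show ?thesis by (intro bexI[of _ ?z]) auto
  qed
  then obtain z where z: "z \<in> vecs 6" "z \<noteq> 0" "hx u0 z" "hx ?y z" by blast
  have "hx (g x) z" using z hx_scl_iff[OF g(2)] g(3) by metis
  then have "hx (h (g x)) (h z)" "hx (h ?y) (h z)" using autmD(7)[OF autm_sym[OF g(1)]] z by blast+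
  then show ?thesis using autmD(4)[OF g(1)] x y autmD(8)[OF g(1)] autm_nz[OF autm_sym[OF g(1)] z(1,2)] by (intro bexI[of _ "h z"]) auto
qed

lemma m_common_B:
  assumes z: "z \<in> vecs 6" "quadQ6 z = 0" "z \<noteq> 0" "hx x z" "hx y z" shows "Bf x y = 0"
proof -
  obtain g h k where g: "autm g h" "k \<noteq> 0" "g z = k *s u0" using trans[OF z(1-3)] by blast
  have "hx (g z) (g x)" "hx (g z) (g y)" using autmD(7)[OF g(1)] z hx_sym by metis+
  then have "hx u0 (g x)" "hx u0 (g y)" using g(3) hx_scl_iff[OF g(2)] by metis+
  then have "Bf (g x) (g y) = 0" unfolding hx_u0 Bf_def cr_def by simp
  then show ?thesis using autm_B[OF g(1)] by simp
qed

lemma m_quad: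
  assumes x: "x \<in> vecs 6" "quadQ6 x = 0" "x \<noteq> 0" and y: "y \<in> vecs 6" "\<not> hx x y"
    and z: "z \<in> vecs 6" "z \<noteq> 0" "hx x z" "hx y z" and w: "w \<in> vecs 6" "hx x w" "hx y w"
  shows "w \<in> vs.span {z}"
proof -
  obtain g h k where g: "autm g h" "k \<noteq> 0" "g x = k *s u0" using trans[OF x] by blast
  let ?y = "g y" and ?z = "g z" and ?w = "g w"
  have a: "hx u0 ?z" "hx u0 ?w" "hx ?y ?z" "hx ?y ?w" using autmD(7)[OF g(1)] z w g(3) hx_scl_iff[OF g(2)] by metis+
  have "\<not> hx (g x) ?y" using autm_hx[OF g(1) x(1) y(1)] y by blast
  then have ny: "\<not> hx u0 ?y" using g(3) hx_scl_iff[OF g(2)] by metis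
  have z0: "?z \<noteq> 0" using autm_nz[OF g(1) z(1,2)] .
  have zv: "?z \<in> vecs 6" "?w \<in> vecs 6" using autmD(3)[OF g(1)] by blast+
  have c: "?z 1 = 0" "?z 2 = 0" "?z 3 = 0" "?z 4 = 0" "?w 1 = 0" "?w 2 = 0" "?w 3 = 0" "?w 4 = 0" using a unfolding hx_u0 by auto
  have zn: "?z 0 \<noteq> 0 \<or> ?z 5 \<noteq> 0 \<or> ?z 6 \<noteq> 0"
  proof (rule ccontr)
    assume "\<not> ?thesis"
    then have "?z = 0" by (intro vecs_eqI) (use c zv in \<open>simp_all add: vecs_0\<close>)
    then show False using z0 by blast
  qed
  have ez: "?y 4 * ?z 0 = 0" "?y 4 * ?z 5 = 0" "?y 4 * ?z 6 = 0" "?y 3 * ?z 5 = ?y 2 * ?z 0" "?y 3 * ?z 6 + ?y 1 * ?z 0 = 0" "?y 1 * ?z 5 + ?y 2 * ?z 6 = 0"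
    using a(3) c unfolding hx_iff by (simp_all add: algebra_simps)
  have ew: "?y 3 * ?w 5 = ?y 2 * ?w 0" "?y 3 * ?w 6 + ?y 1 * ?w 0 = 0" "?y 1 * ?w 5 + ?y 2 * ?w 6 = 0"
    using a(4) c unfolding hx_iff by (simp_all add: algebra_simps)
  have y4: "?y 4 = 0" using ez zn by auto
  then have yn: "?y 1 \<noteq> 0 \<or> ?y 2 \<noteq> 0 \<or> ?y 3 \<noteq> 0" using ny unfolding hx_u0 by blast
  have "\<exists>m. ?w 0 = m * ?z 0 \<and> ?w 5 = m * ?z 5 \<and> ?w 6 = m * ?z 6"
  proof (cases "?y 3 = 0")
    case False
    have z5: "?z 5 = ?y 2 * ?z 0 / ?y 3" "?z 6 = - ?y 1 * ?z 0 / ?y 3" "?w 5 = ?y 2 * ?w 0 / ?y 3" "?w 6 = - ?y 1 * ?w 0 / ?y 3"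
      using ez(4,5) ew(1,2) False by (simp_all add: field_simps eq_neg_iff_add_eq_0)
    then have "?z 0 \<noteq> 0" using zn by auto
    then show ?thesis by (intro exI[of _ "?w 0 / ?z 0"]) (simp add: z5)
  next
    case True
    then have "?z 0 = 0" "?w 0 = 0" using ez ew yn by auto
    moreover have "\<exists>m. ?w 5 = m * ?z 5 \<and> ?w 6 = m * ?z 6"
    proof (cases "?y 1 = 0")
      case t1: True
      then have "?z 6 = 0" "?w 6 = 0" using ez ew yn True by auto
      then show ?thesis using zn \<open>?z 0 = 0\<close> by (intro exI[of _ "?w 5 / ?z 5"]) auto
    next
      case f1: False
      have z5: "?z 5 = - ?y 2 * ?z 6 / ?y 1" "?w 5 = - ?y 2 * ?w 6 / ?y 1" using ez(6) ew(3) f1 by (simp_all add: field_simps eq_neg_iff_add_eq_0)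
      then have "?z 6 \<noteq> 0" using zn \<open>?z 0 = 0\<close> by auto
      then show ?thesis by (intro exI[of _ "?w 6 / ?z 6"]) (simp add: z5)
    qed
    ultimately show ?thesis by auto
  qed
  then obtain m where m: "?w 0 = m * ?z 0" "?w 5 = m * ?z 5" "?w 6 = m * ?z 6" by blast
  have "?w = m *s ?z" by (rule vecs_eqI) (use m c zv in \<open>simp_all add: vecs_scl scl_apply\<close>)
  then have "?w \<in> vs.span {?z}" unfolding span1_iff by blast
  then show ?thesis using autm_span1[OF g(1) z(1) w(1)] by blast
qed

text \<open>When coordinate 4 vanishes, \<open>hx\<close> makes the coordinates 1, 2, 3 of the two
  vectors proportional, so a combination of them is collinear with \<open>u0\<close>. Thus a line
  perpendicular to x has a point collinear with x, which is the form in which the absence of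
  pentagons is used for the model.\<close>

lemma m_pent:
  assumes x: "x \<in> vecs 6" "quadQ6 x = 0" "x \<noteq> 0" and y: "y \<in> vecs 6" "z \<in> vecs 6" "hx y z" "Bf x y = 0" "Bf x z = 0"
  shows "\<exists>a b. (a \<noteq> 0 \<or> b \<noteq> 0) \<and> hx x (a *s y + b *s z)"
proof -
  obtain g h k where g: "autm g h" "k \<noteq> 0" "g x = k *s u0" using trans[OF x] by blast
  let ?y = "g y" and ?z = "g z"
  have yz: "hx ?y ?z" using autmD(7)[OF g(1) y(3)] .
  have "Bf (k *s u0) ?y = 0" "Bf (k *s u0) ?z = 0" using autm_B[OF g(1), of x y] autm_B[OF g(1), of x z] y g(3) by simp_all
  then have y4: "?y 4 = 0" "?z 4 = 0" using g(2) unfolding Bf_bilin by (simp_all add: Bf_def cr_def)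
  have m: "?y 1 * ?z 2 = ?y 2 * ?z 1" "?y 3 * ?z 1 = ?y 1 * ?z 3" "?y 3 * ?z 2 = ?y 2 * ?z 3" using yz y4 unfolding hx_iff by simp_all
  have "\<exists>a b. (a \<noteq> 0 \<or> b \<noteq> 0) \<and> a * ?y 1 + b * ?z 1 = 0 \<and> a * ?y 2 + b * ?z 2 = 0 \<and> a * ?y 3 + b * ?z 3 = 0"
  proof -
    consider "?y 1 = 0" "?y 2 = 0" "?y 3 = 0" | "?y 1 \<noteq> 0" | "?y 2 \<noteq> 0" | "?y 3 \<noteq> 0" by blast
    then show ?thesis
    proof cases
      case 1 then show ?thesis by (intro exI[of _ 1] exI[of _ 0]) simp
    next
      case 2 then show ?thesis using m by (intro exI[of _ "- ?z 1"] exI[of _ "?y 1"]) (simp add: algebra_simps)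
    next
      case 3 then show ?thesis using m by (intro exI[of _ "- ?z 2"] exI[of _ "?y 2"]) (simp add: algebra_simps)
    next
      case 4 then show ?thesis using m by (intro exI[of _ "- ?z 3"] exI[of _ "?y 3"]) (simp add: algebra_simps)
    qed
  qed
  then obtain a b where ab: "a \<noteq> 0 \<or> b \<noteq> 0" "a * ?y 1 + b * ?z 1 = 0" "a * ?y 2 + b * ?z 2 = 0" "a * ?y 3 + b * ?z 3 = 0" by blast
  let ?u = "a *s y + b *s z"
  have gu: "g ?u = a *s ?y + b *s ?z" by (simp add: lin_add[OF autmD(1)[OF g(1)]] lin_scl[OF autmD(1)[OF g(1)]])
  have "hx u0 (g ?u)" unfolding gu hx_u0 using ab y4 by (simp add: scl_apply)
  then have "hx (g x) (g ?u)" using g(3) hx_scl_iff[OF g(2)] by metis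
  then have "hx x ?u" using autm_hx[OF g(1) x(1), of ?u] y by (simp add: vecs_add vecs_scl)
  then show ?thesis using ab by blast
qed

text \<open>Modulo the line xy, the pencil planes of its points behave like the points of a conic:
  no three are coplanar with the line in one solid. This is the computation behind
  \<open>hex_pencils3\<close>.\<close>

lemma m_conic:
  assumes x: "x \<in> vecs 6" "quadQ6 x = 0" "x \<noteq> 0" and y: "y \<in> vecs 6" "hx x y" "y \<notin> vs.span {x}"
    and p: "p \<in> vecs 6" "hx x p" "p \<notin> vs.span {x,y}" and p': "p' \<in> vecs 6" "hx y p'"
    and nz: "\<alpha> \<noteq> 0" "\<beta> \<noteq> 0" "a \<noteq> 0" "b \<noteq> 0" and h: "hx (\<alpha> *s x + \<beta> *s y) (a *s p + b *s p')"
  shows False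
proof -
  obtain g h k where g: "autm g h" "k \<noteq> 0" "g x = k *s u0" using trans[OF x] by blast
  let ?y = "g y" and ?p = "g p" and ?r = "g p'"
  have a: "hx u0 ?y" "hx u0 ?p" "hx ?y ?r" using autmD(7)[OF g(1)] y p p' g(3) hx_scl_iff[OF g(2)] by metis+
  have c: "?y 1 = 0" "?y 2 = 0" "?y 3 = 0" "?y 4 = 0" "?p 1 = 0" "?p 2 = 0" "?p 3 = 0" "?p 4 = 0" using a unfolding hx_u0 by auto
  have "cr j (\<alpha> *s x + \<beta> *s y) (a *s p + b *s p') = \<alpha> * b * cr j x p' + \<beta> * a * cr j y p" for j
    using y p p' by (simp add: cr_add cr_scl hx_def algebra_simps)
  have "hx (g (\<alpha> *s x + \<beta> *s y)) (g (a *s p + b *s p'))" using autmD(7)[OF g(1) h] .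
  then have H: "hx (\<alpha> *s (k *s u0) + \<beta> *s ?y) (a *s ?p + b *s ?r)"
    by (simp add: lin_add[OF autmD(1)[OF g(1)]] lin_scl[OF autmD(1)[OF g(1)]] g(3) del: vs.scale_scale)
  have "cr j (\<alpha> *s (k *s u0) + \<beta> *s ?y) (a *s ?p + b *s ?r) = \<alpha> * b * k * cr j u0 ?r + \<beta> * a * cr j ?y ?p" for j
  proof -
    have "cr j u0 ?p = 0" "cr j ?y ?r = 0" using a unfolding hx_def by auto
    then show ?thesis by (simp add: cr_add cr_scl algebra_simps del: vs.scale_scale)
  qed
  then have E: "\<alpha> * b * k * cr j u0 ?r + \<beta> * a * cr j ?y ?p = 0" for j using H unfolding hx_def by simp
  have r: "?r 2 = 0" "?r 1 = 0" using E[of 1] E[of 2] nz g(2) c by (simp_all add: cr_def)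
  have r3: "\<alpha> * b * k * ?r 3 + \<beta> * a * (?y 6 * ?p 5 - ?y 5 * ?p 6) = 0" using E[of 3] c by (simp add: cr_def)
  have ry: "?r 3 * ?y 5 = 0" "?r 3 * ?y 6 = 0" using a(3) c r unfolding hx_iff by (auto simp: algebra_simps)
  have yv: "?y \<in> vecs 6" "?p \<in> vecs 6" using autmD(3)[OF g(1)] by blast+
  have y56: "?y 5 \<noteq> 0 \<or> ?y 6 \<noteq> 0"
  proof (rule ccontr)
    assume "\<not> ?thesis"
    then have "?y = (?y 0 / k) *s (k *s u0)" using g(2)
      by (intro vecs_eqI) (use c yv in \<open>simp_all add: vecs_scl scl_apply\<close>)
    then have "?y \<in> vs.span {g x}" unfolding g(3) span1_iff by blast
    then show False using autm_span1[OF g(1) x(1) y(1)] y(3) by blast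
  qed
  then have "?r 3 = 0" using ry by auto
  then have d: "?y 6 * ?p 5 = ?y 5 * ?p 6" using r3 nz by simp
  have "hx ?y ?p" unfolding hx_iff using c d by simp
  then have "hx y p" using autm_hx[OF g(1) y(1) p(1)] by blast
  then show False using m_triangle[OF x y p(1,2)] p(3) by blast
qed

section \<open>Counting lines of the hexagon in subspaces\<close>

lemma sd_extend:
  assumes "sd k (U :: (nat \<Rightarrow> 'a::{field,finite}) set)" "U \<subseteq> V" "sd n V" "k \<le> m" "m \<le> n"
  shows "\<exists>U'. sd m U' \<and> U \<subseteq> U' \<and> U' \<subseteq> V"
  using assms
proof (induction "m - k" arbitrary: k U)
  case 0
  then have "k = m" by simp
  then show ?case using 0 by blast
next
  case (Suc j)
  have kn: "k < n" using Suc.hyps(2) Suc.prems(5) by linarith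
  have km: "j = m - Suc k" "Suc k \<le> m" using Suc.hyps(2) by linarith+
  obtain x where x: "x \<in> V" "x \<notin> U" using sd_exists_notin[OF Suc.prems(3) Suc.prems(1) kn] .
  have sp: "vs.span U = U" using Suc.prems(1) by (simp add: sd_def vs.span_eq_iff)
  have "sd (Suc k) (vs.span (insert x U))" using sd_span_insert[of k U x] Suc.prems(1) x sp by simp
  moreover have "vs.span (insert x U) \<subseteq> V" using sd_span_le[OF Suc.prems(3)] x Suc.prems(2) by simp
  ultimately obtain U' where "sd m U'" "vs.span (insert x U) \<subseteq> U'" "U' \<subseteq> V" using Suc.hyps(1)[of "Suc k" "vs.span (insert x U)"] Suc.hyps(2) Suc.prems km by auto
  moreover have "U \<subseteq> vs.span (insert x U)" using vs.span_superset by blast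
  ultimately show ?case by blast
qed

text \<open>All that the line counts need from the model beyond \<open>line_geom\<close>: a form
  whose perpendicularity means distance at most two, and the consequence of \<open>m_pent\<close>
  for perpendicular lines.\<close>

locale hexmod = line_geom V L q for V :: "(nat \<Rightarrow> 'a::{field,finite}) set" and L q +
  fixes B :: "(nat \<Rightarrow> 'a) \<Rightarrow> (nat \<Rightarrow> 'a) \<Rightarrow> 'a"
  assumes V7: "sd 7 V" and P_ne: "P \<noteq> {}"
    and B_add: "\<And>x y z. B x (y + z) = B x y + B x z" and B_scl: "\<And>x k y. B x (k *s y) = k * B x y"
    and B_sym: "\<And>x y. B x y = B y x"
    and B_near: "\<And>x y. x \<in> P \<Longrightarrow> y \<in> P \<Longrightarrow> B x y = 0 \<longleftrightarrow> (\<exists>v. v \<noteq> 0 \<and> v \<in> Pi x \<and> v \<in> Pi y)"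
    and B_pent: "\<And>x m. x \<in> P \<Longrightarrow> m \<in> L \<Longrightarrow> (\<forall>y\<in>m. B x y = 0) \<Longrightarrow> \<exists>p\<in>m. p \<noteq> 0 \<and> p \<in> Pi x"
begin

lemma in2: "a \<in> vs.span {a,b}" "b \<in> vs.span {a,b}" for a b :: "nat \<Rightarrow> 'a" by (simp_all add: vs.span_base)

lemma B_0: "B x 0 = 0" using B_scl[of x 0 0] by simp

lemma B_diff: "B x (y - z) = B x y - B x z" using B_add[of x y "(-1) *s z"] B_scl[of x "-1" z] by simp

lemma path2_B: "x \<in> P \<Longrightarrow> v \<in> Pi x \<Longrightarrow> v \<noteq> 0 \<Longrightarrow> y \<in> Pi v \<Longrightarrow> B x y = 0"
proof (cases "y = 0")
  case False
  assume a: "x \<in> P" "v \<in> Pi x" "v \<noteq> 0" "y \<in> Pi v"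
  then have "y \<in> P" using adj_P False by blast
  then show ?thesis using B_near[OF a(1)] a adj_sym by blast
qed (simp add: B_0)

lemma adj_B: "x \<in> P \<Longrightarrow> y \<in> Pi x \<Longrightarrow> B x y = 0"
  using path2_B[of x x y] Pi_self P_nz by blast

definition Hp where "Hp x = {y\<in>V. B x y = 0}"

lemma Hp_int_sd:
  assumes U: "sd (Suc k) U" "U \<subseteq> V" and y: "y \<in> U" "B x y \<noteq> 0" shows "sd k (U \<inter> Hp x)"
proof -
  have s: "vs.subspace (U \<inter> Hp x)"
    by (rule vs.subspaceI) (use sd_zero[OF U(1)] sd_add[OF U(1)] sd_scale[OF U(1)] U(2) in \<open>auto simp: Hp_def B_0 B_add B_scl\<close>)
  obtain j where j: "sd j (U \<inter> Hp x)" using sd_exists[OF s] sd_finite[OF U(1)] by auto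
  have y0: "y \<noteq> 0" using y B_0 by auto
  obtain i where i: "sd i (U \<inter> Hp x \<inter> vs.span {y})" "sd (j + 1 - i) (ssum (U \<inter> Hp x) (vs.span {y}))" "i \<le> 1"
    using sd_int_sum[OF j sd_span1[OF y0]] by blast
  have "U \<inter> Hp x \<inter> vs.span {y} = {0}"
  proof -
    have "v = 0" if v: "v \<in> Hp x" "v \<in> vs.span {y}" for v
    proof -
      obtain c where c: "v = c *s y" using v(2) span1_iff by blast
      have "c * B x y = 0" using v(1) c B_scl[of x c y] unfolding Hp_def by simp
      then show ?thesis using y c by simp
    qed
    moreover have "0 \<in> U \<inter> Hp x \<inter> vs.span {y}" using vs.subspace_0[OF s] vs.span_zero by blast
    ultimately show ?thesis by blast
  qed
  then have "i = 0" using sd_unique[OF i(1)] sd_0_iff by metis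
  then have t: "sd (j + 1) (ssum (U \<inter> Hp x) (vs.span {y}))" using i(2) by simp
  have "ssum (U \<inter> Hp x) (vs.span {y}) = U"
  proof
    show "ssum (U \<inter> Hp x) (vs.span {y}) \<subseteq> U" using ssum_le[OF sd_subspace[OF U(1)]] sd_span_mem[OF U(1) y(1)] by blast
    show "U \<subseteq> ssum (U \<inter> Hp x) (vs.span {y})"
    proof
      fix u assume u: "u \<in> U"
      let ?c = "B x u / B x y"
      have "u - ?c *s y \<in> U" using sd_diff[OF U(1) u sd_scale[OF U(1) y(1)]] .
      moreover from this have "u - ?c *s y \<in> Hp x" unfolding Hp_def using U(2) y(2) by (auto simp: B_diff B_scl)
      moreover have "?c *s y \<in> vs.span {y}" unfolding span1_iff by blast
      ultimately have "(u - ?c *s y) + ?c *s y \<in> ssum (U \<inter> Hp x) (vs.span {y})" by (intro ssumI) auto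
      then show "u \<in> ssum (U \<inter> Hp x) (vs.span {y})" by simp
    qed
  qed
  then have "j + 1 = Suc k" using sd_unique[OF t] U(1) by metis
  then show ?thesis using j by simp
qed

lemma line_perp: assumes x: "x \<in> P" and m: "m \<in> L" shows "\<exists>w\<in>m. w \<noteq> 0 \<and> B x w = 0"
proof (cases "\<forall>y\<in>m. B x y = 0")
  case True
  then show ?thesis using sd_nz[OF L_sd[OF m]] by auto
next
  case False
  then obtain y where y: "y \<in> m" "B x y \<noteq> 0" by blast
  have m2: "sd (Suc 1) m" using L_sd[OF m] by (simp add: numeral_2_eq_2)
  obtain w where "w \<in> m \<inter> Hp x" "w \<noteq> 0" using sd_nz[OF Hp_int_sd[OF m2 L_V[OF m] y]] by auto
  then show ?thesis unfolding Hp_def by auto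
qed

lemma line_near: assumes x: "x \<in> P" and m: "m \<in> L"
  obtains w v where "w \<in> m" "w \<noteq> 0" "w \<in> P" "v \<noteq> 0" "v \<in> P" "v \<in> Pi x" "v \<in> Pi w" "w \<in> Pi v" "B x w = 0"
proof -
  obtain w where w: "w \<in> m" "w \<noteq> 0" "B x w = 0" using line_perp[OF x m] by blast
  have wP: "w \<in> P" using P_I m w by blast
  obtain v where v: "v \<noteq> 0" "v \<in> Pi x" "v \<in> Pi w" using B_near[OF x wP] w by blast
  then show thesis using that w wP adj_P adj_sym by blast
qed

lemma plane_count:
  assumes T: "sd k T" "k \<le> 3" "T \<subseteq> V" shows "card (LU T) \<in> {0, 1, q + 1}"
proof (cases "card (LU T) \<le> Suc 0")
  case False
  then obtain l m where "l \<in> LU T" "m \<in> LU T" "l \<noteq> m" unfolding card_le_Suc0_iff_eq[OF fin_LU] by blast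
  then have l: "l \<in> L" "m \<in> L" "l \<noteq> m" "l \<subseteq> T" "m \<subseteq> T" unfolding LU_def by auto
  obtain x where x: "x \<in> l" "x \<in> m" "x \<noteq> 0" using sd_int_nz[OF L_sd[OF l(1)] L_sd[OF l(2)] T(1) l(4,5)] T(2) by auto
  have xP: "x \<in> P" using P_I l x by blast
  have "Pi x \<subseteq> T" using Pi_le[OF sd_subspace[OF T(1)] l(1,2,3) x l(4,5)] .
  then have "Pi x = T" using sd_eq[OF Pi_sd[OF xP] T(1)] T(2) by blast
  then show ?thesis using Pi_lines[OF xP] lines_card[OF xP] unfolding LU_def by simp
qed auto

text \<open>If two lines meet in x, then x is full, and each line off x meets \<open>Pi x\<close> in
  another full point. By \<open>pencils3\<close> there is at most one such point, which gives q + 1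
  or 2 q + 1 lines. If there are several lines, all pairwise skew, they correspond to the points of
  one transversal line.\<close>

lemma solid_count:
  assumes S: "sd k S" "k \<le> 4" "S \<subseteq> V" shows "card (LU S) \<in> {0, 1, q + 1, 2 * q + 1}"
proof (cases "\<exists>l\<in>LU S. \<exists>m\<in>LU S. l \<noteq> m \<and> l \<inter> m \<noteq> {0}")
  case True
  then obtain l m where "l \<in> LU S" "m \<in> LU S" "l \<noteq> m" "l \<inter> m \<noteq> {0}" by blast
  then have l: "l \<in> L" "m \<in> L" "l \<noteq> m" "l \<subseteq> S" "m \<subseteq> S" "l \<inter> m \<noteq> {0}" unfolding LU_def by auto
  obtain x where x: "x \<in> l" "x \<in> m" "x \<noteq> 0" using int_zero[OF l(1,2)] l(6) by blast
  have xP: "x \<in> P" using P_I l x by blast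
  have xS: "Pi x \<subseteq> S" using Pi_le[OF sd_subspace[OF S(1)] l(1,2,3) x l(4,5)] .
  have Lx: "{k\<in>L. x \<in> k} \<subseteq> LU S" unfolding LU_def using line_sub_Pi xS by blast
  show ?thesis
  proof (cases "LU S \<subseteq> {k\<in>L. x \<in> k}")
    case True
    then have "LU S = {k\<in>L. x \<in> k}" using Lx by blast
    then show ?thesis using lines_card[OF xP] by simp
  next
    case False
    have full: "\<exists>z. z \<in> j \<and> z \<in> Pi x \<and> z \<noteq> 0 \<and> z \<notin> vs.span {x} \<and> Pi z \<subseteq> S" if j: "j \<in> LU S" "x \<notin> j" for j
    proof -
      have jL: "j \<in> L" "j \<subseteq> S" using j unfolding LU_def by auto
      obtain z where z: "z \<in> j" "z \<in> Pi x" "z \<noteq> 0" using sd_int_nz[OF L_sd[OF jL(1)] Pi_sd[OF xP] S(1) jL(2) xS] S(2) by auto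
      have zx: "z \<notin> vs.span {x}" using span1_sym[OF z(3)] sd_span_mem[OF L_sd[OF jL(1)] z(1)] j(2) by blast
      have l2: "vs.span {x,z} \<in> L" using adj_line[OF xP z(2) zx] .
      have "vs.span {x,z} \<subseteq> S" using line_sub_Pi[OF l2 in2(1)] xS by blast
      moreover have "vs.span {x,z} \<noteq> j" using j(2) in2 by blast
      ultimately have "Pi z \<subseteq> S" using Pi_le[OF sd_subspace[OF S(1)] l2 jL(1) _ in2(2) z(1,3) _ jL(2)] by blast
      then show ?thesis using z zx by blast
    qed
    obtain j where j: "j \<in> LU S" "x \<notin> j" using False unfolding LU_def by blast
    obtain z where z: "z \<in> j" "z \<in> Pi x" "z \<noteq> 0" "z \<notin> vs.span {x}" "Pi z \<subseteq> S" using full[OF j] by blast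
    have zP: "z \<in> P" using adj_P z by blast
    have "ssum (Pi x) (Pi z) \<subseteq> S" using ssum_le[OF sd_subspace[OF S(1)] xS z(5)] .
    then have "4 \<le> k" using sd_mono[OF Pi_int_adj(2)[OF xP z(2,4)] S(1)] by blast
    then have S4: "sd 4 S" using S by simp
    have e: "LU S = {k\<in>L. x \<in> k} \<union> {k\<in>L. z \<in> k}"
    proof
      show "LU S \<subseteq> {k\<in>L. x \<in> k} \<union> {k\<in>L. z \<in> k}"
      proof
        fix i assume i: "i \<in> LU S"
        then have iL: "i \<in> L" unfolding LU_def by blast
        show "i \<in> {k\<in>L. x \<in> k} \<union> {k\<in>L. z \<in> k}"
        proof (cases "x \<in> i")
          case False
          obtain y where y: "y \<in> i" "y \<in> Pi x" "y \<noteq> 0" "y \<notin> vs.span {x}" "Pi y \<subseteq> S" using full[OF i False] by blast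
          have "y \<in> vs.span {z}" using pencils3[OF S4 S(3) xP zP adj_P[OF y(2,3)] xS z(5) y(5) z(4) y(4)] by blast
          then have "z \<in> i" using span1_sym[OF y(3)] sd_span_mem[OF L_sd[OF iL] y(1)] by blast
          then show ?thesis using iL by blast
        qed (use iL in blast)
      qed
      show "{k\<in>L. x \<in> k} \<union> {k\<in>L. z \<in> k} \<subseteq> LU S" using Lx z(5) line_sub_Pi unfolding LU_def by blast
    qed
    have l2: "vs.span {x,z} \<in> L" using adj_line[OF xP z(2,4)] .
    have "k = vs.span {x,z}" if "k \<in> L" "x \<in> k" "z \<in> k" for k
      using sd_line_span[OF L_sd[OF that(1)] that(2,3) P_nz[OF xP] z(4)] .
    then have "{k\<in>L. x \<in> k} \<inter> {k\<in>L. z \<in> k} \<subseteq> {vs.span {x,z}}" by (intro subsetI) simp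
    moreover have "vs.span {x,z} \<in> {k\<in>L. x \<in> k} \<inter> {k\<in>L. z \<in> k}" using l2 in2(1)[of x z] in2(2)[of z x] by simp
    ultimately have "{k\<in>L. x \<in> k} \<inter> {k\<in>L. z \<in> k} = {vs.span {x,z}}" by (simp only: subset_singleton_iff) auto
    then have "card (LU S) + 1 = (q + 1) + (q + 1)"
      using card_Un_Int[OF fin_sub fin_sub, of "\<lambda>k. x \<in> k" "\<lambda>k. z \<in> k"] lines_card[OF xP] lines_card[OF zP] e by simp
    then show ?thesis by simp
  qed
next
  case nomeet: False
  show ?thesis
  proof (cases "card (LU S) \<le> Suc 0")
    case False
    then obtain l m where "l \<in> LU S" "m \<in> LU S" "l \<noteq> m" unfolding card_le_Suc0_iff_eq[OF fin_LU] by blast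
    then have l: "l \<in> L" "m \<in> L" "l \<noteq> m" "l \<subseteq> S" "m \<subseteq> S" unfolding LU_def by auto
    have nm: "a = b" if "a \<in> L" "a \<subseteq> S" "b \<in> L" "b \<subseteq> S" "p \<in> a" "p \<in> b" "p \<noteq> 0" for a b p
      using nomeet that int_zero[of a b] unfolding LU_def by blast
    have lm0: "l \<inter> m = {0}" using nomeet l unfolding LU_def by blast
    have Se: "S = ssum l m" using sd_eq[OF skew_ssum[OF l(1,2) lm0] S(1) ssum_le[OF sd_subspace[OF S(1)] l(4,5)]] S(2) by simp
    have adjS: "vs.span {a,b} \<in> L \<and> vs.span {a,b} \<subseteq> S" if "a \<in> P" "b \<in> Pi a" "b \<notin> vs.span {a}" "a \<in> S" "b \<in> S" for a b
      using adj_line[OF that(1,2,3)] sd_span_le[OF S(1), of "{a,b}"] that by blast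
    \<comment> \<open>The middle point v of a path from l to m cannot lie in S: as no two lines in S
      meet, v would have to be on both l and m.\<close>
    have trans: "\<exists>y' v. y' \<in> m \<and> y' \<noteq> 0 \<and> y' \<in> P \<and> v \<noteq> 0 \<and> v \<in> P \<and> v \<in> Pi y \<and> v \<in> Pi y' \<and> v \<notin> S \<and> B y y' = 0" if y: "y \<in> l" "y \<noteq> 0" for y
    proof -
      have yP: "y \<in> P" using P_I l y by blast
      obtain y' v where v: "y' \<in> m" "y' \<noteq> 0" "y' \<in> P" "v \<noteq> 0" "v \<in> P" "v \<in> Pi y" "v \<in> Pi y'" "y' \<in> Pi v" "B y y' = 0" using line_near[OF yP l(2)] .
      have "v \<notin> S"
      proof
        assume vS: "v \<in> S"
        have g: "v \<in> n" if n: "n \<in> L" "n \<subseteq> S" "u \<in> n" "u \<noteq> 0" "v \<in> Pi u" for n u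
        proof (cases "v \<in> vs.span {u}")
          case True
          then show ?thesis using sd_span_mem[OF L_sd[OF n(1)] n(3)] by blast
        next
          case False
          have uS: "u \<in> S" using n by blast
          have a: "vs.span {u,v} \<in> L \<and> vs.span {u,v} \<subseteq> S" using adjS[OF P_I[OF n(1,3,4)] n(5) False uS vS] .
          then have "vs.span {u,v} = n" using nm[of "vs.span {u,v}" n u] n in2 by blast
          then show ?thesis using in2(2) by blast
        qed
        have "v \<in> l" "v \<in> m" using g[OF l(1,4) y v(6)] g[OF l(2,5) v(1,2,7)] by blast+
        then show False using lm0 v(4) by blast
      qed
      then show ?thesis using v by blast
    qed
    obtain y1 where y1: "y1 \<in> l" "y1 \<noteq> 0" using sd_nz[OF L_sd[OF l(1)]] by auto
    obtain y2 where y2: "y2 \<in> l" "y2 \<notin> vs.span {y1}" using sd_exists_notin[OF L_sd[OF l(1)] sd_span1[OF y1(2)]] by auto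
    have y20: "y2 \<noteq> 0" using y2(2) vs.span_zero by metis
    have yP: "y1 \<in> P" "y2 \<in> P" using P_I l y1 y2 y20 by blast+
    obtain z1 v1 where v1: "z1 \<in> m" "z1 \<noteq> 0" "z1 \<in> P" "v1 \<noteq> 0" "v1 \<in> P" "v1 \<in> Pi y1" "v1 \<in> Pi z1" "v1 \<notin> S" "B y1 z1 = 0" using trans[OF y1] by blast
    obtain z2 v2 where v2: "z2 \<in> m" "z2 \<noteq> 0" "z2 \<in> P" "v2 \<noteq> 0" "v2 \<in> P" "v2 \<in> Pi y2" "v2 \<in> Pi z2" "v2 \<notin> S" "B y2 z2 = 0" using trans[OF y2(1) y20] by blast
    have le: "l = vs.span {y1,y2}" using sd_line_span[OF L_sd[OF l(1)] y1(1) y2(1) y1(2) y2(2)] .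
    \<comment> \<open>If both paths ended in z1, then all of l would be perpendicular to z1, and
      \<open>B_pent\<close> would give a line of S meeting l.\<close>
    have z12: "z2 \<notin> vs.span {z1}"
    proof
      assume "z2 \<in> vs.span {z1}"
      then obtain c where c: "z2 = c *s z1" unfolding span1_iff by blast
      then have c0: "c \<noteq> 0" using v2(2) by auto
      have "c * B y2 z1 = 0" using v2(9) unfolding c B_scl .
      then have b: "B z1 y1 = 0" "B z1 y2 = 0" using c0 v1(9) B_sym by auto
      have "B z1 y = 0" if "y \<in> l" for y
      proof -
        have "y \<in> vs.span {y1,y2}" using that le by simp
        then obtain a d where "y = a *s y1 + d *s y2" unfolding span2_iff by blast
        then show ?thesis using b by (simp add: B_add B_scl)
      qed
      then obtain p where p: "p \<in> l" "p \<noteq> 0" "p \<in> Pi z1" using B_pent[OF v1(3) l(1)] by blast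
      have pz: "p \<notin> vs.span {z1}" using sd_span_mem[OF L_sd[OF l(2)] v1(1)] p lm0 by blast
      have a: "vs.span {z1,p} \<in> L \<and> vs.span {z1,p} \<subseteq> S" using adjS[OF v1(3) p(3) pz] v1(1) p(1) l by blast
      then have "vs.span {z1,p} = l" using nm[of "vs.span {z1,p}" l p] l in2 p by blast
      then have "z1 \<in> l" using in2 by blast
      then show False using v1(1,2) lm0 by blast
    qed
    have me: "m = vs.span {z1,z2}" using sd_line_span[OF L_sd[OF l(2)] v1(1) v2(1) v1(2) z12] .
    have S4: "\<exists>a b c d. s = a *s y1 + b *s y2 + (c *s z1 + d *s z2)" if "s \<in> S" for s
    proof -
      obtain s1 s2 where s: "s = s1 + s2" "s1 \<in> l" "s2 \<in> m" using \<open>s \<in> S\<close> unfolding Se ssum_def by blast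
      obtain a b where "s1 = a *s y1 + b *s y2" using s(2) unfolding le span2_iff by blast
      moreover obtain c d where "s2 = c *s z1 + d *s z2" using s(3) unfolding me span2_iff by blast
      ultimately show ?thesis using s(1) by blast
    qed
    have adjl: "y2 \<in> Pi y1" "y1 \<in> Pi y2" "z2 \<in> Pi z1" "z1 \<in> Pi z2" using line_sub_Pi l y1 y2 v1 v2 by blast+
    have Bv1: "B v1 s = 0" if "s \<in> S" for s
    proof -
      have "B v1 y1 = 0" "B v1 y2 = 0" "B v1 z1 = 0" "B v1 z2 = 0"
        using path2_B[OF v1(5) _ y1(2) adjl(1)] path2_B[OF v1(5) _ v1(2) adjl(3)] adj_B[OF v1(5)] v1(6,7) adj_sym by blast+
      then show ?thesis using S4[OF that] by (auto simp: B_add B_scl)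
    qed
    have Bv2: "B v2 s = 0" if "s \<in> S" for s
    proof -
      have "B v2 y1 = 0" "B v2 y2 = 0" "B v2 z1 = 0" "B v2 z2 = 0"
        using path2_B[OF v2(5) _ y20 adjl(2)] path2_B[OF v2(5) _ v2(2) adjl(4)] adj_B[OF v2(5)] v2(6,7) adj_sym by blast+
      then show ?thesis using S4[OF that] by (auto simp: B_add B_scl)
    qed
    have Pv: "Pi v = vs.span {v,y,z}" if "y \<in> l" "z \<in> m" "y \<noteq> 0" "z \<noteq> 0" "v \<notin> S" "v \<in> P" "v \<in> Pi y" "v \<in> Pi z" for v y z
    proof (rule Pi_span[OF that(6)])
      show "y \<in> Pi v" "z \<in> Pi v" using that adj_sym by blast+
      have yS: "y \<in> S" "z \<in> S" using that l by blast+
      show "y \<notin> vs.span {v}" using span1_sym[OF that(3)] sd_span_mem[OF S(1) yS(1)] that(5) by blast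
      show "z \<notin> vs.span {v,y}"
      proof
        assume "z \<in> vs.span {v,y}"
        then obtain a b where ab: "z = a *s v + b *s y" unfolding span2_iff by blast
        have "a = 0"
        proof (rule ccontr)
          assume a: "a \<noteq> 0"
          have "z - b *s y \<in> S" using sd_diff[OF S(1) yS(2) sd_scale[OF S(1) yS(1)]] .
          then have "inverse a *s (z - b *s y) \<in> S" using sd_scale[OF S(1)] by blast
          then show False using ab a that(5) by simp
        qed
        then have "z \<in> l" using ab sd_scale[OF L_sd[OF l(1)] that(1)] by simp
        then show False using that lm0 by blast
      qed
    qed
    \<comment> \<open>The transversal. S is perpendicular to v1 and meets \<open>Pi v1\<close> only
      in \<open>?r\<close>, so by \<open>B_pent\<close> every line in S meets
      \<open>?r\<close>.\<close>
    let ?r = "vs.span {y1,z1}"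
    have y1z1: "z1 \<notin> vs.span {y1}" using sd_span_mem[OF L_sd[OF l(1)] y1(1)] v1(1,2) lm0 by blast
    have r2: "sd 2 ?r" using sd_span2[OF y1(2) y1z1] .
    have rS: "?r \<subseteq> S" using sd_span_le[OF S(1), of "{y1,z1}"] y1 v1 l by blast
    have rv: "?r \<subseteq> Pi v1" using sd_span_le[OF Pi_sd[OF v1(5)], of "{y1,z1}"] v1(6,7) adj_sym by blast
    have Pi_S: "p \<in> vs.span {y,z}" if "y \<in> l" "z \<in> m" "y \<noteq> 0" "z \<noteq> 0" "v \<notin> S" "v \<in> P" "v \<in> Pi y" "v \<in> Pi z" "p \<in> Pi v" "p \<in> S" for v y z p
    proof -
      have "p \<in> vs.span {v,y,z}" using that(9) Pv[OF that(1-8)] by simp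
      then obtain a b c where p: "p = a *s v + b *s y + c *s z" unfolding span3_iff by blast
      have "a = 0"
      proof (rule ccontr)
        assume a: "a \<noteq> 0"
        have "b *s y + c *s z \<in> S" using sd_add[OF S(1) sd_scale[OF S(1)] sd_scale[OF S(1)]] that l by blast
        then have "p - (b *s y + c *s z) \<in> S" using sd_diff[OF S(1) that(10)] by blast
        then have "inverse a *s (p - (b *s y + c *s z)) \<in> S" using sd_scale[OF S(1)] by blast
        then show False using p a that(5) by (simp add: algebra_simps)
      qed
      then show ?thesis using p unfolding span2_iff by auto
    qed
    have meets: "\<exists>p. p \<noteq> 0 \<and> p \<in> k \<and> p \<in> ?r" if k: "k \<in> L" "k \<subseteq> S" for k
    proof -
      obtain p where p: "p \<in> k" "p \<noteq> 0" "p \<in> Pi v1" using B_pent[OF v1(5) k(1)] Bv1 k by blast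
      have "p \<in> ?r" using Pi_S[OF y1(1) v1(1) y1(2) v1(2) v1(8,5,6,7) p(3)] p k by blast
      then show ?thesis using p by blast
    qed
    \<comment> \<open>Otherwise \<open>B_pent\<close> gives a neighbour of v1 on the line y2v2,
      which closes a quadrangle or a triangle with l.\<close>
    have Bvv: "B v1 v2 \<noteq> 0"
    proof
      assume b: "B v1 v2 = 0"
      have n: "v2 \<notin> vs.span {y2}" using v2(8) sd_span_mem[OF S(1), of y2] y2(1) l by blast
      have l2: "vs.span {y2,v2} \<in> L" using adj_line[OF yP(2) v2(6) n] .
      have y2S: "y2 \<in> S" using y2 l by blast
      have "B v1 y = 0" if "y \<in> vs.span {y2,v2}" for y
        using that b Bv1[OF y2S] unfolding span2_iff by (auto simp: B_add B_scl)
      then obtain u where u: "u \<in> vs.span {y2,v2}" "u \<noteq> 0" "u \<in> Pi v1" using B_pent[OF v1(5) l2] by blast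
      have uy2: "u \<in> Pi y2" using line_sub_Pi[OF l2 in2(1)] u by blast
      show False
      proof (cases "v1 \<in> Pi y2")
        case True
        then have "v1 \<in> vs.span {y1,y2}" using no_triangle[OF yP(1) adjl(1) y2(2) v1(6)] by blast
        then show False using le l(4) v1(8) by blast
      next
        case False
        have "y1 \<in> Pi v1" using v1(6) adj_sym by blast
        then have "u \<in> vs.span {y1}" using no_quad[OF yP(2) v1(5) False adjl(2) _ y1(2) uy2 u(3)] by blast
        then have "y1 \<in> vs.span {y2,v2}" using span1_sym[OF u(2)] sd_span_mem[OF L_sd[OF l2] u(1)] by blast
        moreover have "y1 \<notin> vs.span {y2}" using span1_sym[OF y1(2)] y2(2) by blast
        ultimately have "vs.span {y2,v2} = l" using line_eq[OF l2 l(1) in2(1) y2(1) _ y1(1) y20] by blast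
        then show False using in2(2)[of v2 y2] l(4) v2(8) by blast
      qed
    qed
    \<comment> \<open>The point w is perpendicular to v2, so the two have a common neighbour c. This
      c is perpendicular to v1; since v2 is not, c lies in S, and the line wc is the one
      sought.\<close>
    have onto: "\<exists>k\<in>L. k \<subseteq> S \<and> w \<in> k" if w: "w \<in> ?r" "w \<noteq> 0" for w
    proof -
      have wS: "w \<in> S" and wv: "w \<in> Pi v1" using w rS rv by blast+
      have wP: "w \<in> P" using adj_P wv w by blast
      obtain c where c: "c \<noteq> 0" "c \<in> Pi v2" "c \<in> Pi w" using B_near[OF v2(5) wP] Bv2[OF wS] by blast
      have "B v1 c = 0" using path2_B[OF v1(5) wv w(2) c(3)] .
      have "c \<in> vs.span {v2,y2,z2}" using c(2) Pv[OF y2(1) v2(1) y20 v2(2) v2(8,5,6,7)] by simp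
      then obtain a b d where ce: "c = a *s v2 + b *s y2 + d *s z2" unfolding span3_iff by blast
      have yzS: "y2 \<in> S" "z2 \<in> S" using y2 v2 l by blast+
      have "B v1 c = a * B v1 v2" unfolding ce using Bv1[OF yzS(1)] Bv1[OF yzS(2)] by (simp add: B_add B_scl)
      then have "a = 0" using \<open>B v1 c = 0\<close> Bvv by simp
      then have ce2: "c = b *s y2 + d *s z2" using ce by simp
      have cS: "c \<in> S" unfolding ce2 using sd_add[OF S(1) sd_scale[OF S(1) yzS(1)] sd_scale[OF S(1) yzS(2)]] .
      have "c \<notin> vs.span {w}"
      proof
        assume "c \<in> vs.span {w}"
        then have cr: "c \<in> ?r" using sd_span_mem[OF r2 w(1)] by blast
        then obtain i j where "c = i *s y1 + j *s z1" unfolding span2_iff by blast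
        then have e: "b *s y2 - i *s y1 = j *s z1 - d *s z2" using ce2 by (simp add: algebra_simps)
        have "b *s y2 - i *s y1 \<in> l" using sd_diff[OF L_sd[OF l(1)] sd_scale[OF L_sd[OF l(1)] y2(1)] sd_scale[OF L_sd[OF l(1)] y1(1)]] .
        moreover have "j *s z1 - d *s z2 \<in> m" using sd_diff[OF L_sd[OF l(2)] sd_scale[OF L_sd[OF l(2)] v1(1)] sd_scale[OF L_sd[OF l(2)] v2(1)]] .
        ultimately have "b *s y2 - i *s y1 \<in> l \<inter> m" using e by simp
        then have "b *s y2 - i *s y1 = 0" unfolding lm0 by blast
        then have zz: "b *s y2 - i *s y1 = 0" "j *s z1 - d *s z2 = 0" using e by simp_all
        have "b = 0"
        proof (rule ccontr)
          assume b: "b \<noteq> 0"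
          have "y2 = inverse b *s (i *s y1)" using zz(1) b by (metis eq_iff_diff_eq_0 vs.scale_scale left_inverse vs.scale_one)
          then show False using y2(2) unfolding span1_iff by (metis vs.scale_scale)
        qed
        moreover have "d = 0"
        proof (rule ccontr)
          assume d: "d \<noteq> 0"
          have "z2 = inverse d *s (j *s z1)" using zz(2) d by (metis eq_iff_diff_eq_0 vs.scale_scale left_inverse vs.scale_one)
          then show False using z12 unfolding span1_iff by (metis vs.scale_scale)
        qed
        ultimately show False using ce2 c(1) by simp
      qed
      then show ?thesis using adjS[OF wP c(3) _ wS cS] in2(1) by blast
    qed
    have kr: "\<exists>p. p \<noteq> 0 \<and> p \<in> k \<and> k \<inter> ?r = vs.span {p}" if k: "k \<in> LU S" for k
    proof -
      have kL: "k \<in> L" "k \<subseteq> S" using k unfolding LU_def by auto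
      obtain p where p: "p \<noteq> 0" "p \<in> k" "p \<in> ?r" using meets[OF kL] by blast
      have "k \<inter> ?r \<subseteq> vs.span {p}"
      proof
        fix s assume s: "s \<in> k \<inter> ?r"
        show "s \<in> vs.span {p}"
        proof (rule ccontr)
          assume n: "s \<notin> vs.span {p}"
          have "k = vs.span {p,s}" using sd_line_span[OF L_sd[OF kL(1)] p(2) _ p(1) n] s by blast
          also have "\<dots> = ?r" using sd_line_span[OF r2 p(3) _ p(1) n] s by blast
          finally have "k = ?r" .
          then have "z1 \<in> k" "y1 \<in> k" using in2 by blast+
          then have "k = l" "k = m" using nm[OF kL l(1,4), of y1] nm[OF kL l(2,5), of z1] y1 v1 by blast+
          then show False using l(3) by blast
        qed
      qed
      then show ?thesis using p sd_span_mem[OF L_sd[OF kL(1)] p(2)] sd_span_mem[OF r2 p(3)] by blast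
    qed
    have "bij_betw (\<lambda>k. k \<inter> ?r) (LU S) (pts ?r)"
    proof (rule bij_betw_imageI)
      show "inj_on (\<lambda>k. k \<inter> ?r) (LU S)"
      proof (rule inj_onI)
        fix k k' assume k: "k \<in> LU S" "k' \<in> LU S" "k \<inter> ?r = k' \<inter> ?r"
        obtain p where p: "p \<noteq> 0" "p \<in> k" "k \<inter> ?r = vs.span {p}" using kr[OF k(1)] by blast
        have "p \<in> k'" using p(3) k(3) vs.span_base[of p "{p}"] by blast
        then show "k = k'" using nm[of k k' p] k p unfolding LU_def by blast
      qed
      show "(\<lambda>k. k \<inter> ?r) ` LU S = pts ?r"
      proof
        show "(\<lambda>k. k \<inter> ?r) ` LU S \<subseteq> pts ?r"
        proof
          fix p assume "p \<in> (\<lambda>k. k \<inter> ?r) ` LU S"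
          then obtain k where k: "k \<in> LU S" "p = k \<inter> ?r" by blast
          then obtain w where "w \<noteq> 0" "p = vs.span {w}" using kr[OF k(1)] by blast
          then show "p \<in> pts ?r" unfolding pts_def using sd_span1 k(2) by blast
        qed
        show "pts ?r \<subseteq> (\<lambda>k. k \<inter> ?r) ` LU S"
        proof
          fix p assume p: "p \<in> pts ?r"
          then obtain w where w: "w \<noteq> 0" "p = vs.span {w}" unfolding pts_def sd1_iff by blast
          have wr: "w \<in> ?r" using p w(2) vs.span_base[of w "{w}"] unfolding pts_def by blast
          obtain k where k: "k \<in> L" "k \<subseteq> S" "w \<in> k" using onto[OF wr w(1)] by blast
          then have kS: "k \<in> LU S" unfolding LU_def by blast
          obtain s where s: "s \<noteq> 0" "k \<inter> ?r = vs.span {s}" using kr[OF kS] by blast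
          have "w \<in> vs.span {s}" using s(2) k(3) wr by blast
          then have "vs.span {w} = vs.span {s}" using span1_eq[OF w(1)] by blast
          then show "p \<in> (\<lambda>k. k \<inter> ?r) ` LU S" using w s kS by blast
        qed
      qed
    qed
    then have "card (LU S) = q + 1" using bij_betw_same_card pts_card[OF r2] by metis
    then show ?thesis by simp
  qed auto
qed

end

section \<open>Lines of the model in 4-spaces and in total\<close>

context hexmod begin

lemma two_in_full:
  assumes U: "vs.subspace U" and x: "x \<in> P" "Pi x \<subseteq> U" and z: "z \<in> Pi x" "z \<noteq> 0" "z \<notin> vs.span {x}"
    and w: "w \<in> P" "w \<in> U" "w \<in> Pi z" "w \<notin> Pi x"
  shows "Pi z \<subseteq> U"
proof -
  have l: "vs.span {x,z} \<in> L" using adj_line[OF x(1) z(1,3)] .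
  have lx: "vs.span {x,z} \<subseteq> Pi x" using line_sub_Pi[OF l in2(1)] .
  have "w \<notin> vs.span {z}" using sd_span_mem[OF Pi_sd[OF x(1)] z(1)] w(4) by blast
  then have k: "vs.span {z,w} \<in> L" using adj_line[OF adj_P[OF z(1,2)] w(3)] by blast
  have "{z,w} \<subseteq> U" using z(1) x(2) w(2) by blast
  then have kU: "vs.span {z,w} \<subseteq> U" using vs.span_minimal[OF _ U] by blast
  have ne: "vs.span {x,z} \<noteq> vs.span {z,w}" using lx in2(2)[of w z] w(4) by blast
  have lU: "vs.span {x,z} \<subseteq> U" using lx x(2) by blast
  show ?thesis using Pi_le[OF U l k ne in2(2) in2(1) z(2) lU kU] .
qed

text \<open>If k meets \<open>Pi x\<close> in a point, that point serves as v and w. Otherwise v is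
  the middle point of a path from x to k; it is full because two lines on it lie in U.\<close>

lemma full_step:
  assumes U: "vs.subspace U" and x: "x \<in> P" "Pi x \<subseteq> U" and k: "k \<in> L" "k \<subseteq> U" "x \<notin> k"
  shows "\<exists>v w. v \<in> P \<and> v \<in> Pi x \<and> v \<notin> vs.span {x} \<and> Pi v \<subseteq> U \<and> w \<in> k \<and> w \<noteq> 0 \<and> w \<in> Pi v"
proof (cases "\<exists>p\<in>k. p \<noteq> 0 \<and> p \<in> Pi x")
  case True
  then obtain p where p: "p \<in> k" "p \<noteq> 0" "p \<in> Pi x" by blast
  have pP: "p \<in> P" using adj_P[OF p(3,2)] .
  have px: "p \<notin> vs.span {x}" using span1_sym[OF p(2)] sd_span_mem[OF L_sd[OF k(1)] p(1)] k(3) by blast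
  have l: "vs.span {x,p} \<in> L" using adj_line[OF x(1) p(3) px] .
  have lU: "vs.span {x,p} \<subseteq> U" using line_sub_Pi[OF l in2(1)] x(2) by blast
  have ne: "vs.span {x,p} \<noteq> k" using in2(1)[of x p] k(3) by blast
  have "Pi p \<subseteq> U" using Pi_le[OF U l k(1) ne in2(2) p(1,2) lU k(2)] .
  then show ?thesis using p pP px Pi_self[OF pP] by blast
next
  case False
  obtain w v where v: "w \<in> k" "w \<noteq> 0" "w \<in> P" "v \<noteq> 0" "v \<in> P" "v \<in> Pi x" "v \<in> Pi w" "w \<in> Pi v" "B x w = 0"
    using line_near[OF x(1) k(1)] .
  have wx: "w \<notin> Pi x" using False v by blast
  have vx: "v \<notin> vs.span {x}" using Pi_scale[OF P_nz[OF x(1)] v(4)] v(8) wx by blast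
  have "Pi v \<subseteq> U" using two_in_full[OF U x v(6,4) vx v(3) _ v(8) wx] v(1) k(2) by blast
  then show ?thesis using v vx by blast
qed

text \<open>A line off z meets \<open>Pi z\<close> in a full point, hence lies in one of the q + 1
  solids of U through \<open>Pi z\<close>. By \<open>solid_count\<close> each of these has at most q
  lines besides those on z.\<close>

lemma fourspace_full_meet:
  assumes U: "sd 5 U" "U \<subseteq> V" and z: "z \<in> P" "Pi z \<subseteq> U" and meet: "\<And>k. k \<in> L \<Longrightarrow> k \<subseteq> U \<Longrightarrow> \<exists>p\<in>k. p \<noteq> 0 \<and> p \<in> Pi z"
  shows "card (LU U) \<le> (q + 1) + (q + 1) * q"
proof -
  let ?T = "{T. sd 4 T \<and> Pi z \<subseteq> T \<and> T \<subseteq> U}" and ?Z = "{k\<in>L. z \<in> k}"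
  note sU = sd_subspace[OF U(1)]
  have U5: "sd (Suc 4) U" using U(1) by simp
  have cT: "card ?T = q + 1" using card_hyperplanes[OF Pi_sd[OF z(1)] U5 z(2)] q_def by simp
  have fT: "finite ?T" by (rule card_ge_0_finite) (unfold cT, simp)
  have cov: "LU U \<subseteq> ?Z \<union> (\<Union>T\<in>?T. LU T - ?Z)"
  proof
    fix k assume "k \<in> LU U"
    then have k: "k \<in> L" "k \<subseteq> U" unfolding LU_def by auto
    show "k \<in> ?Z \<union> (\<Union>T\<in>?T. LU T - ?Z)"
    proof (cases "z \<in> k")
      case False
      obtain p where p: "p \<in> k" "p \<noteq> 0" "p \<in> Pi z" using meet[OF k] by blast
      have pz: "p \<notin> vs.span {z}" using span1_sym[OF p(2)] sd_span_mem[OF L_sd[OF k(1)] p(1)] False by blast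
      have l: "vs.span {z,p} \<in> L" using adj_line[OF z(1) p(3) pz] .
      have lU: "vs.span {z,p} \<subseteq> U" using line_sub_Pi[OF l in2(1)] z(2) by blast
      have ne: "vs.span {z,p} \<noteq> k" using in2(1)[of z p] False by blast
      have pU: "Pi p \<subseteq> U" using Pi_le[OF sU l k(1) ne in2(2) p(1,2) lU k(2)] .
      let ?S = "ssum (Pi z) (Pi p)"
      have S: "sd 4 ?S" using Pi_int_adj(2)[OF z(1) p(3) pz] .
      have sp: "vs.subspace (Pi p)" "vs.subspace (Pi z)" using sd_subspace Pi_sd[OF adj_P[OF p(3,2)]] Pi_sd[OF z(1)] by blast+
      have "Pi z \<subseteq> ?S" "Pi p \<subseteq> ?S" "?S \<subseteq> U" using ssum_ge1[OF sp(1)] ssum_ge2[OF sp(2)] ssum_le[OF sU z(2) pU] by blast+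
      then have "?S \<in> ?T" "k \<in> LU ?S - ?Z" using S k line_sub_Pi[OF k(1) p(1)] False unfolding LU_def by auto
      then show ?thesis by blast
    qed (use k in blast)
  qed
  have b: "card (LU T - ?Z) \<le> q" if T: "T \<in> ?T" for T
  proof -
    have "sd 4 T" "T \<subseteq> V" using T U(2) by blast+
    then have "card (LU T) \<le> 2 * q + 1" using solid_count[of 4 T] by auto
    moreover have "?Z \<subseteq> LU T" unfolding LU_def using line_sub_Pi T by blast
    ultimately show ?thesis using card_Diff_subset[OF fin_sub, of "\<lambda>k. z \<in> k" "LU T"] lines_card[OF z(1)] by simp
  qed
  have "card (LU U) \<le> card (?Z \<union> (\<Union>T\<in>?T. LU T - ?Z))" using card_mono[OF _ cov] fT fin_LU fin_sub by simp
  also have "\<dots> \<le> card ?Z + card (\<Union>T\<in>?T. LU T - ?Z)" by (rule card_Un_le)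
  also have "\<dots> \<le> (q + 1) + (\<Sum>T\<in>?T. card (LU T - ?Z))" using lines_card[OF z(1)] card_UN_le[OF fT, of "\<lambda>T. LU T - ?Z"] by simp
  also have "\<dots> \<le> (q + 1) + (\<Sum>T\<in>?T. q)" using sum_mono[OF b, of ?T "\<lambda>x. x"] by simp
  finally show ?thesis using cT by simp
qed

text \<open>If some line of U misses \<open>Pi x\<close>, the vectors of U perpendicular to x form a
  solid, and it contains the pencils of x and of all its full neighbours. By \<open>pencils3\<close>
  there is only one such neighbour v, so every line of U is reached through it and meets
  \<open>Pi v\<close>.\<close>

lemma fourspace_full:
  assumes U: "sd 5 U" "U \<subseteq> V" and x: "x \<in> P" "Pi x \<subseteq> U"
  shows "card (LU U) \<le> (q + 1) + (q + 1) * q"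
proof (cases "\<forall>k\<in>L. k \<subseteq> U \<longrightarrow> (\<exists>p\<in>k. p \<noteq> 0 \<and> p \<in> Pi x)")
  case True
  then show ?thesis using fourspace_full_meet[OF U x] by blast
next
  case False
  then obtain m where m: "m \<in> L" "m \<subseteq> U" "\<And>p. p \<in> m \<Longrightarrow> p \<noteq> 0 \<Longrightarrow> p \<notin> Pi x" by blast
  note sU = sd_subspace[OF U(1)]
  have xm: "x \<notin> m" using m(3) Pi_self[OF x(1)] P_nz[OF x(1)] by blast
  obtain v where v: "v \<in> P" "v \<in> Pi x" "v \<notin> vs.span {x}" "Pi v \<subseteq> U" using full_step[OF sU x m(1,2) xm] by blast
  obtain y where y: "y \<in> m" "B x y \<noteq> 0" using B_pent[OF x(1) m(1)] m(3) by blast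
  have U5: "sd (Suc 4) U" using U(1) by simp
  let ?S = "U \<inter> Hp x"
  have S: "sd 4 ?S" using Hp_int_sd[OF U5 U(2) _ y(2)] y(1) m(2) by blast
  have PS: "Pi p \<subseteq> ?S" if p: "p \<in> Pi x" "p \<noteq> 0" "Pi p \<subseteq> U" for p
    using path2_B[OF x(1) p(1,2)] p(3) U(2) unfolding Hp_def by blast
  have xS: "Pi x \<subseteq> ?S" using PS[OF Pi_self[OF x(1)] P_nz[OF x(1)] x(2)] .
  have vS: "Pi v \<subseteq> ?S" using PS[OF v(2) P_nz[OF v(1)] v(4)] .
  have SV: "?S \<subseteq> V" using U(2) by blast
  have "\<exists>p\<in>k. p \<noteq> 0 \<and> p \<in> Pi v" if k: "k \<in> L" "k \<subseteq> U" for k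
  proof (cases "x \<in> k")
    case True
    then show ?thesis using P_nz[OF x(1)] v(2) adj_sym by blast
  next
    case False
    obtain v' w where v': "v' \<in> P" "v' \<in> Pi x" "v' \<notin> vs.span {x}" "Pi v' \<subseteq> U" "w \<in> k" "w \<noteq> 0" "w \<in> Pi v'"
      using full_step[OF sU x k False] by blast
    have "Pi v' \<subseteq> ?S" using PS[OF v'(2) P_nz[OF v'(1)] v'(4)] .
    then have "v' \<in> vs.span {v}" using pencils3[OF S SV x(1) v(1) v'(1) xS vS _ v(3) v'(3)] by blast
    then have "Pi v' = Pi v" using Pi_scale[OF P_nz[OF v(1)] P_nz[OF v'(1)]] by blast
    then show ?thesis using v' by blast
  qed
  then show ?thesis using fourspace_full_meet[OF U v(1,4)] by blast
qed

text \<open>Without full points the lines in U are pairwise skew. Fix a point y on one of them, m.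
  Every other line is reached from y through a point z outside U, and \<open>Pi z\<close> lies in
  the 4-space spanned by \<open>Pi y\<close> and the vectors of U perpendicular to y. This
  distributes the other lines over the q + 1 solids of that 4-space through
  \<open>Pi y\<close>.\<close>

lemma fourspace_nonfull:
  assumes U: "sd 5 U" "U \<subseteq> V" and nf: "\<And>x. x \<in> P \<Longrightarrow> \<not> Pi x \<subseteq> U"
  shows "card (LU U) \<le> 1 + (q + 1) * q"
proof (cases "card (LU U) \<le> Suc 0")
  case False
  then obtain m l0 where "m \<in> LU U" "l0 \<in> LU U" "l0 \<noteq> m" unfolding card_le_Suc0_iff_eq[OF fin_LU] by blast
  then have m: "m \<in> L" "m \<subseteq> U" and l0: "l0 \<in> L" "l0 \<subseteq> U" "l0 \<noteq> m" unfolding LU_def by auto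
  note sU = sd_subspace[OF U(1)]
  have nm: "a = b" if "a \<in> L" "a \<subseteq> U" "b \<in> L" "b \<subseteq> U" "p \<in> a" "p \<in> b" "p \<noteq> 0" for a b p
    using Pi_le[OF sU that(1,3) _ that(5,6,7,2,4)] nf[OF P_I[OF that(1,5,7)]] by blast
  have adjU: "b \<in> a'" if a: "a \<in> a'" "a' \<in> L" "a' \<subseteq> U" "a \<noteq> 0" "b \<in> Pi a" "b \<in> U" for a b a'
  proof (cases "b \<in> vs.span {a}")
    case True
    then show ?thesis using sd_span_mem[OF L_sd[OF a(2)] a(1)] by blast
  next
    case False
    have l: "vs.span {a,b} \<in> L" using adj_line[OF P_I[OF a(2,1,4)] a(5) False] .
    have "{a,b} \<subseteq> U" using a by blast
    then have "vs.span {a,b} \<subseteq> U" using vs.span_minimal[OF _ sU] by blast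
    then have "vs.span {a,b} = a'" using nm[OF l _ a(2,3) in2(1) a(1,4)] by blast
    then show ?thesis using in2(2) by blast
  qed
  obtain y where y: "y \<in> m" "y \<noteq> 0" using sd_nz[OF L_sd[OF m(1)]] by auto
  have yP: "y \<in> P" using P_I m y by blast
  have zU: "z \<notin> U" if l: "l \<in> L" "l \<subseteq> U" "l \<noteq> m" "w \<in> l" "w \<noteq> 0" "z \<in> Pi y" "w \<in> Pi z" "z \<noteq> 0" for l w z
  proof
    assume z: "z \<in> U"
    have zm: "z \<in> m" using adjU[OF y(1) m y(2) l(6) z] .
    have "w \<in> m" using adjU[OF zm m l(8,7)] l by blast
    then show False using nm[OF l(1,2) m l(4) _ l(5)] l(3) by blast
  qed
  have "\<not> (\<forall>u\<in>l0. B y u = 0)"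
  proof
    assume "\<forall>u\<in>l0. B y u = 0"
    then obtain p where p: "p \<in> l0" "p \<noteq> 0" "p \<in> Pi y" using B_pent[OF yP l0(1)] by blast
    have "p \<in> P" using P_I l0 p by blast
    then show False using zU[OF l0 p(1,2,3) Pi_self p(2)] p(1) l0(2) by blast
  qed
  then obtain u where u: "u \<in> l0" "B y u \<noteq> 0" by blast
  have U5: "sd (Suc 4) U" using U(1) by simp
  let ?S = "U \<inter> Hp y"
  have S: "sd 4 ?S" using Hp_int_sd[OF U5 U(2) _ u(2)] u(1) l0(2) by blast
  have mPi: "m \<subseteq> Pi y" using line_sub_Pi[OF m(1) y(1)] .
  have PiH: "Pi y \<subseteq> Hp y" unfolding Hp_def using adj_B[OF yP] Pi_V by blast
  obtain j where j: "sd j (?S \<inter> Pi y)" "sd (4 + 3 - j) (ssum ?S (Pi y))" "j \<le> 3" using sd_int_sum[OF S Pi_sd[OF yP]] by blast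
  have "m \<subseteq> ?S \<inter> Pi y" using mPi PiH m(2) by blast
  then have j2: "2 \<le> j" using sd_mono[OF L_sd[OF m(1)] j(1)] by blast
  have "j \<noteq> 3"
  proof
    assume "j = 3"
    then have "?S \<inter> Pi y = Pi y" using sd_eq[OF j(1) Pi_sd[OF yP]] by blast
    then show False using nf[OF yP] by blast
  qed
  then have "j = 2" using j2 j(3) by simp
  then have E: "sd (Suc 4) (ssum ?S (Pi y))" using j(2) by simp
  let ?E = "ssum ?S (Pi y)"
  have sPi: "vs.subspace (Pi y)" using sd_subspace[OF Pi_sd[OF yP]] .
  have E1: "?S \<subseteq> ?E" "Pi y \<subseteq> ?E" using ssum_ge1[OF sPi] ssum_ge2[OF sd_subspace[OF S]] by blast+
  let ?T = "{T. sd 4 T \<and> Pi y \<subseteq> T \<and> T \<subseteq> ?E}"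
  have cT: "card ?T = q + 1" using card_hyperplanes[OF Pi_sd[OF yP] E E1(2)] q_def by simp
  have fT: "finite ?T" by (rule card_ge_0_finite) (unfold cT, simp)
  define G where "G T = {l\<in>LU U. l \<noteq> m \<and> (\<exists>w z. w \<in> l \<and> w \<noteq> 0 \<and> z \<in> P \<and> z \<in> Pi y \<and> z \<notin> vs.span {y} \<and> w \<in> Pi z \<and> Pi z \<subseteq> T)}" for T
  have cov: "LU U \<subseteq> {m} \<union> (\<Union>T\<in>?T. G T)"
  proof
    fix l assume lU: "l \<in> LU U"
    then have l: "l \<in> L" "l \<subseteq> U" unfolding LU_def by auto
    show "l \<in> {m} \<union> (\<Union>T\<in>?T. G T)"
    proof (cases "l = m")
      case False
      obtain w z where z: "w \<in> l" "w \<noteq> 0" "w \<in> P" "z \<noteq> 0" "z \<in> P" "z \<in> Pi y" "z \<in> Pi w" "w \<in> Pi z" "B y w = 0"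
        using line_near[OF yP l(1)] .
      have znU: "z \<notin> U" using zU[OF l False z(1,2,6,8,4)] .
      have yU: "y \<in> U" using y m by blast
      have zy: "z \<notin> vs.span {y}" using sd_span_mem[OF U(1) yU] znU by blast
      have wE: "w \<in> ?E" using z l(2) U(2) E1 unfolding Hp_def by blast
      have wy: "w \<notin> vs.span {y}"
      proof
        assume "w \<in> vs.span {y}"
        then have "w \<in> m" using sd_span_mem[OF L_sd[OF m(1)] y(1)] by blast
        then show False using nm[OF l m z(1) _ z(2)] False by blast
      qed
      have lz: "vs.span {y,z} \<in> L" using adj_line[OF yP z(6) zy] .
      have wn: "w \<notin> vs.span {y,z}"
      proof
        assume "w \<in> vs.span {y,z}"
        then have "vs.span {y,z} = vs.span {y,w}" using sd_line_span[OF L_sd[OF lz] in2(1) _ y(2) wy] by blast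
        then have "z \<in> vs.span {y,w}" using in2(2)[of z y] by simp
        moreover have "{y,w} \<subseteq> U" using yU z l by blast
        ultimately show False using znU vs.span_minimal[OF _ sU] by blast
      qed
      have yz: "y \<in> Pi z" using z(6) adj_sym by blast
      have "y \<notin> vs.span {z}" using span1_sym[OF y(2)] zy by blast
      moreover have "w \<notin> vs.span {z,y}" using wn by (simp add: insert_commute)
      ultimately have "Pi z = vs.span {z,y,w}" using Pi_span[OF z(5) yz z(8)] by blast
      moreover have "{z,y,w} \<subseteq> ?E" using wE E1(2) z(6) Pi_self[OF yP] by blast
      ultimately have zE: "Pi z \<subseteq> ?E" using vs.span_minimal[OF _ sd_subspace[OF E]] by metis
      let ?R = "ssum (Pi y) (Pi z)"
      have R: "sd 4 ?R" using Pi_int_adj(2)[OF yP z(6) zy] .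
      have "Pi y \<subseteq> ?R" "Pi z \<subseteq> ?R" "?R \<subseteq> ?E"
        using ssum_ge1[OF sd_subspace[OF Pi_sd[OF z(5)]]] ssum_ge2[OF sPi] ssum_le[OF sd_subspace[OF E] E1(2) zE] by blast+
      then have "?R \<in> ?T" "l \<in> G ?R" using R lU False z zy unfolding G_def by blast+
      then show ?thesis by blast
    qed blast
  qed
  have EV: "?E \<subseteq> V" using ssum_le[OF V(1) _ Pi_V] U(2) by blast
  \<comment> \<open>By \<open>pencils3\<close> all lines assigned to T are reached through the same
    z. They meet the projective line of U in \<open>Pi z\<close> in distinct points other than
    y.\<close>
  have GT: "card (G T) \<le> q" if T: "T \<in> ?T" for T
  proof (cases "G T = {}")
    case False
    have T4: "sd 4 T" "T \<subseteq> V" "Pi y \<subseteq> T" using T EV by blast+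
    obtain l1 w1 z where z: "l1 \<in> LU U" "l1 \<noteq> m" "w1 \<in> l1" "w1 \<noteq> 0" "z \<in> P" "z \<in> Pi y" "z \<notin> vs.span {y}" "w1 \<in> Pi z" "Pi z \<subseteq> T"
      using False unfolding G_def by blast
    have l1: "l1 \<in> L" "l1 \<subseteq> U" using z(1) unfolding LU_def by auto
    have znU: "z \<notin> U" using zU[OF l1 z(2,3,4,6,8) P_nz[OF z(5)]] .
    obtain i where i: "sd i (U \<inter> Pi z)" using sd_exists[OF vs.subspace_inter[OF sU sd_subspace[OF Pi_sd[OF z(5)]]]] sd_finite[OF U(1)] by blast
    have yr: "y \<in> U \<inter> Pi z" using y m z(6) adj_sym by blast
    have i3: "i \<le> 3" using sd_mono[OF i Pi_sd[OF z(5)]] by blast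
    have "i \<noteq> 3"
    proof
      assume "i = 3"
      then have "U \<inter> Pi z = Pi z" using sd_eq[OF i Pi_sd[OF z(5)]] by blast
      then show False using znU Pi_self[OF z(5)] by blast
    qed
    moreover have "2 \<le> i"
    proof -
      have "w1 \<notin> vs.span {y}"
      proof
        assume "w1 \<in> vs.span {y}"
        then have "w1 \<in> m" using sd_span_mem[OF L_sd[OF m(1)] y(1)] by blast
        then show False using nm[OF l1 m z(3) _ z(4)] z(2) by blast
      qed
      then have "sd 2 (vs.span {y,w1})" using sd_span2[OF y(2)] by blast
      moreover have "vs.span {y,w1} \<subseteq> U \<inter> Pi z" using sd_span_le[OF i, of "{y,w1}"] yr z(3,8) l1(2) by auto
      ultimately show ?thesis using sd_mono[OF _ i] by blast
    qed
    ultimately have "i = 2" using i3 by simp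
    then have r2: "sd 2 (U \<inter> Pi z)" using i by simp
    let ?r = "U \<inter> Pi z"
    have ex: "\<exists>w. w \<in> l \<and> w \<in> ?r \<and> w \<noteq> 0 \<and> w \<notin> vs.span {y}" if lG: "l \<in> G T" for l
    proof -
      obtain w z' where a: "l \<in> LU U" "l \<noteq> m" "w \<in> l" "w \<noteq> 0" "z' \<in> P" "z' \<in> Pi y" "z' \<notin> vs.span {y}" "w \<in> Pi z'" "Pi z' \<subseteq> T"
        using lG unfolding G_def by blast
      have l: "l \<in> L" "l \<subseteq> U" using a(1) unfolding LU_def by auto
      have "z' \<in> vs.span {z}" using pencils3[OF T4(1,2) yP z(5) a(5) T4(3) z(9) a(9) z(7) a(7)] by blast
      then have "Pi z' = Pi z" using Pi_scale[OF P_nz[OF z(5)] P_nz[OF a(5)]] by blast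
      moreover have "w \<notin> vs.span {y}"
      proof
        assume "w \<in> vs.span {y}"
        then have "w \<in> m" using sd_span_mem[OF L_sd[OF m(1)] y(1)] by blast
        then show False using nm[OF l m a(3) _ a(4)] a(2) by blast
      qed
      ultimately show ?thesis using a l by blast
    qed
    define f where "f l = (SOME w. w \<in> l \<and> w \<in> ?r \<and> w \<noteq> 0 \<and> w \<notin> vs.span {y})" for l
    have f: "f l \<in> l" "f l \<in> ?r" "f l \<noteq> 0" "f l \<notin> vs.span {y}" if "l \<in> G T" for l
      using someI_ex[OF ex[OF that]] unfolding f_def by blast+
    have "inj_on (\<lambda>l. vs.span {f l}) (G T)"
    proof (rule inj_onI)
      fix a b assume a: "a \<in> G T" "b \<in> G T" "vs.span {f a} = vs.span {f b}"
      have aL: "a \<in> L" "a \<subseteq> U" "b \<in> L" "b \<subseteq> U" using a unfolding G_def LU_def by auto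
      have "f a \<in> vs.span {f b}" using a(3) vs.span_base[of "f a" "{f a}"] by simp
      then have "f a \<in> b" using sd_span_mem[OF L_sd[OF aL(3)] f(1)[OF a(2)]] by blast
      then show "a = b" using nm[OF aL f(1)[OF a(1)] _ f(3)[OF a(1)]] by blast
    qed
    moreover have "(\<lambda>l. vs.span {f l}) ` G T \<subseteq> pts ?r - {vs.span {y}}"
    proof
      fix s assume "s \<in> (\<lambda>l. vs.span {f l}) ` G T"
      then obtain l where l: "l \<in> G T" "s = vs.span {f l}" by blast
      have "s \<in> pts ?r" unfolding l(2) pts_def using sd_span1[OF f(3)[OF l(1)]] sd_span_mem[OF r2 f(2)[OF l(1)]] by blast
      moreover have "s \<noteq> vs.span {y}" using f(4)[OF l(1)] vs.span_base[of "f l" "{f l}"] l(2) by blast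
      ultimately show "s \<in> pts ?r - {vs.span {y}}" by blast
    qed
    ultimately have "card (G T) \<le> card (pts ?r - {vs.span {y}})"
      using card_inj_on_le[of _ "G T" "pts ?r - {vs.span {y}}"] fin_pts[OF sd_finite[OF r2]] by blast
    moreover have "vs.span {y} \<in> pts ?r" unfolding pts_def using sd_span1[OF y(2)] sd_span_mem[OF r2 yr] by blast
    ultimately show ?thesis using pts_card[OF r2] fin_pts[OF sd_finite[OF r2]] by simp
  qed simp
  have fG: "finite (G T)" for T using finite_subset[OF _ fin_LU, of "G T" U] unfolding G_def by blast
  have "card (LU U) \<le> card ({m} \<union> (\<Union>T\<in>?T. G T))" using card_mono[OF _ cov] fT fG by simp
  also have "\<dots> \<le> card {m} + card (\<Union>T\<in>?T. G T)" by (rule card_Un_le)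
  also have "\<dots> \<le> 1 + (\<Sum>T\<in>?T. card (G T))" using card_UN_le[OF fT, of G] by simp
  also have "\<dots> \<le> 1 + (\<Sum>T\<in>?T. q)" using sum_mono[OF GT, of ?T "\<lambda>x. x"] by simp
  finally show ?thesis using cT by simp
qed simp

text \<open>Preimages of 4-spaces under an embedding may have smaller dimension; enlarging to
  dimension 5 can only add lines. It remains to compare (q + 1)^2 with the bound of (4d).\<close>

lemma fourspace_count:
  assumes U: "sd k U" "k \<le> 5" "U \<subseteq> V" shows "card (LU U) \<le> q^3 - q^2 + 4 * q"
proof -
  obtain U' where U': "sd 5 U'" "U \<subseteq> U'" "U' \<subseteq> V" using sd_extend[OF U(1,3) V7 U(2)] by auto
  have "LU U \<subseteq> LU U'" unfolding LU_def using U'(2) by blast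
  then have "card (LU U) \<le> card (LU U')" using card_mono[OF fin_LU] by blast
  also have "\<dots> \<le> (q + 1) + (q + 1) * q"
  proof (cases "\<exists>x\<in>P. Pi x \<subseteq> U'")
    case True
    then show ?thesis using fourspace_full[OF U'(1,3)] by blast
  next
    case False
    then have "card (LU U') \<le> 1 + (q + 1) * q" using fourspace_nonfull[OF U'(1,3)] by blast
    then show ?thesis by simp
  qed
  \<comment> \<open>The substitution q = s + 2 removes the truncated subtraction.\<close>
  also have "\<dots> \<le> q^3 - q^2 + 4 * q"
  proof -
    have "2 \<le> q" using CARD_field_ge2[where 'a='a] q_def by simp
    then obtain s where s: "q = s + 2" by (metis add.commute le_Suc_ex)
    have e: "q^3 = q^2 + (s^3 + 5 * s^2 + 8 * s + 4)" unfolding s by (simp add: power2_eq_square power3_eq_cube algebra_simps)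
    then have "q^3 - q^2 = s^3 + 5 * s^2 + 8 * s + 4" by simp
    moreover have "(q + 1) + (q + 1) * q = s^2 + 6 * s + 9" unfolding s by (simp add: power2_eq_square algebra_simps)
    ultimately show ?thesis using s by simp
  qed
  finally show ?thesis .
qed

text \<open>The three layers of lines seen from a point x cover \<open>L\<close> by
  \<open>line_near\<close>. An upper bound is wanted, so their disjointness does not enter.\<close>

lemma total_count: "card L \<le> q^5 + q^4 + q^3 + q^2 + q + 1"
proof -
  obtain x where x: "x \<in> P" using P_ne by blast
  let ?A0 = "{l\<in>L. x \<in> l}"
  define A1 where "A1 = (\<Union>l\<in>?A0. child l x)"
  define p where "p k = (SOME p. p \<in> k \<and> p \<in> Pi x \<and> p \<noteq> 0)" for k
  define A2 where "A2 = (\<Union>k\<in>A1. child k (p k))"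
  have fc: "finite (child l y)" for l y unfolding child_def by (rule fin_sub)
  have f0: "finite ?A0" using fin_sub .
  have f1: "finite A1" unfolding A1_def using f0 fc by blast
  have f2: "finite A2" unfolding A2_def using f1 fc by blast
  have pk: "p k \<in> k" "p k \<in> Pi x" "p k \<noteq> 0" "k \<in> L" if k: "k \<in> A1" for k
  proof -
    obtain l where l: "l \<in> L" "x \<in> l" "k \<in> child l x" using k unfolding A1_def by blast
    then have kk: "k \<in> L" "k \<inter> l \<noteq> {0}" unfolding child_def by blast+
    obtain y where y: "y \<in> k" "y \<in> l" "y \<noteq> 0" using int_zero[OF kk(1) l(1)] kk(2) by blast
    have "y \<in> Pi x" using line_sub_Pi[OF l(1,2)] y by blast
    then have "\<exists>p. p \<in> k \<and> p \<in> Pi x \<and> p \<noteq> 0" using y by blast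
    from someI_ex[OF this] show "p k \<in> k" "p k \<in> Pi x" "p k \<noteq> 0" unfolding p_def by blast+
    show "k \<in> L" by (rule kk(1))
  qed
  have "L \<subseteq> ?A0 \<union> A1 \<union> A2"
  proof
    fix m assume m: "m \<in> L"
    show "m \<in> ?A0 \<union> A1 \<union> A2"
    proof (cases "x \<in> m")
      case xm: False
      have A1I: "k \<in> A1" if k: "k \<in> L" "y \<in> k" "y \<in> Pi x" "y \<noteq> 0" "x \<notin> k" for k y
      proof -
        have yx: "y \<notin> vs.span {x}" using span1_sym[OF k(4)] sd_span_mem[OF L_sd[OF k(1)] k(2)] k(5) by blast
        have l: "vs.span {x,y} \<in> L" using adj_line[OF x k(3) yx] .
        have "k \<inter> vs.span {x,y} \<noteq> {0}" using in2(2)[of y x] k by blast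
        moreover have "k \<noteq> vs.span {x,y}" using in2(1)[of x y] k(5) by blast
        ultimately have "k \<in> child (vs.span {x,y}) x" unfolding child_def using k by blast
        then show ?thesis unfolding A1_def using l in2(1)[of x y] by blast
      qed
      show ?thesis
      proof (cases "\<exists>y\<in>m. y \<noteq> 0 \<and> y \<in> Pi x")
        case True
        then show ?thesis using A1I[OF m _ _ _ xm] by blast
      next
        case False
        obtain w v where v: "w \<in> m" "w \<noteq> 0" "w \<in> P" "v \<noteq> 0" "v \<in> P" "v \<in> Pi x" "v \<in> Pi w" "w \<in> Pi v" "B x w = 0"
          using line_near[OF x m] .
        have wx: "w \<notin> Pi x" using False v by blast
        have wv: "w \<notin> vs.span {v}" using sd_span_mem[OF Pi_sd[OF x] v(6)] wx by blast
        have k: "vs.span {v,w} \<in> L" using adj_line[OF v(5,8) wv] .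
        have xk: "x \<notin> vs.span {v,w}" using line_sub_Pi[OF k, of x] in2(2)[of w v] wx by blast
        have k1: "vs.span {v,w} \<in> A1" using A1I[OF k in2(1) v(6,4) xk] .
        note q = pk[OF k1]
        have "p (vs.span {v,w}) \<notin> m" using False q by blast
        moreover from this have "m \<noteq> vs.span {v,w}" using q(1) by blast
        moreover have "m \<inter> vs.span {v,w} \<noteq> {0}" using in2(2)[of w v] v(1,2) by blast
        ultimately have "m \<in> child (vs.span {v,w}) (p (vs.span {v,w}))" unfolding child_def using m by blast
        then show ?thesis unfolding A2_def using k1 by blast
      qed
    qed (use m in blast)
  qed
  then have "card L \<le> card (?A0 \<union> A1 \<union> A2)" using card_mono[of "?A0 \<union> A1 \<union> A2" L] f0 f1 f2 by blast
  also have "\<dots> \<le> card ?A0 + card A1 + card A2" using card_Un_le[of "?A0 \<union> A1" A2] card_Un_le[of ?A0 A1] by linarith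
  finally have 1: "card L \<le> card ?A0 + card A1 + card A2" .
  have c0: "card ?A0 = q + 1" using lines_card[OF x] .
  have "card A1 \<le> (\<Sum>l\<in>?A0. card (child l x))" unfolding A1_def by (rule card_UN_le[OF f0])
  also have "\<dots> = (\<Sum>l\<in>?A0. q^2)" using child_card P_nz[OF x] by (intro sum.cong) auto
  finally have c1: "card A1 \<le> (q + 1) * q^2" using c0 by simp
  have "card A2 \<le> (\<Sum>k\<in>A1. card (child k (p k)))" unfolding A2_def by (rule card_UN_le[OF f1])
  also have "\<dots> = (\<Sum>k\<in>A1. q^2)" using child_card pk by (intro sum.cong) auto
  also have "\<dots> \<le> (q + 1) * q^2 * q^2" using mult_le_mono1[OF c1, of "q^2"] by simp
  finally have c2: "card A2 \<le> (q + 1) * q^2 * q^2" .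
  have "(q + 1) + (q + 1) * q^2 + (q + 1) * q^2 * q^2 = q^5 + q^4 + q^3 + q^2 + q + 1"
    by (simp add: algebra_simps numeral_eq_Suc)
  then show ?thesis using 1 c0 c1 c2 by linarith
qed

end

section \<open>The standard line set as an instance of the axioms\<close>

lemma lin_indep_pair: "lin_indep [x, y] \<longleftrightarrow> x \<noteq> 0 \<and> y \<notin> vs.span {x}" for x y :: "nat \<Rightarrow> 'a::{field,finite}"
proof
  assume l: "lin_indep [x, y]"
  have e: "lcomb [x,y] c = c 0 *s x + c 1 *s y" for c unfolding lcomb_sum by (simp add: numeral_2_eq_2)
  have z: "a = 0 \<and> b = 0" if h: "a *s x + b *s y = 0" for a b
  proof -
    let ?c = "\<lambda>i::nat. if i = 0 then a else b"
    have "lcomb [x,y] ?c = (\<lambda>_. 0)" unfolding e using h by (simp add: zero_fun_def)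
    then have "\<forall>i<length [x,y]. ?c i = 0" using l unfolding lin_indep_def by blast
    then show ?thesis by (auto dest: spec[of _ 0] spec[of _ 1])
  qed
  have "x \<noteq> 0" using z[of 1 0] by auto
  moreover have "y \<notin> vs.span {x}"
  proof
    assume "y \<in> vs.span {x}"
    then obtain k where "y = k *s x" unfolding span1_iff by blast
    then show False using z[of k "- 1"] by simp
  qed
  ultimately show "x \<noteq> 0 \<and> y \<notin> vs.span {x}" by blast
next
  assume a: "x \<noteq> 0 \<and> y \<notin> vs.span {x}"
  then have "sd 2 (vs.span {x,y})" using sd_span2 by blast
  then show "lin_indep [x,y]" unfolding lin_indep_iff_card span_list_eq sd_def by (simp add: power2_eq_square)
qed

text \<open>Triple products with a repeated vector vanish, which gives x 3 * D = 0 and y 3 * D = 0.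
  If both third coordinates are zero, Lagrange's identity for the two cross products reduces to D *
  D = 0.\<close>

lemma grass_hx:
  fixes x y :: "nat \<Rightarrow> 'a::field"
  assumes q: "quadQ6 x = 0" "quadQ6 y = 0" "Bf x y = 0"
    and g: "grass x y 1 2 = grass x y 3 4" "grass x y 5 4 = grass x y 3 2"
      "grass x y 2 0 = grass x y 3 5" "grass x y 6 5 = grass x y 3 0"
      "grass x y 0 1 = grass x y 3 6" "grass x y 4 6 = grass x y 3 1"
  shows "hx x y"
proof -
  define D where "D = x 0 * y 4 + x 1 * y 5 + x 2 * y 6 - x 3 * y 3"
  have D': "x 4 * y 0 + x 5 * y 1 + x 6 * y 2 - x 3 * y 3 = - D" using q(3) unfolding Bf_def cr_def D_def by (simp add: algebra_simps)
  note e = g[unfolded grass_def]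
  note Q = q(1,2)[unfolded quadQ6_def]
  have 1: "x 3 * D = 0"
  proof -
    have "x 3 * D = x 0 * (x 1 * y 2 - x 2 * y 1) + x 1 * (x 2 * y 0 - x 0 * y 2) + x 2 * (x 0 * y 1 - x 1 * y 0)"
      unfolding e D_def using Q(1) by algebra
    then show ?thesis by (simp add: algebra_simps)
  qed
  have 2: "y 3 * D = 0"
  proof -
    have "y 3 * (- D) = - (y 0 * (x 1 * y 2 - x 2 * y 1) + y 1 * (x 2 * y 0 - x 0 * y 2) + y 2 * (x 0 * y 1 - x 1 * y 0))"
      unfolding e D'[symmetric] using Q(2) by algebra
    then show ?thesis by (simp add: algebra_simps)
  qed
  have "D = 0"
  proof (cases "x 3 = 0 \<and> y 3 = 0")
    case True
    have L: "(x 1 * y 2 - x 2 * y 1) * (x 5 * y 6 - x 6 * y 5) + (x 2 * y 0 - x 0 * y 2) * (x 6 * y 4 - x 4 * y 6)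
        + (x 0 * y 1 - x 1 * y 0) * (x 4 * y 5 - x 5 * y 4)
      = (x 0 * x 4 + x 1 * x 5 + x 2 * x 6) * (y 0 * y 4 + y 1 * y 5 + y 2 * y 6) - (x 0 * y 4 + x 1 * y 5 + x 2 * y 6) * (x 4 * y 0 + x 5 * y 1 + x 6 * y 2)"
      by algebra
    have z: "x 1 * y 2 - x 2 * y 1 = 0" "x 2 * y 0 - x 0 * y 2 = 0" "x 0 * y 1 - x 1 * y 0 = 0" using e True by simp_all
    have z2: "x 0 * x 4 + x 1 * x 5 + x 2 * x 6 = 0" using Q(1) True by simp
    have z3: "x 0 * y 4 + x 1 * y 5 + x 2 * y 6 = D" "x 4 * y 0 + x 5 * y 1 + x 6 * y 2 = - D" using D' True unfolding D_def by simp_all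
    have "D * D = 0" using L unfolding z z2 z3 by simp
    then show ?thesis by simp
  next
    case False
    then show ?thesis using 1 2 by auto
  qed
  then have "x 0 * y 4 + x 1 * y 5 + x 2 * y 6 = x 3 * y 3" "x 4 * y 0 + x 5 * y 1 + x 6 * y 2 = x 3 * y 3" using D' unfolding D_def by simp_all
  then show ?thesis unfolding hx_iff using e by simp
qed

lemma hx_quad_span:
  assumes "quadQ6 x = 0" "quadQ6 y = 0" "hx x y" "v \<in> vs.span {x,y}" shows "quadQ6 v = 0"
proof -
  obtain a b where v: "v = a *s x + b *s y" using assms(4) unfolding span2_iff by blast
  have "Bf x y = 0" using assms(3) unfolding hx_def Bf_def by simp
  then show ?thesis unfolding v quad_add quad_scl Bf_bilin using assms(1,2) by simp
qed

lemma hex_iff: "l \<in> hexagon_lines \<longleftrightarrow>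
   (\<exists>x y. x \<in> vecs 6 \<and> y \<in> vecs 6 \<and> x \<noteq> 0 \<and> y \<notin> vs.span {x} \<and> l = vs.span {x,y} \<and> quadQ6 x = 0 \<and> quadQ6 y = 0 \<and> hx x y)"
  for l :: "(nat \<Rightarrow> 'a::{field,finite}) set"
proof
  assume "l \<in> hexagon_lines"
  then obtain x y where x: "x \<in> vecs 6" "y \<in> vecs 6" "lin_indep [x, y]" "l = span_list [x, y]" "\<forall>v\<in>l. quadQ6 v = 0"
    and g: "grass x y 1 2 = grass x y 3 4" "grass x y 5 4 = grass x y 3 2"
      "grass x y 2 0 = grass x y 3 5" "grass x y 6 5 = grass x y 3 0"
      "grass x y 0 1 = grass x y 3 6" "grass x y 4 6 = grass x y 3 1" unfolding hexagon_lines_def by blast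
  have l: "l = vs.span {x,y}" using x(4) unfolding span_list_eq by simp
  have "x \<in> l" "y \<in> l" "x + y \<in> l" unfolding l by (auto intro: vs.span_add vs.span_base)
  then have q: "quadQ6 x = 0" "quadQ6 y = 0" "quadQ6 (x + y) = 0" using x(5) by blast+
  then have "Bf x y = 0" unfolding quad_add by simp
  then have "hx x y" using grass_hx[OF q(1,2) _ g] by blast
  then show "\<exists>x y. x \<in> vecs 6 \<and> y \<in> vecs 6 \<and> x \<noteq> 0 \<and> y \<notin> vs.span {x} \<and> l = vs.span {x,y} \<and> quadQ6 x = 0 \<and> quadQ6 y = 0 \<and> hx x y"
    using x q l unfolding lin_indep_pair by blast
next
  assume "\<exists>x y. x \<in> vecs 6 \<and> y \<in> vecs 6 \<and> x \<noteq> 0 \<and> y \<notin> vs.span {x} \<and> l = vs.span {x,y} \<and> quadQ6 x = 0 \<and> quadQ6 y = 0 \<and> hx x y"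
  then obtain x y where x: "x \<in> vecs 6" "y \<in> vecs 6" "x \<noteq> 0" "y \<notin> vs.span {x}" "l = vs.span {x,y}" "quadQ6 x = 0" "quadQ6 y = 0" "hx x y" by blast
  have "grass x y 1 2 = grass x y 3 4 \<and> grass x y 5 4 = grass x y 3 2 \<and>
      grass x y 2 0 = grass x y 3 5 \<and> grass x y 6 5 = grass x y 3 0 \<and>
      grass x y 0 1 = grass x y 3 6 \<and> grass x y 4 6 = grass x y 3 1" using x(8) unfolding grass_def hx_iff by simp
  moreover have "\<forall>v\<in>l. quadQ6 v = 0" using hx_quad_span[OF x(6,7,8)] x(5) by blast
  moreover have "lin_indep [x,y]" using x unfolding lin_indep_pair by blast
  moreover have "l = span_list [x,y]" using x(5) unfolding span_list_eq by simp
  ultimately show "l \<in> hexagon_lines" unfolding hexagon_lines_def using x(1,2) by blast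
qed

lemma sd_vecs6: "sd 7 (vecs 6 :: (nat \<Rightarrow> 'a::{field,finite}) set)"
proof -
  have "bij_betw (\<lambda>v. restrict v {..<7}) (vecs 6 :: (nat \<Rightarrow> 'a) set) (\<Pi>\<^sub>E i\<in>{..<7}. UNIV)"
  proof (rule bij_betwI)
    show "(\<lambda>v. restrict v {..<7}) \<in> (vecs 6 :: (nat \<Rightarrow> 'a) set) \<rightarrow> (\<Pi>\<^sub>E i\<in>{..<7}. UNIV)" by auto
    show "(\<lambda>f i. if i < 7 then f i else 0) \<in> (\<Pi>\<^sub>E i\<in>{..<7}. UNIV) \<rightarrow> (vecs 6 :: (nat \<Rightarrow> 'a) set)" by (auto simp: vecs_def)
    show "(\<lambda>i. if i < 7 then restrict x {..<7} i else 0) = x" if "x \<in> vecs 6" for x :: "nat \<Rightarrow> 'a"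
      using that by (auto simp: vecs_def fun_eq_iff)
    show "restrict (\<lambda>i. if i < 7 then y i else 0) {..<7} = y" if "y \<in> (\<Pi>\<^sub>E i\<in>{..<7}. (UNIV :: 'a set))" for y
      using that by (auto simp: fun_eq_iff PiE_def extensional_def)
  qed
  then have "card (vecs 6 :: (nat \<Rightarrow> 'a) set) = CARD('a) ^ 7" using bij_betw_same_card card_coeffs by metis
  then show ?thesis unfolding sd_def using subspace_vecs by blast
qed

lemma hex_sd: "l \<in> hexagon_lines \<Longrightarrow> sd 2 (l :: (nat \<Rightarrow> 'a::{field,finite}) set)"
  unfolding hex_iff using sd_span2 by blast

lemma hex_vecs: "l \<in> hexagon_lines \<Longrightarrow> l \<subseteq> (vecs 6 :: (nat \<Rightarrow> 'a::{field,finite}) set)"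
proof -
  assume "l \<in> hexagon_lines"
  then obtain x y where x: "x \<in> vecs 6" "y \<in> vecs 6" "l = vs.span {x,y}" unfolding hex_iff by blast
  have "{x,y} \<subseteq> vecs 6" using x by blast
  then show ?thesis unfolding x(3) by (rule sd_span_le[OF sd_vecs6])
qed

definition sing :: "(nat \<Rightarrow> 'a::{field,finite}) \<Rightarrow> bool" where "sing x \<longleftrightarrow> x \<in> vecs 6 \<and> quadQ6 x = 0 \<and> x \<noteq> 0"

lemma singD: "sing x \<Longrightarrow> x \<in> vecs 6" "sing x \<Longrightarrow> quadQ6 x = 0" "sing x \<Longrightarrow> x \<noteq> 0" unfolding sing_def by auto

lemma hex_sing: assumes "l \<in> hexagon_lines" "x \<in> l" "x \<noteq> 0" shows "sing x"
proof -
  obtain a b where a: "l = vs.span {a,b}" "quadQ6 a = 0" "quadQ6 b = 0" "hx a b" using assms(1) unfolding hex_iff by blast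
  then have "quadQ6 x = 0" using hx_quad_span[OF a(2,3,4)] assms(2) by blast
  then show ?thesis unfolding sing_def using hex_vecs[OF assms(1)] assms by blast
qed

lemma hex_hx: assumes "l \<in> hexagon_lines" "x \<in> l" "y \<in> l" shows "hx x (y :: nat \<Rightarrow> 'a::{field,finite})"
proof -
  obtain a b where a: "l = vs.span {a,b}" "quadQ6 a = 0" "quadQ6 b = 0" "hx a b" using assms(1) unfolding hex_iff by blast
  obtain s t where x: "x = s *s a + t *s b" using assms(2) unfolding a(1) span2_iff by blast
  obtain s' t' where y: "y = s' *s a + t' *s b" using assms(3) unfolding a(1) span2_iff by blast
  have h: "hx a a" "hx b b" "hx b a" using a hx_self hx_sym by blast+
  have "hx z y" if "z = a \<or> z = b" for z unfolding y using that h a(4) hx_add[OF hx_scl hx_scl] by blast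
  then have "hx y a" "hx y b" using hx_sym by blast+
  then have "hx y x" unfolding x using hx_add[OF hx_scl hx_scl] by blast
  then show ?thesis using hx_sym by blast
qed

lemma hex_line: assumes "sing x" "y \<in> vecs 6" "hx x y" "y \<notin> vs.span {x}" shows "vs.span {x,y} \<in> hexagon_lines"
proof -
  have "quadQ6 y = 0" using hx_sing[OF singD[OF assms(1)] assms(2,3)] .
  then show ?thesis unfolding hex_iff using assms singD[OF assms(1)] by blast
qed

lemma Pm_mem: "y \<in> Pm x \<longleftrightarrow> y \<in> vecs 6 \<and> hx x y" unfolding Pm_def by blast

lemma sing_Pm: "sing x \<Longrightarrow> y \<in> Pm x \<Longrightarrow> y \<noteq> 0 \<Longrightarrow> sing y"
  unfolding Pm_mem sing_def using hx_sing by blast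

lemma Pm_sd3: "sing x \<Longrightarrow> sd 3 (Pm x)" using Pm_sd singD by blast

lemma Pm_triangle: assumes "sing x" "y \<in> Pm x" "y \<notin> vs.span {x}" "z \<in> Pm x" "z \<in> Pm y" shows "z \<in> vs.span {x,y}"
  using m_triangle[OF singD[OF assms(1)]] assms(2-5) unfolding Pm_mem by blast

lemma Pm_sym: "sing x \<Longrightarrow> sing y \<Longrightarrow> y \<in> Pm x \<longleftrightarrow> x \<in> Pm y" unfolding Pm_mem sing_def using hx_sym by blast

interpretation hexM: lines0 "vecs 6" "hexagon_lines :: (nat \<Rightarrow> 'a::{field,finite}) set set" "CARD('a)"
  by unfold_locales (use subspace_vecs finite_vecs hex_sd hex_vecs in blast)+

lemma hex_through: "sing x \<Longrightarrow> k \<in> hexagon_lines \<and> x \<in> k \<longleftrightarrow> sd 2 k \<and> vs.span {x} \<subseteq> k \<and> k \<subseteq> Pm x"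
proof
  assume s: "sing x" and "k \<in> hexagon_lines \<and> x \<in> k"
  then have k: "k \<in> hexagon_lines" "x \<in> k" by auto
  have "k \<subseteq> Pm x" unfolding Pm_def using hex_hx[OF k] hex_vecs[OF k(1)] by blast
  then show "sd 2 k \<and> vs.span {x} \<subseteq> k \<and> k \<subseteq> Pm x" using hex_sd[OF k(1)] sd_span_mem[OF hex_sd[OF k(1)] k(2)] by blast
next
  assume s: "sing x" and "sd 2 k \<and> vs.span {x} \<subseteq> k \<and> k \<subseteq> Pm x"
  then have k: "sd 2 k" "vs.span {x} \<subseteq> k" "k \<subseteq> Pm x" by auto
  have xk: "x \<in> k" using k(2) vs.span_base[of x "{x}"] by blast
  obtain y where y: "y \<in> k" "y \<notin> vs.span {x}" using sd_exists_notin[OF k(1) sd_span1[OF singD(3)[OF s]]] by auto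
  have "k = vs.span {x,y}" using sd_line_span[OF k(1) xk y(1) singD(3)[OF s] y(2)] .
  moreover have "vs.span {x,y} \<in> hexagon_lines" using hex_line[OF s _ _ y(2)] y(1) k(3) unfolding Pm_def by blast
  ultimately show "k \<in> hexagon_lines \<and> x \<in> k" using xk by simp
qed

lemma hex_on: assumes s: "sing x" and y: "y \<in> Pm x" obtains l where "l \<in> hexagon_lines" "x \<in> l" "y \<in> l"
proof -
  obtain z where z: "z \<in> Pm x" "z \<notin> vs.span {x}" "y \<in> vs.span {x,z}"
  proof (cases "y \<in> vs.span {x}")
    case True
    obtain z where z: "z \<in> Pm x" "z \<notin> vs.span {x}" using sd_exists_notin[OF Pm_sd3[OF s] sd_span1[OF singD(3)[OF s]]] by auto
    have "y \<in> vs.span {x,z}" using True vs.span_mono[of "{x}" "{x,z}"] by blast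
    then show thesis using that z by blast
  next
    case False
    then show thesis using that y vs.span_base[of y "{x,y}"] by blast
  qed
  have "vs.span {x,z} \<in> hexagon_lines" using hex_line[OF s _ _ z(2)] z(1) unfolding Pm_def by blast
  then show thesis using that z(3) vs.span_base[of x "{x,z}"] by blast
qed

lemma hexM_P: "x \<in> hexM.P \<longleftrightarrow> sing x"
proof
  show "x \<in> hexM.P \<Longrightarrow> sing x" unfolding hexM.P_def using hex_sing by blast
  assume s: "sing x"
  have "x \<in> Pm x" unfolding Pm_mem using singD[OF s] hx_self by blast
  then obtain l where "l \<in> hexagon_lines" "x \<in> l" using hex_on[OF s] by blast
  then show "x \<in> hexM.P" using hexM.P_I singD(3)[OF s] by blast
qed

lemma hexM_Pi: assumes s: "sing x" shows "hexM.Pi x = Pm x"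
proof
  show "hexM.Pi x \<subseteq> Pm x" unfolding hexM.Pi_def using hex_through[OF s] by blast
  show "Pm x \<subseteq> hexM.Pi x"
  proof
    fix y assume "y \<in> Pm x"
    then obtain l where "l \<in> hexagon_lines" "x \<in> l" "y \<in> l" using hex_on[OF s] by blast
    then show "y \<in> hexM.Pi x" unfolding hexM.Pi_def by blast
  qed
qed

text \<open>Two planes in a solid share a line, which supplies two independent common neighbours and
  contradicts \<open>m_quad\<close>.\<close>

lemma hex_pencils_adj:
  assumes S: "sd 4 S" and x: "sing x" "sing y" "Pm x \<subseteq> S" "Pm y \<subseteq> S" shows "y \<in> Pm x"
proof (rule ccontr)
  assume n: "y \<notin> Pm x"
  obtain k where k: "sd k (Pm x \<inter> Pm y)" "3 + 3 \<le> 4 + k" using sd_int_ge[OF Pm_sd3[OF x(1)] Pm_sd3[OF x(2)] S x(3,4)] by blast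
  obtain z where z: "z \<in> Pm x \<inter> Pm y" "z \<noteq> 0" using sd_nz[OF k(1)] k(2) by auto
  obtain w where w: "w \<in> Pm x \<inter> Pm y" "w \<notin> vs.span {z}" using sd_exists_notin[OF k(1) sd_span1[OF z(2)]] k(2) by auto
  have "\<not> hx x y" using n singD(1)[OF x(2)] unfolding Pm_mem by blast
  then have "w \<in> vs.span {z}" using m_quad[OF singD[OF x(1)] singD(1)[OF x(2)] _ _ z(2)] z w unfolding Pm_def by blast
  then show False using w by blast
qed

text \<open>The third point z lies on the line xy. A vector of \<open>Pm z\<close> off that line
  splits in S = \<open>Pm x\<close> + \<open>Pm y\<close> into p + p', and \<open>m_conic\<close>
  forbids this.\<close>

lemma hex_pencils3:
  assumes S: "sd 4 S" and x: "sing x" "sing y" "sing z" "Pm x \<subseteq> S" "Pm y \<subseteq> S" "Pm z \<subseteq> S"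
    and n: "y \<notin> vs.span {x}" "z \<notin> vs.span {x}" "z \<notin> vs.span {y}"
  shows False
proof -
  have a: "y \<in> Pm x" "z \<in> Pm x" "z \<in> Pm y" using hex_pencils_adj[OF S] x by blast+
  have zxy: "z \<in> vs.span {x,y}" using Pm_triangle[OF x(1) a(1) n(1) a(2,3)] .
  then obtain \<alpha> \<beta> where z: "z = \<alpha> *s x + \<beta> *s y" unfolding span2_iff by blast
  have nz: "\<alpha> \<noteq> 0" "\<beta> \<noteq> 0" using z n(2,3) unfolding span1_iff by auto
  have xx: "x \<in> Pm x" "y \<in> Pm y" "x \<in> Pm y" using singD[OF x(1)] singD[OF x(2)] hx_self Pm_sym[OF x(1,2)] a(1) unfolding Pm_mem by blast+
  have s2: "sd 2 (vs.span {x,y})" using sd_span2[OF singD(3)[OF x(1)] n(1)] .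
  have int: "Pm x \<inter> Pm y = vs.span {x,y}"
  proof
    show "Pm x \<inter> Pm y \<subseteq> vs.span {x,y}" using Pm_triangle[OF x(1) a(1) n(1)] by blast
    show "vs.span {x,y} \<subseteq> Pm x \<inter> Pm y" using sd_span_le[OF Pm_sd3[OF x(1)], of "{x,y}"] sd_span_le[OF Pm_sd3[OF x(2)], of "{x,y}"] xx a(1) by blast
  qed
  obtain k where k: "sd k (Pm x \<inter> Pm y)" "sd (3 + 3 - k) (ssum (Pm x) (Pm y))" using sd_int_sum[OF Pm_sd3[OF x(1)] Pm_sd3[OF x(2)]] by blast
  have "sd 2 (Pm x \<inter> Pm y)" using int s2 by simp
  then have "k = 2" using sd_unique[OF k(1)] by blast
  then have s4: "sd 4 (ssum (Pm x) (Pm y))" using k(2) by simp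
  have Se: "ssum (Pm x) (Pm y) = S" using sd_eq[OF s4 S ssum_le[OF sd_subspace[OF S] x(4,5)]] by blast
  obtain t where t: "t \<in> Pm z" "t \<notin> vs.span {x,y}" using sd_exists_notin[OF Pm_sd3[OF x(3)] s2] by auto
  have "t \<in> ssum (Pm x) (Pm y)" using t x(6) Se by blast
  then obtain p p' where p: "t = p + p'" "p \<in> Pm x" "p' \<in> Pm y" unfolding ssum_def by blast
  have zz: "\<And>u. u \<in> vs.span {x,y} \<Longrightarrow> u \<in> Pm x \<and> u \<in> Pm y" using int by blast
  have yz: "z \<in> Pm y" "z \<in> Pm x" using a by blast+
  have sub: "vs.span {x,z} \<subseteq> vs.span {x,y}" "vs.span {y,z} \<subseteq> vs.span {x,y}"
    using sd_span_le[OF s2, of "{x,z}"] sd_span_le[OF s2, of "{y,z}"] zxy vs.span_base[of x "{x,y}"] vs.span_base[of y "{x,y}"] by simp_all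
  have pn: "p \<notin> vs.span {x,y}"
  proof
    assume "p \<in> vs.span {x,y}"
    then have "t \<in> Pm y" using p zz sd_add[OF Pm_sd3[OF x(2)]] by blast
    then have "t \<in> vs.span {y,z}" using Pm_triangle[OF x(2) yz(1) n(3) _ t(1)] by blast
    then show False using sub t(2) by blast
  qed
  have h: "hx (\<alpha> *s x + \<beta> *s y) (1 *s p + 1 *s p')" using t(1) unfolding z p(1) Pm_mem by simp
  have "p' \<noteq> 0"
  proof
    assume "p' = 0"
    then have "t \<in> vs.span {x,z}" using Pm_triangle[OF x(1) yz(2) n(2) _ t(1)] p by simp
    then show False using sub t(2) by blast
  qed
  show False
    using m_conic[OF singD[OF x(1)] _ _ n(1) _ _ pn _ _ nz one_neq_zero one_neq_zero h] a(1) p(2,3) unfolding Pm_mem by blast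
qed

interpretation hexM: line_geom "vecs 6" "hexagon_lines :: (nat \<Rightarrow> 'a::{field,finite}) set set" "CARD('a)"
proof (unfold_locales, goal_cases)
  case (1 x)
  then have s: "sing x" using hexM_P by blast
  have e: "{l \<in> hexagon_lines. x \<in> l} = {T. sd 2 T \<and> vs.span {x} \<subseteq> T \<and> T \<subseteq> Pm x}" using hex_through[OF s] by blast
  have 3: "sd (Suc 2) (Pm x)" using Pm_sd3[OF s] by (simp add: numeral_3_eq_3)
  have x: "vs.span {x} \<subseteq> Pm x" using sd_span_mem[OF Pm_sd3[OF s]] singD[OF s] hx_self[of x] unfolding Pm_mem by blast
  show ?case unfolding e using card_hyperplanes[OF sd_span1[OF singD(3)[OF s]] 3 x] by simp
next
  case (2 x)
  then have s: "sing x" using hexM_P by blast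
  then show ?case using hexM_Pi[OF s] Pm_sd3[OF s] by simp
next
  case (3 x)
  then have s: "sing x" using hexM_P by blast
  have "x \<in> k" if k: "k \<in> hexagon_lines" "k \<subseteq> Pm x" for k
  proof (rule ccontr)
    assume n: "x \<notin> k"
    obtain a b where a: "a \<noteq> 0" "b \<notin> vs.span {a}" "k = vs.span {a,b}" "hx a b" "b \<in> vecs 6" using k(1) unfolding hex_iff by blast
    have ab: "a \<in> k" "b \<in> k" unfolding a(3) by (auto intro: vs.span_base)
    have ax: "a \<notin> vs.span {x}" using span1_sym[OF a(1)] sd_span_mem[OF hex_sd[OF k(1)] ab(1)] n by blast
    have "b \<in> Pm a" using a unfolding Pm_mem by blast
    then have "b \<in> vs.span {x,a}" using Pm_triangle[OF s _ ax] ab k(2) by blast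
    moreover have "a \<in> vs.span {x,a}" "x \<in> vs.span {x,a}" by (auto intro: vs.span_base)
    ultimately have "vs.span {x,a} = vs.span {a,b}" using sd_line_span[OF sd_span2[OF singD(3)[OF s] ax] _ _ a(1,2)] by blast
    then show False using n a(3) \<open>x \<in> vs.span {x,a}\<close> by blast
  qed
  then show ?case unfolding hexM_Pi[OF s] using hex_through[OF s] by blast
next
  case (4 S x y)
  then have s: "sing x" "sing y" using hexM_P by blast+
  then show ?case using hex_pencils_adj[OF 4(1) s] 4 unfolding hexM_Pi[OF s(1)] hexM_Pi[OF s(2)] by blast
next
  case (5 S x y z)
  then have s: "sing x" "sing y" "sing z" using hexM_P by blast+
  then show ?case using hex_pencils3[OF 5(1) s] 5 unfolding hexM_Pi[OF s(1)] hexM_Pi[OF s(2)] hexM_Pi[OF s(3)] by blast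
qed

interpretation hexM: hexmod "vecs 6" "hexagon_lines :: (nat \<Rightarrow> 'a::{field,finite}) set set" "CARD('a)" Bf
proof (unfold_locales, goal_cases)
  case 1
  then show ?case by (rule sd_vecs6)
next
  case 2
  have "sing (u0 :: nat \<Rightarrow> 'a)" unfolding sing_def quadQ6_def by (auto dest: fun_cong[of _ _ 0])
  then show ?case using hexM_P by blast
next
  case (3 x y z)
  then show ?case by (rule Bf_bilin)
next
  case (4 x k y)
  then show ?case by (rule Bf_bilin)
next
  case (5 x y)
  then show ?case unfolding Bf_def cr_def by (simp add: algebra_simps)
next
  case (6 x y)
  then have s: "sing x" "sing y" using hexM_P by blast+
  show ?case unfolding hexM_Pi[OF s(1)] hexM_Pi[OF s(2)]
  proof
    assume "Bf x y = 0"
    then show "\<exists>v. v \<noteq> 0 \<and> v \<in> Pm x \<and> v \<in> Pm y" using m_common[OF singD[OF s(1)] singD[OF s(2)]] unfolding Pm_mem by blast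
  next
    assume "\<exists>v. v \<noteq> 0 \<and> v \<in> Pm x \<and> v \<in> Pm y"
    then obtain v where v: "v \<noteq> 0" "v \<in> Pm x" "v \<in> Pm y" by blast
    have sv: "sing v" using sing_Pm[OF s(1) v(2,1)] .
    show "Bf x y = 0" using m_common_B[OF singD[OF sv]] v unfolding Pm_mem by blast
  qed
next
  case (7 x m)
  then have s: "sing x" using hexM_P by blast
  obtain a b where a: "a \<noteq> 0" "b \<notin> vs.span {a}" "m = vs.span {a,b}" "hx a b" "a \<in> vecs 6" "b \<in> vecs 6" using 7(2) unfolding hex_iff by blast
  have "a \<in> m" "b \<in> m" unfolding a(3) by (auto intro: vs.span_base)
  then have "Bf x a = 0" "Bf x b = 0" using 7(3) by blast+
  then obtain c d where c: "c \<noteq> 0 \<or> d \<noteq> 0" "hx x (c *s a + d *s b)" using m_pent[OF singD[OF s] a(5,6,4)] by blast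
  let ?p = "c *s a + d *s b"
  have p: "?p \<in> m" unfolding a(3) span2_iff by blast
  have "?p \<noteq> 0"
  proof
    assume p0: "?p = 0"
    show False
    proof (cases "d = 0")
      case True
      then show False using p0 c a(1) by simp
    next
      case False
      have "d *s b = (- c) *s a" using p0 by (simp add: add_eq_0_iff)
      then have "inverse d *s (d *s b) = inverse d *s ((- c) *s a)" by simp
      then have "b = (inverse d * (- c)) *s a" using False by (simp del: vs.scale_minus_left)
      then show False using a(2) unfolding span1_iff by blast
    qed
  qed
  moreover have "?p \<in> Pm x" unfolding Pm_mem using c(2) p hex_vecs[OF 7(2)] by blast
  ultimately show ?case unfolding hexM_Pi[OF s] using p by blast
qed

section \<open>Transfer of the counts along an injective linear map\<close>

lemma lin_matmap: "lin (matmap n A)"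
  by (rule lin_mkI) (simp_all add: matmap_def scl_def algebra_simps sum.distrib sum_distrib_left)

text \<open>The image of g need not contain S, so the preimage may lose dimensions. This is why the
  counting lemmas are stated for dimensions up to a bound.\<close>

lemma lin_pullback:
  fixes g :: "(nat \<Rightarrow> 'a::{field,finite}) \<Rightarrow> nat \<Rightarrow> 'a"
  assumes g: "lin g" "inj_on g (vecs 6)" and S: "sd k S"
  obtains j where "sd j {c\<in>vecs 6. g c \<in> S}" "j \<le> k"
proof -
  let ?T = "{c\<in>vecs 6. g c \<in> S}"
  have g0: "g 0 = 0" using lin_scl[OF g(1), of 0 0] by simp
  have sub: "vs.subspace ?T"
    by (rule vs.subspaceI) (use sd_zero[OF S] sd_add[OF S] sd_scale[OF S] vecs_add vecs_scl vecs_0 g0 in \<open>auto simp: lin_add[OF g(1)] lin_scl[OF g(1)]\<close>)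
  have fin: "finite ?T" by (rule finite_subset[OF _ finite_vecs]) blast
  obtain j where j: "sd j ?T" using sd_exists[OF sub fin] by blast
  have "inj_on g ?T" using g(2) by (rule inj_on_subset) blast
  then have "card ?T \<le> card S" using card_inj_on_le[of g ?T S] sd_finite[OF S] by blast
  then have "CARD('a) ^ j \<le> CARD('a) ^ k" using j S unfolding sd_def by simp
  then have "j \<le> k" using CARD_field_gt1[where 'a='a] by (simp add: power_increasing_iff)
  then show thesis using that j by blast
qed

context
  fixes g :: "(nat \<Rightarrow> 'a::{field,finite}) \<Rightarrow> nat \<Rightarrow> 'a" and L
  assumes g: "lin g" "inj_on g (vecs 6)" and L: "L = (\<lambda>l. g ` l) ` hexagon_lines"
begin

lemma image_inj: "inj_on (\<lambda>l. g ` l) hexagon_lines"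
proof (rule inj_onI)
  fix a b assume a: "a \<in> hexagon_lines" "b \<in> hexagon_lines" "g ` a = g ` b"
  then show "a = b" using inj_on_image_eq_iff[OF g(2) hex_vecs hex_vecs] by blast
qed

lemma image_count: "card {l\<in>L. Q l} = card {l\<in>hexagon_lines. Q (g ` l)}"
proof -
  have "{l\<in>L. Q l} = (\<lambda>l. g ` l) ` {l\<in>hexagon_lines. Q (g ` l)}" unfolding L by (rule Compr_image_eq)
  moreover have "inj_on (\<lambda>l. g ` l) {l\<in>hexagon_lines. Q (g ` l)}" using image_inj by (rule inj_on_subset) blast
  ultimately show ?thesis by (simp only: card_image)
qed

lemma image_LU: "card {l\<in>L. l \<subseteq> S} = card (hexM.LU {c\<in>vecs 6. g c \<in> S})"
proof -
  have "{l\<in>hexagon_lines. g ` l \<subseteq> S} = hexM.LU {c\<in>vecs 6. g c \<in> S}" unfolding hexM.LU_def using hex_vecs by blast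
  then show ?thesis using image_count[of "\<lambda>l. l \<subseteq> S"] by simp
qed

lemma image_plane: assumes S: "sd 3 S" shows "card {l\<in>L. l \<subseteq> S} \<in> {0, 1, CARD('a) + 1}"
proof -
  obtain j where "sd j {c\<in>vecs 6. g c \<in> S}" "j \<le> 3" using lin_pullback[OF g S] .
  then show ?thesis unfolding image_LU using hexM.plane_count by blast
qed

lemma image_solid: assumes S: "sd 4 S" shows "card {l\<in>L. l \<subseteq> S} \<in> {0, 1, CARD('a) + 1, 2 * CARD('a) + 1}"
proof -
  obtain j where "sd j {c\<in>vecs 6. g c \<in> S}" "j \<le> 4" using lin_pullback[OF g S] .
  then show ?thesis unfolding image_LU using hexM.solid_count by blast
qed

lemma image_fourspace: assumes S: "sd 5 S" shows "card {l\<in>L. l \<subseteq> S} \<le> CARD('a)^3 - CARD('a)^2 + 4 * CARD('a)"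
proof -
  obtain j where "sd j {c\<in>vecs 6. g c \<in> S}" "j \<le> 5" using lin_pullback[OF g S] .
  then show ?thesis unfolding image_LU using hexM.fourspace_count by blast
qed

lemma image_total: "card L \<le> CARD('a)^5 + CARD('a)^4 + CARD('a)^3 + CARD('a)^2 + CARD('a) + 1"
  using image_count[of "\<lambda>l. True"] hexM.total_count by simp

lemma image_point: assumes x: "x \<noteq> 0" shows "card {l\<in>L. x \<in> l} \<in> {0, CARD('a) + 1}"
proof (cases "\<exists>c\<in>vecs 6. g c = x")
  case True
  then obtain c where c: "c \<in> vecs 6" "g c = x" by blast
  have c0: "c \<noteq> 0" using c x lin_scl[OF g(1), of 0 0] by auto
  have "{l\<in>hexagon_lines. x \<in> g ` l} = {l\<in>hexagon_lines. c \<in> l}"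
    using c inj_on_image_mem_iff[OF g(2) c(1) hex_vecs] by blast
  then have e: "card {l\<in>L. x \<in> l} = card {l\<in>hexagon_lines. c \<in> l}" using image_count[of "\<lambda>l. x \<in> l"] by simp
  show ?thesis
  proof (cases "c \<in> hexM.P")
    case True
    then show ?thesis using e hexM.lines_card[OF True] by simp
  next
    case False
    then have "{l\<in>hexagon_lines. c \<in> l} = {}" using hexM.P_I[OF _ _ c0] by blast
    then show ?thesis unfolding e by (simp only: card.empty) blast
  qed
next
  case False
  then have "{l\<in>L. x \<in> l} = {}" unfolding L using hex_vecs by blast
  then show ?thesis by (simp only: card.empty) blast
qed

end

section \<open>Standard frames\<close>

text \<open>In the standard model the apartment \<open>a0, \<dots>, a5\<close> is the hexagon of unit vectors with indices 0, 5, 2, 4, 1, 6, and \<open>e\<close> has index 3.\<close>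
definition Phi :: "(nat \<Rightarrow> 'a::field) \<Rightarrow> (nat \<Rightarrow> 'a) \<Rightarrow> (nat \<Rightarrow> 'a) \<Rightarrow> (nat \<Rightarrow> 'a) \<Rightarrow> (nat \<Rightarrow> 'a) \<Rightarrow> (nat \<Rightarrow> 'a) \<Rightarrow> (nat \<Rightarrow> 'a) \<Rightarrow> (nat \<Rightarrow> 'a) \<Rightarrow> nat \<Rightarrow> 'a"
  where "Phi a0 a1 a2 a3 a4 a5 e c = c 0 *s a0 + c 1 *s a4 + c 2 *s a2 + c 3 *s e + c 4 *s a3 + c 5 *s a1 + c 6 *s a5"

lemma lin_Phi: "lin (Phi a0 a1 a2 a3 a4 a5 e)"
  by (rule lin_mkI) (simp_all add: Phi_def scl_apply algebra_simps)

text \<open>Changing the frame amounts to precomposing its coordinate map with an automorphism of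
  the model; this and the next three identities link frames with octonion coordinates.\<close>

lemma Phi_M1: "Phi (a0 + s *s a2) a1 a2 a3 a4 (a5 - s *s a3) e c = Phi a0 a1 a2 a3 a4 a5 e (gM1 s c)"
  by (rule ext) (simp add: Phi_def gM1_def scl_apply algebra_simps)

lemma Phi_M2: "Phi (a0 + t *s a1) a1 a2 a3 (a4 - t *s a3) (a5 + t *s e + t^2 *s a2) (e + (2 * t) *s a2) c = Phi a0 a1 a2 a3 a4 a5 e (gM2 t c)"
  by (rule ext) (simp add: Phi_def gM2_def scl_apply algebra_simps)

lemma Phi_rot: "Phi a1 a2 a3 a4 a5 a0 (- e) c = Phi a0 a1 a2 a3 a4 a5 e (gR c)"
  by (rule ext) (simp add: Phi_def gR_def scl_apply algebra_simps)

lemma Phi_ref: "Phi a2 a1 a0 a5 a4 a3 (- e) c = Phi a0 a1 a2 a3 a4 a5 e (gF c)"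
  by (rule ext) (simp add: Phi_def gF_def scl_apply algebra_simps)

lemma autm_hex:
  fixes g :: "(nat \<Rightarrow> 'a::{field,finite}) \<Rightarrow> nat \<Rightarrow> 'a"
  assumes a: "autm g h" and l: "l \<in> hexagon_lines" shows "g ` l \<in> hexagon_lines"
proof -
  obtain x y where x: "x \<in> vecs 6" "y \<in> vecs 6" "x \<noteq> 0" "y \<notin> vs.span {x}" "l = vs.span {x,y}" "quadQ6 x = 0" "quadQ6 y = 0" "hx x y"
    using l unfolding hex_iff by blast
  have 1: "g ` l = vs.span {g x, g y}" unfolding x(5) by (rule lin_span2_image[OF autmD(1)[OF a]])
  have 2: "g y \<notin> vs.span {g x}" using autm_span1[OF a x(1,2)] x(4) by blast
  have 3: "quadQ6 (g x) = 0" "quadQ6 (g y) = 0" using autmD(6)[OF a] x(6,7) by simp_all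
  show ?thesis unfolding hex_iff using 1 2 3 autmD(3)[OF a] autm_nz[OF a x(1,3)] autmD(7)[OF a x(8)] by blast
qed

section \<open>The normal form of a frame and its symmetries\<close>

context flat_lines begin

lemma H_neg: "x \<in> P \<Longrightarrow> e \<in> H x \<Longrightarrow> - e \<in> H x"
  using sd_scale[OF H_sd, of x e "-1"] by simp

lemma Fr_neg: "Fr a0 a1 a2 a3 a4 a5 e \<Longrightarrow> Fr a0 a1 a2 a3 a4 a5 (- e)"
  unfolding Fr_def using H_neg by simp

lemma VD_neg: assumes "VD a0 a1 a2 a3 a4 a5 e \<kappa> \<rho>" shows "VD a0 a1 a2 a3 a4 a5 (- e) \<kappa> (- \<rho>)"
  unfolding VD_def
proof (intro conjI allI impI)
  fix \<tau> :: 'a assume "\<tau> \<noteq> 0"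
  then obtain c d where "c \<noteq> 0" "d \<noteq> 0" "a1 + c *s e + d *s a4 \<in> Pi (a0 + \<tau> *s a5)" "a1 + c *s e + d *s a4 \<in> Pi (a2 + (\<kappa> * \<tau>) *s a3)"
    using VD2[OF assms] by blast
  then have "- c \<noteq> 0 \<and> d \<noteq> 0 \<and> a1 + (- c) *s (- e) + d *s a4 \<in> Pi (a0 + \<tau> *s a5) \<and> a1 + (- c) *s (- e) + d *s a4 \<in> Pi (a2 + (\<kappa> * \<tau>) *s a3)" by simp
  then show "\<exists>c d. c \<noteq> 0 \<and> d \<noteq> 0 \<and> a1 + c *s (- e) + d *s a4 \<in> Pi (a0 + \<tau> *s a5) \<and> a1 + c *s (- e) + d *s a4 \<in> Pi (a2 + (\<kappa> * \<tau>) *s a3)" by blast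
qed (use VD_k[OF assms] VD_r[OF assms] VD1[OF assms] VD3[OF assms] VD4[OF assms] in simp_all)

lemma VD_ref:
  assumes F: "Fr a0 a1 a2 a3 a4 a5 e" and D: "VD a0 a1 a2 a3 a4 a5 e \<kappa> \<rho>" shows "VD a2 a1 a0 a5 a4 a3 e (1 / \<kappa>) (\<rho> / \<kappa>)"
  unfolding VD_def
proof (intro conjI allI impI)
  interpret f: frame V L q a0 a1 a2 a3 a4 a5 e using frameI[OF F] .
  note k = VD_k[OF D] and r = VD_r[OF D]
  show "1 / \<kappa> \<noteq> 0" "\<rho> / \<kappa> \<noteq> 0" using k r by simp_all
  show "a3 + (1 / \<kappa> * s) *s a5 \<in> Pi (a2 + s *s a0)" for s
  proof (cases "s = 0")
    case True
    then show ?thesis using f.adj by simp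
  next
    case False
    have "a5 + (\<kappa> * (1/s)) *s a3 \<in> Pi (a0 + (1/s) *s a2)" using VD1[OF D] .
    then have "(s / \<kappa>) *s (a5 + (\<kappa> * (1/s)) *s a3) \<in> Pi (a0 + (1/s) *s a2)" using f.PiI(2)[OF f.zP(4)] by blast
    then have "(s / \<kappa>) *s (a5 + (\<kappa> * (1/s)) *s a3) \<in> Pi (s *s (a0 + (1/s) *s a2))" using scale_in_Pi[OF P_nz[OF f.zP(4)] False] by simp
    moreover have "(s / \<kappa>) *s (a5 + (\<kappa> * (1/s)) *s a3) = a3 + (1 / \<kappa> * s) *s a5" using k False by (intro ext) (simp add: scl_apply field_simps)
    moreover have "s *s (a0 + (1/s) *s a2) = a2 + s *s a0" using False by (intro ext) (simp add: scl_apply field_simps)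
    ultimately show ?thesis by simp
  qed
  show "\<exists>c d. c \<noteq> 0 \<and> d \<noteq> 0 \<and> a1 + c *s e + d *s a4 \<in> Pi (a2 + \<tau> *s a3) \<and> a1 + c *s e + d *s a4 \<in> Pi (a0 + (1 / \<kappa> * \<tau>) *s a5)" if t: "\<tau> \<noteq> 0" for \<tau>
  proof -
    have "1 / \<kappa> * \<tau> \<noteq> 0" using t k by simp
    then obtain c d where cd: "c \<noteq> 0" "d \<noteq> 0" "a1 + c *s e + d *s a4 \<in> Pi (a0 + (1 / \<kappa> * \<tau>) *s a5)" "a1 + c *s e + d *s a4 \<in> Pi (a2 + (\<kappa> * (1 / \<kappa> * \<tau>)) *s a3)"
      using VD2[OF D] by blast
    have "\<kappa> * (1 / \<kappa> * \<tau>) = \<tau>" using k by simp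
    then show ?thesis using cd by metis
  qed
  show "\<exists>\<delta>. a3 + (\<rho> / \<kappa> * t) *s e + \<delta> *s a0 \<in> Pi (a2 + t *s a1)" for t using VD4[OF D, of t] by simp
  show "\<exists>d. a5 + (\<rho> / \<kappa> * t / (1 / \<kappa>)) *s e + d *s a2 \<in> Pi (a0 + t *s a1)" for t using VD3[OF D, of t] k by simp
qed

text \<open>The value -1 for \<kappa> agrees with the sign in \<open>VD_prod\<close>. The constants
  \<rho> alternate in sign around the apartment, which is why rotations and reflections turn e into
  -e.\<close>

definition Std where
  "Std a0 a1 a2 a3 a4 a5 e \<longleftrightarrow> Fr a0 a1 a2 a3 a4 a5 e \<and> VD a0 a1 a2 a3 a4 a5 e (-1) 1 \<and> VD a1 a2 a3 a4 a5 a0 e (-1) (-1)"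

text \<open>The structure constants are unique, so incidences at parameter 1 determine them: the two
  diagonal ones give both \<kappa>, and the edge, by \<open>VD_edge\<close>, gives both
  \<rho>.\<close>

lemma Std_intro:
  assumes F: "Fr a0 a1 a2 a3 a4 a5 e" and 1: "a5 - a3 \<in> Pi (a0 + a2)" and 2: "a0 - a4 \<in> Pi (a1 + a3)" and 3: "a0 - e + a3 \<in> Pi (a1 + a2)"
  shows "Std a0 a1 a2 a3 a4 a5 e"
proof -
  note F1 = Fr_rot[OF F]
  obtain k1 r1 where d1: "VD a0 a1 a2 a3 a4 a5 e k1 r1" using VD_exists[OF F] by blast
  obtain k2 r2 where d2: "VD a1 a2 a3 a4 a5 a0 e k2 r2" using VD_exists[OF F1] by blast
  have "a5 + (k1 * 1) *s a3 \<in> Pi (a0 + 1 *s a2)" using VD1[OF d1] .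
  moreover have "a5 + (-1) *s a3 \<in> Pi (a0 + 1 *s a2)" using 1 by simp
  ultimately have k1: "k1 = -1" using frame.kappa_unique[OF frameI[OF F]] by fastforce
  have "a0 + (k2 * 1) *s a4 \<in> Pi (a1 + 1 *s a3)" using VD1[OF d2] .
  moreover have "a0 + (-1) *s a4 \<in> Pi (a1 + 1 *s a3)" using 2 by simp
  ultimately have k2: "k2 = -1" using frame.kappa_unique[OF frameI[OF F1]] by fastforce
  have "a0 + (r2 * 1) *s e + (k1 * r2 / r1 * 1^2) *s a3 \<in> Pi (a1 + 1 *s a2)" using VD_edge[OF F1 d2 d1] .
  moreover have "a0 + (-1) *s e + 1 *s a3 \<in> Pi (a1 + 1 *s a2)" using 3 by simp
  ultimately have "r2 * 1 = -1 \<and> k1 * r2 / r1 * 1^2 = 1" by (rule frame.edge_unique[OF frameI[OF F1]])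
  then have "r2 = -1" "r1 = 1" using k1 VD_r[OF d1] by auto
  then show ?thesis unfolding Std_def using F d1 d2 k1 k2 by simp
qed

text \<open>\<open>VD_prod\<close> and \<open>VD_opp\<close> determine all \<kappa>, and
  \<open>VD_rho\<close> relates the constants \<rho> at vertices two steps apart.\<close>

lemma Std_data:
  assumes S: "Std a0 a1 a2 a3 a4 a5 e"
  shows "VD a2 a3 a4 a5 a0 a1 e (-1) 1" "VD a5 a0 a1 a2 a3 a4 e (-1) (-1)"
proof -
  have F: "Fr a0 a1 a2 a3 a4 a5 e" and d1: "VD a0 a1 a2 a3 a4 a5 e (-1) 1" and d2: "VD a1 a2 a3 a4 a5 a0 e (-1) (-1)" using S unfolding Std_def by auto
  note F1 = Fr_rot[OF F] note F2 = Fr_rot[OF F1] note F3 = Fr_rot[OF F2] note F4 = Fr_rot[OF F3] note F5 = Fr_rot[OF F4]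
  obtain k3 r3 where d3: "VD a2 a3 a4 a5 a0 a1 e k3 r3" using VD_exists[OF F2] by blast
  obtain k4 r4 where d4: "VD a3 a4 a5 a0 a1 a2 e k4 r4" using VD_exists[OF F3] by blast
  obtain k5 r5 where d5: "VD a4 a5 a0 a1 a2 a3 e k5 r5" using VD_exists[OF F4] by blast
  obtain k0 r0 where d0: "VD a5 a0 a1 a2 a3 a4 e k0 r0" using VD_exists[OF F5] by blast
  have k3: "k3 = -1" using VD_prod[OF F d1 d2 d3] by simp
  have k4: "k4 = -1" using VD_opp[OF F d1 d4] by simp
  have k5: "k5 = -1" using VD_opp[OF F1 d2 d5] by simp
  have k0: "k0 = -1" using VD_opp[OF F2 d3 d0] k3 by simp
  have "r5 / k5 = -1 * r3" using VD_rho[OF F d1 d5 d3] by simp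
  moreover have "1 / (-1) = k3 * r5" using VD_rho[OF F2 d3 d1 d5] .
  ultimately have r3: "r3 = 1" using k3 k5 by simp
  have "(-1) / (-1) = k4 * r0" using VD_rho[OF F3 d4 d2 d0] .
  then have r0: "r0 = -1" using k4 by (simp add: minus_equation_iff)
  show "VD a2 a3 a4 a5 a0 a1 e (-1) 1" "VD a5 a0 a1 a2 a3 a4 e (-1) (-1)" using d3 d0 k3 r3 k0 r0 by simp_all
qed

lemma Std_rot: assumes S: "Std a0 a1 a2 a3 a4 a5 e" shows "Std a1 a2 a3 a4 a5 a0 (- e)"
  using Fr_neg[OF Fr_rot] VD_neg[of a1 a2 a3 a4 a5 a0 e "-1" "-1"] VD_neg[OF Std_data(1)[OF S]] S unfolding Std_def by simp

lemma Std_ref: assumes S: "Std a0 a1 a2 a3 a4 a5 e" shows "Std a2 a1 a0 a5 a4 a3 (- e)"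
proof -
  have F: "Fr a0 a1 a2 a3 a4 a5 e" and d1: "VD a0 a1 a2 a3 a4 a5 e (-1) 1" using S unfolding Std_def by auto
  have F5: "Fr a5 a0 a1 a2 a3 a4 e" using Fr_rot[OF Fr_rot[OF Fr_rot[OF Fr_rot[OF Fr_rot[OF F]]]]] .
  show ?thesis unfolding Std_def using Fr_neg[OF Fr_ref1[OF F]] VD_neg[OF VD_ref[OF F d1]] VD_neg[OF VD_ref[OF F5 Std_data(2)[OF S]]] by simp
qed

lemma Std_edge: assumes S: "Std a0 a1 a2 a3 a4 a5 e" shows "a5 + t *s e + t^2 *s a2 \<in> Pi (a0 + t *s a1)"
proof -
  have F: "Fr a0 a1 a2 a3 a4 a5 e" and d1: "VD a0 a1 a2 a3 a4 a5 e (-1) 1" using S unfolding Std_def by auto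
  show ?thesis using VD_edge[OF F d1 Std_data(2)[OF S], of t] by simp
qed

lemma Std_edge': assumes S: "Std a0 a1 a2 a3 a4 a5 e" shows "a5 + t *s e + t^2 *s a2 \<in> Pi (a4 - t *s a3)"
proof -
  have "Std a4 a3 a2 a1 a0 a5 (- e)" using Std_rot[OF Std_rot[OF Std_rot[OF Std_rot[OF Std_ref[OF S]]]]] by simp
  from Std_edge[OF this, of "- t"] show ?thesis by simp
qed

lemma Std_incid:
  assumes S: "Std a0 a1 a2 a3 a4 a5 e"
  shows "a5 - s *s a3 \<in> Pi (a0 + s *s a2)" "a0 - s *s a4 \<in> Pi (a1 + s *s a3)" "a0 - t *s e + t^2 *s a3 \<in> Pi (a1 + t *s a2)"
proof -
  have d1: "VD a0 a1 a2 a3 a4 a5 e (-1) 1" and d2: "VD a1 a2 a3 a4 a5 a0 e (-1) (-1)" using S unfolding Std_def by auto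
  show "a5 - s *s a3 \<in> Pi (a0 + s *s a2)" "a0 - s *s a4 \<in> Pi (a1 + s *s a3)" using VD1[OF d1, of s] VD1[OF d2, of s] by simp_all
  show "a0 - t *s e + t^2 *s a3 \<in> Pi (a1 + t *s a2)" using Std_edge[OF Std_rot[OF S], of t] by simp
qed

lemma Std_Fr: "Std a0 a1 a2 a3 a4 a5 e \<Longrightarrow> Fr a0 a1 a2 a3 a4 a5 e" unfolding Std_def by blast

lemma Std_M1: assumes S: "Std a0 a1 a2 a3 a4 a5 e" shows "Std (a0 + s *s a2) a1 a2 a3 a4 (a5 - s *s a3) e"
proof -
  have F: "Fr a0 a1 a2 a3 a4 a5 e" and d1: "VD a0 a1 a2 a3 a4 a5 e (-1) 1" using S unfolding Std_def by auto
  interpret f: frame V L q a0 a1 a2 a3 a4 a5 e using frameI[OF F] .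
  interpret r: frame V L q a1 a2 a3 a4 a5 a0 e using frameI[OF Fr_rot[OF F]] .
  have F': "Fr (a0 + s *s a2) a1 a2 a3 a4 (a5 - s *s a3) e" using VD_shear[OF F d1, of s] by simp
  show ?thesis
  proof (rule Std_intro[OF F'])
    have "a5 - (s + 1) *s a3 \<in> Pi (a0 + (s + 1) *s a2)" using Std_incid(1)[OF S] .
    then show "a5 - s *s a3 - a3 \<in> Pi (a0 + s *s a2 + a2)" by (simp add: vs.scale_left_distrib algebra_simps)
    have p: "a1 + a3 \<in> P" "a1 + a2 \<in> P" using r.zP(4)[of 1] r.zP(2)[of 1] by simp_all
    have m: "a2 \<in> Pi (a1 + a3)" "a2 \<in> Pi (a1 + a2)" using r.z_a1(4)[of 1] r.z_a1(2)[of 1] by simp_all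
    have "a0 - a4 + s *s a2 \<in> Pi (a1 + a3)" using f.PiI(1)[OF p(1) _ f.PiI(2)[OF p(1) m(1)]] Std_incid(2)[OF S, of 1] by simp
    then show "a0 + s *s a2 - a4 \<in> Pi (a1 + a3)" by (simp add: algebra_simps)
    have "a0 - e + a3 + s *s a2 \<in> Pi (a1 + a2)" using f.PiI(1)[OF p(2) _ f.PiI(2)[OF p(2) m(2)]] Std_incid(3)[OF S, of 1] by simp
    then show "a0 + s *s a2 - e + a3 \<in> Pi (a1 + a2)" by (simp add: algebra_simps)
  qed
qed

lemma path2_H: "x \<in> P \<Longrightarrow> v \<in> Pi x \<Longrightarrow> v \<noteq> 0 \<Longrightarrow> w \<in> Pi v \<Longrightarrow> w \<in> H x"
  unfolding H_def N2_def by (rule vs.span_base) blast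

text \<open>Over the field with two elements the only nonzero value \<open>s = 1\<close> still suffices, because then \<open>C = 1\<close>.\<close>
lemma two_values: assumes C: "C \<noteq> 0" and h: "\<And>s. s \<noteq> 0 \<Longrightarrow> C * s = y + s" shows "y = (0::'a)"
proof (cases "\<exists>s. s \<noteq> 0 \<and> s \<noteq> (1::'a)")
  case True
  then obtain s where s: "s \<noteq> 0" "s \<noteq> (1::'a)" by blast
  have 1: "C = y + 1" using h[of 1] by simp
  have "(C - 1) * (s - 1) = 0" using h[OF s(1)] 1 by (simp add: algebra_simps)
  then have "C = 1" using s(2) by simp
  then show ?thesis using 1 by simp
next
  case False
  then have "C = 1" using C by blast
  then show ?thesis using h[of 1] by simp
qed

text \<open>The vector e must be corrected by some x a2 to lie in the hyperplane of the moved a5.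
  Computing the pencils along the edge a0a1 both in the old standard frame and in the new frame with
  unknown constants gives C s = (2 t - x) + s for all nonzero s, and \<open>two_values\<close>
  yields x = 2 t.\<close>

lemma Std_M2:
  assumes S: "Std a0 a1 a2 a3 a4 a5 e"
  shows "Std (a0 + t *s a1) a1 a2 a3 (a4 - t *s a3) (a5 + t *s e + t^2 *s a2) (e + (2 * t) *s a2)"
proof (cases "t = 0")
  case True
  then show ?thesis using S by simp
next
  case t0: False
  note F = Std_Fr[OF S]
  interpret f: frame V L q a0 a1 a2 a3 a4 a5 e using frameI[OF F] .
  let ?b0 = "a0 + t *s a1" and ?b4 = "a4 - t *s a3" and ?b5 = "a5 + t *s e + t^2 *s a2"
  have b50: "?b5 \<in> Pi ?b0" using Std_edge[OF S] .
  have b54: "?b5 \<in> Pi ?b4" using Std_edge'[OF S] .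
  have nz: "?b5 \<noteq> 0" "?b4 \<noteq> 0"
  proof -
    have "f.co 5 ?b5 = 1" "f.co 4 ?b4 = 1" by simp_all
    moreover have "f.co i 0 = 0" for i using f.co_scl[of a0 i 0] by simp
    ultimately show "?b5 \<noteq> 0" "?b4 \<noteq> 0" by fastforce+
  qed
  have b0P: "?b0 \<in> P" using f.zP(2) .
  have b5P: "?b5 \<in> P" using adj_P[OF b50 nz(1)] .
  have b43: "?b4 \<in> Pi a3" using f.PiI(3)[OF f.aP(4) f.adj(4) f.PiI(2)[OF f.aP(4) Pi_self[OF f.aP(4)]]] .
  have b4P: "?b4 \<in> P" using adj_P[OF b43 nz(2)] .
  have b01: "a1 \<in> Pi ?b0" using f.z_a1(2) .
  have b10: "?b0 \<in> Pi a1" using b01 adj_sym by blast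
  have b34: "a3 \<in> Pi ?b4" using b43 adj_sym by blast
  have b05: "?b0 \<in> Pi ?b5" using b50 adj_sym by blast
  have b45: "?b4 \<in> Pi ?b5" using b54 adj_sym by blast
  have n03: "\<not> near ?b0 a3" using f.near_co(4)[OF b0P] near_sym by simp
  have n14: "\<not> near a1 ?b4" using f.near_co(2)[OF b4P] by simp
  have n25: "\<not> near a2 ?b5" using f.near_co(3)[OF b5P] by simp
  note sub = f.HsubI
  have a20: "a2 \<in> H ?b0" using path2_H[OF b0P b01 P_nz[OF f.aP(2)] f.adj(2)] .
  have a24: "a2 \<in> H ?b4" using path2_H[OF b4P b34 P_nz[OF f.aP(4)] f.adj(9)] .
  have eH: "e \<in> H x" if x: "x \<in> P" "?b5 \<in> H x" "a5 \<in> H x" "a2 \<in> H x" for x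
  proof -
    have "?b5 - a5 - t^2 *s a2 \<in> H x" using sub(3)[OF x(1) sub(3)[OF x(1,2,3)] sub(2)[OF x(1,4)]] .
    then have "t *s e \<in> H x" by (simp add: algebra_simps)
    then have "(1/t) *s (t *s e) \<in> H x" using sub(2)[OF x(1)] by blast
    then show ?thesis using t0 by simp
  qed
  have e0: "e \<in> H ?b0"
  proof (rule eH[OF b0P _ _ a20])
    show "?b5 \<in> H ?b0" using path2_H[OF b0P Pi_self[OF b0P] P_nz[OF b0P] b50] .
    have "a0 \<in> Pi ?b0"
    proof -
      have "?b0 - t *s a1 \<in> Pi ?b0" using f.PiI(3)[OF b0P Pi_self[OF b0P] f.PiI(2)[OF b0P b01]] .
      then show ?thesis by simp
    qed
    then show "a5 \<in> H ?b0" using path2_H[OF b0P _ P_nz[OF f.aP(1)] f.adj(12)] by blast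
  qed
  have e4: "e \<in> H ?b4"
  proof (rule eH[OF b4P _ _ a24])
    show "?b5 \<in> H ?b4" using path2_H[OF b4P Pi_self[OF b4P] P_nz[OF b4P] b54] .
    have "a4 \<in> Pi ?b4"
    proof -
      have "?b4 + t *s a3 \<in> Pi ?b4" using f.PiI(1)[OF b4P Pi_self[OF b4P] f.PiI(2)[OF b4P b34]] .
      then show ?thesis by simp
    qed
    then show "a5 \<in> H ?b4" using path2_H[OF b4P _ P_nz[OF f.aP(5)] f.adj(5)] by blast
  qed
  have n52: "\<not> near ?b5 a2" using n25 near_sym by blast
  have "e \<in> ssum (H ?b5) (vs.span {a2})" using opp_W(2)[OF b5P f.aP(3) n52] f.aW by blast
  then obtain h y where hy: "e = h + y" "h \<in> H ?b5" "y \<in> vs.span {a2}" unfolding ssum_def by blast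
  obtain x' where x': "y = x' *s a2" using hy(3) unfolding span1_iff by blast
  define x where "x = - x'"
  let ?e = "e + x *s a2"
  have e5: "?e \<in> H ?b5" using hy x' unfolding x_def by simp
  have ne: "?e \<noteq> 0"
  proof
    assume "?e = 0"
    then have "f.co 6 ?e = f.co 6 (0 *s a0)" by simp
    then show False by (simp del: vs.scale_zero_left)
  qed
  have F': "Fr ?b0 a1 a2 a3 ?b4 ?b5 ?e"
    unfolding Fr_def using f.aP b0P b4P b5P b01 f.adj b43 b54 b05 n03 n14 n25 ne e5
      sub(1)[OF b0P e0 sub(2)[OF b0P a20]] sub(1)[OF b4P e4 sub(2)[OF b4P a24]]
      sub(1)[OF f.aP(2) _ sub(2)[OF f.aP(2)], of e a2] sub(1)[OF f.aP(3) _ sub(2)[OF f.aP(3)], of e a2] sub(1)[OF f.aP(4) _ sub(2)[OF f.aP(4)], of e a2]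
      f.aH F[unfolded Fr_def] b45 by simp
  interpret g: frame V L q ?b0 a1 a2 a3 ?b4 ?b5 ?e using frameI[OF F'] .
  obtain k1 r1 where d1: "VD ?b0 a1 a2 a3 ?b4 ?b5 ?e k1 r1" using VD_exists[OF F'] by blast
  obtain k0 r0 where d0: "VD ?b5 ?b0 a1 a2 a3 ?b4 ?e k0 r0" using VD_exists[OF Fr_rot[OF Fr_rot[OF Fr_rot[OF Fr_rot[OF Fr_rot[OF F']]]]]] by blast
  let ?C = "k0 * r1 / r0"
  have C0: "?C \<noteq> 0" using VD_k[OF d0] VD_r[OF d0] VD_r[OF d1] by simp
  have "?C * s = (2 * t - x) + s" if s: "s \<noteq> 0" for s
  proof -
    have 1: "?b5 + (r1 * s) *s ?e + (?C * s^2) *s a2 \<in> Pi (?b0 + s *s a1)" using VD_edge[OF F' d1 d0] .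
    have "a5 + (t + s) *s e + (t + s)^2 *s a2 \<in> Pi (a0 + (t + s) *s a1)" using Std_edge[OF S] .
    moreover have "a5 + (t + s) *s e + (t + s)^2 *s a2 = ?b5 + s *s ?e + (2 * t * s + s^2 - s * x) *s a2"
      by (rule ext) (simp add: scl_apply algebra_simps power2_eq_square)
    moreover have "a0 + (t + s) *s a1 = ?b0 + s *s a1" by (simp add: vs.scale_left_distrib algebra_simps)
    ultimately have "?b5 + s *s ?e + (2 * t * s + s^2 - s * x) *s a2 \<in> Pi (?b0 + s *s a1)" by simp
    then have "?C * s^2 = 2 * t * s + s^2 - s * x" using g.edge_unique[OF 1] by blast
    then have "s * (?C * s) = s * ((2 * t - x) + s)" by (simp add: algebra_simps power2_eq_square)
    then show ?thesis using mult_left_cancel[OF s] by blast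
  qed
  then have "2 * t - x = 0" by (rule two_values[OF C0])
  then have x: "x = 2 * t" by simp
  interpret r: frame V L q a1 a2 a3 a4 a5 a0 e using frameI[OF Fr_rot[OF F]] .
  show ?thesis
  proof (rule Std_intro)
    show "Fr ?b0 a1 a2 a3 ?b4 ?b5 (e + (2 * t) *s a2)" using F' unfolding x .
    have "(a5 - 1 *s a3) + t *s e + t^2 *s a2 \<in> Pi ((a0 + 1 *s a2) + t *s a1)" using Std_edge[OF Std_M1[OF S]] .
    then show "?b5 - a3 \<in> Pi (?b0 + a2)" by (simp add: algebra_simps)
    have p: "a1 + a3 \<in> P" "a1 + a2 \<in> P" using r.zP(4)[of 1] r.zP(2)[of 1] by simp_all
    have "a0 - a4 + t *s (a1 + a3) \<in> Pi (a1 + a3)" using f.PiI(1)[OF p(1) _ f.PiI(2)[OF p(1) Pi_self[OF p(1)]]] Std_incid(2)[OF S, of 1] by simp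
    then show "?b0 - ?b4 \<in> Pi (a1 + a3)" by (simp add: algebra_simps vs.scale_right_distrib)
    have m2: "a2 \<in> Pi (a1 + a2)" using r.z_a1(2)[of 1] by simp
    have "a1 + a2 - a2 \<in> Pi (a1 + a2)" using f.PiI(3)[OF p(2) Pi_self[OF p(2)] m2] .
    then have m1: "a1 \<in> Pi (a1 + a2)" by simp
    have "a0 - e + a3 \<in> Pi (a1 + a2)" using Std_incid(3)[OF S, of 1] by simp
    then have "a0 - e + a3 + t *s a1 - (2 * t) *s a2 \<in> Pi (a1 + a2)"
      using f.PiI(3)[OF p(2) f.PiI(1)[OF p(2) _ f.PiI(2)[OF p(2) m1]] f.PiI(2)[OF p(2) m2]] by blast
    moreover have "a0 - e + a3 + t *s a1 - (2 * t) *s a2 = ?b0 - (e + (2 * t) *s a2) + a3" by (simp add: algebra_simps)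
    ultimately show "?b0 - (e + (2 * t) *s a2) + a3 \<in> Pi (a1 + a2)" by simp
  qed
qed

text \<open>One opposite pair of vertices forces the next. If a1 were near a4, the line a4a5 would
  have two points near a1, so by \<open>near_line\<close> a point collinear with a1. By
  \<open>no_quad\<close> that point is a0, which would make a0 and a4 collinear.\<close>

lemma hexagon_opp:
  assumes P: "a0 \<in> P" "a1 \<in> P" "a2 \<in> P" "a3 \<in> P" "a4 \<in> P" "a5 \<in> P"
    and A: "a1 \<in> Pi a0" "a2 \<in> Pi a1" "a3 \<in> Pi a2" "a4 \<in> Pi a3" "a5 \<in> Pi a4" "a0 \<in> Pi a5"
    and n: "\<not> near a0 a3" and i: "a5 \<notin> vs.span {a0,a1}"
  shows "\<not> near a1 a4"
proof
  assume nr: "near a1 a4"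
  have a40: "a4 \<notin> Pi a0"
  proof
    assume "a4 \<in> Pi a0"
    then have "near a0 a3" unfolding near_def using P_nz[OF P(5)] A(4) by blast
    then show False using n by blast
  qed
  have a20: "a2 \<notin> Pi a0"
  proof
    assume "a2 \<in> Pi a0"
    moreover have "a2 \<in> Pi a3" using A(3) adj_sym by blast
    ultimately have "near a0 a3" unfolding near_def using P_nz[OF P(3)] by blast
    then show False using n by blast
  qed
  have a45: "a5 \<notin> vs.span {a4}"
  proof
    assume "a5 \<in> vs.span {a4}"
    then have "Pi a5 = Pi a4" using Pi_scale[OF P_nz[OF P(5)] P_nz[OF P(6)]] by blast
    then show False using A(6) a40 adj_sym by blast
  qed
  have a10: "a1 \<notin> vs.span {a0}"
  proof
    assume "a1 \<in> vs.span {a0}"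
    then have "Pi a1 = Pi a0" using Pi_scale[OF P_nz[OF P(1)] P_nz[OF P(2)]] by blast
    then show False using A(2) a20 by blast
  qed
  have k: "vs.span {a4,a5} \<in> L" using adj_line[OF P(5) A(5) a45] .
  have m: "a4 \<in> vs.span {a4,a5}" "a5 \<in> vs.span {a4,a5}" by (simp_all add: vs.span_base)
  have a01: "a0 \<in> Pi a1" using A(1) adj_sym by blast
  have n5: "near a1 a5" unfolding near_def using P_nz[OF P(1)] a01 A(6) by blast
  obtain p where p: "p \<in> vs.span {a4,a5}" "p \<noteq> 0" "p \<in> Pi a1"
    using near_line[OF P(2) k m(1) P_nz[OF P(5)] nr m(2) n5 a45] by blast
  have a51: "a5 \<notin> Pi a1"
  proof
    assume "a5 \<in> Pi a1"
    moreover have "a5 \<in> Pi a0" using A(6) adj_sym by blast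
    ultimately show False using no_triangle[OF P(1) A(1) a10] i by blast
  qed
  have "p \<in> Pi a5" using line_sub_Pi[OF k m(2)] p(1) by blast
  then have "p \<in> vs.span {a0}" using no_quad[OF P(2,6) a51 a01 A(6) P_nz[OF P(1)] p(3)] by blast
  then have "a0 \<in> vs.span {a4,a5}" using span1_sym[OF p(2)] sd_span_mem[OF L_sd[OF k] p(1)] by blast
  then have "a4 \<in> Pi a0" using line_sub_Pi[OF k] m(1) by blast
  then show False using a40 by blast
qed

lemma Fr_exists: "\<exists>a0 a1 a2 a3 a4 a5 e. Fr a0 a1 a2 a3 a4 a5 e"
proof -
  obtain l0 where l0: "l0 \<in> L" using L_ne by blast
  obtain a0 where a0: "a0 \<in> l0" "a0 \<noteq> 0" using sd_nz[OF L_sd[OF l0]] by auto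
  have P0: "a0 \<in> P" using P_I l0 a0 by blast
  obtain a3 where a3: "a3 \<in> P" "\<not> near a0 a3" using ex_opp[OF P0] by blast
  obtain l m where l: "l \<in> L" "m \<in> L" "l \<noteq> m" "a0 \<in> l" "a0 \<in> m" using two_lines[OF P0] .
  have proj: "\<exists>b c. b \<in> P \<and> c \<in> P \<and> b \<in> k \<and> b \<in> Pi a0 \<and> c \<in> Pi b \<and> a3 \<in> Pi c \<and> b \<notin> vs.span {a0}" if k: "k \<in> L" "a0 \<in> k" for k
  proof -
    obtain b where b: "b \<in> k" "b \<noteq> 0" "near a3 b" using hexagon_proj[OF a3(1) k(1)] by blast
    then obtain c where c: "c \<noteq> 0" "c \<in> Pi a3" "c \<in> Pi b" unfolding near_def by blast
    have "b \<notin> vs.span {a0}"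
    proof
      assume "b \<in> vs.span {a0}"
      then have "Pi b = Pi a0" using Pi_scale[OF a0(2) b(2)] by blast
      then have "near a0 a3" unfolding near_def using c by blast
      then show False using a3 by blast
    qed
    then show ?thesis using b c P_I[OF k(1) b(1,2)] adj_P[OF c(2,1)] line_sub_Pi[OF k] adj_sym by blast
  qed
  obtain a1 a2 where a1: "a1 \<in> P" "a2 \<in> P" "a1 \<in> l" "a1 \<in> Pi a0" "a2 \<in> Pi a1" "a3 \<in> Pi a2" "a1 \<notin> vs.span {a0}" using proj[OF l(1,4)] by blast
  obtain a5 a4 where a5: "a5 \<in> P" "a4 \<in> P" "a5 \<in> m" "a5 \<in> Pi a0" "a4 \<in> Pi a5" "a3 \<in> Pi a4" "a5 \<notin> vs.span {a0}" using proj[OF l(2,5)] by blast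
  have le: "l = vs.span {a0,a1}" using sd_line_span[OF L_sd[OF l(1)] l(4) a1(3) a0(2) a1(7)] .
  have me: "m = vs.span {a0,a5}" using sd_line_span[OF L_sd[OF l(2)] l(5) a5(3) a0(2) a5(7)] .
  have i: "a5 \<notin> vs.span {a0,a1}" using line_eq[OF l(1,2,4,5) _ a5(3) a0(2) a5(7)] l(3) le by blast
  have i': "a1 \<notin> vs.span {a0,a5}" using line_eq[OF l(1,2,4,5) a1(3) _ a0(2) a1(7)] l(3) me by blast
  have s: "a0 \<in> Pi a1" "a1 \<in> Pi a2" "a2 \<in> Pi a3" "a0 \<in> Pi a5" "a5 \<in> Pi a4" "a4 \<in> Pi a3" using a1 a5 adj_sym by blast+
  have n14: "\<not> near a1 a4" using hexagon_opp[OF P0 a1(1,2) a3(1) a5(2,1) a1(4,5,6) s(6,5,4) a3(2) i] .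
  have "\<not> near a5 a2" using hexagon_opp[OF P0 a5(1,2) a3(1) a1(2,1) a5(4,5,6) s(3,2,1) a3(2) i'] .
  then have n25: "\<not> near a2 a5" using near_sym by blast
  \<comment> \<open>Each hyperplane of the 7-dimensional \<open>W\<close> lowers the dimension by at
    most one, so six of them leave a nonzero vector e.\<close>
  have step: "\<exists>k. sd k (A \<inter> H x) \<and> A \<inter> H x \<subseteq> W \<and> j \<le> k" if A: "sd i A" "A \<subseteq> W" "Suc j \<le> i" and x: "x \<in> P" for A i j x
  proof -
    obtain k where k: "sd k (A \<inter> H x)" "i + 6 \<le> 7 + k" using sd_int_ge[OF A(1) H_sd[OF x] W_sd A(2) H_W[OF x]] by blast
    then show ?thesis using A by (intro exI[of _ k]) auto
  qed
  obtain k1 where k1: "sd k1 (H a0 \<inter> H a1)" "H a0 \<inter> H a1 \<subseteq> W" "5 \<le> k1" using step[OF H_sd[OF P0] H_W[OF P0] _ a1(1), of 5] by auto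
  obtain k2 where k2: "sd k2 (H a0 \<inter> H a1 \<inter> H a2)" "H a0 \<inter> H a1 \<inter> H a2 \<subseteq> W" "4 \<le> k2" using step[OF k1(1,2) _ a1(2), of 4] k1(3) by auto
  obtain k3 where k3: "sd k3 (H a0 \<inter> H a1 \<inter> H a2 \<inter> H a3)" "H a0 \<inter> H a1 \<inter> H a2 \<inter> H a3 \<subseteq> W" "3 \<le> k3" using step[OF k2(1,2) _ a3(1), of 3] k2(3) by auto
  obtain k4 where k4: "sd k4 (H a0 \<inter> H a1 \<inter> H a2 \<inter> H a3 \<inter> H a4)" "H a0 \<inter> H a1 \<inter> H a2 \<inter> H a3 \<inter> H a4 \<subseteq> W" "2 \<le> k4" using step[OF k3(1,2) _ a5(2), of 2] k3(3) by auto
  obtain k5 where k5: "sd k5 (H a0 \<inter> H a1 \<inter> H a2 \<inter> H a3 \<inter> H a4 \<inter> H a5)" "1 \<le> k5" using step[OF k4(1,2) _ a5(1), of 1] k4(3) by auto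
  obtain e where e: "e \<in> H a0 \<inter> H a1 \<inter> H a2 \<inter> H a3 \<inter> H a4 \<inter> H a5" "e \<noteq> 0" using sd_nz[OF k5(1)] k5(2) by auto
  have "Fr a0 a1 a2 a3 a4 a5 e" unfolding Fr_def using P0 a1 a3 a5 s n14 n25 e by simp
  then show ?thesis by blast
qed

lemma Fr_scale:
  assumes F: "Fr a0 a1 a2 a3 a4 a5 e" and k: "k0 \<noteq> 0" "k1 \<noteq> 0" "k2 \<noteq> 0" "k3 \<noteq> 0" "k4 \<noteq> 0" "k5 \<noteq> 0"
  shows "Fr (k0 *s a0) (k1 *s a1) (k2 *s a2) (k3 *s a3) (k4 *s a4) (k5 *s a5) e"
proof -
  have P: "k *s x \<in> P" if x: "x \<in> P" "k \<noteq> 0" for k x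
    using adj_P[OF sd_scale[OF Pi_sd[OF x(1)] Pi_self[OF x(1)]], of k] x P_nz[OF x(1)] by simp
  have A: "j *s y \<in> Pi (k *s x)" if x: "x \<in> P" "k \<noteq> 0" "y \<in> Pi x" for j k x y
    using sd_scale[OF Pi_sd[OF x(1)] x(3)] scale_in_Pi[OF P_nz[OF x(1)] x(2)] by simp
  have N: "near (k *s x) (j *s y) \<longleftrightarrow> near x y" if "x \<in> P" "y \<in> P" "k \<noteq> 0" "j \<noteq> 0" for x y j k
    unfolding near_def using scale_in_Pi[OF P_nz[OF that(1)] that(3)] scale_in_Pi[OF P_nz[OF that(2)] that(4)] by simp
  have E: "H (k *s x) = H x" if "x \<in> P" "k \<noteq> 0" for x k
    unfolding H_def N2_def using scale_in_Pi[OF P_nz[OF that(1)] that(2)] by simp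
  show ?thesis using F k unfolding Fr_def by (simp add: P A N E)
qed

lemma Std_exists: "\<exists>a0 a1 a2 a3 a4 a5 e. Std a0 a1 a2 a3 a4 a5 e"
proof -
  obtain a0 a1 a2 a3 a4 a5 e where F: "Fr a0 a1 a2 a3 a4 a5 e" using Fr_exists by blast
  note F1 = Fr_rot[OF F]
  interpret f: frame V L q a0 a1 a2 a3 a4 a5 e using frameI[OF F] .
  interpret r: frame V L q a1 a2 a3 a4 a5 a0 e using frameI[OF F1] .
  obtain k1 r1 where d1: "VD a0 a1 a2 a3 a4 a5 e k1 r1" using VD_exists[OF F] by blast
  obtain k2 r2 where d2: "VD a1 a2 a3 a4 a5 a0 e k2 r2" using VD_exists[OF F1] by blast
  note nz = VD_k[OF d1] VD_r[OF d1] VD_k[OF d2] VD_r[OF d2]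
  \<comment> \<open>With a1, a2 and e left unscaled, the incidences in \<open>Std_intro\<close>
    determine the factors: the edge gives \<open>l0\<close> and \<open>l3\<close>, the two diagonals
    then give \<open>l5\<close> and \<open>l4\<close>.\<close>
  define l0 where "l0 = - 1 / r2"
  define l3 where "l3 = - k1 / r1"
  define l5 where "l5 = - l3 * l0 / k1"
  define l4 where "l4 = - l0 * k2 * l3"
  have ln: "l0 \<noteq> 0" "l3 \<noteq> 0" "l5 \<noteq> 0" "l4 \<noteq> 0" unfolding l5_def l4_def l0_def l3_def using nz by simp_all
  have F': "Fr (l0 *s a0) (1 *s a1) (1 *s a2) (l3 *s a3) (l4 *s a4) (l5 *s a5) e" using Fr_scale[OF F ln(1) one_neq_zero one_neq_zero ln(2,4,3)] .
  have P1: "a0 + (1/l0) *s a2 \<in> P" using f.zP(4) .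
  have "Std (l0 *s a0) (1 *s a1) (1 *s a2) (l3 *s a3) (l4 *s a4) (l5 *s a5) e"
  proof (rule Std_intro[OF F'])
    have "l5 *s (a5 + (k1 * (1/l0)) *s a3) \<in> Pi (a0 + (1/l0) *s a2)" using f.PiI(2)[OF f.zP(4) VD1[OF d1]] .
    then have "l5 *s (a5 + (k1 * (1/l0)) *s a3) \<in> Pi (l0 *s (a0 + (1/l0) *s a2))" using scale_in_Pi[OF P_nz[OF f.zP(4)] ln(1)] by simp
    moreover have "l0 *s (a0 + (1/l0) *s a2) = l0 *s a0 + 1 *s a2" using ln(1) by (intro ext) (simp add: scl_apply field_simps)
    moreover have "l5 *s (a5 + (k1 * (1/l0)) *s a3) = l5 *s a5 - l3 *s a3"
      unfolding l5_def using ln(1) nz(1) by (intro ext) (simp add: scl_apply field_simps)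
    ultimately show "l5 *s a5 - l3 *s a3 \<in> Pi (l0 *s a0 + 1 *s a2)" by simp
    have "l0 *s (a0 + (k2 * l3) *s a4) \<in> Pi (a1 + l3 *s a3)" using f.PiI(2)[OF r.zP(4) VD1[OF d2]] .
    moreover have "l0 *s (a0 + (k2 * l3) *s a4) = l0 *s a0 - l4 *s a4" unfolding l4_def by (intro ext) (simp add: scl_apply algebra_simps)
    ultimately show "l0 *s a0 - l4 *s a4 \<in> Pi (1 *s a1 + l3 *s a3)" by simp
    have "l0 *s (a0 + (r2 * 1) *s e + (k1 * r2 / r1 * 1^2) *s a3) \<in> Pi (a1 + 1 *s a2)" using f.PiI(2)[OF r.zP(2) VD_edge[OF F1 d2 d1]] .
    moreover have "l0 *s (a0 + (r2 * 1) *s e + (k1 * r2 / r1 * 1^2) *s a3) = l0 *s a0 - e + l3 *s a3"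
      unfolding l0_def l3_def using nz by (intro ext) (simp add: scl_apply field_simps)
    ultimately show "l0 *s a0 - e + l3 *s a3 \<in> Pi (1 *s a1 + 1 *s a2)" by simp
  qed
  then show ?thesis by blast
qed

text \<open>Here G stays fixed as the image of the model under one frame. That another frame also
  maps the model into G is preserved by every change of frame that comes from an
  automorphism.\<close>

definition Good where
  "Good G a0 a1 a2 a3 a4 a5 e \<longleftrightarrow> Std a0 a1 a2 a3 a4 a5 e \<and> (\<forall>h\<in>hexagon_lines. Phi a0 a1 a2 a3 a4 a5 e ` h \<in> G)"

lemma Good_move:
  assumes G: "Good G a0 a1 a2 a3 a4 a5 e" and S: "Std b0 b1 b2 b3 b4 b5 b" and a: "autm g h"
    and e: "\<And>c. Phi b0 b1 b2 b3 b4 b5 b c = Phi a0 a1 a2 a3 a4 a5 e (g c)"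
  shows "Good G b0 b1 b2 b3 b4 b5 b"
  unfolding Good_def
proof (intro conjI ballI S)
  fix l :: "(nat \<Rightarrow> 'a) set" assume l: "l \<in> hexagon_lines"
  have "Phi b0 b1 b2 b3 b4 b5 b ` l = Phi a0 a1 a2 a3 a4 a5 e ` (g ` l)" unfolding image_image e ..
  then show "Phi b0 b1 b2 b3 b4 b5 b ` l \<in> G" using G autm_hex[OF a l] unfolding Good_def by simp
qed

lemma Good_Std: "Good G a0 a1 a2 a3 a4 a5 e \<Longrightarrow> Std a0 a1 a2 a3 a4 a5 e" unfolding Good_def by blast

lemma Good_M1: "Good G a0 a1 a2 a3 a4 a5 e \<Longrightarrow> Good G (a0 + s *s a2) a1 a2 a3 a4 (a5 - s *s a3) e"
  by (rule Good_move[OF _ Std_M1[OF Good_Std] autm_M1 Phi_M1])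

lemma Good_M2: "Good G a0 a1 a2 a3 a4 a5 e \<Longrightarrow> Good G (a0 + t *s a1) a1 a2 a3 (a4 - t *s a3) (a5 + t *s e + t^2 *s a2) (e + (2 * t) *s a2)"
  by (rule Good_move[OF _ Std_M2[OF Good_Std] autm_M2 Phi_M2])

lemma Good_rot: "Good G a0 a1 a2 a3 a4 a5 e \<Longrightarrow> Good G a1 a2 a3 a4 a5 a0 (- e)"
  by (rule Good_move[OF _ Std_rot[OF Good_Std] autm_R Phi_rot])

lemma Good_ref: "Good G a0 a1 a2 a3 a4 a5 e \<Longrightarrow> Good G a2 a1 a0 a5 a4 a3 (- e)"
  by (rule Good_move[OF _ Std_ref[OF Good_Std] autm_F Phi_ref])

lemma Good_edge: assumes G: "Good G a0 a1 a2 a3 a4 a5 e" shows "vs.span {a0,a1} \<in> G"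
proof -
  let ?x = "u0 :: nat \<Rightarrow> 'a" and ?y = "mk 0 0 0 0 0 1 0 :: nat \<Rightarrow> 'a"
  have s: "sing ?x" unfolding sing_def quadQ6_def by (auto dest: fun_cong[of _ _ 0])
  have n: "?y \<notin> vs.span {?x}"
  proof
    assume "?y \<in> vs.span {?x}"
    then obtain c where "?y = c *s ?x" unfolding span1_iff by blast
    then have "?y 5 = (c *s ?x) 5" by simp
    then show False by (simp add: scl_apply)
  qed
  have "vs.span {?x,?y} \<in> hexagon_lines" using hex_line[OF s _ _ n] hx_u0[of ?y] by simp
  then have "Phi a0 a1 a2 a3 a4 a5 e ` vs.span {?x,?y} \<in> G" using G unfolding Good_def by blast
  moreover have "Phi a0 a1 a2 a3 a4 a5 e ?x = a0" "Phi a0 a1 a2 a3 a4 a5 e ?y = a1" by (simp_all add: Phi_def)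
  ultimately show ?thesis unfolding lin_span2_image[OF lin_Phi] by simp
qed

text \<open>The vertex a1 is singled out because the two elations \<open>Good_M1\<close> and
  \<open>Good_M2\<close> fix it while moving a0.\<close>

definition Ctr where "Ctr G p \<longleftrightarrow> p \<in> P \<and> (\<exists>a0 a1 a2 a3 a4 a5 e. Good G a0 a1 a2 a3 a4 a5 e \<and> p \<in> vs.span {a1})"

lemma Ctr_step:
  assumes C: "Ctr G p" and v: "v \<in> Pi p" "v \<notin> vs.span {p}"
  shows "Ctr G v" "vs.span {p,v} \<in> G"
proof -
  obtain a0 a1 a2 a3 a4 a5 e where g: "Good G a0 a1 a2 a3 a4 a5 e" and p: "p \<in> P" "p \<in> vs.span {a1}" using C unfolding Ctr_def by blast
  interpret f: frame V L q a0 a1 a2 a3 a4 a5 e using frameI[OF Std_Fr[OF Good_Std[OF g]]] .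
  have sp: "vs.span {p} = vs.span {a1}" using span1_eq[OF P_nz[OF p(1)] p(2)] .
  have va: "v \<in> Pi a1" "v \<notin> vs.span {a1}" using v sp Pi_scale[OF P_nz[OF f.aP(2)] P_nz[OF p(1)] p(2)] by simp_all
  have v0: "v \<noteq> 0" using v(2) vs.span_zero by blast
  have vP: "v \<in> P" using adj_P[OF v(1) v0] .
  have "\<exists>b0 b2 b3 b4 b5 b. Good G b0 a1 b2 b3 b4 b5 b \<and> v \<in> vs.span {b0}"
  proof -
    have vW: "v \<in> W" using P_W[OF vP] .
    let ?x = "f.co 0 v" and ?y = "f.co 1 v" and ?z = "f.co 2 v"
    have ve: "v = ?x *s a0 + ?y *s a1 + ?z *s a2" using f.co_expand[OF vW] f.Pi_a1[OF va(1)] by simp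
    show ?thesis
    \<comment> \<open>The elations move a0 to every point of \<open>Pi a1\<close> off the line a1a2;
      points on that line are reached after the reflection that exchanges a0 and a2.\<close>
    proof (cases "?x = 0")
      case False
      have "Good G (a0 + (?z/?x) *s a2 + (?y/?x) *s a1) a1 a2 a3 (a4 - (?y/?x) *s a3) ((a5 - (?z/?x) *s a3) + (?y/?x) *s e + (?y/?x)^2 *s a2) (e + (2 * (?y/?x)) *s a2)"
        using Good_M2[OF Good_M1[OF g]] .
      moreover have "v = ?x *s (a0 + (?z/?x) *s a2 + (?y/?x) *s a1)" using False by (subst ve) (intro ext, simp add: scl_apply field_simps)
      ultimately show ?thesis unfolding span1_iff by blast
    next
      case True
      have z: "?z \<noteq> 0"
      proof
        assume "?z = 0"
        then have "v = ?y *s a1" using ve True by simp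
        then show False using va(2) unfolding span1_iff by blast
      qed
      have "Good G (a2 + (?y/?z) *s a1) a1 a0 a5 (a4 - (?y/?z) *s a5) (a3 + (?y/?z) *s (- e) + (?y/?z)^2 *s a0) (- e + (2 * (?y/?z)) *s a0)"
        using Good_M2[OF Good_ref[OF g]] .
      moreover have "v = ?z *s (a2 + (?y/?z) *s a1)" using True z by (subst ve) (intro ext, simp add: scl_apply field_simps)
      ultimately show ?thesis unfolding span1_iff by blast
    qed
  qed
  then obtain b0 b2 b3 b4 b5 b where b: "Good G b0 a1 b2 b3 b4 b5 b" "v \<in> vs.span {b0}" by blast
  \<comment> \<open>Five rotations bring b0 into the second place, each with a change of sign of the
    last vector.\<close>
  have r: "Good G b5 b0 a1 b2 b3 b4 (- (- (- (- (- b)))))" using Good_rot[OF Good_rot[OF Good_rot[OF Good_rot[OF Good_rot[OF b(1)]]]]] .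
  then show "Ctr G v" unfolding Ctr_def using vP b(2) by blast
  have l: "vs.span {b0,a1} \<in> G" using Good_edge[OF b(1)] .
  have b0P: "b0 \<in> P" and ba: "a1 \<in> Pi b0" using Std_Fr[OF Good_Std[OF b(1)]] unfolding Fr_def by blast+
  have "a1 \<notin> vs.span {b0}"
  proof
    assume "a1 \<in> vs.span {b0}"
    then have "vs.span {a1} = vs.span {b0}" using span1_eq[OF P_nz[OF f.aP(2)]] by blast
    then show False using b(2) va(2) by blast
  qed
  then have s2: "sd 2 (vs.span {b0,a1})" using sd_span2[OF P_nz[OF b0P]] by blast
  have "p \<in> vs.span {b0,a1}" "v \<in> vs.span {b0,a1}" using p(2) b(2) vs.span_mono[of "{a1}" "{b0,a1}"] vs.span_mono[of "{b0}" "{b0,a1}"] by blast+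
  then have "vs.span {b0,a1} = vs.span {p,v}" using sd_line_span[OF s2 _ _ P_nz[OF p(1)] v(2)] by blast
  then show "vs.span {p,v} \<in> G" using l by simp
qed

lemma Ctr_adj: assumes C: "Ctr G p" and v: "v \<in> Pi p" "v \<noteq> 0" shows "Ctr G v"
proof (cases "v \<in> vs.span {p}")
  case True
  have pP: "p \<in> P" using C unfolding Ctr_def by blast
  have "vs.span {p} \<subseteq> vs.span {a1}" if "p \<in> vs.span {a1}" for a1 using span1_eq[OF P_nz[OF pP] that] by blast
  then show ?thesis using C True adj_P[OF v] unfolding Ctr_def by blast
qed (use Ctr_step[OF C v(1)] in blast)

text \<open>Each line has a point at distance at most two from a1. Two collinearity steps from a1
  reach that point, and a third, along the line itself, puts the line into G.\<close>

lemma lines_in_Good: assumes g: "Good G a0 a1 a2 a3 a4 a5 e" shows "L \<subseteq> G"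
proof
  fix k assume k: "k \<in> L"
  have a1: "a1 \<in> P" using Std_Fr[OF Good_Std[OF g]] unfolding Fr_def by blast
  have C: "Ctr G a1" unfolding Ctr_def using a1 g vs.span_base[of a1 "{a1}"] by blast
  obtain w where w: "w \<in> k" "w \<noteq> 0" "near a1 w" using hexagon_proj[OF a1 k] by blast
  then obtain v where v: "v \<noteq> 0" "v \<in> Pi a1" "v \<in> Pi w" unfolding near_def by blast
  have "w \<in> Pi v" using v(3) adj_sym by blast
  then have Cw: "Ctr G w" using Ctr_adj[OF Ctr_adj[OF C v(2,1)]] w(2) by blast
  obtain y where y: "y \<in> k" "y \<notin> vs.span {w}" using sd_exists_notin[OF L_sd[OF k] sd_span1[OF w(2)]] by auto
  have "y \<in> Pi w" using line_sub_Pi[OF k w(1)] y(1) by blast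
  then have "vs.span {w,y} \<in> G" using Ctr_step(2)[OF Cw _ y(2)] by blast
  then show "k \<in> G" using sd_line_span[OF L_sd[OF k] w(1) y(1) w(2) y(2)] by simp
qed

lemma Phi_inj: assumes F: "Fr a0 a1 a2 a3 a4 a5 e" shows "inj_on (Phi a0 a1 a2 a3 a4 a5 e) (vecs 6)" "Phi a0 a1 a2 a3 a4 a5 e ` vecs 6 = W"
proof -
  interpret f: frame V L q a0 a1 a2 a3 a4 a5 e using frameI[OF F] .
  let ?p = "Phi a0 a1 a2 a3 a4 a5 e"
  have co: "f.co 0 (?p c) = c 0" "f.co 4 (?p c) = c 1" "f.co 2 (?p c) = c 2" "f.co 6 (?p c) = c 3" "f.co 3 (?p c) = c 4" "f.co 1 (?p c) = c 5" "f.co 5 (?p c) = c 6" for c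
    unfolding Phi_def by simp_all
  show i: "inj_on ?p (vecs 6)"
  proof (rule inj_onI)
    fix c d assume c: "c \<in> vecs 6" "d \<in> vecs 6" "?p c = ?p d"
    show "c = d" by (rule vecs_eqI[OF c(1,2)]) (use co[of c] co[of d] c(3) in simp_all)
  qed
  have "card (?p ` vecs 6) = card W" using card_image[OF i] sd_vecs6[where 'a='a] W_sd unfolding sd_def by simp
  moreover have "?p ` vecs 6 \<subseteq> W" unfolding Phi_def by auto
  ultimately show "?p ` vecs 6 = W" using card_subset_eq[OF sd_finite[OF W_sd]] by blast
qed

theorem hexagon_model:
  obtains a0 a1 a2 a3 a4 a5 e where "Fr a0 a1 a2 a3 a4 a5 e" "L = (\<lambda>l. Phi a0 a1 a2 a3 a4 a5 e ` l) ` hexagon_lines"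
proof -
  obtain a0 a1 a2 a3 a4 a5 e where S: "Std a0 a1 a2 a3 a4 a5 e" using Std_exists by blast
  let ?p = "Phi a0 a1 a2 a3 a4 a5 e"
  let ?G = "(\<lambda>l. ?p ` l) ` hexagon_lines"
  have "Good ?G a0 a1 a2 a3 a4 a5 e" unfolding Good_def using S by blast
  then have LG: "L \<subseteq> ?G" by (rule lines_in_Good)
  have fh: "finite (hexagon_lines :: (nat \<Rightarrow> 'a) set set)" by (rule hexM.fin_L)
  have a0: "a0 \<in> P" using Std_Fr[OF S] unfolding Fr_def by blast
  \<comment> \<open>The inclusion is an equality: the model has at most as many lines as (To)
    allows, and \<open>L\<close> attains that number by \<open>layers\<close>.\<close>
  have "card ?G \<le> card (hexagon_lines :: (nat \<Rightarrow> 'a) set set)" by (rule card_image_le[OF fh])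
  also have "\<dots> \<le> card L" using hexM.total_count[where 'a='a] layers(1)[OF a0] q_def by simp
  finally have "L = ?G" using card_seteq[OF finite_imageI[OF fh] LG] by blast
  then show thesis using that Std_Fr[OF S] by blast
qed

end

section \<open>Assembling the two directions of the characterization\<close>

lemma matmap_Phi:
  assumes V: "a0 \<in> vecs n" "a1 \<in> vecs n" "a2 \<in> vecs n" "a3 \<in> vecs n" "a4 \<in> vecs n" "a5 \<in> vecs n" "e \<in> vecs n"
  shows "matmap n (\<lambda>i j. ([a0,a4,a2,e,a3,a1,a5] ! j) i) = Phi a0 a1 a2 a3 a4 a5 e"
proof (intro ext)
  fix c :: "nat \<Rightarrow> 'a" and i
  have s: "(\<Sum>j\<le>6. f j) = f 0 + f 1 + f 2 + f 3 + f 4 + f 5 + f 6" for f :: "nat \<Rightarrow> 'a"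
    by (simp add: eval_nat_numeral)
  show "matmap n (\<lambda>i j. ([a0,a4,a2,e,a3,a1,a5] ! j) i) c i = Phi a0 a1 a2 a3 a4 a5 e c i"
  proof (cases "i \<le> n")
    case True
    then show ?thesis unfolding matmap_def Phi_def s by (simp add: scl_apply mult.commute)
  next
    case False
    then have "a0 i = 0" "a1 i = 0" "a2 i = 0" "a3 i = 0" "a4 i = 0" "a5 i = 0" "e i = 0" using V unfolding vecs_def by auto
    then show ?thesis using False unfolding matmap_def Phi_def by (simp add: scl_apply)
  qed
qed

theorem theorem1:
  fixes L :: "(nat \<Rightarrow> 'a::{field,finite}) set set" and n :: nat
  defines "q \<equiv> card (UNIV :: 'a set)"
  assumes "n \<ge> 2" and "L \<subseteq> pg_lines n" and "L \<noteq> {}"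
  shows "is_hexagon_line_set n L \<longleftrightarrow>
    ((\<forall>P. proj_subspace n 0 P \<longrightarrow> card {l\<in>L. P \<subseteq> l} \<in> {0, q + 1}) \<and>
     (\<forall>S. proj_subspace n 2 S \<longrightarrow> card {l\<in>L. l \<subseteq> S} \<in> {0, 1, q + 1}) \<and>
     (\<forall>S. proj_subspace n 3 S \<longrightarrow> card {l\<in>L. l \<subseteq> S} \<in> {0, 1, q + 1, 2 * q + 1}) \<and>
     (\<forall>S. proj_subspace n 4 S \<longrightarrow> card {l\<in>L. l \<subseteq> S} \<le> q ^ 3 - q ^ 2 + 4 * q) \<and>
     card L \<le> q ^ 5 + q ^ 4 + q ^ 3 + q ^ 2 + q + 1)"
proof -
  have ps: "proj_subspace n k S \<longleftrightarrow> sd (Suc k) S \<and> S \<subseteq> vecs n" for k and S :: "(nat \<Rightarrow> 'a) set"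
    unfolding proj_subspace_def vsubspace_iff ..
  have ps': "proj_subspace n 0 S \<longleftrightarrow> sd 1 S \<and> S \<subseteq> vecs n" "proj_subspace n 2 S \<longleftrightarrow> sd 3 S \<and> S \<subseteq> vecs n"
    "proj_subspace n 3 S \<longleftrightarrow> sd 4 S \<and> S \<subseteq> vecs n" "proj_subspace n 4 S \<longleftrightarrow> sd 5 S \<and> S \<subseteq> vecs n" for S :: "(nat \<Rightarrow> 'a) set"
    unfolding ps by (simp_all add: eval_nat_numeral)
  have Lsd: "sd 2 l" "l \<subseteq> vecs n" if "l \<in> L" for l
    using that assms(3) unfolding pg_lines_def ps by (auto simp: numeral_2_eq_2)
  interpret lg: lines0 "vecs n" L q
    by unfold_locales (use q_def subspace_vecs finite_vecs Lsd in \<open>simp_all\<close>)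
  have pt: "{l\<in>L. vs.span {x} \<subseteq> l} = {l\<in>L. x \<in> l}" for x
    using sd_span_mem[OF Lsd(1), of _ x] vs.span_base[of x "{x}"] by blast
  show ?thesis unfolding ps'
  proof
    assume "is_hexagon_line_set n L"
    then obtain A where A: "inj_on (matmap n A) (vecs 6)" "L = (\<lambda>l. matmap n A ` l) ` hexagon_lines" unfolding is_hexagon_line_set_def by blast
    note g = lin_matmap[of n A] A
    show "(\<forall>P. sd 1 P \<and> P \<subseteq> vecs n \<longrightarrow> card {l\<in>L. P \<subseteq> l} \<in> {0, q + 1}) \<and>
     (\<forall>S. sd 3 S \<and> S \<subseteq> vecs n \<longrightarrow> card {l\<in>L. l \<subseteq> S} \<in> {0, 1, q + 1}) \<and>
     (\<forall>S. sd 4 S \<and> S \<subseteq> vecs n \<longrightarrow> card {l\<in>L. l \<subseteq> S} \<in> {0, 1, q + 1, 2 * q + 1}) \<and>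
     (\<forall>S. sd 5 S \<and> S \<subseteq> vecs n \<longrightarrow> card {l\<in>L. l \<subseteq> S} \<le> q ^ 3 - q ^ 2 + 4 * q) \<and>
     card L \<le> q ^ 5 + q ^ 4 + q ^ 3 + q ^ 2 + q + 1"
    proof (intro conjI allI impI)
      fix T :: "(nat \<Rightarrow> 'a) set" assume "sd 1 T \<and> T \<subseteq> vecs n"
      then have T: "sd 1 T" by blast
      obtain x where x: "x \<in> T" "x \<noteq> 0" using sd_nz[OF T] by auto
      have "vs.span {x} = T" using sd_eq[OF sd_span1[OF x(2)] T sd_span_mem[OF T x(1)]] by blast
      then have "{l\<in>L. T \<subseteq> l} = {l\<in>L. x \<in> l}" using pt[of x] by simp
      then show "card {l\<in>L. T \<subseteq> l} \<in> {0, q + 1}" using image_point[OF g x(2)] unfolding q_def by simp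
    next
      fix S :: "(nat \<Rightarrow> 'a) set" assume "sd 3 S \<and> S \<subseteq> vecs n"
      then show "card {l\<in>L. l \<subseteq> S} \<in> {0, 1, q + 1}" unfolding q_def by (intro image_plane[OF g]) blast
    next
      fix S :: "(nat \<Rightarrow> 'a) set" assume "sd 4 S \<and> S \<subseteq> vecs n"
      then show "card {l\<in>L. l \<subseteq> S} \<in> {0, 1, q + 1, 2 * q + 1}" unfolding q_def by (intro image_solid[OF g]) blast
    next
      fix S :: "(nat \<Rightarrow> 'a) set" assume "sd 5 S \<and> S \<subseteq> vecs n"
      then show "card {l\<in>L. l \<subseteq> S} \<le> q ^ 3 - q ^ 2 + 4 * q" unfolding q_def by (intro image_fourspace[OF g]) blast
    next
      show "card L \<le> q ^ 5 + q ^ 4 + q ^ 3 + q ^ 2 + q + 1" unfolding q_def by (rule image_total[OF g])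
    qed
  next
    assume h: "(\<forall>P. sd 1 P \<and> P \<subseteq> vecs n \<longrightarrow> card {l\<in>L. P \<subseteq> l} \<in> {0, q + 1}) \<and>
     (\<forall>S. sd 3 S \<and> S \<subseteq> vecs n \<longrightarrow> card {l\<in>L. l \<subseteq> S} \<in> {0, 1, q + 1}) \<and>
     (\<forall>S. sd 4 S \<and> S \<subseteq> vecs n \<longrightarrow> card {l\<in>L. l \<subseteq> S} \<in> {0, 1, q + 1, 2 * q + 1}) \<and>
     (\<forall>S. sd 5 S \<and> S \<subseteq> vecs n \<longrightarrow> card {l\<in>L. l \<subseteq> S} \<le> q ^ 3 - q ^ 2 + 4 * q) \<and>
     card L \<le> q ^ 5 + q ^ 4 + q ^ 3 + q ^ 2 + q + 1"
    interpret fl: flat_lines "vecs n" L q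
    proof (unfold_locales, goal_cases)
      case 1
      then show ?case by (rule assms(4))
    next
      case (2 x)
      have "vs.span {x} \<subseteq> vecs n" using vs.span_minimal[OF _ subspace_vecs] 2(1) by blast
      then have "card {l\<in>L. vs.span {x} \<subseteq> l} \<in> {0, q + 1}" using h sd_span1[OF 2(2)] by blast
      then show ?case unfolding pt .
    qed (use h in blast)+
    obtain a0 a1 a2 a3 a4 a5 e where F: "fl.Fr a0 a1 a2 a3 a4 a5 e" and Le: "L = (\<lambda>l. Phi a0 a1 a2 a3 a4 a5 e ` l) ` hexagon_lines"
      using fl.hexagon_model .
    interpret f: frame "vecs n" L q a0 a1 a2 a3 a4 a5 e using fl.frameI[OF F] .
    have V: "a0 \<in> vecs n" "a1 \<in> vecs n" "a2 \<in> vecs n" "a3 \<in> vecs n" "a4 \<in> vecs n" "a5 \<in> vecs n" "e \<in> vecs n"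
      using f.aW fl.W_V by blast+
    \<comment> \<open>The columns are listed in the order of the standard coordinates 0 to 6, not in
      cyclic order around the apartment.\<close>
    let ?A = "\<lambda>i j. ([a0,a4,a2,e,a3,a1,a5] ! j) i"
    note m = matmap_Phi[OF V]
    have "inj_on (matmap n ?A) (vecs 6)" "matmap n ?A ` vecs 6 = fl.W" unfolding m by (rule fl.Phi_inj[OF F])+
    moreover have "vsubspace n 7 fl.W" unfolding vsubspace_iff using fl.W_sd fl.W_V by blast
    moreover have "span_set (\<Union>L) = fl.W" unfolding span_set_eq fl.W_def ..
    moreover have "L = (\<lambda>l. matmap n ?A ` l) ` hexagon_lines" unfolding m by (rule Le)
    ultimately show "is_hexagon_line_set n L" unfolding is_hexagon_line_set_def by (intro exI[of _ ?A]) simp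
  qed
qed

end
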